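(* Assume $\mathbb{Q}\subseteq R$. Restriction of functionals along the inclusion $\mathbf{D}_{Q^\vee}\subset\mathbf{D}_{W_a}$ defines a surjection $\mathbf{D}_{W_a}^*\to\mathbf{D}_{Q^\vee}^*$ which factors through a map $\imath^{*\prime}:\mathrm{HH}_0(\mathbf{D}_{W_a}^* )\to\mathbf{D}_{Q^\vee}^*$, and $\imath^{*\prime}$ is an isomorphism of Hopf algebras $$\mathrm{HH}_0(\mathbf{D}_{W_a}^* )\simeq\mathbf{D}_{Q^\vee}^*.$$
   Context: $R$ is a commutative ring of characteristic $0$ and $F$ is a (one-dimensional commutative) formal group law over $R$. For a lattice $\Lambda$, $R[[\Lambda]]_F$ is the quotient of the power series ring $R[[x_\lambda\mid\lambda\in\Lambda]]$ by the closure of the ideal generated by $x_0$ and $x_{\lambda_1+\lambda_2}-F(x_{\lambda_1},x_{\lambda_2})$. (In the case $F_\beta(x,y)=x+y-\beta xy$ over $R=\mathbb{Z}[\beta]$ one takes instead the quotient of the polynomial ring by the ideal generated by the same elements.) $\Phi$ is a finite irreducible root system with simple roots $\alpha_1,\dots,\alpha_n$, root lattice $Q$, coroot lattice $Q^\vee$, Weyl group $W$, highest root $\theta$. $W_a=Q^\vee\rtimes W$ has elements $t_\lambda w$; $s_i=s_{\alpha_i}$ for $1\le i\le n$, $s_0=t_{\theta^\vee}s_\theta$. $W_a$ acts on $S=R[[Q]]_F$ through $W$ (translations act trivially). Each $x_\alpha$, $\alpha\in\Phi$, is assumed regular in $S$; $\mathcal{Q}=S[\frac1{x_\alpha}\mid\alpha\in\Phi]$.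 $\mathcal{Q}_{W_a}$ is the free left $\mathcal{Q}$-module with basis $\eta_u$, $u\in W_a$, with product $c\eta_u\cdot c'\eta_{u'}=c\,u(c')\eta_{uu'}$; $\mathcal{Q}_{Q^\vee}$ is the analogous commutative algebra with basis $\eta_{t_\lambda}$, $\lambda\in Q^\vee$. $\mathrm{pr}:\mathcal{Q}_{W_a}\to\mathcal{Q}_{Q^\vee}$, $c\eta_{t_\lambda w}\mapsto c\eta_{t_\lambda}$; $\imath:\mathcal{Q}_{Q^\vee}\to\mathcal{Q}_{W_a}$, $c\eta_{t_\lambda}\mapsto c\eta_{t_\lambda}$. $X_i=\frac1{x_{\alpha_i}}(1-\eta_{s_i})$ ($1\le i\le n$), $X_0=\frac1{x_{-\theta}}(1-\eta_{s_0})$. $\mathbf{D}_{W_a}$ is the subring of $\mathcal{Q}_{W_a}$ generated by $S,X_0,\dots,X_n$; the formal Peterson subalgebra $\mathbf{D}_{Q^\vee}=\imath(\mathrm{pr}(\mathbf{D}_{W_a}))$ is a subring of $\mathbf{D}_{W_a}$ (when $\mathbb{Q}\subseteq R$). Duals are left-linear: $\mathcal{Q}_{W_a}^*=\mathrm{Hom}_{\mathcal{Q}}(\mathcal{Q}_{W_a},\mathcal{Q})$, $\mathbf{D}_{W_a}^*=\mathrm{Hom}_S(\mathbf{D}_{W_a},S)$, $\mathbf{D}_{Q^\vee}^*=\mathrm{Hom}_S(\mathbf{D}_{Q^\vee},S)$; $\mathbf{D}_{W_a}^*$ is identified with $\{f\in\mathcal{Q}_{W_a}^*\mid f(\mathbf{D}_{W_a})\subseteq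 S\}$, and $f\in\mathcal{Q}_{W_a}^*$ is viewed as a function $w\mapsto f(\eta_w)$ on $W_a$. $\mathcal{Q}^*_{W_a}$ and $\mathbf{D}_{W_a}^*$ have two commuting $S$-actions, $(a\odot f)(\eta_w)=a f(\eta_w)$ and $(a\bullet f)(\eta_w)=w(a)f(\eta_w)$. The $0$-th Hochschild homology is the quotient $$\mathrm{HH}_0(\mathbf{D}_{W_a}^* )=\mathbf{D}_{W_a}^*/\langle a\bullet f-a\odot f\mid a\in S,\ f\in\mathbf{D}_{W_a}^*\rangle.$$ Hopf structures: the products on $\mathbf{D}_{W_a}^*$ (hence on $\mathrm{HH}_0$) and on $\mathbf{D}_{Q^\vee}^*$ are dual to the coproduct $a\eta_w\mapsto a\eta_w\otimes\eta_w$ (tensor product of left modules), i.e. they are pointwise multiplication of functions on $W_a$, resp. on $Q^\vee$. The coproducts are dual to the multiplications of $\mathbf{D}_{W_a}$ and $\mathbf{D}_{Q^\vee}$ (understood in the completed sense): with $f_w$ the dual basis elements, $f_w\mapsto\prod_{u}f_u\hat\otimes f_{u^{-1}w}$, where in $\hat\otimes$ one has $af_w\hat\otimes bf_v=a\,w(b)f_w\hat\otimes f_v$. *)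

theory Defs
  imports
    "HOL-Library.Multiset"
    "HOL-Library.Poly_Mapping"
    "HOL-Analysis.Euclidean_Space"
    "HOL-Algebra.Module"
    "HOL-Algebra.QuotRing"
    "HOL-Algebra.Generated_Rings"
begin

text \<open>
  A power series in variables indexed by \<open>\<Lambda>\<close> is given by its coefficients; a monomial is the multiset
  of its variables. \<open>ps_ring \<Lambda>\<close> is the completion of the polynomial ring at the augmentation ideal
  \<open>(x\<^sub>\<lambda> | \<lambda> \<in> \<Lambda>)\<close>, so a series has only finitely many monomials in each degree. This matters because
  \<open>\<Lambda>\<close> is infinite for a lattice: in the ring of all formal sums the quotients below would be wrong.
\<close>

definition ps_ring :: "'v set \<Rightarrow> ('v multiset \<Rightarrow> 'r::comm_ring_1) ring" where
  "ps_ring \<Lambda> = \<lparr>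
     carrier = {p. (\<forall>m. p m \<noteq> 0 \<longrightarrow> set_mset m \<subseteq> \<Lambda>) \<and> (\<forall>d. finite {m. p m \<noteq> 0 \<and> size m = d})},
     mult = (\<lambda>p q m. \<Sum>a | a \<subseteq># m. p a * q (m - a)),
     one = (\<lambda>m. if m = {#} then 1 else 0),
     zero = (\<lambda>_. 0),
     add = (\<lambda>p q m. p m + q m)\<rparr>"

definition ps_var :: "'v \<Rightarrow> 'v multiset \<Rightarrow> 'r::comm_ring_1" where
  "ps_var v = (\<lambda>m. if m = {#v#} then 1 else 0)"

text \<open>The renaming \<open>x\<^sub>\<lambda> \<mapsto> x\<^bsub>g \<lambda>\<^esub>\<close> for a bijection \<open>g\<close>.\<close>

definition ps_rename :: "('v \<Rightarrow> 'v) \<Rightarrow> ('v multiset \<Rightarrow> 'r) \<Rightarrow> 'v multiset \<Rightarrow> 'r" where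
  "ps_rename g p = (\<lambda>m. p (image_mset (inv_into UNIV g) m))"

text \<open>
  \<open>fgl_subst c p q\<close> is \<open>F(p, q) = \<Sum>\<^sub>i\<^sub>j c\<^sub>i\<^sub>j p\<^sup>i q\<^sup>j\<close>, for \<open>p\<close>, \<open>q\<close> without constant term. The term with
  indices \<open>i\<close>, \<open>j\<close> has order at least \<open>i + j\<close>, hence the bounds on the sums.
\<close>

definition fgl_subst ::
  "(nat \<Rightarrow> nat \<Rightarrow> 'r::comm_ring_1) \<Rightarrow> ('v multiset \<Rightarrow> 'r) \<Rightarrow> ('v multiset \<Rightarrow> 'r) \<Rightarrow> 'v multiset \<Rightarrow> 'r" where
  "fgl_subst c p q = (\<lambda>m. \<Sum>i\<le>size m. \<Sum>j\<le>size m.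
      c i j * ((p [^]\<^bsub>ps_ring UNIV\<^esub> i) \<otimes>\<^bsub>ps_ring UNIV\<^esub> (q [^]\<^bsub>ps_ring UNIV\<^esub> j)) m)"

definition formal_group_law :: "(nat \<Rightarrow> nat \<Rightarrow> 'r::comm_ring_1) \<Rightarrow> bool" where
  "formal_group_law c \<longleftrightarrow>
     (\<forall>i. c i 0 = (if i = 1 then 1 else 0)) \<and>
     (\<forall>i j. c i j = c j i) \<and>
     (let X = ps_var (0::nat); Y = ps_var 1; Z = ps_var 2
      in fgl_subst c (fgl_subst c X Y) Z = fgl_subst c X (fgl_subst c Y Z))"

text \<open>The closure is taken in the topology given by the order of power series.\<close>

definition fgr_ideal ::
  "(nat \<Rightarrow> nat \<Rightarrow> 'r::comm_ring_1) \<Rightarrow> 'v::ab_group_add set \<Rightarrow> ('v multiset \<Rightarrow> 'r) set" where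
  "fgr_ideal c \<Lambda> =
     (let J = genideal (ps_ring \<Lambda>) ({ps_var 0} \<union>
                {ps_var (\<mu> + \<nu>) \<ominus>\<^bsub>ps_ring \<Lambda>\<^esub> fgl_subst c (ps_var \<mu>) (ps_var \<nu>) | \<mu> \<nu>. \<mu> \<in> \<Lambda> \<and> \<nu> \<in> \<Lambda>})
      in {p \<in> carrier (ps_ring \<Lambda>). \<forall>d. \<exists>q\<in>J. \<forall>m. size m < d \<longrightarrow> p m = q m})"

definition formal_group_ring ::
  "(nat \<Rightarrow> nat \<Rightarrow> 'r::comm_ring_1) \<Rightarrow> 'v::ab_group_add set \<Rightarrow> ('v multiset \<Rightarrow> 'r) set ring" where
  "formal_group_ring c \<Lambda> = ps_ring \<Lambda> Quot fgr_ideal c \<Lambda>"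

definition fgr_class ::
  "(nat \<Rightarrow> nat \<Rightarrow> 'r::comm_ring_1) \<Rightarrow> 'v::ab_group_add set \<Rightarrow> ('v multiset \<Rightarrow> 'r) \<Rightarrow> ('v multiset \<Rightarrow> 'r) set" where
  "fgr_class c \<Lambda> p = fgr_ideal c \<Lambda> +>\<^bsub>ps_ring \<Lambda>\<^esub> p"

definition rational_embedding :: "(rat \<Rightarrow> 'r::comm_ring_1) \<Rightarrow> bool" where
  "rational_embedding h \<longleftrightarrow> inj h \<and> h 1 = 1 \<and>
     (\<forall>x y. h (x + y) = h x + h y) \<and> (\<forall>x y. h (x * y) = h x * h y)"

definition regular_in :: "('s, 'm) ring_scheme \<Rightarrow> 's \<Rightarrow> bool" where
  "regular_in S x \<longleftrightarrow> (\<forall>a\<in>carrier S. x \<otimes>\<^bsub>S\<^esub> a = \<zero>\<^bsub>S\<^esub> \<longrightarrow> a = \<zero>\<^bsub>S\<^esub>)"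

inductive_set mult_closure :: "('s, 'm) ring_scheme \<Rightarrow> 's set \<Rightarrow> 's set" for S X where
  one: "\<one>\<^bsub>S\<^esub> \<in> mult_closure S X"
| mult: "x \<in> X \<Longrightarrow> m \<in> mult_closure S X \<Longrightarrow> x \<otimes>\<^bsub>S\<^esub> m \<in> mult_closure S X"

text \<open>\<open>\<iota>\<close> exhibits the type \<open>'q\<close> as the localization \<open>S[1/x | x \<in> X]\<close>.\<close>

definition localization_map :: "('s, 'm) ring_scheme \<Rightarrow> 's set \<Rightarrow> ('s \<Rightarrow> 'q::comm_ring_1) \<Rightarrow> bool" where
  "localization_map S X \<iota> \<longleftrightarrow>
     \<iota> \<one>\<^bsub>S\<^esub> = 1 \<and>
     (\<forall>a\<in>carrier S. \<forall>b\<in>carrier S. \<iota> (a \<oplus>\<^bsub>S\<^esub> b) = \<iota> a + \<iota> b \<and> \<iota> (a \<otimes>\<^bsub>S\<^esub> b) = \<iota> a * \<iota> b) \<and>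
     (\<forall>x\<in>X. \<iota> x dvd 1) \<and>
     (\<forall>q. \<exists>a\<in>carrier S. \<exists>m\<in>mult_closure S X. q * \<iota> m = \<iota> a) \<and>
     (\<forall>a\<in>carrier S. \<iota> a = 0 \<longrightarrow> (\<exists>m\<in>mult_closure S X. m \<otimes>\<^bsub>S\<^esub> a = \<zero>\<^bsub>S\<^esub>))"

definition unit_inv :: "'q::comm_ring_1 \<Rightarrow> 'q" where
  "unit_inv x = (THE y. x * y = 1)"

text \<open>
  Root systems are reduced and crystallographic. The inner product identifies the ambient space
  with its dual, so that roots and coroots live in the same space.
\<close>

definition coroot :: "'v::euclidean_space \<Rightarrow> 'v" where
  "coroot \<alpha> = (2 / inner \<alpha> \<alpha>) *\<^sub>R \<alpha>"

definition reflection :: "'v::euclidean_space \<Rightarrow> 'v \<Rightarrow> 'v" where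
  "reflection \<alpha> v = v - inner v (coroot \<alpha>) *\<^sub>R \<alpha>"

definition root_system :: "'v::euclidean_space set \<Rightarrow> bool" where
  "root_system \<Phi> \<longleftrightarrow> finite \<Phi> \<and> span \<Phi> = UNIV \<and> 0 \<notin> \<Phi> \<and>
     (\<forall>\<alpha>\<in>\<Phi>. \<forall>\<beta>\<in>\<Phi>. reflection \<alpha> \<beta> \<in> \<Phi> \<and> inner \<beta> (coroot \<alpha>) \<in> \<int>) \<and>
     (\<forall>\<alpha>\<in>\<Phi>. \<forall>r. r *\<^sub>R \<alpha> \<in> \<Phi> \<longrightarrow> r = 1 \<or> r = -1)"

definition irreducible_roots :: "'v::euclidean_space set \<Rightarrow> bool" where
  "irreducible_roots \<Phi> \<longleftrightarrow> \<Phi> \<noteq> {} \<and>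
     \<not> (\<exists>A B. A \<noteq> {} \<and> B \<noteq> {} \<and> A \<union> B = \<Phi> \<and> A \<inter> B = {} \<and> (\<forall>a\<in>A. \<forall>b\<in>B. inner a b = 0))"

definition nat_comb :: "'v::euclidean_space set \<Rightarrow> 'v set" where
  "nat_comb A = {\<Sum>a\<in>A. real (k a) *\<^sub>R a | k :: 'v \<Rightarrow> nat. True}"

definition int_comb :: "'v::euclidean_space set \<Rightarrow> 'v set" where
  "int_comb A = {\<Sum>a\<in>A. real_of_int (k a) *\<^sub>R a | k :: 'v \<Rightarrow> int. True}"

definition simple_roots :: "'v::euclidean_space set \<Rightarrow> 'v set \<Rightarrow> bool" where
  "simple_roots \<Phi> \<Delta> \<longleftrightarrow> \<Delta> \<subseteq> \<Phi> \<and> independent \<Delta> \<and> (\<forall>\<beta>\<in>\<Phi>. \<beta> \<in> nat_comb \<Delta> \<or> - \<beta> \<in> nat_comb \<Delta>)"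

definition highest_root :: "'v::euclidean_space set \<Rightarrow> 'v set \<Rightarrow> 'v \<Rightarrow> bool" where
  "highest_root \<Phi> \<Delta> \<theta> \<longleftrightarrow> \<theta> \<in> \<Phi> \<and> (\<forall>\<beta>\<in>\<Phi>. \<theta> - \<beta> \<in> nat_comb \<Delta>)"

inductive_set weyl_group :: "'v::euclidean_space set \<Rightarrow> ('v \<Rightarrow> 'v) set" for \<Phi> where
  id: "id \<in> weyl_group \<Phi>"
| refl: "\<alpha> \<in> \<Phi> \<Longrightarrow> w \<in> weyl_group \<Phi> \<Longrightarrow> reflection \<alpha> \<circ> w \<in> weyl_group \<Phi>"

text \<open>The pair \<open>(\<lambda>, w)\<close> stands for \<open>t\<^sub>\<lambda> w\<close>.\<close>

type_synonym 'v aff = "'v \<times> ('v \<Rightarrow> 'v)"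

definition aff_weyl :: "'v::euclidean_space set \<Rightarrow> 'v aff set" where
  "aff_weyl \<Phi> = int_comb (coroot ` \<Phi>) \<times> weyl_group \<Phi>"

definition aff_one :: "'v::euclidean_space aff" where
  "aff_one = (0, id)"

definition aff_mult :: "'v::euclidean_space aff \<Rightarrow> 'v aff \<Rightarrow> 'v aff" where
  "aff_mult u v = (fst u + snd u (fst v), snd u \<circ> snd v)"

definition aff_inv :: "'v::euclidean_space aff \<Rightarrow> 'v aff" where
  "aff_inv u = (- inv_into UNIV (snd u) (fst u), inv_into UNIV (snd u))"

text \<open>
  \<open>coeffs\<close> are the coefficients of \<open>F\<close>, and \<open>emb\<close> is the localization map
  \<open>S \<rightarrow> \<Q> = S[1/x\<^sub>\<alpha> | \<alpha> \<in> \<Phi>]\<close>, with \<open>\<Q>\<close> the whole type \<open>'q\<close>.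
\<close>

record ('v, 'r, 'q) affine_datum =
  roots :: "'v set"
  simples :: "'v set"
  theta :: 'v
  coeffs :: "nat \<Rightarrow> nat \<Rightarrow> 'r"
  emb :: "('v multiset \<Rightarrow> 'r) set \<Rightarrow> 'q"

definition Sring :: "('v::euclidean_space, 'r::comm_ring_1, 'q::comm_ring_1) affine_datum
    \<Rightarrow> ('v multiset \<Rightarrow> 'r) set ring" where
  "Sring G = formal_group_ring (coeffs G) (int_comb (roots G))"

definition Sclass :: "('v::euclidean_space, 'r::comm_ring_1, 'q::comm_ring_1) affine_datum
    \<Rightarrow> ('v multiset \<Rightarrow> 'r) \<Rightarrow> ('v multiset \<Rightarrow> 'r) set" where
  "Sclass G p = fgr_class (coeffs G) (int_comb (roots G)) p"

text \<open>The image of \<open>S\<close> in \<open>\<Q>\<close>, isomorphic to \<open>S\<close> because the \<open>x\<^sub>\<alpha>\<close> are regular.\<close>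

definition Sset :: "('v::euclidean_space, 'r::comm_ring_1, 'q::comm_ring_1) affine_datum \<Rightarrow> 'q set" where
  "Sset G = emb G ` carrier (Sring G)"

definition xel :: "('v::euclidean_space, 'r::comm_ring_1, 'q::comm_ring_1) affine_datum \<Rightarrow> 'v \<Rightarrow> 'q" where
  "xel G \<mu> = emb G (Sclass G (ps_var \<mu>))"

text \<open>The action of \<open>w \<in> W\<close> on \<open>\<Q>\<close>: the unique ring endomorphism extending the action on \<open>S\<close>.\<close>

definition act :: "('v::euclidean_space, 'r::comm_ring_1, 'q::comm_ring_1) affine_datum
    \<Rightarrow> ('v \<Rightarrow> 'v) \<Rightarrow> 'q \<Rightarrow> 'q" where
  "act G w = (THE \<sigma>. \<sigma> 1 = 1 \<and> (\<forall>a b. \<sigma> (a + b) = \<sigma> a + \<sigma> b) \<and> (\<forall>a b. \<sigma> (a * b) = \<sigma> a * \<sigma> b) \<and>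
     (\<forall>p\<in>carrier (ps_ring (int_comb (roots G))).
        \<sigma> (emb G (Sclass G p)) = emb G (Sclass G (ps_rename w p))))"

type_synonym ('v, 'q) tga = "'v aff \<Rightarrow>\<^sub>0 'q"

definition cst :: "'q::comm_ring_1 \<Rightarrow> ('v::euclidean_space, 'q) tga" where
  "cst a = Poly_Mapping.single aff_one a"

definition eta :: "'v::euclidean_space aff \<Rightarrow> ('v, 'q::comm_ring_1) tga" where
  "eta u = Poly_Mapping.single u 1"

definition QWa :: "('v::euclidean_space, 'r::comm_ring_1, 'q::comm_ring_1) affine_datum
    \<Rightarrow> ('v, 'q) tga ring" where
  "QWa G = \<lparr>
     carrier = {z. Poly_Mapping.keys z \<subseteq> aff_weyl (roots G)},
     mult = (\<lambda>z z'. \<Sum>u\<in>Poly_Mapping.keys z. \<Sum>v\<in>Poly_Mapping.keys z'.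
               Poly_Mapping.single (aff_mult u v)
                 (Poly_Mapping.lookup z u * act G (snd u) (Poly_Mapping.lookup z' v))),
     one = cst 1,
     zero = 0,
     add = (+)\<rparr>"

definition demazure :: "('v::euclidean_space, 'r::comm_ring_1, 'q::comm_ring_1) affine_datum
    \<Rightarrow> 'v \<Rightarrow> 'v aff \<Rightarrow> ('v, 'q) tga" where
  "demazure G \<alpha> s = cst (unit_inv (xel G \<alpha>)) \<otimes>\<^bsub>QWa G\<^esub> (cst 1 - eta s)"

definition DWa :: "('v::euclidean_space, 'r::comm_ring_1, 'q::comm_ring_1) affine_datum
    \<Rightarrow> ('v, 'q) tga set" where
  "DWa G = generate_ring (QWa G)
     (cst ` Sset G \<union>
      (\<lambda>\<alpha>. demazure G \<alpha> (0, reflection \<alpha>)) ` simples G \<union>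
      {demazure G (- theta G) (coroot (theta G), reflection (theta G))})"

text \<open>The algebra \<open>\<Q>\<^bsub>Q\<^sup>\<or>\<^esub>\<close> is modelled by finitely supported functions on the coroot lattice.\<close>

definition pr :: "('v::euclidean_space, 'q::comm_ring_1) tga \<Rightarrow> 'v \<Rightarrow>\<^sub>0 'q" where
  "pr z = (\<Sum>u\<in>Poly_Mapping.keys z. Poly_Mapping.single (fst u) (Poly_Mapping.lookup z u))"

definition imath :: "('v::euclidean_space \<Rightarrow>\<^sub>0 'q::comm_ring_1) \<Rightarrow> ('v, 'q) tga" where
  "imath y = (\<Sum>\<mu>\<in>Poly_Mapping.keys y. Poly_Mapping.single (\<mu>, id) (Poly_Mapping.lookup y \<mu>))"

definition DQ :: "('v::euclidean_space, 'r::comm_ring_1, 'q::comm_ring_1) affine_datum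
    \<Rightarrow> ('v, 'q) tga set" where
  "DQ G = imath ` pr ` DWa G"

text \<open>
  Commutative Hopf algebras over a ring of scalars, with a completed tensor square \<open>tsq\<close> (an abelian
  group, written as a monoid record) and the tensors \<open>tens x y\<close> in it.
\<close>

record ('s, 'a, 't) hopf = "('s, 'a) module" +
  tsq :: "'t monoid"
  tens :: "'a \<Rightarrow> 'a \<Rightarrow> 't"
  comult :: "'a \<Rightarrow> 't"
  counit :: "'a \<Rightarrow> 's"
  antipode :: "'a \<Rightarrow> 'a"

text \<open>Here \<open>h2\<close> plays the role of the completed tensor square of \<open>h\<close>.\<close>

definition hopf_iso :: "'s set \<Rightarrow> ('s, 'a, 't) hopf \<Rightarrow> ('s, 'b, 'u) hopf \<Rightarrow> ('a \<Rightarrow> 'b) \<Rightarrow> ('t \<Rightarrow> 'u) \<Rightarrow> bool" where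
  "hopf_iso K A B h h2 \<longleftrightarrow>
     h \<in> ring_iso A B \<and>
     (\<forall>a\<in>K. \<forall>x\<in>carrier A. h (a \<odot>\<^bsub>A\<^esub> x) = a \<odot>\<^bsub>B\<^esub> h x) \<and>
     h2 \<in> iso (tsq A) (tsq B) \<and>
     (\<forall>x\<in>carrier A. \<forall>y\<in>carrier A. tens A x y \<in> carrier (tsq A) \<and> h2 (tens A x y) = tens B (h x) (h y)) \<and>
     (\<forall>x\<in>carrier A. comult A x \<in> carrier (tsq A) \<and> h2 (comult A x) = comult B (h x)) \<and>
     (\<forall>x\<in>carrier A. counit A x = counit B (h x)) \<and>
     (\<forall>x\<in>carrier A. antipode A x \<in> carrier A \<and> h (antipode A x) = antipode B (h x))"

text \<open>The linear functional on \<open>D\<close> with value \<open>g u\<close> at \<open>\<eta>\<^sub>u\<close>.\<close>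

definition functional :: "('v::euclidean_space, 'q::comm_ring_1) tga set \<Rightarrow> ('v aff \<Rightarrow> 'q) \<Rightarrow> ('v, 'q) tga \<Rightarrow> 'q" where
  "functional D g = (\<lambda>z\<in>D. \<Sum>u\<in>Poly_Mapping.keys z. Poly_Mapping.lookup z u * g u)"

text \<open>
  \<open>dual_tsq G D = Hom\<^sub>S(D \<otimes>\<^sub>S D, S)\<close>, the completed tensor square of \<open>D\<^sup>*\<close>; the tensor product of \<open>D\<close> with
  itself is that of \<open>S\<close>-bimodules, so its functionals are the balanced biadditive maps.
\<close>

definition dual_tsq :: "('v::euclidean_space, 'r::comm_ring_1, 'q::comm_ring_1) affine_datum
    \<Rightarrow> ('v, 'q) tga set \<Rightarrow> (('v, 'q) tga \<times> ('v, 'q) tga \<Rightarrow> 'q) monoid" where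
  "dual_tsq G D = \<lparr>
     carrier = {\<Psi> \<in> extensional (D \<times> D).
       (\<forall>z\<in>D. \<forall>y\<in>D. \<Psi> (z, y) \<in> Sset G) \<and>
       (\<forall>z\<in>D. \<forall>z'\<in>D. \<forall>y\<in>D. \<Psi> (z + z', y) = \<Psi> (z, y) + \<Psi> (z', y) \<and> \<Psi> (y, z + z') = \<Psi> (y, z) + \<Psi> (y, z')) \<and>
       (\<forall>a\<in>Sset G. \<forall>z\<in>D. \<forall>y\<in>D. \<Psi> (cst a \<otimes>\<^bsub>QWa G\<^esub> z, y) = a * \<Psi> (z, y) \<and>
                                \<Psi> (z \<otimes>\<^bsub>QWa G\<^esub> cst a, y) = \<Psi> (z, cst a \<otimes>\<^bsub>QWa G\<^esub> y))},
     mult = (\<lambda>\<Psi> \<Psi>'. \<lambda>p\<in>D \<times> D. \<Psi> p + \<Psi>' p),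
     one = (\<lambda>p\<in>D \<times> D. 0)\<rparr>"

text \<open>
  The dual \<open>D\<^sup>* = Hom\<^sub>S(D, S)\<close>. With \<open>f\<^sub>u\<close> dual to \<open>\<eta>\<^sub>u\<close>, the formula for \<open>tens\<close> gives
  \<open>(a f\<^sub>w \<otimes> b f\<^sub>v)(\<eta>\<^sub>w \<otimes> \<eta>\<^sub>v) = a w(b)\<close>, and \<open>comult\<close> sends \<open>f\<^sub>w\<close> to the product of all
  \<open>f\<^sub>u \<otimes> f\<^sub>v\<close> with \<open>u v = w\<close>. The antipode is inversion on \<open>W\<^sub>a\<close>, twisted so as to exchange the two
  actions of \<open>S\<close>; on translations it is \<open>t\<^sub>\<lambda> \<mapsto> t\<^bsub>-\<lambda>\<^esub>\<close>.
\<close>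

definition dual :: "('v::euclidean_space, 'r::comm_ring_1, 'q::comm_ring_1) affine_datum
    \<Rightarrow> ('v, 'q) tga set \<Rightarrow> ('q, ('v, 'q) tga \<Rightarrow> 'q, ('v, 'q) tga \<times> ('v, 'q) tga \<Rightarrow> 'q) hopf" where
  "dual G D = \<lparr>
     carrier = {f \<in> extensional D.
       (\<forall>z\<in>D. f z \<in> Sset G) \<and>
       (\<forall>z\<in>D. \<forall>z'\<in>D. f (z + z') = f z + f z') \<and>
       (\<forall>a\<in>Sset G. \<forall>z\<in>D. f (cst a \<otimes>\<^bsub>QWa G\<^esub> z) = a * f z)},
     mult = (\<lambda>f g. functional D (\<lambda>u. f (eta u) * g (eta u))),
     one = functional D (\<lambda>_. 1),
     zero = (\<lambda>z\<in>D. 0),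
     add = (\<lambda>f g. \<lambda>z\<in>D. f z + g z),
     smult = (\<lambda>a f. \<lambda>z\<in>D. a * f z),
     tsq = dual_tsq G D,
     tens = (\<lambda>f g. \<lambda>(z, y)\<in>D \<times> D. f (z \<otimes>\<^bsub>QWa G\<^esub> cst (g y))),
     comult = (\<lambda>f. \<lambda>(z, y)\<in>D \<times> D. f (z \<otimes>\<^bsub>QWa G\<^esub> y)),
     counit = (\<lambda>f. f (eta aff_one)),
     antipode = (\<lambda>f. functional D (\<lambda>u. act G (snd u) (f (eta (aff_inv u)))))\<rparr>"

definition bullet :: "('v::euclidean_space, 'r::comm_ring_1, 'q::comm_ring_1) affine_datum
    \<Rightarrow> 'q \<Rightarrow> (('v, 'q) tga \<Rightarrow> 'q) \<Rightarrow> ('v, 'q) tga \<Rightarrow> 'q" where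
  "bullet G a f = functional (DWa G) (\<lambda>u. act G (snd u) a * f (eta u))"

definition comm_sub :: "('v::euclidean_space, 'r::comm_ring_1, 'q::comm_ring_1) affine_datum
    \<Rightarrow> (('v, 'q) tga \<Rightarrow> 'q) set" where
  "comm_sub G = generate (add_monoid (dual G (DWa G)))
     {bullet G a f \<ominus>\<^bsub>dual G (DWa G)\<^esub> (a \<odot>\<^bsub>dual G (DWa G)\<^esub> f) | a f.
        a \<in> Sset G \<and> f \<in> carrier (dual G (DWa G))}"

definition hh_class :: "('v::euclidean_space, 'r::comm_ring_1, 'q::comm_ring_1) affine_datum
    \<Rightarrow> (('v, 'q) tga \<Rightarrow> 'q) \<Rightarrow> (('v, 'q) tga \<Rightarrow> 'q) set" where
  "hh_class G f = comm_sub G +>\<^bsub>dual G (DWa G)\<^esub> f"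

text \<open>
  The completed tensor square of \<open>HH\<^sub>0\<close> is the quotient of that of \<open>D\<^sup>*\<close> by the commutators in both
  factors: the generators below extend \<open>(a \<bullet> f - a \<odot> f) \<otimes> g\<close> and \<open>f \<otimes> (a \<bullet> g - a \<odot> g)\<close>.
\<close>

definition comm_sub2 :: "('v::euclidean_space, 'r::comm_ring_1, 'q::comm_ring_1) affine_datum
    \<Rightarrow> (('v, 'q) tga \<times> ('v, 'q) tga \<Rightarrow> 'q) set" where
  "comm_sub2 G = generate (dual_tsq G (DWa G))
     ({\<lambda>(z, y)\<in>DWa G \<times> DWa G. \<Psi> (z \<otimes>\<^bsub>QWa G\<^esub> cst a, y) - a * \<Psi> (z, y) | a \<Psi>.
         a \<in> Sset G \<and> \<Psi> \<in> carrier (dual_tsq G (DWa G))} \<union>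
      {\<lambda>(z, y)\<in>DWa G \<times> DWa G. \<Psi> (z, y \<otimes>\<^bsub>QWa G\<^esub> cst a) - \<Psi> (z, cst a \<otimes>\<^bsub>QWa G\<^esub> y) | a \<Psi>.
         a \<in> Sset G \<and> \<Psi> \<in> carrier (dual_tsq G (DWa G))})"

definition hh_class2 :: "('v::euclidean_space, 'r::comm_ring_1, 'q::comm_ring_1) affine_datum
    \<Rightarrow> (('v, 'q) tga \<times> ('v, 'q) tga \<Rightarrow> 'q) \<Rightarrow> (('v, 'q) tga \<times> ('v, 'q) tga \<Rightarrow> 'q) set" where
  "hh_class2 G \<Psi> = comm_sub2 G #>\<^bsub>dual_tsq G (DWa G)\<^esub> \<Psi>"

text \<open>
  The operations on cosets are unions over representatives, as for the product of cosets
  in \<^const>\<open>FactRing\<close>; such a union is a coset only if the operation is well defined.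
\<close>

definition HH0 :: "('v::euclidean_space, 'r::comm_ring_1, 'q::comm_ring_1) affine_datum
    \<Rightarrow> ('q, (('v, 'q) tga \<Rightarrow> 'q) set, (('v, 'q) tga \<times> ('v, 'q) tga \<Rightarrow> 'q) set) hopf" where
  "HH0 G = (let C = dual G (DWa G); H = C Quot comm_sub G in \<lparr>
     carrier = carrier H,
     mult = mult H,
     one = one H,
     zero = zero H,
     add = add H,
     smult = (\<lambda>a X. \<Union>f\<in>X. hh_class G (a \<odot>\<^bsub>C\<^esub> f)),
     tsq = tsq C Mod comm_sub2 G,
     tens = (\<lambda>X Y. \<Union>f\<in>X. \<Union>g\<in>Y. hh_class2 G (tens C f g)),
     comult = (\<lambda>X. \<Union>f\<in>X. hh_class2 G (comult C f)),
     counit = (\<lambda>X. the_elem (counit C ` X)),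
     antipode = (\<lambda>X. \<Union>f\<in>X. hh_class G (antipode C f))\<rparr>)"

definition res :: "('v::euclidean_space, 'r::comm_ring_1, 'q::comm_ring_1) affine_datum
    \<Rightarrow> (('v, 'q) tga \<Rightarrow> 'q) \<Rightarrow> ('v, 'q) tga \<Rightarrow> 'q" where
  "res G f = restrict f (DQ G)"

definition res2 :: "('v::euclidean_space, 'r::comm_ring_1, 'q::comm_ring_1) affine_datum
    \<Rightarrow> (('v, 'q) tga \<times> ('v, 'q) tga \<Rightarrow> 'q) \<Rightarrow> ('v, 'q) tga \<times> ('v, 'q) tga \<Rightarrow> 'q" where
  "res2 G \<Psi> = restrict \<Psi> (DQ G \<times> DQ G)"

end

theory Submission
  imports Defs "HOL-Analysis.Linear_Algebra"
begin

text \<open>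
  Everything follows from the existence of \<open>b\<^sub>i \<in> S\<close> and elements \<open>d\<^sub>i\<close> of \<open>D\<^bsub>W\<^esub>\<close>, invariant under left
  multiplication by \<open>W\<close>, with \<open>\<Sum>\<^sub>i b\<^sub>i d\<^sub>i = 1\<close>; in other words \<open>1 \<in> D\<^bsub>W\<^esub> e D\<^bsub>W\<^esub>\<close> for the averaging
  idempotent \<open>e\<close>. The elements \<open>t\<^sub>\<mu> = \<Sum>\<^sub>\<beta> \<langle>\<mu>, \<beta>\<^sup>\<or>\<rangle> x\<^sub>\<beta>\<close> are additive and \<open>W\<close>-equivariant, and \<open>t\<^sub>\<alpha>\<close> is a unit
  multiple of \<open>x\<^sub>\<alpha>\<close>, since \<open>2 t\<^sub>\<alpha> = t\<^sub>\<alpha> - s\<^sub>\<alpha>(t\<^sub>\<alpha>)\<close>. The operators \<open>\<Delta>\<^sub>\<alpha> = t\<^sub>\<alpha>\<^sup>-\<^sup>1(1 - s\<^sub>\<alpha>)\<close> lower the degree of polynomials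
  in the \<open>t\<^sub>\<mu>\<close>, so words of length \<open>|W|\<close> kill all polynomials of degree below \<open>|W|\<close>. Such a word is zero:
  for \<open>w \<noteq> v\<close> in \<open>W\<close> there is \<open>\<mu>\<close> with \<open>w\<mu> - v\<mu>\<close> a nonzero multiple of a root, because elements of \<open>W\<close>
  fixing a regular vector are trivial. If all \<open>\<Delta>\<^sub>i y\<close> lie in \<open>D\<^bsub>W\<^esub> e D\<^bsub>W\<^esub>\<close>, then modulo this ideal \<open>y\<close> is
  \<open>W\<close>-invariant, so \<open>y = ey\<close> lies in it as well. Descending induction on the length of words gives \<open>1\<close>.

  Since \<open>pr(z) d = z d\<close> for invariant \<open>d\<close>, one gets \<open>pr(z) = \<Sum>\<^sub>i b\<^sub>i z d\<^sub>i\<close> and \<open>z = \<Sum>\<^sub>i pr(z b\<^sub>i) d\<^sub>i\<close>. The first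
  identity gives \<open>D\<^bsub>Q\<^esub> \<subseteq> D\<^bsub>Wa\<^esub>\<close>, and \<open>f \<mapsto> f \<circ> pr\<close> splits the restriction. By the second,
  \<open>f = \<Sum>\<^sub>i b\<^sub>i \<bullet> c\<^sub>i\<close> with \<open>c\<^sub>i(z) = f(pr(z) d\<^sub>i)\<close>, while \<open>\<Sum>\<^sub>i b\<^sub>i \<odot> c\<^sub>i = f \<circ> pr\<close> vanishes when \<open>f\<close> does on \<open>D\<^bsub>Q\<^esub>\<close>.
\<close>

text \<open>The argument never chooses a basis of \<open>DWa G\<close> over \<open>S\<close>. A
  functional is determined by its values on the \<open>eta u\<close>, so each dual is a set of
  functions on the affine Weyl group cut out by integrality. The price is that products and
  antipodes must be shown integral by induction over the generators. The quotient of
  \<open>x \<mu> - x (reflection \<alpha> \<mu>)\<close> by \<open>x \<alpha>\<close> is in general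
  a series and not an integer, so the Demazure elements themselves offer no degree count; the
  additive \<open>t\<close> does. The length |W| of the words comes from interpolation: |W| - 1
  linear factors isolate one element of \<open>W\<close>. The rationals in \<open>R\<close> serve to
  divide by |W|, by an exponent n with w^n = 1, and by a sum of products of Cartan integers. The
  coproduct forces a second kernel computation, on balanced biadditive maps. Such a map is linear
  over \<open>S\<close> only in its first argument; at \<open>eta u\<close> a scalar leaves the
  second argument twisted by the finite part of \<open>u\<close>. The constructions
  \<open>ext\<close> and \<open>th\<close> introduce and undo this twist.\<close>

section \<open>Reflections and the finite Weyl group\<close>

lemma reflection_linear: "linear (reflection \<alpha>)"
  unfolding reflection_def
  by (rule linearI) (auto simp: algebra_simps inner_add_left)

lemmas reflection_scaleR = linear_scale[OF reflection_linear]
  and reflection_diff = linear_diff[OF reflection_linear]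
  and reflection_neg = linear_neg[OF reflection_linear]

lemma inner_coroot_self: "\<alpha> \<noteq> 0 \<Longrightarrow> inner \<alpha> (coroot \<alpha>) = 2"
  by (simp add: coroot_def)

lemma reflection_self: "\<alpha> \<noteq> 0 \<Longrightarrow> reflection \<alpha> \<alpha> = - \<alpha>"
  unfolding reflection_def inner_coroot_self by (simp add: scaleR_2)

lemma reflection_involutive: "reflection \<alpha> (reflection \<alpha> v) = v"
proof (cases "\<alpha> = 0")
  case False
  have "reflection \<alpha> (reflection \<alpha> v) = reflection \<alpha> v - inner v (coroot \<alpha>) *\<^sub>R reflection \<alpha> \<alpha>"
    by (subst (2) reflection_def) (simp add: reflection_diff reflection_scaleR)
  then show ?thesis by (simp add: reflection_self[OF False]) (simp add: reflection_def)
qed (simp add: reflection_def)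

lemma reflection_comp_self: "reflection \<alpha> \<circ> reflection \<alpha> = id"
  by (simp add: fun_eq_iff reflection_involutive)

lemma reflection_inner: "inner (reflection \<alpha> v) (reflection \<alpha> w) = inner v w"
proof (cases "\<alpha> = 0")
  case False
  then show ?thesis
    by (simp add: reflection_def coroot_def inner_diff_left inner_diff_right inner_commute field_simps)
qed (simp add: reflection_def)

lemma reflection_minus: "reflection (- \<alpha>) = reflection \<alpha>"
  by (simp add: fun_eq_iff reflection_def coroot_def)

lemma weyl_linear: "w \<in> weyl_group \<Phi> \<Longrightarrow> linear w"
proof (induction rule: weyl_group.induct)
  case id
  show ?case unfolding id_def by (rule linear_ident)
qed (rule linear_compose[OF _ reflection_linear])

lemma weyl_inner: "w \<in> weyl_group \<Phi> \<Longrightarrow> inner (w x) (w y) = inner x y"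
  by (induction rule: weyl_group.induct) (auto simp: reflection_inner)

lemma weyl_comp: "w \<in> weyl_group \<Phi> \<Longrightarrow> v \<in> weyl_group \<Phi> \<Longrightarrow> w \<circ> v \<in> weyl_group \<Phi>"
  by (induction rule: weyl_group.induct) (auto simp: comp_assoc intro: weyl_group.refl)

lemma weyl_refl: "\<alpha> \<in> \<Phi> \<Longrightarrow> reflection \<alpha> \<in> weyl_group \<Phi>"
  using weyl_group.refl[OF _ weyl_group.id] by fastforce

text \<open>The inductive set \<open>weyl_group\<close> provides left multiplication by reflections
  only, so inverses have to be built along the way: each new reflection is its own inverse and is
  appended on the right.\<close>

lemma weyl_inverse: "w \<in> weyl_group \<Phi> \<Longrightarrow> \<exists>v\<in>weyl_group \<Phi>. (\<forall>x. w (v x) = x) \<and> (\<forall>x. v (w x) = x)"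
proof (induction rule: weyl_group.induct)
  case id
  show ?case by (rule bexI[of _ id]) (auto intro: weyl_group.id)
next
  case (refl \<alpha> w)
  then obtain v where "v \<in> weyl_group \<Phi>" "\<And>x. w (v x) = x" "\<And>x. v (w x) = x" by blast
  then show ?case using refl
    by (intro bexI[of _ "v \<circ> reflection \<alpha>"]) (simp_all add: reflection_involutive weyl_comp weyl_refl)
qed

lemma weyl_bij: "w \<in> weyl_group \<Phi> \<Longrightarrow> bij w"
  using weyl_inverse[of w \<Phi>] bij_betw_byWitness[of UNIV _ w UNIV] by auto

abbreviation winv :: "('v \<Rightarrow> 'v) \<Rightarrow> 'v \<Rightarrow> 'v" where
  "winv \<equiv> inv_into UNIV"

lemma weyl_inv_comp:
  assumes "w \<in> weyl_group \<Phi>"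
  shows "w (winv w x) = x" "winv w (w x) = x"
  using weyl_bij[OF assms] by (simp_all add: bij_is_inj bij_is_surj surj_f_inv_f)

lemma weyl_inv:
  assumes "w \<in> weyl_group \<Phi>" shows "winv w \<in> weyl_group \<Phi>"
proof -
  obtain v where v: "v \<in> weyl_group \<Phi>" "\<And>x. w (v x) = x" "\<And>x. v (w x) = x"
    using weyl_inverse[OF assms] by blast
  have "winv w x = v x" for x using weyl_inv_comp(2)[OF assms, of "v x"] v(2) by simp
  then have "winv w = v" by (rule ext)
  then show ?thesis using v(1) by simp
qed

lemma weyl_roots:
  assumes "root_system \<Phi>" "w \<in> weyl_group \<Phi>" "\<beta> \<in> \<Phi>"
  shows "w \<beta> \<in> \<Phi>"
  using assms(2,3) assms(1) by (induction rule: weyl_group.induct) (auto simp: root_system_def)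

lemma weyl_coroot:
  assumes "w \<in> weyl_group \<Phi>" shows "w (coroot \<beta>) = coroot (w \<beta>)"
  by (simp add: coroot_def weyl_inner[OF assms] linear_scale[OF weyl_linear[OF assms]])

lemma weyl_reflection:
  assumes "w \<in> weyl_group \<Phi>"
  shows "reflection (w \<beta>) \<circ> w = w \<circ> reflection \<beta>"
  by (simp add: fun_eq_iff reflection_def linear_diff[OF weyl_linear[OF assms]]
      linear_scale[OF weyl_linear[OF assms]] weyl_inner[OF assms] flip: weyl_coroot[OF assms])

text \<open>The roots span the space, so an element of the group is determined by its restriction to
  the finite set \<Phi>, and this restriction maps \<Phi> to itself.\<close>

lemma finite_weyl_group:
  assumes "root_system \<Phi>" shows "finite (weyl_group \<Phi>)"
proof -
  have fin: "finite \<Phi>" and sp: "span \<Phi> = UNIV" using assms by (auto simp: root_system_def)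
  have "inj_on (\<lambda>w. restrict w \<Phi>) (weyl_group \<Phi>)"
  proof (rule inj_onI, rule ext)
    fix w v x assume w: "w \<in> weyl_group \<Phi>" "v \<in> weyl_group \<Phi>" and eq: "restrict w \<Phi> = restrict v \<Phi>"
    have "x \<in> span \<Phi>" using sp by simp
    then show "w x = v x"
      by (rule linear_eq_on_span[OF weyl_linear[OF w(1)] weyl_linear[OF w(2)], rotated])
        (metis eq restrict_apply')
  qed
  moreover have "(\<lambda>w. restrict w \<Phi>) ` weyl_group \<Phi> \<subseteq> \<Phi> \<rightarrow>\<^sub>E \<Phi>"
    using weyl_roots[OF assms] by auto
  ultimately show ?thesis
    using finite_PiE[OF fin, of "\<lambda>_. \<Phi>"] fin by (meson finite_imageD finite_subset)
qed

section \<open>Root lattice and coroot lattice as integral combinations\<close>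

lemma int_comb_zero: "0 \<in> int_comb A"
  unfolding int_comb_def by (rule CollectI, rule exI[of _ "\<lambda>_. 0"]) simp

lemma int_comb_add:
  assumes "x \<in> int_comb A" "y \<in> int_comb A" shows "x + y \<in> int_comb A"
proof -
  obtain k l where "x = (\<Sum>a\<in>A. real_of_int (k a) *\<^sub>R a)" "y = (\<Sum>a\<in>A. real_of_int (l a) *\<^sub>R a)"
    using assms by (auto simp: int_comb_def)
  then have "x + y = (\<Sum>a\<in>A. real_of_int (k a + l a) *\<^sub>R a)"
    by (simp add: sum.distrib scaleR_left_distrib)
  then show ?thesis unfolding int_comb_def
    by (intro CollectI exI[of _ "\<lambda>a. k a + l a"]) simp
qed

lemma int_comb_neg:
  assumes "x \<in> int_comb A" shows "- x \<in> int_comb A"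
proof -
  obtain k where "x = (\<Sum>a\<in>A. real_of_int (k a) *\<^sub>R a)"
    using assms by (auto simp: int_comb_def)
  then have "- x = (\<Sum>a\<in>A. real_of_int (- k a) *\<^sub>R a)"
    by (simp add: sum_negf)
  then show ?thesis unfolding int_comb_def
    by (intro CollectI exI[of _ "\<lambda>a. - k a"]) simp
qed

lemma int_comb_diff: "x \<in> int_comb A \<Longrightarrow> y \<in> int_comb A \<Longrightarrow> x - y \<in> int_comb A"
  using int_comb_add[of x A "- y"] int_comb_neg by fastforce

lemma int_comb_incl:
  assumes "finite A" "a \<in> A" shows "a \<in> int_comb A"
proof -
  have "(\<Sum>b\<in>A. real_of_int (if b = a then 1 else 0) *\<^sub>R b) = (\<Sum>b\<in>A. if b = a then b else 0)"
    by (rule sum.cong) auto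
  then have "a = (\<Sum>b\<in>A. real_of_int (if b = a then 1 else 0) *\<^sub>R b)" using assms by simp
  then show ?thesis unfolding int_comb_def
    by (intro CollectI exI[of _ "\<lambda>b. if b = a then 1 else 0"]) simp
qed

lemma scaleR_of_int_closed:
  fixes a :: "'v::real_vector"
  assumes "P 0" "\<And>x y. P x \<Longrightarrow> P y \<Longrightarrow> P (x + y)" "\<And>x. P x \<Longrightarrow> P (- x)" "P a"
  shows "P (real_of_int k *\<^sub>R a)"
proof (induction k rule: int_induct[where k = 0])
  case base show ?case by (simp only: of_int_0 scaleR_zero_left assms(1))
next
  case (step1 i)
  have "real_of_int (i + 1) *\<^sub>R a = real_of_int i *\<^sub>R a + a" by (simp add: scaleR_left_distrib)
  then show ?case using assms(2)[OF step1(2) assms(4)] by (simp only:)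
next
  case (step2 i)
  have "real_of_int (i - 1) *\<^sub>R a = real_of_int i *\<^sub>R a + - a" by (simp add: scaleR_left_diff_distrib)
  then show ?case using assms(2)[OF step2(2) assms(3)[OF assms(4)]] by (simp only:)
qed

text \<open>Lets later proofs treat the lattice as the subgroup generated by \<open>A\<close>,
  without coefficient functions.\<close>

lemma int_comb_induct [consumes 1, case_names zero add neg incl]:
  assumes "x \<in> int_comb A"
    and "P 0" "\<And>x y. P x \<Longrightarrow> P y \<Longrightarrow> P (x + y)" "\<And>x. P x \<Longrightarrow> P (- x)" "\<And>a. a \<in> A \<Longrightarrow> P a"
  shows "P x"
proof -
  obtain k where x: "x = (\<Sum>a\<in>A. real_of_int (k a) *\<^sub>R a)"
    using assms by (auto simp: int_comb_def)
  have "P (\<Sum>a\<in>B. real_of_int (k a) *\<^sub>R a)" if "B \<subseteq> A" for B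
    using that
  proof (induction B rule: infinite_finite_induct)
    case (insert b B)
    then show ?case using assms(3) scaleR_of_int_closed[of P b, OF assms(2-4)] assms(5) by simp
  qed (use assms(2) in auto)
  then show ?thesis using x by simp
qed

lemma int_comb_scale: "x \<in> int_comb A \<Longrightarrow> real_of_int k *\<^sub>R x \<in> int_comb A"
  by (rule scaleR_of_int_closed) (auto intro: int_comb_zero int_comb_add int_comb_neg)

lemma int_comb_sum: "(\<And>i. i \<in> I \<Longrightarrow> f i \<in> int_comb A) \<Longrightarrow> (\<Sum>i\<in>I. f i) \<in> int_comb A"
  by (induction I rule: infinite_finite_induct) (auto intro: int_comb_zero int_comb_add)

lemma weyl_int_comb:
  assumes "root_system \<Phi>" "w \<in> weyl_group \<Phi>" "x \<in> int_comb \<Phi>"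
  shows "w x \<in> int_comb \<Phi>"
proof -
  note l = weyl_linear[OF assms(2)]
  show ?thesis using assms(3)
    by (induction rule: int_comb_induct)
      (auto simp: linear_0[OF l] linear_add[OF l] linear_neg[OF l]
        intro: int_comb_zero int_comb_add int_comb_neg int_comb_incl weyl_roots assms(1,2)
          assms(1)[unfolded root_system_def, THEN conjunct1])
qed

lemma weyl_int_comb_coroot:
  assumes "root_system \<Phi>" "w \<in> weyl_group \<Phi>" "x \<in> int_comb (coroot ` \<Phi>)"
  shows "w x \<in> int_comb (coroot ` \<Phi>)"
proof -
  note l = weyl_linear[OF assms(2)]
  have f: "finite (coroot ` \<Phi>)" using assms by (auto simp: root_system_def)
  have "coroot (w \<beta>) \<in> int_comb (coroot ` \<Phi>)" if "\<beta> \<in> \<Phi>" for \<beta>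
    using int_comb_incl[OF f] weyl_roots[OF assms(1,2) that] by blast
  with assms(3) show ?thesis
    by (induction rule: int_comb_induct)
      (auto simp: linear_0[OF l] linear_add[OF l] linear_neg[OF l] weyl_coroot[OF assms(2)]
        intro: int_comb_zero int_comb_add int_comb_neg)
qed

lemma int_comb_pairing:
  assumes "root_system \<Phi>" "\<beta> \<in> \<Phi>" "x \<in> int_comb \<Phi>"
  shows "inner x (coroot \<beta>) \<in> \<int>"
  using assms(3)
  by (induction rule: int_comb_induct)
    (use assms in \<open>auto simp: inner_add_left root_system_def\<close>)

text \<open>A real vector space is not a finite union of hyperplanes: a vector that is good for
  \<open>F\<close> is moved along the new \<gamma>, avoiding finitely many bad parameters. It will
  supply regular vectors.\<close>

lemma ex_vector_avoiding_hyperplanes: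
  fixes F :: "'v::real_inner set"
  assumes "finite F" "0 \<notin> F"
  shows "\<exists>v. \<forall>\<gamma>\<in>F. inner \<gamma> v \<noteq> 0"
  using assms
proof (induction F rule: finite_induct)
  case (insert \<gamma> F)
  then obtain v where v: "\<forall>\<delta>\<in>F. inner \<delta> v \<noteq> 0" by auto
  \<comment> \<open>The parameters at which the moved vector could become orthogonal to some
    \<delta>. If \<delta> is itself orthogonal to \<gamma>, the quotient is 0 by convention and the
    product with \<delta> does not change at all.\<close>
  define B where "B = (\<lambda>\<delta>. - inner \<delta> v / inner \<delta> \<gamma>) ` insert \<gamma> F"
  have "finite (insert 0 B)" using insert by (auto simp: B_def)
  then obtain t where t: "t \<notin> insert 0 B" using ex_new_if_finite[OF infinite_UNIV_char_0] by blast
  have "inner \<delta> (v + t *\<^sub>R \<gamma>) \<noteq> 0" if "\<delta> \<in> insert \<gamma> F" for \<delta>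
  proof (cases "inner \<delta> \<gamma> = 0")
    case True
    then have "\<delta> \<in> F" using insert.prems that by auto
    then show ?thesis using v True by (simp add: inner_add_right)
  next
    case False
    have "t \<noteq> - inner \<delta> v / inner \<delta> \<gamma>" using t that by (auto simp: B_def)
    then show ?thesis using False by (auto simp: inner_add_right field_simps add_eq_0_iff2)
  qed
  then show ?case by blast
qed auto

section \<open>Words in simple reflections, positive roots and the exchange argument\<close>

fun refl_word :: "'v::euclidean_space list \<Rightarrow> 'v \<Rightarrow> 'v" where
  "refl_word [] = id"
| "refl_word (a # L) = reflection a \<circ> refl_word L"

lemma refl_word_append: "refl_word (L @ M) = refl_word L \<circ> refl_word M"
  by (induction L) (auto simp: comp_assoc)

lemma refl_word_weyl: "set L \<subseteq> \<Phi> \<Longrightarrow> refl_word L \<in> weyl_group \<Phi>"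
  by (induction L) (auto intro: weyl_group.intros)

lemma refl_word_rev: "refl_word (rev L) (refl_word L x) = x"
  by (induction L arbitrary: x) (simp_all add: refl_word_append reflection_involutive)

locale based_root_system =
  fixes \<Phi> \<Delta> :: "'v::euclidean_space set"
  assumes root_system: "root_system \<Phi>" and simple: "simple_roots \<Phi> \<Delta>"
begin

abbreviation "W \<equiv> weyl_group \<Phi>"

abbreviation coef :: "'v \<Rightarrow> 'v \<Rightarrow> real" where
  "coef \<equiv> representation \<Delta>"

definition pos :: "'v set" where "pos = \<Phi> \<inter> nat_comb \<Delta>"

lemma finite_roots: "finite \<Phi>" and zero_notin_roots: "0 \<notin> \<Phi>"
  and roots_refl: "\<alpha> \<in> \<Phi> \<Longrightarrow> \<beta> \<in> \<Phi> \<Longrightarrow> reflection \<alpha> \<beta> \<in> \<Phi>"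
  and roots_int: "\<alpha> \<in> \<Phi> \<Longrightarrow> \<beta> \<in> \<Phi> \<Longrightarrow> inner \<beta> (coroot \<alpha>) \<in> \<int>"
  and roots_reduced: "\<alpha> \<in> \<Phi> \<Longrightarrow> r *\<^sub>R \<alpha> \<in> \<Phi> \<Longrightarrow> r = 1 \<or> r = -1"
  using root_system by (auto simp: root_system_def)

lemma roots_neg: "\<alpha> \<in> \<Phi> \<Longrightarrow> - \<alpha> \<in> \<Phi>"
  using roots_refl[of \<alpha> \<alpha>] reflection_self[of \<alpha>] zero_notin_roots by metis

lemma roots_inner_pos: "\<alpha> \<in> \<Phi> \<Longrightarrow> inner \<alpha> \<alpha> > 0"
  using zero_notin_roots by auto

lemma simple_sub: "\<Delta> \<subseteq> \<Phi>" and indep: "independent \<Delta>"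
  and root_sign: "\<beta> \<in> \<Phi> \<Longrightarrow> \<beta> \<in> nat_comb \<Delta> \<or> - \<beta> \<in> nat_comb \<Delta>"
  using simple by (auto simp: simple_roots_def)

lemma finite_simple: "finite \<Delta>"
  using simple_sub finite_roots finite_subset by blast

lemma nat_comb_span: "nat_comb \<Delta> \<subseteq> span \<Delta>"
  by (auto simp: nat_comb_def intro: span_sum span_scale span_base)

lemma span_simple: "span \<Delta> = UNIV"
proof -
  have "\<Phi> \<subseteq> span \<Delta>" using root_sign nat_comb_span span_neg by (metis minus_minus subset_iff)
  then have "span \<Phi> \<subseteq> span \<Delta>" using span_minimal subspace_span by blast
  then show ?thesis using root_system by (auto simp: root_system_def)
qed

lemma coef_diff: "coef (x - y) a = coef x a - coef y a"
  and coef_neg: "coef (- x) a = - coef x a"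
  and coef_scale: "coef (r *\<^sub>R x) a = r * coef x a"
  and coef_sum: "coef (sum f I) a = (\<Sum>i\<in>I. coef (f i) a)"
  by (simp_all add: representation_diff[OF indep] representation_neg[OF indep]
      representation_scale[OF indep] representation_sum[OF indep] span_simple)

lemma coef_simple: "a \<in> \<Delta> \<Longrightarrow> coef a b = (if b = a then 1 else 0)"
  by (simp add: representation_basis[OF indep])

lemma coef_expand: "(\<Sum>a\<in>\<Delta>. coef x a *\<^sub>R a) = x"
  by (rule sum_representation_eq[OF indep]) (auto simp: span_simple finite_simple)

lemma nat_comb_iff: "x \<in> nat_comb \<Delta> \<longleftrightarrow> (\<forall>a\<in>\<Delta>. coef x a \<in> \<nat>)"
proof
  assume "x \<in> nat_comb \<Delta>"
  then obtain k where x: "x = (\<Sum>a\<in>\<Delta>. real (k a) *\<^sub>R a)" by (auto simp: nat_comb_def)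
  have "coef x b = real (k b)" if "b \<in> \<Delta>" for b
  proof -
    have "coef x b = (\<Sum>a\<in>\<Delta>. real (k a) * (if b = a then 1 else 0))"
      unfolding x coef_sum by (rule sum.cong) (auto simp: coef_scale coef_simple)
    then show ?thesis using that finite_simple by (simp add: if_distrib cong: if_cong)
  qed
  then show "\<forall>a\<in>\<Delta>. coef x a \<in> \<nat>" by simp
next
  assume N: "\<forall>a\<in>\<Delta>. coef x a \<in> \<nat>"
  have "x = (\<Sum>a\<in>\<Delta>. real (nat \<lfloor>coef x a\<rfloor>) *\<^sub>R a)"
    by (subst coef_expand[symmetric], rule sum.cong) (use N in \<open>auto elim!: Nats_cases\<close>)
  then show "x \<in> nat_comb \<Delta>" unfolding nat_comb_def by (intro CollectI exI[of _ "\<lambda>a. nat \<lfloor>coef x a\<rfloor>"]) simp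
qed

lemma nat_comb_inner_nonneg:
  assumes "x \<in> nat_comb \<Delta>" "\<And>a. a \<in> \<Delta> \<Longrightarrow> inner a v \<ge> 0"
  shows "inner x v \<ge> 0"
proof -
  have "inner x v = (\<Sum>a\<in>\<Delta>. coef x a * inner a v)"
    by (subst coef_expand[of x, symmetric]) (simp add: inner_sum_left)
  moreover have "coef x a \<ge> 0" if "a \<in> \<Delta>" for a
    using assms(1) that by (auto simp: nat_comb_iff elim!: Nats_cases ballE[of _ _ a])
  ultimately show ?thesis using assms(2) by (simp add: sum_nonneg)
qed

lemma pos_neg: "\<beta> \<in> pos \<Longrightarrow> - \<beta> \<notin> pos"
proof
  assume b: "\<beta> \<in> pos" "- \<beta> \<in> pos"
  have "coef \<beta> a = 0" if "a \<in> \<Delta>" for a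
    using b that by (auto simp: pos_def nat_comb_iff coef_neg elim!: ballE[of _ _ a] Nats_cases)
  then have "\<beta> = 0" using coef_expand[of \<beta>] by simp
  then show False using b zero_notin_roots by (auto simp: pos_def)
qed

lemma pos_roots: "\<beta> \<in> pos \<Longrightarrow> \<beta> \<in> \<Phi>" by (simp add: pos_def)

lemma root_cases: "\<beta> \<in> \<Phi> \<Longrightarrow> \<beta> \<in> pos \<or> - \<beta> \<in> pos"
  using root_sign roots_neg by (auto simp: pos_def)

lemma pos_coef_nonneg: "\<beta> \<in> pos \<Longrightarrow> a \<in> \<Delta> \<Longrightarrow> coef \<beta> a \<ge> 0"
  by (auto simp: pos_def nat_comb_iff elim!: Nats_cases ballE[of _ _ a])

lemma pos_of_coef: "\<beta> \<in> \<Phi> \<Longrightarrow> a \<in> \<Delta> \<Longrightarrow> coef \<beta> a > 0 \<Longrightarrow> \<beta> \<in> pos"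
  using root_cases[of \<beta>] pos_coef_nonneg[of "- \<beta>" a] by (auto simp: coef_neg)

lemma simple_pos: "a \<in> \<Delta> \<Longrightarrow> a \<in> pos"
  using pos_of_coef[of a a] simple_sub by (auto simp: coef_simple)

text \<open>Reflecting in \<open>a\<close> changes only the coefficient at \<open>a\<close>. Since
  the root system is reduced, \<beta> is not a multiple of \<open>a\<close>, so it has a positive
  coefficient elsewhere; this one survives and fixes the sign.\<close>

lemma reflection_simple_pos:
  assumes "a \<in> \<Delta>" "\<beta> \<in> pos" "\<beta> \<noteq> a"
  shows "reflection a \<beta> \<in> pos"
proof -
  have "\<exists>b\<in>\<Delta>. b \<noteq> a \<and> coef \<beta> b > 0"
  proof (rule ccontr)
    assume n: "\<not> ?thesis"
    have z: "coef \<beta> b = 0" if "b \<in> \<Delta>" "b \<noteq> a" for b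
      using pos_coef_nonneg[OF assms(2) that(1)] that n by force
    have "\<beta> = (\<Sum>b\<in>\<Delta>. if b = a then coef \<beta> b *\<^sub>R b else 0)"
      by (subst coef_expand[of \<beta>, symmetric], rule sum.cong) (auto simp: z)
    then have e: "\<beta> = coef \<beta> a *\<^sub>R a" using assms finite_simple by simp
    have "coef \<beta> a = 1 \<or> coef \<beta> a = -1"
      by (rule roots_reduced[of a]) (use e assms simple_sub pos_roots in auto)
    then show False using e assms pos_coef_nonneg[OF assms(2,1)] by auto
  qed
  then obtain b where b: "b \<in> \<Delta>" "b \<noteq> a" "coef \<beta> b > 0" by blast
  have "coef (reflection a \<beta>) b = coef \<beta> b"
    using b by (simp add: reflection_def coef_diff coef_scale coef_simple assms(1))
  then show ?thesis using b assms pos_roots simple_sub by (intro pos_of_coef[OF roots_refl, of _ _ b]) auto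
qed

text \<open>Descent on the height. As the squared length of \<beta> is positive, some simple
  \<open>a\<close> has positive product with \<beta>; reflecting in it stays inside
  \<open>pos\<close> and lowers the height by an integer that is at least 1. The height is a real
  number here, hence the floor in the induction measure.\<close>

lemma pos_conj_simple:
  "\<beta> \<in> pos \<Longrightarrow> \<exists>L a. set L \<subseteq> \<Delta> \<and> a \<in> \<Delta> \<and> \<beta> = refl_word L a"
proof (induction "nat \<lfloor>\<Sum>a\<in>\<Delta>. coef \<beta> a\<rfloor>" arbitrary: \<beta> rule: less_induct)
  case less
  show ?case
  proof (cases "\<beta> \<in> \<Delta>")
    case True
    then show ?thesis by (intro exI[of _ "[]"] exI[of _ \<beta>]) simp
  next
    case False
    have "0 < inner \<beta> \<beta>" using less.prems pos_roots roots_inner_pos by blast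
    also have "inner \<beta> \<beta> = (\<Sum>a\<in>\<Delta>. coef \<beta> a * inner a \<beta>)"
      by (subst (1) coef_expand[of \<beta>, symmetric]) (simp add: inner_sum_left)
    finally obtain a where a: "a \<in> \<Delta>" "coef \<beta> a * inner a \<beta> > 0"
      by (meson not_less sum_nonpos)
    then have ia: "inner a \<beta> > 0" using pos_coef_nonneg[OF less.prems a(1)]
      by (simp add: zero_less_mult_iff)
    define c where "c = inner \<beta> (coroot a)"
    have c0: "c > 0" using ia a(1) simple_sub roots_inner_pos[of a]
      by (auto simp: c_def coroot_def inner_commute)
    have "c \<in> \<int>" unfolding c_def using roots_int[of a \<beta>] a simple_sub less.prems pos_roots by blast
    then have c: "c \<ge> 1" using c0 by (auto elim!: Ints_cases)
    define \<gamma> where "\<gamma> = reflection a \<beta>"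
    have g: "\<gamma> \<in> pos" unfolding \<gamma>_def
      by (rule reflection_simple_pos) (use a False less.prems in auto)
    have "(\<Sum>b\<in>\<Delta>. coef \<gamma> b) = (\<Sum>b\<in>\<Delta>. coef \<beta> b - (if b = a then c else 0))"
      by (rule sum.cong) (auto simp: \<gamma>_def reflection_def coef_diff coef_scale coef_simple a(1) c_def)
    then have ht: "(\<Sum>b\<in>\<Delta>. coef \<gamma> b) = (\<Sum>b\<in>\<Delta>. coef \<beta> b) - c"
      using a finite_simple by (simp add: sum_subtractf)
    moreover have "(\<Sum>b\<in>\<Delta>. coef \<gamma> b) \<ge> 0" using pos_coef_nonneg[OF g] by (simp add: sum_nonneg)
    ultimately have "nat \<lfloor>\<Sum>b\<in>\<Delta>. coef \<gamma> b\<rfloor> < nat \<lfloor>\<Sum>b\<in>\<Delta>. coef \<beta> b\<rfloor>" using c by linarith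
    then obtain L b where L: "set L \<subseteq> \<Delta>" "b \<in> \<Delta>" "\<gamma> = refl_word L b" using less.hyps g by blast
    have "\<beta> = refl_word (a # L) b" using L by (simp flip: L(3)) (simp add: \<gamma>_def reflection_involutive)
    then show ?thesis using L a by (intro exI[of _ "a # L"] exI[of _ b]) auto
  qed
qed

text \<open>A positive root is the image of a simple root \<open>a\<close> under a word
  \<open>L\<close>, so its reflection is the conjugate of the reflection in \<open>a\<close> by
  \<open>L\<close>. A root and its negative have the same reflection.\<close>

lemma root_reflection_word:
  assumes "\<beta> \<in> \<Phi>" shows "\<exists>L. set L \<subseteq> \<Delta> \<and> reflection \<beta> = refl_word L"
proof -
  have *: "\<exists>L. set L \<subseteq> \<Delta> \<and> reflection \<beta> = refl_word L" if b: "\<beta> \<in> pos" for \<beta>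
  proof -
    obtain L a where L: "set L \<subseteq> \<Delta>" "a \<in> \<Delta>" "\<beta> = refl_word L a" using pos_conj_simple[OF b] by blast
    have "L = rev (rev L)" by simp
    then have "refl_word L (refl_word (rev L) x) = x" for x by (metis refl_word_rev)
    moreover have "reflection \<beta> \<circ> refl_word L = refl_word L \<circ> reflection a" unfolding L(3)
      by (rule weyl_reflection[OF refl_word_weyl]) (use L simple_sub in auto)
    ultimately have "reflection \<beta> x = refl_word (L @ a # rev L) x" for x
      by (simp add: refl_word_append) (metis comp_apply)
    then show ?thesis using L by (intro exI[of _ "L @ a # rev L"]) auto
  qed
  show ?thesis using root_cases[OF assms] *[of \<beta>] *[of "- \<beta>"] by (auto simp: reflection_minus)
qed

lemma weyl_word: "w \<in> W \<Longrightarrow> \<exists>L. set L \<subseteq> \<Delta> \<and> w = refl_word L"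
proof (induction rule: weyl_group.induct)
  case id show ?case by (rule exI[of _ "[]"]) simp
next
  case (refl \<alpha> w)
  obtain L M where "set L \<subseteq> \<Delta>" "reflection \<alpha> = refl_word L" "set M \<subseteq> \<Delta>" "w = refl_word M"
    using refl root_reflection_word by blast
  then show ?case by (intro exI[of _ "L @ M"]) (simp add: refl_word_append)
qed

text \<open>Read from the right, the letters carry the positive root \<open>a\<close> along until it
  leaves \<open>pos\<close> at some letter \<open>b\<close>. A simple reflection makes no positive
  root negative except its own, so at that moment the image of \<open>a\<close> is
  \<open>b\<close>.\<close>

lemma exchange_aux:
  assumes "set M \<subseteq> \<Delta>" "a \<in> \<Delta>" "refl_word M a \<notin> pos"
  shows "\<exists>M1 b M2. M = M1 @ b # M2 \<and> refl_word M2 a = b"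
  using assms
proof (induction M)
  case Nil then show ?case using simple_pos by auto
next
  case (Cons b M)
  show ?case
  proof (cases "refl_word M a \<in> pos")
    case True
    then have "refl_word M a = b" using Cons.prems reflection_simple_pos[of b] by auto
    then show ?thesis by (intro exI[of _ "[]"]) auto
  next
    case False
    then obtain M1 c M2 where "M = M1 @ c # M2" "refl_word M2 a = c" using Cons by auto
    then show ?thesis by (intro exI[of _ "b # M1"]) auto
  qed
qed

text \<open>The last letter \<open>a\<close> turns the root \<open>a\<close> into its negative, so
  the remaining word \<open>M\<close> must send \<open>a\<close> out of \<open>pos\<close>. By the
  exchange argument \<open>M\<close> has a letter that cancels against the last one, and the word
  becomes shorter by two.\<close>

lemma word_preserving_pos:
  assumes "set L \<subseteq> \<Delta>" "\<And>\<beta>. \<beta> \<in> pos \<Longrightarrow> refl_word L \<beta> \<in> pos"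
  shows "refl_word L = id"
  using assms
proof (induction L rule: length_induct)
  case (1 L)
  show ?case
  proof (cases L rule: rev_cases)
    case (snoc M a)
    have a: "a \<in> \<Delta>" "set M \<subseteq> \<Delta>" "a \<noteq> 0" using 1 snoc simple_sub zero_notin_roots by auto
    have lin: "linear (refl_word M)"
      by (rule weyl_linear[OF refl_word_weyl[of _ \<Phi>]]) (use a simple_sub in auto)
    have "refl_word L a \<in> pos" using 1 a simple_pos by blast
    then have "- refl_word M a \<in> pos"
      by (simp add: snoc refl_word_append reflection_self[OF a(3)] linear_neg[OF lin])
    then have "refl_word M a \<notin> pos" using pos_neg by fastforce
    then obtain M1 b M2 where M: "M = M1 @ b # M2" "refl_word M2 a = b"
      using exchange_aux[OF a(2,1)] by blast
    have "reflection b \<circ> refl_word M2 = refl_word M2 \<circ> reflection a"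
      unfolding M(2)[symmetric]
      by (rule weyl_reflection[OF refl_word_weyl]) (use a M simple_sub in auto)
    then have e: "refl_word L = refl_word (M1 @ M2)"
      by (simp add: fun_eq_iff snoc M(1) refl_word_append reflection_involutive)
    have "refl_word (M1 @ M2) = id"
      by (rule 1(1)[rule_format]) (use 1 e snoc M in auto)
    then show ?thesis using e by simp
  qed simp
qed

text \<open>Among the finitely many images of \<open>v\<close>, one with the largest product with
  \<rho> is dominant: reflecting it in a simple root with which it has negative product would
  increase the maximum.\<close>

lemma ex_weyl_dominant: "\<exists>u\<in>W. \<forall>a\<in>\<Delta>. inner a (u v) \<ge> 0"
proof -
  obtain g where g: "linear g" "\<forall>a\<in>\<Delta>. g a = (1::real)"
    using linear_independent_extend[OF indep, of "\<lambda>_. 1"] by blast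
  \<comment> \<open>The vector representing the functional \<open>g\<close>; it has product 1 with
    every simple root.\<close>
  define \<rho> where "\<rho> = adjoint g 1"
  have rho: "inner x \<rho> = g x" for x using adjoint_works[OF g(1), of x 1] by (simp add: \<rho>_def)
  define F where "F = (\<lambda>u. inner (u v) \<rho>) ` W"
  have F: "finite F" "F \<noteq> {}" using finite_weyl_group[OF root_system] weyl_group.id
    by (auto simp: F_def)
  then have "Max F \<in> F" by (rule Max_in)
  then obtain u where u: "u \<in> W" "inner (u v) \<rho> = Max F" by (auto simp: F_def)
  have "inner a (u v) \<ge> 0" if a: "a \<in> \<Delta>" for a
  proof (rule ccontr)
    assume n: "\<not> inner a (u v) \<ge> 0"
    have "reflection a \<circ> u \<in> W" by (rule weyl_comp[OF weyl_refl u(1)]) (use a simple_sub in blast)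
    then have "inner ((reflection a \<circ> u) v) \<rho> \<le> Max F"
      unfolding F_def[symmetric] by (intro Max_ge[OF F(1)]) (unfold F_def, blast)
    then have "inner (u v) (coroot a) \<ge> 0"
      using g(2) a by (simp add: reflection_def u(2)[symmetric] rho linear_diff[OF g(1)] linear_scale[OF g(1)])
    moreover have "inner a a > 0" using a simple_sub roots_inner_pos by blast
    ultimately show False using n by (simp add: coroot_def inner_commute zero_le_divide_iff)
  qed
  then show ?thesis using u by blast
qed

text \<open>Conjugation by \<open>u\<close> makes \<open>v\<close> dominant, and regularity makes
  its products with positive roots strictly positive. The conjugate of \<open>w\<close> fixes this
  vector, hence preserves the sign of every root, hence is trivial.\<close>

lemma regular_stabilizer_trivial:
  assumes w: "w \<in> W" and fixed: "w v = v" and reg: "\<And>\<beta>. \<beta> \<in> \<Phi> \<Longrightarrow> inner \<beta> v \<noteq> 0"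
  shows "w = id"
proof -
  obtain u where u: "u \<in> W" "\<forall>a\<in>\<Delta>. inner a (u v) \<ge> 0" using ex_weyl_dominant by blast
  note ui = weyl_inv_comp[OF u(1)]
  have posi: "inner \<beta> (u v) > 0" if "\<beta> \<in> pos" for \<beta>
  proof -
    have "inner \<beta> (u v) \<ge> 0" by (rule nat_comb_inner_nonneg) (use that u in \<open>auto simp: pos_def\<close>)
    moreover have "inner \<beta> (u v) = inner (winv u \<beta>) v"
      using weyl_inner[OF u(1), of "winv u \<beta>" v] ui by simp
    moreover have "winv u \<beta> \<in> \<Phi>"
      using weyl_roots[OF root_system weyl_inv[OF u(1)]] that pos_roots by blast
    ultimately show ?thesis using reg[of "winv u \<beta>"] by simp
  qed
  define w' where "w' = u \<circ> w \<circ> winv u"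
  have w'W: "w' \<in> W" unfolding w'_def by (intro weyl_comp u w weyl_inv)
  have w'v: "w' (u v) = u v" by (simp add: w'_def ui fixed)
  have w'pos: "w' \<beta> \<in> pos" if "\<beta> \<in> pos" for \<beta>
  proof (rule ccontr)
    assume "w' \<beta> \<notin> pos"
    then have "- w' \<beta> \<in> pos" using root_cases weyl_roots[OF root_system w'W pos_roots[OF that]] by blast
    then have "inner (- w' \<beta>) (u v) > 0" by (rule posi)
    moreover have "inner (w' \<beta>) (u v) = inner \<beta> (u v)" using weyl_inner[OF w'W, of \<beta> "u v"] w'v by simp
    ultimately show False using posi[OF that] by simp
  qed
  obtain L where L: "set L \<subseteq> \<Delta>" "w' = refl_word L" using weyl_word[OF w'W] by blast
  have "w' = id" using word_preserving_pos L w'pos by auto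
  then have "u (w (winv u x)) = x" for x by (metis w'_def comp_apply id_apply)
  then show ?thesis 
    using ui by (simp add: fun_eq_iff) (metis ui(1))
qed

lemma weyl_funpow: "w \<in> W \<Longrightarrow> w ^^ n \<in> W"
  by (induction n) (auto intro: weyl_group.id weyl_comp)

lemma weyl_finite_order:
  assumes "w \<in> W" shows "\<exists>n>0. w ^^ n = id"
proof -
  have "\<not> inj (\<lambda>n. w ^^ n)"
    using finite_subset[OF _ finite_weyl_group[OF root_system], of "range (\<lambda>n. w ^^ n)"]
      finite_imageD[of "\<lambda>n. w ^^ n" UNIV] weyl_funpow[OF assms] by auto
  then obtain i j where "i \<noteq> j" "w ^^ i = w ^^ j" by (auto simp: inj_on_def)
  then obtain i j where ij: "i < j" "w ^^ i = w ^^ j" by (metis nat_neq_iff)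
  have "(w ^^ i) ((w ^^ (j - i)) x) = (w ^^ i) x" for x
    using ij funpow_add[of i "j - i" w] by (metis add_diff_inverse_nat comp_apply less_imp_not_less)
  then have "(w ^^ (j - i)) x = x" for x
    by (metis weyl_inv_comp(2)[OF weyl_funpow[OF assms]])
  then show ?thesis using ij by (intro exI[of _ "j - i"]) auto
qed

text \<open>Summation by parts, to be applied to the orbit of a root under the powers of
  \<open>w\<close>.\<close>

lemma abel_sum:
  fixes g :: "nat \<Rightarrow> 'b::real_vector"
  shows "(\<Sum>k<m. real k *\<^sub>R g (Suc k)) - (\<Sum>k<m. real k *\<^sub>R g k) = real m *\<^sub>R g m - (\<Sum>k<m. g (Suc k))"
  by (induction m) (auto simp: algebra_simps)

text \<open>If no root is killed by the norm \<open>N = 1 + w + \<dots> + w\<^bsup>n-1\<^esup>\<close>, then \<open>w\<close> fixes a regular vector.\<close>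

lemma weyl_displacement_root:
  assumes w: "w \<in> W" and ne: "w \<noteq> id"
  shows "\<exists>\<mu>\<in>int_comb \<Phi>. \<exists>\<beta>\<in>\<Phi>. \<exists>n>0. w \<mu> - \<mu> = real n *\<^sub>R \<beta>"
proof -
  obtain n where n: "n > 0" "w ^^ n = id" using weyl_finite_order[OF w] by blast
  define N where "N = (\<lambda>x. \<Sum>k<n. (w ^^ k) x)"
  have lin: "linear N" unfolding N_def
    by (rule linear_compose_sum) (use weyl_linear weyl_funpow w in blast)
  have sh: "(w ^^ Suc k) x = (w ^^ k) (w x)" for k x by (simp add: funpow_swap1)
  have Nw: "N (w x) = N x" for x
  proof -
    have "(\<Sum>k<Suc n. (w ^^ k) x) = x + N (w x)"
      unfolding N_def sum.lessThan_Suc_shift sh by simp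
    moreover have "(\<Sum>k<Suc n. (w ^^ k) x) = N x + x" using n by (simp add: N_def)
    ultimately show ?thesis by simp
  qed
  obtain \<beta> where b: "\<beta> \<in> \<Phi>" "N \<beta> = 0"
  proof (rule ccontr)
    assume "\<not> thesis"
    then have "0 \<notin> N ` \<Phi>" using that by force
    then obtain v where v: "\<forall>\<gamma>\<in>N ` \<Phi>. inner \<gamma> v \<noteq> 0"
      using ex_vector_avoiding_hyperplanes[of "N ` \<Phi>"] finite_roots by blast
    define v' where "v' = adjoint N v"
    have v': "inner x v' = inner (N x) v" for x using adjoint_works[OF lin, of x v] by (simp add: v'_def)
    have "inner x (w v') = inner x v'" for x
    proof -
      have "inner x (w v') = inner (winv w x) v'"
        using weyl_inner[OF w, of "winv w x" v'] weyl_inv_comp[OF w] by simp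
      also have "\<dots> = inner x v'" using Nw[of "winv w x"] by (simp add: v' weyl_inv_comp[OF w])
      finally show ?thesis .
    qed
    then have "\<forall>x. inner x (w v') = inner x v'" by (rule allI)
    then have "w v' = v'" by (simp only: vector_eq_ldot)
    moreover have "inner \<gamma> v' \<noteq> 0" if "\<gamma> \<in> \<Phi>" for \<gamma> using v that by (simp add: v')
    ultimately show False using regular_stabilizer_trivial[OF w] ne by blast
  qed
  \<comment> \<open>The weights \<open>k\<close> are chosen so that \<open>w \<mu> - \<mu>\<close>
    telescopes to \<open>n\<close> times the last term of the orbit minus a norm. The last term is
    \<beta> again because \<open>w ^^ n = id\<close>, and the norm vanishes on \<beta>.\<close>
  define \<mu> where "\<mu> = (\<Sum>k<n. real k *\<^sub>R (w ^^ k) \<beta>)"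
  have "real k *\<^sub>R (w ^^ k) \<beta> \<in> int_comb \<Phi>" for k
    using int_comb_scale[of _ \<Phi> "int k"] weyl_roots[OF root_system weyl_funpow[OF w] b(1)]
      int_comb_incl[OF finite_roots] by fastforce
  then have mu: "\<mu> \<in> int_comb \<Phi>" unfolding \<mu>_def by (intro int_comb_sum)
  have "w \<mu> = (\<Sum>k<n. real k *\<^sub>R (w ^^ Suc k) \<beta>)"
    unfolding \<mu>_def linear_sum[OF weyl_linear[OF w]] linear_scale[OF weyl_linear[OF w]] by simp
  then have "w \<mu> - \<mu> = real n *\<^sub>R (w ^^ n) \<beta> - (\<Sum>k<n. (w ^^ Suc k) \<beta>)"
    unfolding \<mu>_def using abel_sum[of "\<lambda>k. (w ^^ k) \<beta>" n] by simp
  also have "(\<Sum>k<n. (w ^^ Suc k) \<beta>) = N (w \<beta>)" unfolding N_def sh by simp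
  finally have "w \<mu> - \<mu> = real n *\<^sub>R \<beta>" using n b Nw by simp
  then show ?thesis using mu b n by blast
qed

end

section \<open>The highest root and generation of the coroot lattice by its orbit\<close>

locale irreducible_root_system = based_root_system \<Phi> \<Delta>
  for \<Phi> \<Delta> :: "'v::euclidean_space set" +
  fixes \<theta> :: 'v
  assumes irreducible: "irreducible_roots \<Phi>" and highest: "highest_root \<Phi> \<Delta> \<theta>"
begin

lemma theta_root: "\<theta> \<in> \<Phi>" and theta_highest: "\<beta> \<in> \<Phi> \<Longrightarrow> \<theta> - \<beta> \<in> nat_comb \<Delta>"
  using highest by (auto simp: highest_root_def)

text \<open>The difference of \<theta> and its reflection is a multiple of \<open>a\<close>;
  maximality of \<theta> forces the coefficient to be nonnegative.\<close>

lemma theta_dominant: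
  assumes "a \<in> \<Delta>" shows "inner a \<theta> \<ge> 0"
proof -
  have n: "\<theta> - reflection a \<theta> \<in> nat_comb \<Delta>"
    using theta_highest roots_refl simple_sub assms theta_root by blast
  have aa: "inner a a > 0" using assms simple_sub roots_inner_pos by blast
  have "\<theta> - reflection a \<theta> = inner \<theta> (coroot a) *\<^sub>R a" by (simp add: reflection_def)
  then have "coef (inner \<theta> (coroot a) *\<^sub>R a) a \<in> \<nat>" using n assms nat_comb_iff by metis
  then have "inner \<theta> (coroot a) \<ge> 0" using assms by (auto simp: coef_scale coef_simple elim!: Nats_cases)
  then show ?thesis using aa
    by (simp add: coroot_def inner_commute zero_le_divide_iff)
qed

text \<open>Let \<beta>' be the dominant conjugate of \<beta>. Since \<theta> - \<beta>' is a
  nonnegative combination of simple roots, its products with the dominant vectors \<theta> and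
  \<beta>' are nonnegative, so (\<theta>, \<theta>) \<ge> (\<beta>', \<theta>) \<ge> (\<beta>',
  \<beta>').\<close>

lemma theta_longest:
  assumes "\<beta> \<in> \<Phi>" shows "inner \<beta> \<beta> \<le> inner \<theta> \<theta>"
proof -
  obtain u where u: "u \<in> W" "\<forall>a\<in>\<Delta>. inner a (u \<beta>) \<ge> 0" using ex_weyl_dominant by blast
  have n: "\<theta> - u \<beta> \<in> nat_comb \<Delta>" using theta_highest weyl_roots[OF root_system u(1) assms] by blast
  have "inner (\<theta> - u \<beta>) \<theta> \<ge> 0" "inner (\<theta> - u \<beta>) (u \<beta>) \<ge> 0"
    by (rule nat_comb_inner_nonneg[OF n]; use theta_dominant u in blast)+
  then have "inner (u \<beta>) (u \<beta>) \<le> inner \<theta> \<theta>"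
    by (simp add: inner_diff_left) (simp add: inner_commute)
  then show ?thesis using weyl_inner[OF u(1)] by simp
qed

text \<open>A root orthogonal to the whole orbit of \<theta> is also orthogonal to every root that
  is not: reflecting the orbit in the latter reveals the product. Irreducibility leaves one of the
  two classes empty, and \<theta> lies in the second.\<close>

lemma theta_orbit_not_orthogonal:
  assumes "\<beta> \<in> \<Phi>" shows "\<exists>w\<in>W. inner \<beta> (w \<theta>) \<noteq> 0"
proof (rule ccontr)
  assume n: "\<not> ?thesis"
  define A where "A = {\<alpha>\<in>\<Phi>. \<forall>w\<in>W. inner \<alpha> (w \<theta>) = 0}"
  have orth: "inner a b = 0" if a: "a \<in> A" and b: "b \<in> \<Phi> - A" for a b
  proof -
    obtain w where w: "w \<in> W" "inner b (w \<theta>) \<noteq> 0" using b by (auto simp: A_def)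
    have "reflection b \<circ> w \<in> W" using w b by (auto intro: weyl_comp weyl_refl)
    then have "inner a ((reflection b \<circ> w) \<theta>) = 0" using a unfolding A_def by blast
    moreover have "inner a (w \<theta>) = 0" using a w by (auto simp: A_def)
    ultimately have "inner (w \<theta>) (coroot b) * inner a b = 0"
      by (simp add: reflection_def inner_diff_right)
    then show ?thesis using w roots_inner_pos[of b] b by (auto simp: coroot_def inner_commute)
  qed
  have tA: "\<theta> \<notin> A" using weyl_group.id[of \<Phi>] roots_inner_pos[OF theta_root] by (force simp: A_def)
  have "A \<noteq> {} \<and> \<Phi> - A \<noteq> {} \<and> A \<union> (\<Phi> - A) = \<Phi> \<and> A \<inter> (\<Phi> - A) = {}"
    using n assms tA theta_root by (auto simp: A_def)
  moreover have "\<forall>a\<in>A. \<forall>b\<in>\<Phi> - A. inner a b = 0" by (intro ballI orth)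
  ultimately have "\<exists>A B. A \<noteq> {} \<and> B \<noteq> {} \<and> A \<union> B = \<Phi> \<and> A \<inter> B = {} \<and> (\<forall>a\<in>A. \<forall>b\<in>B. inner a b = 0)"
    by (intro exI[of _ A] exI[of _ "\<Phi> - A"]) (simp only: simp_thms)
  then show False using irreducible by (simp add: irreducible_roots_def)
qed

text \<open>The only translation that the generators of \<open>DWa G\<close> yield directly is by
  the coroot of \<theta>, so its orbit must generate the lattice. For a root \<beta> take \<gamma>
  in the orbit of \<theta> with \<open>k = inner \<beta> (coroot \<gamma>)\<close> nonzero. If
  \<open>k\<close> is 1 or -1, the coroot of \<beta> is up to sign the difference of the coroot of
  \<gamma> and its reflection in \<beta>. Otherwise \<beta>, being no longer than \<gamma>, must be
  \<gamma> or its negative.\<close>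

lemma int_comb_coroot_induct [consumes 1, case_names zero add neg orbit]:
  assumes x: "x \<in> int_comb (coroot ` \<Phi>)"
    and P0: "P 0" and Padd: "\<And>x y. P x \<Longrightarrow> P y \<Longrightarrow> P (x + y)" and Pneg: "\<And>x. P x \<Longrightarrow> P (- x)"
    and Porb: "\<And>w. w \<in> W \<Longrightarrow> P (w (coroot \<theta>))"
  shows "P x"
  using x
proof (induction rule: int_comb_induct)
  case (incl c)
  then obtain \<beta> where b: "\<beta> \<in> \<Phi>" "c = coroot \<beta>" by blast
  obtain w where w: "w \<in> W" "inner \<beta> (w \<theta>) \<noteq> 0" using theta_orbit_not_orthogonal[OF b(1)] by blast
  define \<gamma> where "\<gamma> = w \<theta>"
  have g: "\<gamma> \<in> \<Phi>" using weyl_roots[OF root_system w(1) theta_root] by (simp add: \<gamma>_def)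
  have cg: "coroot \<gamma> = w (coroot \<theta>)" by (simp add: \<gamma>_def weyl_coroot[OF w(1)])
  have Pg: "P (coroot \<gamma>)" using Porb w cg by simp
  have Prg: "P (reflection \<beta> (coroot \<gamma>))"
    using Porb[OF weyl_comp[OF weyl_refl[OF b(1)] w(1)]] by (simp add: cg)
  have len: "inner \<beta> \<beta> \<le> inner \<gamma> \<gamma>" using theta_longest[OF b(1)] weyl_inner[OF w(1)] by (simp add: \<gamma>_def)
  define k where "k = inner \<beta> (coroot \<gamma>)"
  have refl: "reflection \<beta> (coroot \<gamma>) = coroot \<gamma> - k *\<^sub>R coroot \<beta>"
    by (simp add: reflection_def k_def coroot_def inner_commute)
  have k0: "k \<noteq> 0" using w roots_inner_pos[OF g] by (auto simp: k_def coroot_def \<gamma>_def)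
  have kI: "k \<in> \<int>" using roots_int[OF g b(1)] by (simp add: k_def)
  consider "k = 1" | "k = -1" | "k \<ge> 2" | "k \<le> -2" proof -
    obtain z where z: "k = of_int z" using kI by (auto elim!: Ints_cases)
    have "z = 1 \<or> z = -1 \<or> z \<ge> 2 \<or> z \<le> -2" using k0 z by auto
    then show thesis using that z by fastforce
  qed
  then show ?case
  proof cases
    case 1
    then have "coroot \<beta> = coroot \<gamma> + - reflection \<beta> (coroot \<gamma>)" using refl by simp
    then show ?thesis using b Padd[OF Pg Pneg[OF Prg]] by simp
  next
    case 2
    then have "coroot \<beta> = reflection \<beta> (coroot \<gamma>) + - coroot \<gamma>" using refl by simp
    then show ?thesis using b Padd[OF Prg Pneg[OF Pg]] by simp
  next
    case 3
    then have "inner \<beta> \<gamma> \<ge> inner \<gamma> \<gamma>" using roots_inner_pos[OF g]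
      by (auto simp: k_def coroot_def field_simps)
    then have "inner (\<beta> - \<gamma>) (\<beta> - \<gamma>) \<le> 0" using len by (simp add: inner_diff_left inner_diff_right inner_commute)
    then have "\<beta> - \<gamma> = 0" using inner_ge_zero[of "\<beta> - \<gamma>"] inner_eq_zero_iff[of "\<beta> - \<gamma>"] by linarith
    then have "\<beta> = \<gamma>" by simp
    then show ?thesis using Pg b by simp
  next
    case 4
    then have "- inner \<beta> \<gamma> \<ge> inner \<gamma> \<gamma>" using roots_inner_pos[OF g]
      by (auto simp: k_def coroot_def field_simps)
    then have "inner (\<beta> + \<gamma>) (\<beta> + \<gamma>) \<le> 0" using len by (simp add: inner_add_left inner_add_right inner_commute)
    then have "\<beta> + \<gamma> = 0" using inner_ge_zero[of "\<beta> + \<gamma>"] inner_eq_zero_iff[of "\<beta> + \<gamma>"] by linarith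
    then have "\<beta> = - \<gamma>" by (simp add: eq_neg_iff_add_eq_0)
    then have "coroot \<beta> = - coroot \<gamma>" by (simp add: coroot_def)
    then show ?thesis using Pneg[OF Pg] b by simp
  qed
next
  case (add x y)
  then show ?case by (intro Padd)
next
  case (neg x)
  then show ?case by (intro Pneg)
qed (rule P0)

end

section \<open>Power series with finitely many monomials in each degree\<close>

lemma finite_submultisets: "finite {a. a \<subseteq># m}"
proof (induction m)
  case (add x m)
  have "{a. a \<subseteq># add_mset x m} \<subseteq> {a. a \<subseteq># m} \<union> add_mset x ` {a. a \<subseteq># m}"
  proof
    fix a assume "a \<in> {a. a \<subseteq># add_mset x m}"
    then have a: "a \<subseteq># add_mset x m" by simp
    show "a \<in> {a. a \<subseteq># m} \<union> add_mset x ` {a. a \<subseteq># m}"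
    proof (cases "x \<in># a")
      case True
      then obtain b where "a = add_mset x b" by (meson multi_member_split)
      then show ?thesis using a by auto
    next
      case False
      have "count a y \<le> count m y" for y
        using mset_subset_eq_count[OF a, of y] False by (cases "y = x") (auto simp: not_in_iff)
      then have "a \<subseteq># m" by (rule mset_subset_eqI)
      then show ?thesis by simp
    qed
  qed
  then show ?case using add finite_subset by blast
qed simp

text \<open>Named apart from \<open>ps_ring\<close> because the product does not depend on the set
  of variables: \<open>fgl_subst\<close> computes over all variables, the formal group ring over a
  lattice.\<close>

definition psmult :: "('v multiset \<Rightarrow> 'r::comm_ring_1) \<Rightarrow> ('v multiset \<Rightarrow> 'r) \<Rightarrow> 'v multiset \<Rightarrow> 'r" where
  "psmult p q = (\<lambda>m. \<Sum>a | a \<subseteq># m. p a * q (m - a))"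

definition ps_monom :: "'v multiset \<Rightarrow> 'v multiset \<Rightarrow> 'r::comm_ring_1" where
  "ps_monom n = (\<lambda>m. if m = n then 1 else 0)"

abbreviation psc :: "'v set \<Rightarrow> ('v multiset \<Rightarrow> 'r::comm_ring_1) set" where
  "psc \<Lambda> \<equiv> carrier (ps_ring \<Lambda>)"

lemma ps_mult: "p \<otimes>\<^bsub>ps_ring \<Lambda>\<^esub> q = psmult p q"
  and ps_one: "\<one>\<^bsub>ps_ring \<Lambda>\<^esub> = ps_monom {#}"
  and ps_zero: "\<zero>\<^bsub>ps_ring \<Lambda>\<^esub> = (\<lambda>_. 0)"
  and ps_add: "p \<oplus>\<^bsub>ps_ring \<Lambda>\<^esub> q = (\<lambda>m. p m + q m)"
  and ps_var_mono: "ps_var v = ps_monom {#v#}"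
  by (simp_all add: ps_ring_def psmult_def ps_monom_def ps_var_def)

lemma psc_iff: "p \<in> psc \<Lambda> \<longleftrightarrow> (\<forall>m. p m \<noteq> 0 \<longrightarrow> set_mset m \<subseteq> \<Lambda>) \<and> (\<forall>d. finite {m. p m \<noteq> 0 \<and> size m = d})"
  by (simp add: ps_ring_def)

lemma psc_support: "p \<in> psc \<Lambda> \<Longrightarrow> p m \<noteq> 0 \<Longrightarrow> set_mset m \<subseteq> \<Lambda>"
  and psc_finite: "p \<in> psc \<Lambda> \<Longrightarrow> finite {m. p m \<noteq> 0 \<and> size m = d}"
  by (auto simp: psc_iff)

lemma psc_finite_le:
  assumes "p \<in> psc \<Lambda>" shows "finite {m. p m \<noteq> 0 \<and> size m \<le> d}"
proof -
  have "{m. p m \<noteq> 0 \<and> size m \<le> d} = (\<Union>i\<le>d. {m. p m \<noteq> 0 \<and> size m = i})" by auto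
  then show ?thesis using psc_finite[OF assms] by simp
qed

lemma psmult_comm: "psmult p q = psmult q p"
proof
  fix m
  show "psmult p q m = psmult q p m" unfolding psmult_def
    by (rule sum.reindex_bij_witness[of _ "\<lambda>a. m - a" "\<lambda>a. m - a"])
      (auto simp: mult.commute subset_mset.diff_diff_right)
qed

lemma psmult_mono: "psmult (ps_monom n) q m = (if n \<subseteq># m then q (m - n) else 0)"
proof -
  have "psmult (ps_monom n) q m = (\<Sum>a | a \<subseteq># m. if a = n then q (m - n) else 0)"
    unfolding psmult_def ps_monom_def by (rule sum.cong) auto
  then show ?thesis by (simp add: finite_submultisets)
qed

text \<open>Both sides run over the ordered decompositions of \<open>m\<close> into three multisets;
  a chain \<open>b\<close>, \<open>a\<close> of submultisets corresponds to the pair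
  \<open>b\<close>, \<open>a - b\<close>.\<close>

lemma psmult_assoc:
  fixes p q r :: "'v multiset \<Rightarrow> 'r::comm_ring_1"
  shows "psmult (psmult p q) r = psmult p (psmult q r)"
proof
  fix m :: "'v multiset"
  have f1: "a - b \<subseteq># m - b" "m - b - (a - b) = m - a" "b \<subseteq># m" if "b \<subseteq># a" "a \<subseteq># m" for a b
  proof -
    obtain c d where "a = b + c" "m = b + c + d" using \<open>b \<subseteq># a\<close> \<open>a \<subseteq># m\<close> by (metis subset_mset.le_iff_add)
    then show "a - b \<subseteq># m - b" "m - b - (a - b) = m - a" "b \<subseteq># m" by (simp_all add: add.assoc)
  qed
  have f2: "b + c \<subseteq># m" "m - (b + c) = m - b - c" if "b \<subseteq># m" "c \<subseteq># m - b" for b c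
  proof -
    obtain d where "m = b + c + d" using \<open>b \<subseteq># m\<close> \<open>c \<subseteq># m - b\<close> by (metis subset_mset.le_iff_add add.assoc subset_mset.add_diff_inverse)
    then show "b + c \<subseteq># m" "m - (b + c) = m - b - c" by (simp_all add: add.assoc)
  qed
  have "psmult (psmult p q) r m = (\<Sum>a | a \<subseteq># m. \<Sum>b | b \<subseteq># a. p b * q (a - b) * r (m - a))"
    unfolding psmult_def by (simp add: sum_distrib_right)
  also have "\<dots> = (\<Sum>(a,b)\<in>(SIGMA a:{a. a \<subseteq># m}. {b. b \<subseteq># a}). p b * q (a - b) * r (m - a))"
    by (rule sum.Sigma) (auto simp: finite_submultisets)
  also have "\<dots> = (\<Sum>(b,c)\<in>(SIGMA b:{b. b \<subseteq># m}. {c. c \<subseteq># m - b}). p b * (q c * r (m - b - c)))"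
    by (rule sum.reindex_bij_witness[of _ "\<lambda>(b,c). (b + c, b)" "\<lambda>(a,b). (b, a - b)"])
      (auto simp: mult.assoc f1 f2)
  also have "\<dots> = (\<Sum>b | b \<subseteq># m. \<Sum>c | c \<subseteq># m - b. p b * (q c * r (m - b - c)))"
    by (rule sum.Sigma[symmetric]) (auto simp: finite_submultisets)
  also have "\<dots> = psmult p (psmult q r) m"
    unfolding psmult_def by (simp add: sum_distrib_left)
  finally show "psmult (psmult p q) r m = psmult p (psmult q r) m" .
qed

lemma psmult_one: "psmult (ps_monom {#}) q = q"
  by (rule ext) (simp add: psmult_mono)

lemma psmult_add: "psmult (\<lambda>m. p m + q m) r = (\<lambda>m. psmult p r m + psmult q r m)"
  by (simp add: psmult_def distrib_right sum.distrib)

text \<open>A monomial of degree \<open>d\<close> in the product splits into one from each factor,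
  both of degree at most \<open>d\<close>, and each factor has only finitely many of those.\<close>

lemma psmult_closed:
  assumes p: "p \<in> psc \<Lambda>" and q: "q \<in> psc \<Lambda>"
  shows "psmult p q \<in> psc \<Lambda>"
proof -
  have *: "\<exists>a. a \<subseteq># m \<and> p a \<noteq> 0 \<and> q (m - a) \<noteq> 0" if "psmult p q m \<noteq> 0" for m
  proof (rule ccontr)
    assume "\<not> ?thesis"
    then have "psmult p q m = 0" unfolding psmult_def by (intro sum.neutral) auto
    then show False using that by simp
  qed
  have "set_mset m \<subseteq> \<Lambda>" if nz: "psmult p q m \<noteq> 0" for m
  proof -
    obtain a where a: "a \<subseteq># m" "p a \<noteq> 0" "q (m - a) \<noteq> 0" using *[OF nz] by blast
    have "set_mset a \<subseteq> \<Lambda>" "set_mset (m - a) \<subseteq> \<Lambda>" using psc_support p q a by blast+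
    moreover have "m = a + (m - a)" using a by simp
    ultimately show ?thesis by (metis le_sup_iff set_mset_union)
  qed
  moreover have "finite {m. psmult p q m \<noteq> 0 \<and> size m = d}" for d
  proof (rule finite_subset)
    show "{m. psmult p q m \<noteq> 0 \<and> size m = d} \<subseteq>
      (\<lambda>(a,b). a + b) ` ({a. p a \<noteq> 0 \<and> size a \<le> d} \<times> {b. q b \<noteq> 0 \<and> size b \<le> d})"
    proof
      fix m assume m: "m \<in> {m. psmult p q m \<noteq> 0 \<and> size m = d}"
      then obtain a where a: "a \<subseteq># m" "p a \<noteq> 0" "q (m - a) \<noteq> 0" using * by blast
      have "size a \<le> d" "size (m - a) \<le> d" using a m size_mset_mono by (auto intro: size_mset_mono)
      then show "m \<in> (\<lambda>(a,b). a + b) ` ({a. p a \<noteq> 0 \<and> size a \<le> d} \<times> {b. q b \<noteq> 0 \<and> size b \<le> d})"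
        using a by (intro image_eqI[of _ _ "(a, m - a)"]) auto
    qed
  qed (intro finite_imageI finite_cartesian_product psc_finite_le[OF p] psc_finite_le[OF q])
  ultimately show ?thesis by (simp add: psc_iff)
qed

lemma psc_zero: "(\<lambda>_. 0) \<in> psc \<Lambda>"
  by (simp add: psc_iff)

lemma psc_add:
  assumes p: "p \<in> psc \<Lambda>" and q: "q \<in> psc \<Lambda>"
  shows "(\<lambda>m. p m + q m) \<in> psc \<Lambda>"
proof -
  have "set_mset m \<subseteq> \<Lambda>" if "p m + q m \<noteq> 0" for m
    using that psc_support[OF p, of m] psc_support[OF q, of m] by (cases "p m = 0") auto
  moreover have "finite {m. p m + q m \<noteq> 0 \<and> size m = d}" for d
    by (rule finite_subset[of _ "{m. p m \<noteq> 0 \<and> size m = d} \<union> {m. q m \<noteq> 0 \<and> size m = d}"])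
      (auto simp: psc_finite[OF p] psc_finite[OF q])
  ultimately show ?thesis by (simp add: psc_iff)
qed

lemma psc_sum: "(\<And>i. i \<in> I \<Longrightarrow> f i \<in> psc \<Lambda>) \<Longrightarrow> (\<lambda>m. \<Sum>i\<in>I. f i m) \<in> psc \<Lambda>"
  by (induction I rule: infinite_finite_induct) (auto intro: psc_zero psc_add)

lemma psc_scale:
  assumes "p \<in> psc \<Lambda>" shows "(\<lambda>m. r * p m) \<in> psc \<Lambda>"
proof -
  have "finite {m. r * p m \<noteq> 0 \<and> size m = d}" for d
    by (rule finite_subset[OF _ psc_finite[OF assms, of d]]) auto
  moreover have "set_mset m \<subseteq> \<Lambda>" if "r * p m \<noteq> 0" for m
    by (rule psc_support[OF assms]) (use that in auto)
  ultimately show ?thesis by (simp add: psc_iff)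
qed

lemma psc_neg: "p \<in> psc \<Lambda> \<Longrightarrow> (\<lambda>m. - p m) \<in> psc \<Lambda>"
  using psc_scale[of p \<Lambda> "-1"] by simp

lemma psc_diff: "p \<in> psc \<Lambda> \<Longrightarrow> q \<in> psc \<Lambda> \<Longrightarrow> (\<lambda>m. p m - q m) \<in> psc \<Lambda>"
  using psc_add[OF _ psc_neg, of p \<Lambda> q] by simp

lemma psc_mono: "set_mset n \<subseteq> \<Lambda> \<Longrightarrow> ps_monom n \<in> psc \<Lambda>"
  by (auto simp: psc_iff ps_monom_def)

lemma psc_var: "v \<in> \<Lambda> \<Longrightarrow> ps_var v \<in> psc \<Lambda>"
  by (simp add: ps_var_mono psc_mono)

lemma cring_ps: "cring (ps_ring \<Lambda> :: ('v multiset \<Rightarrow> 'r::comm_ring_1) ring)"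
proof (rule cringI)
  show "abelian_group (ps_ring \<Lambda> :: ('v multiset \<Rightarrow> 'r) ring)"
  proof (rule abelian_groupI)
    fix x :: "'v multiset \<Rightarrow> 'r" assume "x \<in> psc \<Lambda>"
    then show "\<exists>y\<in>psc \<Lambda>. y \<oplus>\<^bsub>ps_ring \<Lambda>\<^esub> x = \<zero>\<^bsub>ps_ring \<Lambda>\<^esub>"
      by (intro bexI[of _ "\<lambda>m. - x m"]) (auto simp: ps_add ps_zero psc_neg)
  qed (auto simp: ps_add ps_zero psc_add psc_zero add.assoc add.commute)
  show "Group.comm_monoid (ps_ring \<Lambda> :: ('v multiset \<Rightarrow> 'r) ring)"
    by (rule comm_monoidI) (auto simp: ps_mult ps_one psmult_closed psmult_assoc psmult_one psc_mono
        intro: psmult_comm)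
qed (simp add: ps_mult ps_add psmult_add)

lemma ring_ps: "ring (ps_ring \<Lambda>)"
  using cring_ps cring.axioms(1) by blast

lemma ps_a_inv:
  assumes "p \<in> psc \<Lambda>" shows "\<ominus>\<^bsub>ps_ring \<Lambda>\<^esub> p = (\<lambda>m. - p m)"
proof -
  interpret cring "ps_ring \<Lambda>" by (rule cring_ps)
  show ?thesis
    by (rule minus_equality) (use assms in \<open>auto simp: ps_add ps_zero psc_neg\<close>)
qed

lemma ps_minus: "p \<in> psc \<Lambda> \<Longrightarrow> q \<in> psc \<Lambda> \<Longrightarrow> p \<ominus>\<^bsub>ps_ring \<Lambda>\<^esub> q = (\<lambda>m. p m - q m)"
  by (simp add: a_minus_def ps_a_inv ps_add)

lemma mono_mult: "psmult (ps_monom n) (ps_monom n') = ps_monom (n + n')"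
  by (rule ext, subst psmult_mono) (auto simp: ps_monom_def)

lemma ps_pow_mono: "ps_monom n [^]\<^bsub>ps_ring \<Lambda>\<^esub> i = ps_monom (repeat_mset i n)"
proof -
  interpret cring "ps_ring \<Lambda>" by (rule cring_ps)
  show ?thesis by (induction i) (simp_all add: nat_pow_0 nat_pow_Suc ps_one ps_mult mono_mult add.commute)
qed

section \<open>The formal group law evaluated at two variables, and inversion of series\<close>

lemma fgl_var:
  fixes \<mu> \<nu> :: 'v
  shows "fgl_subst c (ps_var \<mu>) (ps_var \<nu>) m =
    (\<Sum>i\<le>size m. \<Sum>j\<le>size m. c i j * ps_monom (replicate_mset i \<mu> + replicate_mset j \<nu>) m)"
proof -
  have "repeat_mset i {#v#} = replicate_mset i v" for i and v :: 'v by (induction i) auto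
  then show ?thesis by (simp add: fgl_subst_def ps_var_mono ps_pow_mono ps_mult mono_mult)
qed

text \<open>For \<open>F(x, y) = x + y H(x, y)\<close>, the series \<open>H(x\<^sub>\<mu>, x\<^sub>\<nu>)\<close>.\<close>

definition fgl_quot :: "(nat \<Rightarrow> nat \<Rightarrow> 'r::comm_ring_1) \<Rightarrow> 'v \<Rightarrow> 'v \<Rightarrow> 'v multiset \<Rightarrow> 'r" where
  "fgl_quot c \<mu> \<nu> = (\<lambda>m. \<Sum>i\<le>size m. \<Sum>j\<le>size m. c i (Suc j) * ps_monom (replicate_mset i \<mu> + replicate_mset j \<nu>) m)"

lemma fgl_quot_psc:
  assumes "\<mu> \<in> \<Lambda>" "\<nu> \<in> \<Lambda>" shows "fgl_quot c \<mu> \<nu> \<in> psc \<Lambda>"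
proof -
  have *: "\<exists>i\<le>size m. \<exists>j\<le>size m. m = replicate_mset i \<mu> + replicate_mset j \<nu>" if "fgl_quot c \<mu> \<nu> m \<noteq> 0" for m
  proof (rule ccontr)
    assume "\<not> ?thesis"
    then have "fgl_quot c \<mu> \<nu> m = 0" unfolding fgl_quot_def ps_monom_def by (intro sum.neutral) auto
    then show False using that by simp
  qed
  have "set_mset m \<subseteq> \<Lambda>" if nz: "fgl_quot c \<mu> \<nu> m \<noteq> 0" for m
  proof -
    obtain i j where "m = replicate_mset i \<mu> + replicate_mset j \<nu>" using *[OF nz] by blast
    then show ?thesis using assms by (auto simp: in_replicate_mset)
  qed
  moreover have "finite {m. fgl_quot c \<mu> \<nu> m \<noteq> 0 \<and> size m = d}" for d
    by (rule finite_subset[of _ "(\<lambda>(i,j). replicate_mset i \<mu> + replicate_mset j \<nu>) ` ({..d} \<times> {..d})"])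
      (use * in \<open>fastforce+\<close>)
  ultimately show ?thesis by (simp add: psc_iff)
qed

lemma fgl_coeffs:
  assumes "formal_group_law c"
  shows "c i 0 = (if i = 1 then 1 else 0)" "c 0 i = (if i = 1 then 1 else 0)"
proof -
  have *: "\<forall>i. c i 0 = (if i = 1 then 1 else 0)" "\<forall>i j. c i j = c j i"
    using assms unfolding formal_group_law_def by blast+
  show "c i 0 = (if i = 1 then 1 else 0)" using *(1) by blast
  then show "c 0 i = (if i = 1 then 1 else 0)" using *(2)[rule_format, of 0 i] by simp
qed

text \<open>Since F(x, 0) = x, the terms without y contribute exactly x. From all others one factor
  y is taken out, which shifts the second index by one.\<close>

lemma fgl_var_eq:
  fixes c :: "nat \<Rightarrow> nat \<Rightarrow> 'r::comm_ring_1" and \<mu> \<nu> :: 'v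
  assumes "formal_group_law c"
  shows "fgl_subst c (ps_var \<mu>) (ps_var \<nu>) = (\<lambda>m. ps_var \<mu> m + psmult (ps_var \<nu>) (fgl_quot c \<mu> \<nu>) m)"
proof
  fix m :: "'v multiset"
  note c0 = fgl_coeffs(1)[OF assms]
  let ?e = "\<lambda>i j m. ps_monom (replicate_mset i \<mu> + replicate_mset j \<nu>) m :: 'r"
  have "fgl_subst c (ps_var \<mu>) (ps_var \<nu>) m = (\<Sum>i\<le>size m. c i 0 * ?e i 0 m + (\<Sum>j<size m. c i (Suc j) * ?e i (Suc j) m))"
    unfolding fgl_var by (simp add: sum.atMost_shift del: replicate_mset_Suc)
  also have "\<dots> = (\<Sum>i\<le>size m. c i 0 * ?e i 0 m) + (\<Sum>i\<le>size m. \<Sum>j<size m. c i (Suc j) * ?e i (Suc j) m)"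
    by (rule sum.distrib)
  also have "(\<Sum>i\<le>size m. c i 0 * ?e i 0 m) = (\<Sum>i\<le>size m. if i = 1 then ps_monom {#\<mu>#} m else 0)"
    by (rule sum.cong) (auto simp: c0)
  also have "\<dots> = ps_var \<mu> m"
    by (auto simp: ps_var_mono ps_monom_def)
  also have "(\<Sum>i\<le>size m. \<Sum>j<size m. c i (Suc j) * ?e i (Suc j) m) = psmult (ps_var \<nu>) (fgl_quot c \<mu> \<nu>) m"
  proof (cases "\<nu> \<in># m")
    case True
    then obtain n where m: "m = add_mset \<nu> n" by (meson multi_member_split)
    have e: "?e i (Suc j) m = ?e i j n" for i j by (simp add: ps_monom_def m)
    have "(\<Sum>i\<le>size m. \<Sum>j<size m. c i (Suc j) * ?e i (Suc j) m) = (\<Sum>i\<le>Suc (size n). \<Sum>j\<le>size n. c i (Suc j) * ?e i j n)"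
      unfolding e by (simp add: m lessThan_Suc_atMost)
    also have "\<dots> = fgl_quot c \<mu> \<nu> n"
    proof -
      \<comment> \<open>Removing \<nu> leaves one value of \<open>i\<close> more than the definition
        of \<open>fgl_quot\<close> allows at \<open>n\<close>; its monomial is too large to equal
        \<open>n\<close>.\<close>
      have "?e (Suc (size n)) j n = 0" for j by (auto simp: ps_monom_def dest: arg_cong[of _ _ size])
      then show ?thesis by (simp add: fgl_quot_def)
    qed
    finally show ?thesis by (simp add: ps_var_mono psmult_mono m)
  next
    case False
    then have "?e i (Suc j) m = 0" for i j by (auto simp: ps_monom_def)
    then show ?thesis using False by (simp add: ps_var_mono psmult_mono)
  qed
  finally show "fgl_subst c (ps_var \<mu>) (ps_var \<nu>) m = ps_var \<mu> m + psmult (ps_var \<nu>) (fgl_quot c \<mu> \<nu>) m" .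
qed

text \<open>The constant term is \<open>c 0 1\<close>, which equals \<open>c 1 0\<close> by
  commutativity.\<close>

lemma fgl_quot_const: "formal_group_law c \<Longrightarrow> fgl_quot c \<mu> \<nu> {#} = 1"
  using fgl_coeffs(2)[of c 1] by (simp add: fgl_quot_def ps_monom_def)

lemma fgl_psc:
  assumes "formal_group_law c" "\<mu> \<in> \<Lambda>" "\<nu> \<in> \<Lambda>"
  shows "fgl_subst c (ps_var \<mu>) (ps_var \<nu>) \<in> psc \<Lambda>"
  unfolding fgl_var_eq[OF assms(1)] by (intro psc_add psmult_closed psc_var fgl_quot_psc assms)

text \<open>Here \<open>v\<close> is meant to be the inverse of the constant term of \<open>h\<close>.\<close>

function ps_inv :: "('v multiset \<Rightarrow> 'r::comm_ring_1) \<Rightarrow> 'r \<Rightarrow> 'v multiset \<Rightarrow> 'r" where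
  "ps_inv h v m = v * ((if m = {#} then 1 else 0) - (\<Sum>a | a \<subseteq># m \<and> a \<noteq> {#}. h a * ps_inv h v (m - a)))"
  by auto
termination
proof (relation "measure (\<lambda>(h, v, m). size m)")
  fix h :: "'v multiset \<Rightarrow> 'r" and v m a
  assume "a \<in> {a. a \<subseteq># m \<and> a \<noteq> {#}}"
  then have a: "a \<subseteq># m" "a \<noteq> {#}" by auto
  then have "size m = size a + size (m - a)" by (metis size_union subset_mset.add_diff_inverse)
  then show "((h, v, m - a), h, v, m) \<in> measure (\<lambda>(h, v, m). size m)"
    using a by (simp add: nonempty_has_size)
qed simp

declare ps_inv.simps [simp del]

lemma psmult_ps_inv:
  fixes h :: "'v multiset \<Rightarrow> 'r::comm_ring_1"
  assumes "h {#} * v = 1" shows "psmult h (ps_inv h v) = ps_monom {#}"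
proof
  fix m :: "'v multiset"
  have "{a. a \<subseteq># m} = insert {#} {a. a \<subseteq># m \<and> a \<noteq> {#}}" by auto
  moreover have "finite {a. a \<subseteq># m \<and> a \<noteq> {#}}" using finite_submultisets[of m] by simp
  ultimately have "psmult h (ps_inv h v) m = h {#} * ps_inv h v m + (\<Sum>a | a \<subseteq># m \<and> a \<noteq> {#}. h a * ps_inv h v (m - a))"
    unfolding psmult_def by simp
  also have "h {#} * ps_inv h v m = (if m = {#} then 1 else 0) - (\<Sum>a | a \<subseteq># m \<and> a \<noteq> {#}. h a * ps_inv h v (m - a))"
    by (subst ps_inv.simps) (simp add: assms flip: mult.assoc)
  finally show "psmult h (ps_inv h v) m = ps_monom {#} m" by (simp add: ps_monom_def)
qed

lemma ps_inv_support:
  assumes "ps_inv h v m \<noteq> 0"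
  shows "m = {#} \<or> (\<exists>a. a \<subseteq># m \<and> a \<noteq> {#} \<and> h a \<noteq> 0 \<and> ps_inv h v (m - a) \<noteq> 0)"
proof (rule ccontr)
  assume n: "\<not> ?thesis"
  then have "(\<Sum>a | a \<subseteq># m \<and> a \<noteq> {#}. h a * ps_inv h v (m - a)) = 0" by (intro sum.neutral) auto
  then have "ps_inv h v m = 0" using n by (subst ps_inv.simps) simp
  then show False using assms by simp
qed

text \<open>By the recursion, a nonempty monomial of the inverse is a nonempty monomial of
  \<open>h\<close> plus a monomial of the inverse of smaller degree. Strong induction on the degree
  then gives both the support condition and finiteness.\<close>

lemma ps_inv_psc:
  assumes h: "h \<in> psc \<Lambda>" shows "ps_inv h v \<in> psc \<Lambda>"
proof -
  have sup: "set_mset m \<subseteq> \<Lambda>" if "ps_inv h v m \<noteq> 0" for m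
    using that
  proof (induction "size m" arbitrary: m rule: less_induct)
    case less
    show ?case
    proof (cases "m = {#}")
      case False
      then obtain a where a: "a \<subseteq># m" "a \<noteq> {#}" "h a \<noteq> 0" "ps_inv h v (m - a) \<noteq> 0"
        using ps_inv_support[OF less.prems] by blast
      have m: "m = a + (m - a)" using a by simp
      then have "size m = size a + size (m - a)" by (metis size_union)
      then have "size (m - a) < size m" using a by (simp add: nonempty_has_size)
      then have "set_mset (m - a) \<subseteq> \<Lambda>" "set_mset a \<subseteq> \<Lambda>"
        using less.hyps a psc_support[OF h] by blast+
      then show ?thesis by (subst m) (simp only: set_mset_union, blast)
    qed simp
  qed
  have fin: "finite {m. ps_inv h v m \<noteq> 0 \<and> size m = d}" for d
  proof (induction d rule: less_induct)
    case (less d)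
    define B where "B = (\<Union>i<d. {m. ps_inv h v m \<noteq> 0 \<and> size m = i})"
    have B: "finite B" unfolding B_def using less by auto
    show ?case
    proof (rule finite_subset)
      show "{m. ps_inv h v m \<noteq> 0 \<and> size m = d} \<subseteq> insert {#} ((\<lambda>(a,b). a + b) ` ({a. h a \<noteq> 0 \<and> size a \<le> d} \<times> B))"
      proof
        fix m assume m: "m \<in> {m. ps_inv h v m \<noteq> 0 \<and> size m = d}"
        show "m \<in> insert {#} ((\<lambda>(a,b). a + b) ` ({a. h a \<noteq> 0 \<and> size a \<le> d} \<times> B))"
        proof (cases "m = {#}")
          case False
          then obtain a where a: "a \<subseteq># m" "a \<noteq> {#}" "h a \<noteq> 0" "ps_inv h v (m - a) \<noteq> 0"
            using ps_inv_support m by blast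
          have "m = a + (m - a)" using a by simp
          then have "size m = size a + size (m - a)" by (metis size_union)
          then have "size (m - a) < d" "size a \<le> d" using a m by (auto simp: nonempty_has_size)
          then have "(a, m - a) \<in> {a. h a \<noteq> 0 \<and> size a \<le> d} \<times> B" using a by (auto simp: B_def)
          then show ?thesis using a by (intro insertI2 image_eqI[of _ _ "(a, m - a)"]) auto
        qed simp
      qed
    qed (use B psc_finite_le[OF h] in simp)
  qed
  show ?thesis using sup fin by (simp add: psc_iff)
qed

section \<open>Renaming of variables\<close>

lemma ps_rename_psmult:
  assumes "bij g"
  shows "ps_rename g (psmult p q) = psmult (ps_rename g p) (ps_rename g q)"
proof
  fix m
  let ?i = "image_mset (inv_into UNIV g)"
  have gi: "g (inv_into UNIV g x) = x" "inv_into UNIV g (g x) = x" for x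
    using assms by (simp_all add: bij_is_surj bij_is_inj surj_f_inv_f)
  have i1: "image_mset g (?i x) = x" "?i (image_mset g x) = x" for x
    by (simp_all add: multiset.map_comp comp_def gi)
  have "(\<Sum>a | a \<subseteq># ?i m. p a * q (?i m - a)) = (\<Sum>a | a \<subseteq># m. p (?i a) * q (?i (m - a)))"
    by (rule sum.reindex_bij_witness[of _ "?i" "image_mset g"])
      (auto simp: i1 image_mset_Diff intro: image_mset_subseteq_mono dest: image_mset_subseteq_mono[of _ _ g])
  then show "ps_rename g (psmult p q) m = psmult (ps_rename g p) (ps_rename g q) m"
    by (simp add: ps_rename_def psmult_def)
qed

lemma ps_rename_mono:
  assumes "bij g" shows "ps_rename g (ps_monom n) = ps_monom (image_mset g n)"
proof -
  have gi: "g (inv_into UNIV g x) = x" "inv_into UNIV g (g x) = x" for x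
    using assms by (simp_all add: bij_is_surj bij_is_inj surj_f_inv_f)
  have "image_mset (inv_into UNIV g) m = n \<longleftrightarrow> m = image_mset g n" for m
    by (auto simp: multiset.map_comp comp_def gi)
  then show ?thesis by (auto simp: ps_rename_def ps_monom_def)
qed

lemma ps_rename_psc:
  assumes g: "bij g" "g ` \<Lambda> \<subseteq> \<Lambda>" and p: "p \<in> psc \<Lambda>"
  shows "ps_rename g p \<in> psc \<Lambda>"
proof -
  have gi: "g (inv_into UNIV g x) = x" for x
    using g by (simp add: bij_is_surj surj_f_inv_f)
  have i1: "image_mset g (image_mset (inv_into UNIV g) x) = x" for x
    by (simp add: multiset.map_comp comp_def gi)
  have "set_mset m \<subseteq> \<Lambda>" if "ps_rename g p m \<noteq> 0" for m
  proof -
    have "set_mset (image_mset (inv_into UNIV g) m) \<subseteq> \<Lambda>"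
      by (rule psc_support[OF p]) (use that in \<open>simp add: ps_rename_def\<close>)
    then have "g ` set_mset (image_mset (inv_into UNIV g) m) \<subseteq> \<Lambda>" using g by blast
    then show ?thesis by (metis i1 set_image_mset)
  qed
  moreover have "finite {m. ps_rename g p m \<noteq> 0 \<and> size m = d}" for d
  proof (rule finite_subset)
    show "{m. ps_rename g p m \<noteq> 0 \<and> size m = d} \<subseteq> image_mset g ` {m. p m \<noteq> 0 \<and> size m = d}"
    proof
      fix m assume "m \<in> {m. ps_rename g p m \<noteq> 0 \<and> size m = d}"
      then show "m \<in> image_mset g ` {m. p m \<noteq> 0 \<and> size m = d}"
        by (intro image_eqI[of _ _ "image_mset (inv_into UNIV g) m"]) (auto simp: ps_rename_def i1)
    qed
  qed (simp add: psc_finite[OF p])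
  ultimately show ?thesis by (simp add: psc_iff)
qed

lemma ps_rename_comp:
  assumes "bij g" "bij h" shows "ps_rename g (ps_rename h p) = ps_rename (g \<circ> h) p"
proof -
  have "inv_into UNIV (g \<circ> h) = inv_into UNIV h \<circ> inv_into UNIV g"
    using assms by (simp add: o_inv_distrib)
  then show ?thesis by (simp add: ps_rename_def multiset.map_comp)
qed

lemma ps_rename_id: "ps_rename id p = p"
  by (simp add: ps_rename_def inv_id)

lemma ps_rename_fgl:
  fixes c :: "nat \<Rightarrow> nat \<Rightarrow> 'r::comm_ring_1" and g :: "'v \<Rightarrow> 'v"
  assumes "bij g"
  shows "ps_rename g (fgl_subst c (ps_var \<mu>) (ps_var \<nu>)) = fgl_subst c (ps_var (g \<mu>)) (ps_var (g \<nu>))"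
proof -
  have "ps_monom n (image_mset (inv_into UNIV g) m) = (ps_monom (image_mset g n) m :: 'r)" for n m
    using fun_cong[OF ps_rename_mono[OF assms, of n], of m] by (simp add: ps_rename_def)
  then show ?thesis by (simp add: fun_eq_iff ps_rename_def fgl_var)
qed

section \<open>Closures of ideals and the defining ideal of the formal group ring\<close>

definition ps_agree :: "nat \<Rightarrow> ('v multiset \<Rightarrow> 'r) \<Rightarrow> ('v multiset \<Rightarrow> 'r) \<Rightarrow> bool" where
  "ps_agree d p q \<longleftrightarrow> (\<forall>m. size m < d \<longrightarrow> p m = q m)"

lemma ps_agree_psmult:
  fixes p :: "'v multiset \<Rightarrow> 'r::comm_ring_1"
  shows "ps_agree d p q \<Longrightarrow> ps_agree d (psmult x p) (psmult x q)"
  unfolding ps_agree_def psmult_def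
proof (intro allI impI sum.cong refl)
  fix m a :: "'v multiset" assume *: "\<forall>m. size m < d \<longrightarrow> p m = q m" "size m < d" "a \<in> {a. a \<subseteq># m}"
  have "size (m - a) \<le> size m" by (rule size_mset_mono) simp
  then show "x a * p (m - a) = x a * q (m - a)" using * by simp
qed auto

text \<open>Addition, negation and multiplication by a fixed series preserve agreement below degree
  \<open>d\<close>, so approximations from \<open>J\<close> are carried along by the ring
  operations.\<close>

lemma ideal_closure:
  fixes \<Lambda> :: "'v set"
  assumes "ideal J (ps_ring \<Lambda> :: ('v multiset \<Rightarrow> 'r::comm_ring_1) ring)"
  shows "ideal {p \<in> psc \<Lambda>. \<forall>d. \<exists>q\<in>J. ps_agree d p q} (ps_ring \<Lambda> :: ('v multiset \<Rightarrow> 'r) ring)"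
    (is "ideal ?I ?R")
proof -
  interpret J: ideal J ?R by fact
  note sg = ideal.axioms(1)[OF assms]
  have Jc: "q \<in> psc \<Lambda>" if "q \<in> J" for q using J.Icarr[OF that] .
  have mult: "psmult x p \<in> ?I" if p: "p \<in> ?I" and x: "x \<in> psc \<Lambda>" for p x
  proof -
    have "\<exists>q\<in>J. ps_agree d (psmult x p) q" for d
    proof -
      obtain q where "q \<in> J" "ps_agree d p q" using p by blast
      then show ?thesis using J.I_l_closed[OF _ x, of q] ps_agree_psmult
        by (intro bexI[of _ "psmult x q"]) (auto simp: ps_mult)
    qed
    then show ?thesis using p x psmult_closed by auto
  qed
  have neg: "(\<lambda>m. - p m) \<in> ?I" if p: "p \<in> ?I" for p
  proof -
    have "\<exists>q\<in>J. ps_agree d (\<lambda>m. - p m) q" for d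
    proof -
      obtain q where q: "q \<in> J" "ps_agree d p q" using p by blast
      have "(\<lambda>m. - q m) \<in> J" using additive_subgroup.a_inv_closed[OF sg q(1)] by (simp add: ps_a_inv[OF Jc[OF q(1)]])
      then show ?thesis using q by (intro bexI[of _ "\<lambda>m. - q m"]) (auto simp: ps_agree_def)
    qed
    then show ?thesis using p psc_neg by auto
  qed
  have add: "(\<lambda>m. p m + p' m) \<in> ?I" if p: "p \<in> ?I" and p': "p' \<in> ?I" for p p'
  proof -
    have "\<exists>q\<in>J. ps_agree d (\<lambda>m. p m + p' m) q" for d
    proof -
      obtain q q' where q: "q \<in> J" "ps_agree d p q" "q' \<in> J" "ps_agree d p' q'" using p p' by blast
      then show ?thesis using additive_subgroup.a_closed[OF sg q(1,3)]
        by (intro bexI[of _ "\<lambda>m. q m + q' m"]) (auto simp: ps_agree_def ps_add)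
    qed
    then show ?thesis using p p' psc_add by auto
  qed
  have zero: "(\<lambda>_. 0) \<in> ?I"
    using additive_subgroup.zero_closed[OF sg] by (auto simp: psc_zero ps_zero ps_agree_def)
  have inv: "inv\<^bsub>add_monoid ?R\<^esub> p = (\<lambda>m. - p m)" if "p \<in> ?I" for p
    using ps_a_inv[of p \<Lambda>] that by (simp add: a_inv_def)
  show ?thesis
  proof (rule idealI[OF ring_ps])
    show "subgroup ?I (add_monoid ?R)"
      by (rule subgroup.intro) (use add zero neg inv in \<open>auto simp: ps_add ps_zero\<close>)
  next
    fix a x assume "a \<in> ?I" "x \<in> carrier ?R"
    then show "x \<otimes>\<^bsub>?R\<^esub> a \<in> ?I" "a \<otimes>\<^bsub>?R\<^esub> x \<in> ?I"
      using mult psmult_comm[of a x] by (simp_all add: ps_mult)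
  qed
qed

definition fgr_gens :: "(nat \<Rightarrow> nat \<Rightarrow> 'r::comm_ring_1) \<Rightarrow> 'v::ab_group_add set \<Rightarrow> ('v multiset \<Rightarrow> 'r) set" where
  "fgr_gens c \<Lambda> = {ps_var 0} \<union>
     {ps_var (\<mu> + \<nu>) \<ominus>\<^bsub>ps_ring \<Lambda>\<^esub> fgl_subst c (ps_var \<mu>) (ps_var \<nu>) | \<mu> \<nu>. \<mu> \<in> \<Lambda> \<and> \<nu> \<in> \<Lambda>}"

lemma fgr_ideal_alt:
  "fgr_ideal c \<Lambda> = {p \<in> psc \<Lambda>. \<forall>d. \<exists>q\<in>genideal (ps_ring \<Lambda>) (fgr_gens c \<Lambda>). ps_agree d p q}"
  by (simp add: fgr_ideal_def fgr_gens_def ps_agree_def Let_def)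

section \<open>The coefficient ring and its localization\<close>

locale affine_setup = irreducible_root_system "roots G" "simples G" "theta G"
  for G :: "('v::euclidean_space, 'r::{comm_ring_1, ring_char_0}, 'q::comm_ring_1) affine_datum" +
  assumes fgl: "formal_group_law (coeffs G)"
    and regular: "\<forall>\<alpha>\<in>roots G. regular_in (Sring G) (Sclass G (ps_var \<alpha>))"
    and loc: "localization_map (Sring G) ((\<lambda>\<alpha>. Sclass G (ps_var \<alpha>)) ` roots G) (emb G)"
    and rat: "\<exists>h :: rat \<Rightarrow> 'r. rational_embedding h"
begin

abbreviation "\<Lambda> \<equiv> int_comb (roots G)"
abbreviation "\<Phi> \<equiv> roots G"
abbreviation "I \<equiv> fgr_ideal (coeffs G) \<Lambda>"
abbreviation "P \<equiv> psc \<Lambda> :: ('v multiset \<Rightarrow> 'r) set"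
abbreviation "x \<equiv> xel G"

text \<open>Quotient map followed by localization. All computations in \<open>S\<close> are done on
  representing series through this one homomorphism, so cosets hardly appear again.\<close>

definition E :: "('v multiset \<Rightarrow> 'r) \<Rightarrow> 'q" where
  "E p = emb G (Sclass G p)"

lemma gens_psc: "fgr_gens (coeffs G) \<Lambda> \<subseteq> P"
  by (auto simp: fgr_gens_def psc_var int_comb_zero int_comb_add
      intro!: ring.ring_simprules(4)[OF ring_ps] fgl_psc[OF fgl])

lemma genideal_gens: "ideal (genideal (ps_ring \<Lambda>) (fgr_gens (coeffs G) \<Lambda>)) (ps_ring \<Lambda>)"
  by (rule ring.genideal_ideal[OF ring_ps gens_psc])

lemma ideal_I: "ideal I (ps_ring \<Lambda>)"
  unfolding fgr_ideal_alt by (rule ideal_closure[OF genideal_gens])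

lemma gens_I: "fgr_gens (coeffs G) \<Lambda> \<subseteq> I"
  using ring.genideal_self[OF ring_ps gens_psc] gens_psc
  by (auto simp: fgr_ideal_alt ps_agree_def)

text \<open>An approximation of order \<open>d\<close> from the closure can itself be replaced, to
  the same order, by an element of the ideal.\<close>

lemma I_closed:
  assumes "p \<in> P" "\<And>d. \<exists>q\<in>I. ps_agree d p q"
  shows "p \<in> I"
proof -
  have "\<exists>q\<in>genideal (ps_ring \<Lambda>) (fgr_gens (coeffs G) \<Lambda>). ps_agree d p q" for d
  proof -
    obtain q where "q \<in> I" "ps_agree d p q" using assms(2) by blast
    moreover then obtain q' where "q' \<in> genideal (ps_ring \<Lambda>) (fgr_gens (coeffs G) \<Lambda>)" "ps_agree d q q'"
      unfolding fgr_ideal_alt by blast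
    ultimately show ?thesis by (intro bexI[of _ q']) (auto simp: ps_agree_def)
  qed
  then show ?thesis using assms(1) by (auto simp: fgr_ideal_alt)
qed

lemma Sring_alt: "Sring G = ps_ring \<Lambda> Quot I"
  by (simp add: Sring_def formal_group_ring_def)

lemma cring_Sring: "cring (Sring G)"
  unfolding Sring_alt by (rule ideal.quotient_is_cring[OF ideal_I cring_ps])

lemma Sclass_hom: "Sclass G \<in> ring_hom (ps_ring \<Lambda>) (Sring G)"
proof -
  have "Sclass G = (+>\<^bsub>ps_ring \<Lambda>\<^esub>) I" by (simp add: fun_eq_iff Sclass_def fgr_class_def)
  then show ?thesis unfolding Sring_alt using ideal.rcos_ring_hom[OF ideal_I] by simp
qed

lemma Sring_carrier: "carrier (Sring G) = Sclass G ` P"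
  by (auto simp: Sring_alt FactRing_def A_RCOSETS_def' Sclass_def fgr_class_def)

lemma Sclass_zero_iff: "p \<in> P \<Longrightarrow> Sclass G p = \<zero>\<^bsub>Sring G\<^esub> \<longleftrightarrow> p \<in> I"
  using ring.quotient_eq_iff_same_a_r_cos[OF ring_ps ideal_I, of p "\<zero>\<^bsub>ps_ring \<Lambda>\<^esub>"]
    ideal.Icarr[OF ideal_I] ring_hom_zero[OF Sclass_hom ring_ps cring.axioms(1)[OF cring_Sring]]
  by (simp add: Sclass_def fgr_class_def ps_minus psc_zero ps_zero)

lemma emb_props:
  shows "emb G \<one>\<^bsub>Sring G\<^esub> = 1"
    and "a \<in> carrier (Sring G) \<Longrightarrow> b \<in> carrier (Sring G) \<Longrightarrow> emb G (a \<oplus>\<^bsub>Sring G\<^esub> b) = emb G a + emb G b"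
    and "a \<in> carrier (Sring G) \<Longrightarrow> b \<in> carrier (Sring G) \<Longrightarrow> emb G (a \<otimes>\<^bsub>Sring G\<^esub> b) = emb G a * emb G b"
  using loc by (auto simp: localization_map_def)

lemma E_one: "E (ps_monom {#}) = 1"
  using ring_hom_one[OF Sclass_hom] emb_props(1) by (simp add: E_def ps_one)

lemma E_add: "p \<in> P \<Longrightarrow> q \<in> P \<Longrightarrow> E (\<lambda>m. p m + q m) = E p + E q"
  using ring_hom_add[OF Sclass_hom, of p q] emb_props(2)[of "Sclass G p" "Sclass G q"]
  by (simp add: E_def ps_add Sring_carrier)

lemma E_mult: "p \<in> P \<Longrightarrow> q \<in> P \<Longrightarrow> E (psmult p q) = E p * E q"
  using ring_hom_mult[OF Sclass_hom, of p q] emb_props(3)[of "Sclass G p" "Sclass G q"]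
  by (simp add: E_def ps_mult Sring_carrier)

lemma E_zero: "E (\<lambda>_. 0) = 0"
  using E_add[OF psc_zero psc_zero] by simp

lemma E_neg: "p \<in> P \<Longrightarrow> E (\<lambda>m. - p m) = - E p"
  using E_add[OF _ psc_neg, of p p] by (simp add: E_zero eq_neg_iff_add_eq_0 add.commute)

lemma E_diff: "p \<in> P \<Longrightarrow> q \<in> P \<Longrightarrow> E (\<lambda>m. p m - q m) = E p - E q"
  using E_add[OF _ psc_neg, of p q] by (simp add: E_neg)

lemma E_sum: "(\<And>i. i \<in> A \<Longrightarrow> f i \<in> P) \<Longrightarrow> E (\<lambda>m. \<Sum>i\<in>A. f i m) = (\<Sum>i\<in>A. E (f i))"
proof (induction A rule: infinite_finite_induct)
  case (insert i A)
  then have "E (\<lambda>m. \<Sum>i\<in>insert i A. f i m) = E (\<lambda>m. f i m + (\<Sum>i\<in>A. f i m))" by simp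
  also have "\<dots> = E (f i) + E (\<lambda>m. \<Sum>i\<in>A. f i m)" using insert by (intro E_add psc_sum) auto
  finally show ?case using insert by simp
qed (auto simp: E_zero)

lemma x_eq: "x \<mu> = E (ps_var \<mu>)"
  by (simp add: xel_def E_def)

lemma Sset_eq: "Sset G = E ` P"
  by (auto simp: Sset_def Sring_carrier E_def image_image)

lemma SsetI: "p \<in> P \<Longrightarrow> E p \<in> Sset G"
  by (simp add: Sset_eq)

lemma Sset_closed:
  shows Sset_zero: "0 \<in> Sset G" and Sset_one: "1 \<in> Sset G"
    and Sset_add: "a \<in> Sset G \<Longrightarrow> b \<in> Sset G \<Longrightarrow> a + b \<in> Sset G"
    and Sset_mult: "a \<in> Sset G \<Longrightarrow> b \<in> Sset G \<Longrightarrow> a * b \<in> Sset G"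
    and Sset_neg: "a \<in> Sset G \<Longrightarrow> - a \<in> Sset G"
  unfolding Sset_eq
  by (force simp flip: E_zero E_one E_add E_mult E_neg
      intro: psc_zero psc_mono psc_add psmult_closed psc_neg)+

lemma Sset_diff: "a \<in> Sset G \<Longrightarrow> b \<in> Sset G \<Longrightarrow> a - b \<in> Sset G"
  using Sset_add[OF _ Sset_neg, of a b] by simp

lemma Sset_sum: "(\<And>i. i \<in> A \<Longrightarrow> f i \<in> Sset G) \<Longrightarrow> (\<Sum>i\<in>A. f i) \<in> Sset G"
  by (induction A rule: infinite_finite_induct) (auto intro: Sset_zero Sset_add)

lemma Sset_of_int: "of_int k \<in> Sset G"
  by (induction k rule: int_induct[where k = 0]) (auto intro: Sset_zero Sset_one Sset_add Sset_diff)

lemma root_lattice: "\<alpha> \<in> \<Phi> \<Longrightarrow> \<alpha> \<in> \<Lambda>"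
  using int_comb_incl finite_roots by blast

lemma x_Sset: "\<mu> \<in> \<Lambda> \<Longrightarrow> x \<mu> \<in> Sset G"
  by (simp add: x_eq SsetI psc_var)

lemma x_unit: "\<alpha> \<in> \<Phi> \<Longrightarrow> x \<alpha> dvd 1"
  using loc by (auto simp: localization_map_def xel_def)

text \<open>Denominators are products of the elements \<open>x \<alpha>\<close>, and a product of
  regular elements is regular.\<close>

lemma emb_mult_closure:
  assumes "m \<in> mult_closure (Sring G) ((\<lambda>\<alpha>. Sclass G (ps_var \<alpha>)) ` \<Phi>)"
  shows "m \<in> carrier (Sring G) \<and> (\<exists>L. set L \<subseteq> \<Phi> \<and> emb G m = prod_list (map x L)) \<and> regular_in (Sring G) m"
  using assms
proof (induction rule: mult_closure.induct)
  case one
  interpret cring "Sring G" by (rule cring_Sring)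
  show ?case by (auto simp: emb_props regular_in_def intro: exI[of _ "[]"])
next
  case (mult y m)
  interpret cring "Sring G" by (rule cring_Sring)
  obtain \<alpha> where a: "\<alpha> \<in> \<Phi>" "y = Sclass G (ps_var \<alpha>)" using mult by blast
  have y: "y \<in> carrier (Sring G)" using a by (simp add: Sring_carrier psc_var root_lattice)
  obtain L where L: "set L \<subseteq> \<Phi>" "emb G m = prod_list (map x L)" using mult by blast
  have "emb G (y \<otimes>\<^bsub>Sring G\<^esub> m) = prod_list (map x (\<alpha> # L))"
    using y mult L a by (simp add: emb_props(3) xel_def)
  moreover have "regular_in (Sring G) (y \<otimes>\<^bsub>Sring G\<^esub> m)"
    unfolding regular_in_def
  proof (intro ballI impI)
    fix b assume b: "b \<in> carrier (Sring G)" "y \<otimes>\<^bsub>Sring G\<^esub> m \<otimes>\<^bsub>Sring G\<^esub> b = \<zero>\<^bsub>Sring G\<^esub>"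
    have m: "m \<in> carrier (Sring G)" "regular_in (Sring G) m" using mult by blast+
    have "y \<otimes>\<^bsub>Sring G\<^esub> (m \<otimes>\<^bsub>Sring G\<^esub> b) = \<zero>\<^bsub>Sring G\<^esub>" using b m_assoc[OF y m(1) b(1)] by simp
    then have "m \<otimes>\<^bsub>Sring G\<^esub> b = \<zero>\<^bsub>Sring G\<^esub>"
      using regular a m_closed[OF m(1) b(1)] unfolding regular_in_def by blast
    then show "b = \<zero>\<^bsub>Sring G\<^esub>" using m(2) b(1) unfolding regular_in_def by blast
  qed
  moreover have "set (\<alpha> # L) \<subseteq> \<Phi>" using L a by simp
  moreover have "y \<otimes>\<^bsub>Sring G\<^esub> m \<in> carrier (Sring G)" using y mult by blast
  ultimately show ?case by blast
qed

text \<open>An element killed by the localization is annihilated by a denominator, which is regular.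
  So \<open>S\<close> embeds into its localization, and the kernel of \<open>E\<close> is the closed
  ideal itself.\<close>

lemma E_eq_0_iff:
  assumes "p \<in> P" shows "E p = 0 \<longleftrightarrow> p \<in> I"
proof
  assume "E p = 0"
  then obtain m where m: "m \<in> mult_closure (Sring G) ((\<lambda>\<alpha>. Sclass G (ps_var \<alpha>)) ` \<Phi>)"
    "m \<otimes>\<^bsub>Sring G\<^esub> Sclass G p = \<zero>\<^bsub>Sring G\<^esub>"
    using loc assms by (auto simp: localization_map_def E_def Sring_carrier)
  then have "Sclass G p = \<zero>\<^bsub>Sring G\<^esub>"
    using emb_mult_closure[OF m(1)] assms by (auto simp: regular_in_def Sring_carrier)
  then show "p \<in> I" using Sclass_zero_iff assms by simp
next
  assume "p \<in> I"
  then have "Sclass G p = Sclass G (\<lambda>_. 0)"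
    using Sclass_zero_iff[OF assms] Sclass_zero_iff[OF psc_zero]
      additive_subgroup.zero_closed[OF ideal.axioms(1)[OF ideal_I]] by (simp add: ps_zero)
  then show "E p = 0" using E_zero by (simp add: E_def)
qed

text \<open>Because the ideal is closed, an identity in \<open>S\<close> may be checked on
  truncations; this is how identities for finite sums pass to series.\<close>

lemma E_eq_0_limit:
  assumes "p \<in> P" "\<And>d. \<exists>q\<in>P. ps_agree d p q \<and> E q = 0"
  shows "E p = 0"
proof -
  have "p \<in> I"
  proof (rule I_closed[OF assms(1)])
    fix d
    obtain q where "q \<in> P" "ps_agree d p q" "E q = 0" using assms(2) by blast
    then show "\<exists>q\<in>I. ps_agree d p q" using E_eq_0_iff by blast
  qed
  then show ?thesis using E_eq_0_iff[OF assms(1)] by simp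
qed

lemma denominators: "\<exists>L a. set L \<subseteq> \<Phi> \<and> a \<in> Sset G \<and> q * prod_list (map x L) = a"
proof -
  have "\<forall>q. \<exists>a\<in>carrier (Sring G). \<exists>m\<in>mult_closure (Sring G) ((\<lambda>\<alpha>. Sclass G (ps_var \<alpha>)) ` \<Phi>).
      q * emb G m = emb G a"
    using loc unfolding localization_map_def by (elim conjE)
  then obtain a m where am: "a \<in> carrier (Sring G)"
    "m \<in> mult_closure (Sring G) ((\<lambda>\<alpha>. Sclass G (ps_var \<alpha>)) ` \<Phi>)" "q * emb G m = emb G a"
    by meson
  obtain L where "set L \<subseteq> \<Phi>" "emb G m = prod_list (map x L)" using emb_mult_closure[OF am(2)] by blast
  then show ?thesis using am by (intro exI[of _ L] exI[of _ "emb G a"]) (simp add: Sset_def)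
qed

lemma unit_mult: "(a::'q) dvd 1 \<Longrightarrow> b dvd 1 \<Longrightarrow> a * b dvd 1"
  using mult_dvd_mono[of a 1 b 1] by simp

lemma prod_x_unit: "set L \<subseteq> \<Phi> \<Longrightarrow> prod_list (map x L) dvd 1"
  using x_unit by (induction L) (auto intro: unit_mult)

lemma prod_x_Sset: "set L \<subseteq> \<Phi> \<Longrightarrow> prod_list (map x L) \<in> Sset G"
  using x_Sset root_lattice by (induction L) (auto intro: Sset_one Sset_mult)

lemma unit_cancel: "(u::'q) dvd 1 \<Longrightarrow> u * a = u * b \<Longrightarrow> a = b"
  by (metis dvdE mult.assoc mult.commute mult.left_neutral)

lemma unit_inv: "u dvd 1 \<Longrightarrow> u * unit_inv u = (1::'q)"
proof -
  assume "u dvd 1"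
  then obtain v where v: "u * v = 1" by (metis dvdE)
  have "unit_inv u = v" unfolding unit_inv_def
    by (rule the_equality) (use v unit_cancel \<open>u dvd 1\<close> in auto)
  then show ?thesis using v by simp
qed

subsection \<open>The action of the Weyl group\<close>

lemma W_lattice: "w \<in> W \<Longrightarrow> w ` \<Lambda> \<subseteq> \<Lambda>"
  using weyl_int_comb[OF root_system] by blast

lemma rename_P: "w \<in> W \<Longrightarrow> p \<in> P \<Longrightarrow> ps_rename w p \<in> P"
  by (rule ps_rename_psc[OF weyl_bij W_lattice])

lemma rename_hom:
  assumes "w \<in> W"
  shows "ring_hom_ring (ps_ring \<Lambda> :: ('v multiset \<Rightarrow> 'r) ring) (ps_ring \<Lambda>) (ps_rename w)"
  by (rule ring_hom_ringI2[OF ring_ps ring_ps], rule ring_hom_memI)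
    (use assms in \<open>simp_all add: rename_P ps_mult ps_rename_psmult[OF weyl_bij] ps_one ps_rename_mono[OF weyl_bij],
      simp add: ps_add ps_rename_def\<close>)

lemma rename_gens:
  assumes w: "w \<in> W" and p: "p \<in> fgr_gens (coeffs G) \<Lambda>"
  shows "ps_rename w p \<in> fgr_gens (coeffs G) \<Lambda>"
proof -
  note l = weyl_linear[OF w]
  have rv: "ps_rename w (ps_var \<mu>) = ps_var (w \<mu>)" for \<mu>
    by (simp add: ps_var_mono ps_rename_mono[OF weyl_bij[OF w]])
  consider "p = ps_var 0" | \<mu> \<nu> where "\<mu> \<in> \<Lambda>" "\<nu> \<in> \<Lambda>"
    "p = ps_var (\<mu> + \<nu>) \<ominus>\<^bsub>ps_ring \<Lambda>\<^esub> fgl_subst (coeffs G) (ps_var \<mu>) (ps_var \<nu>)"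
    using p by (auto simp: fgr_gens_def)
  then show ?thesis
  proof cases
    case 1
    then show ?thesis by (simp add: rv linear_0[OF l] fgr_gens_def)
  next
    case 2
    have wl: "w \<mu> \<in> \<Lambda>" "w \<nu> \<in> \<Lambda>" using 2 W_lattice[OF w] by auto
    have "p = (\<lambda>m. ps_var (\<mu> + \<nu>) m - fgl_subst (coeffs G) (ps_var \<mu>) (ps_var \<nu>) m)"
      using 2 by (simp add: ps_minus psc_var int_comb_add fgl_psc[OF fgl])
    then have "ps_rename w p = (\<lambda>m. ps_rename w (ps_var (\<mu> + \<nu>)) m
        - ps_rename w (fgl_subst (coeffs G) (ps_var \<mu>) (ps_var \<nu>)) m)"
      by (simp add: ps_rename_def)
    also have "\<dots> = ps_var (w \<mu> + w \<nu>) \<ominus>\<^bsub>ps_ring \<Lambda>\<^esub> fgl_subst (coeffs G) (ps_var (w \<mu>)) (ps_var (w \<nu>))"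
      using wl by (simp add: rv ps_rename_fgl[OF weyl_bij[OF w]] linear_add[OF l] ps_minus psc_var int_comb_add fgl_psc[OF fgl])
    finally show ?thesis using wl by (auto simp: fgr_gens_def)
  qed
qed

text \<open>Elements of \<open>W\<close> are additive, so renaming maps the generators among
  themselves and carries the ideal they generate into \<open>I\<close>. Renaming preserves degrees,
  and \<open>I\<close> is closed, so the closure follows.\<close>

lemma rename_I:
  assumes w: "w \<in> W" and p: "p \<in> I" shows "ps_rename w p \<in> I"
proof (rule I_closed)
  show "ps_rename w p \<in> P" using rename_P[OF w] p by (simp add: fgr_ideal_alt)
next
  fix d
  define J where "J = genideal (ps_ring \<Lambda>) (fgr_gens (coeffs G) \<Lambda>)"
  obtain q where q: "q \<in> J" "ps_agree d p q" using p by (auto simp: fgr_ideal_alt J_def)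
  have "ideal {r \<in> P. ps_rename w r \<in> I} (ps_ring \<Lambda>)"
    by (rule ring_hom_ring.ideal_vimage[OF rename_hom[OF w] ideal_I])
  then have "J \<subseteq> {r \<in> P. ps_rename w r \<in> I}" unfolding J_def
    by (rule ring.genideal_minimal[OF ring_ps]) (use rename_gens[OF w] gens_I gens_psc in auto)
  then have "ps_rename w q \<in> I" using q by blast
  moreover have "ps_agree d (ps_rename w p) (ps_rename w q)"
    using q(2) by (simp add: ps_agree_def ps_rename_def)
  ultimately show "\<exists>q\<in>I. ps_agree d (ps_rename w p) q" by blast
qed

lemma E_rename_eq:
  assumes w: "w \<in> W" and pq: "p \<in> P" "q \<in> P" "E p = E q"
  shows "E (ps_rename w p) = E (ps_rename w q)"
proof -
  have "(\<lambda>m. p m - q m) \<in> I" using pq E_eq_0_iff[OF psc_diff] by (simp add: E_diff)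
  then have "ps_rename w (\<lambda>m. p m - q m) \<in> I" by (rule rename_I[OF w])
  then have "E (\<lambda>m. ps_rename w p m - ps_rename w q m) = 0"
    using E_eq_0_iff[OF psc_diff[OF rename_P rename_P], OF w pq(1) w pq(2)] by (simp add: ps_rename_def)
  then show ?thesis using E_diff[OF rename_P rename_P, OF w pq(1) w pq(2)] by simp
qed

definition ring_endo :: "('q \<Rightarrow> 'q) \<Rightarrow> bool" where
  "ring_endo \<sigma> \<longleftrightarrow> \<sigma> 1 = 1 \<and> (\<forall>a b. \<sigma> (a + b) = \<sigma> a + \<sigma> b) \<and> (\<forall>a b. \<sigma> (a * b) = \<sigma> a * \<sigma> b)"

text \<open>Every element is a fraction, and an endomorphism sends the unit in its denominator to a
  unit, so it is determined on \<open>S\<close>. This gives uniqueness for \<open>act\<close> and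
  reduces the laws of the action to series.\<close>

lemma ring_endo_eqI:
  assumes "ring_endo \<sigma>" "ring_endo \<tau>" "\<And>p. p \<in> P \<Longrightarrow> \<sigma> (E p) = \<tau> (E p)"
  shows "\<sigma> = \<tau>"
proof
  fix q
  obtain L a where L: "set L \<subseteq> \<Phi>" "a \<in> Sset G" "q * prod_list (map x L) = a" using denominators by blast
  let ?m = "prod_list (map x L)"
  have eq: "\<sigma> b = \<tau> b" if "b \<in> Sset G" for b using that assms(3) by (auto simp: Sset_eq)
  have "\<sigma> ?m dvd 1" using prod_x_unit[OF L(1)] assms(1) unfolding ring_endo_def by (metis dvd_def)
  moreover have "\<sigma> ?m * \<sigma> q = \<sigma> ?m * \<tau> q"
    using eq[OF L(2)] eq[OF prod_x_Sset[OF L(1)]] assms(1,2) L(3) unfolding ring_endo_def by (metis mult.commute)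
  ultimately show "\<sigma> q = \<tau> q" by (rule unit_cancel)
qed

text \<open>Extension along the localization. Renaming defines \<open>s\<close> on \<open>S\<close>,
  which permutes the elements \<open>x \<alpha>\<close> and therefore sends denominators to units;
  fractions are then mapped accordingly.\<close>

lemma ex_act:
  assumes w: "w \<in> W"
  shows "\<exists>\<sigma>. ring_endo \<sigma> \<and> (\<forall>p\<in>P. \<sigma> (E p) = E (ps_rename w p))"
proof -
  define s where "s = (\<lambda>a. E (ps_rename w (SOME p. p \<in> P \<and> E p = a)))"
  have s: "s (E p) = E (ps_rename w p)" if "p \<in> P" for p
  proof -
    have "(SOME q. q \<in> P \<and> E q = E p) \<in> P \<and> E (SOME q. q \<in> P \<and> E q = E p) = E p"
      by (rule someI[of _ p]) (use that in simp)
    then show ?thesis unfolding s_def using E_rename_eq[OF w] that by blast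
  qed
  have s1: "s 1 = 1" using s[OF psc_mono, of "{#}"] by (simp add: E_one ps_rename_mono[OF weyl_bij[OF w]])
  have sadd: "s (a + b) = s a + s b" if ab: "a \<in> Sset G" "b \<in> Sset G" for a b
  proof -
    obtain p q where pq: "p \<in> P" "q \<in> P" "a = E p" "b = E q" using ab by (auto simp: Sset_eq)
    then have "s (a + b) = E (ps_rename w (\<lambda>m. p m + q m))" by (simp add: s psc_add flip: E_add)
    also have "\<dots> = E (\<lambda>m. ps_rename w p m + ps_rename w q m)" by (simp add: ps_rename_def)
    finally show ?thesis using pq by (simp add: s E_add rename_P w)
  qed
  have smul: "s (a * b) = s a * s b" if ab: "a \<in> Sset G" "b \<in> Sset G" for a b
  proof -
    obtain p q where pq: "p \<in> P" "q \<in> P" "a = E p" "b = E q" using ab by (auto simp: Sset_eq)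
    then show ?thesis
      by (simp add: s psmult_closed ps_rename_psmult[OF weyl_bij[OF w]] E_mult rename_P w flip: E_mult)
  qed
  have sx: "s (x \<mu>) = x (w \<mu>)" if "\<mu> \<in> \<Lambda>" for \<mu>
    using that by (simp add: x_eq s psc_var) (simp add: ps_var_mono ps_rename_mono[OF weyl_bij[OF w]])
  let ?m = "\<lambda>L. prod_list (map x L)"
  have sm: "s (?m L) dvd 1" if "set L \<subseteq> \<Phi>" for L
    using that
  proof (induction L)
    case (Cons \<alpha> L)
    then show ?case
      using x_unit[OF weyl_roots[OF root_system w, of \<alpha>]] smul[of "x \<alpha>" "?m L"]
      by (simp add: sx root_lattice x_Sset prod_x_Sset unit_mult)
  qed (simp add: s1)
  \<comment> \<open>The value of a fraction is characterized by all ways of clearing its denominator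
    at once, which builds independence of the choice into the definition.\<close>
  define \<sigma> where "\<sigma> = (\<lambda>q. THE r. \<forall>L. set L \<subseteq> \<Phi> \<longrightarrow> q * ?m L \<in> Sset G \<longrightarrow> r * s (?m L) = s (q * ?m L))"
  have sig: "\<sigma> q * s (?m L) = s (q * ?m L)" if L: "set L \<subseteq> \<Phi>" "q * ?m L \<in> Sset G" for q L
  proof -
    obtain v where v: "s (?m L) * v = 1" using sm[OF L(1)] by (metis dvdE)
    have "\<sigma> q = s (q * ?m L) * v" unfolding \<sigma>_def
    proof (rule the_equality)
      show "\<forall>M. set M \<subseteq> \<Phi> \<longrightarrow> q * ?m M \<in> Sset G \<longrightarrow> s (q * ?m L) * v * s (?m M) = s (q * ?m M)"
      proof (intro allI impI)
        fix M assume M: "set M \<subseteq> \<Phi>" "q * ?m M \<in> Sset G"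
        have "s (q * ?m L) * s (?m M) = s (q * ?m M) * s (?m L)"
          using L M prod_x_Sset by (simp add: mult.assoc mult.commute mult.left_commute flip: smul)
        then show "s (q * ?m L) * v * s (?m M) = s (q * ?m M)"
          using v by (metis (no_types, lifting) mult.assoc mult.commute mult.right_neutral)
      qed
    next
      fix r assume "\<forall>M. set M \<subseteq> \<Phi> \<longrightarrow> q * ?m M \<in> Sset G \<longrightarrow> r * s (?m M) = s (q * ?m M)"
      then have "s (q * ?m L) = r * s (?m L)" using L by simp
      then show "r = s (q * ?m L) * v" using v by (simp add: mult.assoc)
    qed
    then show ?thesis using v by (metis mult.assoc mult.commute mult.right_neutral)
  qed
  have sigS: "\<sigma> a = s a" if "a \<in> Sset G" for a using sig[of "[]" a] that s1 by simp
  \<comment> \<open>Concatenating two lists of roots gives a common denominator, as is needed for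
    sums and products.\<close>
  have den2: "\<exists>L. set L \<subseteq> \<Phi> \<and> a * ?m L \<in> Sset G \<and> b * ?m L \<in> Sset G" for a b
  proof -
    obtain L M where LM: "set L \<subseteq> \<Phi>" "a * ?m L \<in> Sset G" "set M \<subseteq> \<Phi>" "b * ?m M \<in> Sset G"
      using denominators by metis
    have e: "a * ?m (L @ M) = (a * ?m L) * ?m M" "b * ?m (L @ M) = (b * ?m M) * ?m L"
      by (simp_all add: mult_ac)
    have "a * ?m (L @ M) \<in> Sset G" "b * ?m (L @ M) \<in> Sset G"
      unfolding e by (intro Sset_mult LM prod_x_Sset)+
    then show ?thesis using LM by (intro exI[of _ "L @ M"]) simp
  qed
  have "\<sigma> (a + b) = \<sigma> a + \<sigma> b" for a b
  proof -
    obtain L where L: "set L \<subseteq> \<Phi>" "a * ?m L \<in> Sset G" "b * ?m L \<in> Sset G" using den2 by blast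
    have "(a + b) * ?m L \<in> Sset G" using L by (simp add: distrib_right Sset_add)
    then have "\<sigma> (a + b) * s (?m L) = s ((a + b) * ?m L)" by (rule sig[OF L(1)])
    also have "\<dots> = (\<sigma> a + \<sigma> b) * s (?m L)" using L by (simp add: distrib_right sadd sig)
    finally show ?thesis using unit_cancel[OF sm[OF L(1)]] by (simp add: mult.commute)
  qed
  moreover have "\<sigma> (a * b) = \<sigma> a * \<sigma> b" for a b
  proof -
    obtain L where L: "set L \<subseteq> \<Phi>" "a * ?m L \<in> Sset G" "b * ?m L \<in> Sset G" using den2 by blast
    have e: "(a * b) * ?m (L @ L) = (a * ?m L) * (b * ?m L)" by (simp add: mult_ac)
    have e': "s (?m (L @ L)) = s (?m L) * s (?m L)" using smul prod_x_Sset[OF L(1)] by simp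
    have "\<sigma> (a * b) * s (?m (L @ L)) = s ((a * b) * ?m (L @ L))"
      by (rule sig) (use L in simp, unfold e, rule Sset_mult[OF L(2,3)])
    also have "\<dots> = s (a * ?m L) * s (b * ?m L)" unfolding e by (rule smul[OF L(2,3)])
    also have "\<dots> = \<sigma> a * \<sigma> b * s (?m (L @ L))" unfolding sig[OF L(1,2), symmetric] sig[OF L(1,3), symmetric] e' by (simp only: mult_ac)
    finally show ?thesis using unit_cancel[OF sm, of "L @ L"] L by (simp add: mult.commute)
  qed
  moreover have "\<sigma> 1 = 1" using sigS[OF Sset_one] s1 by simp
  ultimately have "ring_endo \<sigma>" by (simp add: ring_endo_def)
  moreover have "\<forall>p\<in>P. \<sigma> (E p) = E (ps_rename w p)" using s sigS SsetI by simp
  ultimately show ?thesis by blast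
qed

lemma act_props:
  assumes w: "w \<in> W"
  shows "ring_endo (act G w)" and act_E: "p \<in> P \<Longrightarrow> act G w (E p) = E (ps_rename w p)"
proof -
  obtain \<sigma> where s: "ring_endo \<sigma>" "\<forall>p\<in>P. \<sigma> (E p) = E (ps_rename w p)" using ex_act[OF w] by blast
  have "act G w = \<sigma>" unfolding act_def
  proof (rule the_equality)
    fix \<tau>
    assume t: "\<tau> 1 = 1 \<and> (\<forall>a b. \<tau> (a + b) = \<tau> a + \<tau> b) \<and> (\<forall>a b. \<tau> (a * b) = \<tau> a * \<tau> b) \<and>
      (\<forall>p\<in>P. \<tau> (emb G (Sclass G p)) = emb G (Sclass G (ps_rename w p)))"
    show "\<tau> = \<sigma>"
      by (rule ring_endo_eqI[OF _ s(1)]) (use t s in \<open>auto simp: ring_endo_def E_def\<close>)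
  qed (use s in \<open>auto simp: ring_endo_def E_def\<close>)
  then show "ring_endo (act G w)" "p \<in> P \<Longrightarrow> act G w (E p) = E (ps_rename w p)" using s by auto
qed

lemma act_one: "w \<in> W \<Longrightarrow> act G w 1 = 1"
  and act_add: "w \<in> W \<Longrightarrow> act G w (a + b) = act G w a + act G w b"
  and act_mult: "w \<in> W \<Longrightarrow> act G w (a * b) = act G w a * act G w b"
  using act_props(1)[of w] by (auto simp: ring_endo_def)

lemma act_zero: "w \<in> W \<Longrightarrow> act G w 0 = 0"
  using act_add[of w 0 0] by simp

lemma act_neg: "w \<in> W \<Longrightarrow> act G w (- a) = - act G w a"
  using act_add[of w a "- a"] by (simp add: act_zero eq_neg_iff_add_eq_0 add.commute)

lemma act_diff: "w \<in> W \<Longrightarrow> act G w (a - b) = act G w a - act G w b"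
  using act_add[of w a "- b"] by (simp add: act_neg)

lemma act_sum: "w \<in> W \<Longrightarrow> act G w (sum f A) = (\<Sum>i\<in>A. act G w (f i))"
  by (induction A rule: infinite_finite_induct) (auto simp: act_zero act_add)

lemma act_id: "act G id = id"
  by (rule ring_endo_eqI[OF act_props(1)[OF weyl_group.id]])
    (auto simp: ring_endo_def act_E[OF weyl_group.id] ps_rename_id)

lemma act_comp:
  assumes "w \<in> W" "v \<in> W" shows "act G w (act G v a) = act G (w \<circ> v) a"
proof -
  have "act G w \<circ> act G v = act G (w \<circ> v)"
    by (rule ring_endo_eqI)
      (use assms in \<open>auto simp: ring_endo_def act_one act_add act_mult weyl_comp act_E rename_P
        ps_rename_comp[OF weyl_bij weyl_bij]\<close>)
  then show ?thesis by (metis comp_apply)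
qed

lemma act_x: "w \<in> W \<Longrightarrow> \<mu> \<in> \<Lambda> \<Longrightarrow> act G w (x \<mu>) = x (w \<mu>)"
  by (simp add: x_eq act_E psc_var) (simp add: ps_var_mono ps_rename_mono[OF weyl_bij])

lemma act_Sset: "w \<in> W \<Longrightarrow> a \<in> Sset G \<Longrightarrow> act G w a \<in> Sset G"
  by (auto simp: Sset_eq act_E rename_P)

lemma act_of_int: "w \<in> W \<Longrightarrow> act G w (of_int k) = of_int k"
  by (induction k rule: int_induct[where k = 0]) (auto simp: act_zero act_one act_add act_diff)

end

section \<open>Scalars, differences of coordinates and divided differences on the coefficient
  ring\<close>

lemma psmult_scale: "psmult (\<lambda>m. r * p m) q = (\<lambda>m. r * psmult p q m)"
  by (simp add: psmult_def sum_distrib_left mult.assoc)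

context affine_setup
begin

text \<open>The structure map of \<open>S\<close> as an algebra over \<open>R\<close>; through it,
  integers that are invertible in \<open>R\<close> become invertible in \<open>S\<close>.\<close>

definition C :: "'r \<Rightarrow> 'q" where
  "C r = E (\<lambda>m. r * ps_monom {#} m)"

lemma E_scale: "p \<in> P \<Longrightarrow> E (\<lambda>m. r * p m) = C r * E p"
  using E_mult[OF psc_scale[OF psc_mono], of "{#}" p r] by (simp add: C_def psmult_scale psmult_one)

lemma C_one: "C 1 = 1"
  by (simp add: C_def E_one)

lemma C_zero: "C 0 = 0"
  by (simp add: C_def E_zero)

lemma C_Sset: "C r \<in> Sset G"
  unfolding C_def by (intro SsetI psc_scale psc_mono) simp

lemma C_mult: "C (r * s) = C r * C s"
  using E_scale[OF psc_scale[OF psc_mono], of "{#}" r s] by (simp add: C_def mult.assoc)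

lemma C_add: "C (r + s) = C r + C s"
  using E_add[OF psc_scale[OF psc_mono] psc_scale[OF psc_mono], of "{#}" "{#}" r s]
  by (simp add: C_def distrib_right)

lemma C_of_int: "C (of_int k) = of_int k"
proof (induction k rule: int_induct[where k = 0])
  case (step2 i)
  have "C (of_int (i - 1)) + C 1 = C (of_int i)" unfolding C_add[symmetric] by simp
  then show ?case using step2 by (simp add: C_one algebra_simps)
qed (simp_all add: C_zero C_one C_add)

lemma ex_int_inverse:
  assumes "k \<noteq> 0" shows "\<exists>r. of_int k * r = (1::'r)"
proof -
  obtain h where h: "rational_embedding h" "\<And>x y. h (x + y) = h x + (h y :: 'r)"
    "\<And>x y. h (x * y) = h x * h y" "h 1 = 1" using rat unfolding rational_embedding_def by blast
  have h0: "h 0 = 0" using h(2)[of 0 0] by simp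
  have "h (of_int k) = of_int k"
  proof (induction k rule: int_induct[where k = 0])
    case (step2 i)
    have "h (of_int (i - 1)) + h 1 = h (of_int i)" unfolding h(2)[symmetric] by simp
    then show ?case using step2 by (simp add: h(4) algebra_simps)
  qed (simp_all add: h h0)
  then have "of_int k * h (1 / of_int k) = 1" using assms h(3)[of "of_int k" "1 / of_int k"] h(4) by simp
  then show ?thesis by blast
qed

lemma int_unit: "k \<noteq> 0 \<Longrightarrow> \<exists>b\<in>Sset G. of_int k * b = (1::'q)"
  using ex_int_inverse[of k] C_Sset by (metis C_mult C_of_int C_one)

lemma E_unit:
  assumes "p \<in> P" "p {#} * v = 1" shows "\<exists>b\<in>Sset G. E p * b = 1"
  using E_mult[OF assms(1) ps_inv_psc[OF assms(1)], of v] psmult_ps_inv[where h = p and v = v, OF assms(2)] ps_inv_psc[OF assms(1), of v]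
  by (auto simp: E_one intro: SsetI)

lemma x_add_diff:
  assumes "\<mu> \<in> \<Lambda>" "\<nu> \<in> \<Lambda>"
  shows "\<exists>p\<in>P. x (\<mu> + \<nu>) - x \<mu> = x \<nu> * E p \<and> p {#} = 1"
proof -
  let ?F = "fgl_subst (coeffs G) (ps_var \<mu>) (ps_var \<nu>)"
  have F: "?F \<in> P" by (rule fgl_psc[OF fgl assms])
  have q: "fgl_quot (coeffs G) \<mu> \<nu> \<in> P" by (rule fgl_quot_psc[OF assms])
  have v: "ps_var (\<mu> + \<nu>) \<in> P" using assms by (simp add: psc_var int_comb_add)
  have "ps_var (\<mu> + \<nu>) \<ominus>\<^bsub>ps_ring \<Lambda>\<^esub> ?F \<in> I" using gens_I assms by (auto simp: fgr_gens_def)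
  then have "(\<lambda>m. ps_var (\<mu> + \<nu>) m - ?F m) \<in> I" by (simp add: ps_minus[OF v F])
  then have "E (\<lambda>m. ps_var (\<mu> + \<nu>) m - ?F m) = 0" using E_eq_0_iff[OF psc_diff[OF v F]] by simp
  then have "x (\<mu> + \<nu>) = E ?F" by (simp add: E_diff[OF v F] x_eq)
  also have "\<dots> = x \<mu> + x \<nu> * E (fgl_quot (coeffs G) \<mu> \<nu>)"
    unfolding fgl_var_eq[OF fgl] x_eq
    by (simp add: E_add E_mult psc_var assms q psmult_closed)
  finally show ?thesis using q fgl_quot_const[OF fgl] by (intro bexI[of _ "fgl_quot (coeffs G) \<mu> \<nu>"]) auto
qed

text \<open>Telescoping over \<open>n\<close> steps of length \<nu>, each with a quotient of
  constant term 1. The constant term is recorded because it decides later whether a combination of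
  such quotients is a unit.\<close>

lemma x_add_nat_diff:
  assumes "\<mu> \<in> \<Lambda>" "\<nu> \<in> \<Lambda>"
  shows "\<exists>p\<in>P. x (\<mu> + real n *\<^sub>R \<nu>) - x \<mu> = x \<nu> * E p \<and> p {#} = of_nat n"
proof (induction n)
  case 0
  show ?case by (rule bexI[of _ "\<lambda>_. 0"]) (auto simp: E_zero psc_zero)
next
  case (Suc n)
  then obtain p where p: "p \<in> P" "x (\<mu> + real n *\<^sub>R \<nu>) - x \<mu> = x \<nu> * E p" "p {#} = of_nat n" by blast
  have "\<mu> + real n *\<^sub>R \<nu> \<in> \<Lambda>" using int_comb_scale[OF assms(2), of "int n"] assms(1) by (simp add: int_comb_add)
  then obtain q where q: "q \<in> P" "x (\<mu> + real n *\<^sub>R \<nu> + \<nu>) - x (\<mu> + real n *\<^sub>R \<nu>) = x \<nu> * E q" "q {#} = 1"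
    using x_add_diff[OF _ assms(2)] by blast
  have e: "\<mu> + real (Suc n) *\<^sub>R \<nu> = \<mu> + real n *\<^sub>R \<nu> + \<nu>" by (simp add: scaleR_left_distrib)
  have "x (\<mu> + real (Suc n) *\<^sub>R \<nu>) - x \<mu> = x \<nu> * E (\<lambda>m. p m + q m)"
    using p q unfolding e by (simp add: E_add algebra_simps)
  then show ?case using p q by (intro bexI[of _ "\<lambda>m. p m + q m"]) (auto simp: psc_add)
qed

abbreviation pair :: "'v \<Rightarrow> 'v \<Rightarrow> int" where
  "pair \<mu> \<alpha> \<equiv> \<lfloor>inner \<mu> (coroot \<alpha>)\<rfloor>"

lemma of_int_pair: "\<mu> \<in> \<Lambda> \<Longrightarrow> \<alpha> \<in> \<Phi> \<Longrightarrow> of_int (pair \<mu> \<alpha>) = inner \<mu> (coroot \<alpha>)"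
  using int_comb_pairing[OF root_system] by (auto elim!: Ints_cases)

lemma reflection_pair: "\<mu> \<in> \<Lambda> \<Longrightarrow> \<alpha> \<in> \<Phi> \<Longrightarrow> reflection \<alpha> \<mu> = \<mu> - of_int (pair \<mu> \<alpha>) *\<^sub>R \<alpha>"
  by (simp add: of_int_pair reflection_def)

lemma reflection_lattice: "\<mu> \<in> \<Lambda> \<Longrightarrow> \<alpha> \<in> \<Phi> \<Longrightarrow> reflection \<alpha> \<mu> \<in> \<Lambda>"
  using W_lattice weyl_refl by blast

lemma x_reflection_diff:
  assumes "\<mu> \<in> \<Lambda>" "\<alpha> \<in> \<Phi>"
  shows "\<exists>p\<in>P. x \<mu> - x (reflection \<alpha> \<mu>) = x \<alpha> * E p \<and> p {#} = of_int (pair \<mu> \<alpha>)"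
proof -
  have a: "\<alpha> \<in> \<Lambda>" using assms root_lattice by simp
  have s: "reflection \<alpha> \<mu> \<in> \<Lambda>" using reflection_lattice assms by simp
  show ?thesis
  proof (cases "pair \<mu> \<alpha> \<ge> 0")
    case True
    then have k: "real (nat (pair \<mu> \<alpha>)) = of_int (pair \<mu> \<alpha>)" "of_nat (nat (pair \<mu> \<alpha>)) = (of_int (pair \<mu> \<alpha>) :: 'r)"
      by (simp_all add: of_nat_nat)
    show ?thesis using x_add_nat_diff[OF s a, of "nat (pair \<mu> \<alpha>)"] unfolding k
      by (simp add: reflection_pair[OF assms])
  next
    case False
    then have k: "real (nat (- pair \<mu> \<alpha>)) = - of_int (pair \<mu> \<alpha>)"
      "of_nat (nat (- pair \<mu> \<alpha>)) = (- of_int (pair \<mu> \<alpha>) :: 'r)"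
      by (simp_all add: of_nat_nat)
    obtain p where p: "p \<in> P" "x (reflection \<alpha> \<mu>) - x \<mu> = x \<alpha> * E p" "p {#} = - of_int (pair \<mu> \<alpha>)"
      using x_add_nat_diff[OF assms(1) a, of "nat (- pair \<mu> \<alpha>)"] unfolding k
      by (auto simp: reflection_pair[OF assms])
    then show ?thesis
      by (intro bexI[of _ "\<lambda>m. - p m"]) (auto simp: E_neg psc_neg algebra_simps)
  qed
qed

lemma E_monom_add: "set_mset m \<subseteq> \<Lambda> \<Longrightarrow> \<mu> \<in> \<Lambda> \<Longrightarrow> E (ps_monom (add_mset \<mu> m)) = x \<mu> * E (ps_monom m)"
  using E_mult[OF psc_var psc_mono, of \<mu> m] by (simp add: ps_var_mono mono_mult x_eq)

text \<open>The twisted Leibniz rule, one variable at a time. The degree bound says that the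
  quotient drops the degree by at most one; it is what makes the quotients of infinitely many
  monomials summable.\<close>

lemma monom_divided_difference:
  assumes "set_mset m \<subseteq> \<Lambda>" "\<alpha> \<in> \<Phi>"
  shows "\<exists>g\<in>P. (\<forall>n. size n + 1 < size m \<longrightarrow> g n = 0) \<and>
    E (ps_monom m) - E (ps_monom (image_mset (reflection \<alpha>) m)) = x \<alpha> * E g"
  using assms(1)
proof (induction m)
  case empty
  show ?case by (rule bexI[of _ "\<lambda>_. 0"]) (auto simp: E_zero psc_zero)
next
  case (add \<mu> m)
  have mu: "\<mu> \<in> \<Lambda>" and m: "set_mset m \<subseteq> \<Lambda>" using add by auto
  have sm: "set_mset (image_mset (reflection \<alpha>) m) \<subseteq> \<Lambda>" using m reflection_lattice assms by auto
  have smu: "reflection \<alpha> \<mu> \<in> \<Lambda>" using reflection_lattice mu assms by simp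
  obtain g where g: "g \<in> P" "\<forall>n. size n + 1 < size m \<longrightarrow> g n = 0"
    "E (ps_monom m) - E (ps_monom (image_mset (reflection \<alpha>) m)) = x \<alpha> * E g" using add.IH m by blast
  obtain p where p: "p \<in> P" "x \<mu> - x (reflection \<alpha> \<mu>) = x \<alpha> * E p"
    using x_reflection_diff[OF mu assms(2)] by blast
  define g' where "g' = (\<lambda>n. psmult (ps_monom m) p n + psmult (ps_var (reflection \<alpha> \<mu>)) g n)"
  have Pg': "g' \<in> P" unfolding g'_def by (intro psc_add psmult_closed psc_mono psc_var m smu p g)
  have "E (ps_monom (add_mset \<mu> m)) - E (ps_monom (image_mset (reflection \<alpha>) (add_mset \<mu> m)))
    = x \<mu> * E (ps_monom m) - x (reflection \<alpha> \<mu>) * E (ps_monom (image_mset (reflection \<alpha>) m))"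
    using mu m sm smu by (simp add: E_monom_add)
  also have "\<dots> = (x \<mu> - x (reflection \<alpha> \<mu>)) * E (ps_monom m) + x (reflection \<alpha> \<mu>) *
     (E (ps_monom m) - E (ps_monom (image_mset (reflection \<alpha>) m)))" by (simp add: algebra_simps)
  also have "\<dots> = x \<alpha> * E g'" unfolding p(2) g(3) g'_def
    by (simp add: E_add E_mult psmult_closed psc_mono psc_var m smu p g x_eq algebra_simps)
  finally have eq: "E (ps_monom (add_mset \<mu> m)) - E (ps_monom (image_mset (reflection \<alpha>) (add_mset \<mu> m))) = x \<alpha> * E g'" .
  have "g' n = 0" if n: "size n + 1 < size (add_mset \<mu> m)" for n
  proof -
    have "\<not> m \<subseteq># n" using n size_mset_mono[of m n] by auto
    moreover have "g (n - {#reflection \<alpha> \<mu>#}) = 0" if "{#reflection \<alpha> \<mu>#} \<subseteq># n"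
    proof -
      have "size n = Suc (size (n - {#reflection \<alpha> \<mu>#}))"
        using that by (metis size_Suc_Diff1 single_subset_iff)
      then show ?thesis using n g(2) by simp
    qed
    ultimately show ?thesis by (auto simp: g'_def psmult_mono ps_var_mono)
  qed
  then show ?case using eq Pg' by blast
qed

text \<open>The quotient of a series is the sum of quotients chosen for its monomials. By the degree
  bound only finitely many of them reach a given degree, and the resulting identity is verified on
  truncations.\<close>

lemma divided_difference:
  assumes a: "a \<in> Sset G" and al: "\<alpha> \<in> \<Phi>"
  shows "\<exists>b\<in>Sset G. a - act G (reflection \<alpha>) a = x \<alpha> * b"
proof -
  obtain p where p: "p \<in> P" "a = E p" using a by (auto simp: Sset_eq)
  let ?s = "reflection \<alpha>"
  have sW: "?s \<in> W" using weyl_refl al by blast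
  define gg where "gg = (\<lambda>m. SOME g. g \<in> P \<and> (\<forall>n. size n + 1 < size m \<longrightarrow> g n = 0) \<and>
    E (ps_monom m) - E (ps_monom (image_mset ?s m)) = x \<alpha> * E g)"
  have gg: "gg m \<in> P" "size n + 1 < size m \<Longrightarrow> gg m n = 0"
    "E (ps_monom m) - E (ps_monom (image_mset ?s m)) = x \<alpha> * E (gg m)" if "p m \<noteq> 0" for m n
    using someI_ex[OF monom_divided_difference[OF psc_support[OF p(1) that] al, unfolded Bex_def]]
    by (simp_all add: gg_def)
  define F where "F = (\<lambda>d. {m. p m \<noteq> 0 \<and> size m \<le> d})"
  have F: "finite (F d)" for d unfolding F_def by (rule psc_finite_le[OF p(1)])
  \<comment> \<open>At \<open>n\<close> only monomials of degree at most \<open>size n + 1\<close>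
    contribute, since the quotient of a larger monomial starts above the degree of
    \<open>n\<close>.\<close>
  define g where "g = (\<lambda>n. \<Sum>m\<in>F (size n + 1). p m * gg m n)"
  define gF where "gF = (\<lambda>d n. \<Sum>m\<in>F d. p m * gg m n)"
  have gF: "gF d \<in> P" for d unfolding gF_def by (intro psc_sum psc_scale) (auto simp: F_def gg)
  have agree: "g n = gF d n" if "size n + 1 \<le> d" for n d
    unfolding g_def gF_def
  proof (rule sum.mono_neutral_left)
    show "\<forall>i\<in>F d - F (size n + 1). p i * gg i n = 0"
    proof
      fix i assume "i \<in> F d - F (size n + 1)"
      then have i: "p i \<noteq> 0" "size n + 1 < size i" by (auto simp: F_def)
      show "p i * gg i n = 0" using gg(2)[OF i] by simp
    qed
  qed (use that F in \<open>auto simp: F_def\<close>)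
  have g: "g \<in> P"
  proof -
    have "g m = gF (size m + 1) m" for m by (rule agree) simp
    then have "set_mset m \<subseteq> \<Lambda>" if "g m \<noteq> 0" for m using that psc_support[OF gF] by metis
    moreover have "{m. g m \<noteq> 0 \<and> size m = d} = {m. gF (d + 1) m \<noteq> 0 \<and> size m = d}" for d
    proof (rule Collect_cong)
      fix m :: "'v multiset"
      show "g m \<noteq> 0 \<and> size m = d \<longleftrightarrow> gF (d + 1) m \<noteq> 0 \<and> size m = d"
        using agree[of m "d + 1"] by (cases "size m = d") simp_all
    qed
    ultimately show ?thesis using psc_finite[OF gF] by (simp add: psc_iff)
  qed
  define pF where "pF = (\<lambda>d n. \<Sum>m\<in>F d. p m * ps_monom m n)"
  have mP: "ps_monom m \<in> P" if "m \<in> F d" for m d using that psc_support[OF p(1)] by (auto simp: F_def intro: psc_mono)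
  have pFP: "pF d \<in> P" for d unfolding pF_def by (intro psc_sum psc_scale mP)
  have pF: "pF d n = p n" if "size n \<le> d" for n d
  proof -
    have "pF d n = (\<Sum>m\<in>F d. if m = n then p n else 0)"
      unfolding pF_def by (rule sum.cong) (auto simp: ps_monom_def)
    then show ?thesis using F that by (auto simp: F_def)
  qed
  have "E (\<lambda>m. (p m - ps_rename ?s p m) - psmult (ps_var \<alpha>) g m) = 0"
  proof (rule E_eq_0_limit)
    fix d
    define q where "q = (\<lambda>m. (pF d m - ps_rename ?s (pF d) m) - psmult (ps_var \<alpha>) (gF d) m)"
    have "q \<in> P" unfolding q_def
      by (intro psc_diff rename_P sW pFP psmult_closed psc_var root_lattice al gF)
    moreover have "ps_agree d (\<lambda>m. (p m - ps_rename ?s p m) - psmult (ps_var \<alpha>) g m) q"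
      unfolding ps_agree_def
    proof (intro allI impI)
      fix m :: "'v multiset" assume m: "size m < d"
      have "psmult (ps_var \<alpha>) g m = psmult (ps_var \<alpha>) (gF d) m"
      proof (cases "\<alpha> \<in># m")
        case True
        then have "size (m - {#\<alpha>#}) + 1 \<le> d" using m by (simp add: size_Diff_singleton)
        then show ?thesis by (simp add: ps_var_mono psmult_mono agree)
      qed (simp add: ps_var_mono psmult_mono)
      then show "(p m - ps_rename ?s p m) - psmult (ps_var \<alpha>) g m = q m"
        using m by (simp add: q_def pF ps_rename_def)
    qed
    moreover have "E q = 0"
    proof -
      have rn: "ps_rename ?s (pF d) = (\<lambda>n. \<Sum>m\<in>F d. p m * ps_monom (image_mset ?s m) n)"
        by (simp add: pF_def fun_eq_iff ps_rename_def flip: ps_rename_mono[OF weyl_bij[OF sW]])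
      have smP: "ps_monom (image_mset ?s m) \<in> P" if "m \<in> F d" for m
        using rename_P[OF sW mP[OF that]] by (simp add: ps_rename_mono[OF weyl_bij[OF sW]])
      have "E (pF d) = (\<Sum>m\<in>F d. C (p m) * E (ps_monom m))"
        unfolding pF_def by (subst E_sum) (auto intro!: psc_scale mP sum.cong E_scale)
      moreover have "E (ps_rename ?s (pF d)) = (\<Sum>m\<in>F d. C (p m) * E (ps_monom (image_mset ?s m)))"
        unfolding rn by (subst E_sum) (auto intro!: psc_scale smP sum.cong E_scale)
      moreover have "E (gF d) = (\<Sum>m\<in>F d. C (p m) * E (gg m))"
        unfolding gF_def by (subst E_sum) (auto intro!: psc_scale sum.cong E_scale simp: F_def gg)
      moreover have "C (p m) * E (ps_monom m) - C (p m) * E (ps_monom (image_mset ?s m)) = x \<alpha> * (C (p m) * E (gg m))"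
        if "m \<in> F d" for m
        using gg(3)[of m] that by (simp add: F_def algebra_simps flip: right_diff_distrib)
      ultimately have "E (pF d) - E (ps_rename ?s (pF d)) = x \<alpha> * E (gF d)"
        by (simp add: sum_distrib_left flip: sum_subtractf)
      then show ?thesis unfolding q_def
        by (simp add: E_diff E_mult psc_diff rename_P sW pFP psmult_closed psc_var root_lattice al gF flip: x_eq)
    qed
    ultimately show "\<exists>q\<in>P. ps_agree d (\<lambda>m. (p m - ps_rename ?s p m) - psmult (ps_var \<alpha>) g m) q \<and> E q = 0" by blast
  qed (intro psc_diff rename_P sW p psmult_closed psc_var root_lattice al g)
  then have "a - act G ?s a = x \<alpha> * E g"
    by (simp add: E_diff E_mult psc_diff rename_P sW p psmult_closed psc_var root_lattice al g act_E flip: x_eq)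
  then show ?thesis using g SsetI by blast
qed

text \<open>
  Additive \<open>W\<close>-equivariant coordinates on \<open>S\<close>, playing the role of the logarithm of the formal
  group law.
\<close>

definition t :: "'v \<Rightarrow> 'q" where
  "t \<mu> = (\<Sum>\<beta>\<in>\<Phi>. of_int (pair \<mu> \<beta>) * x \<beta>)"

lemma t_Sset: "t \<mu> \<in> Sset G"
  unfolding t_def by (intro Sset_sum Sset_mult Sset_of_int x_Sset root_lattice)

lemma pair_add: "\<mu> \<in> \<Lambda> \<Longrightarrow> \<nu> \<in> \<Lambda> \<Longrightarrow> \<beta> \<in> \<Phi> \<Longrightarrow> pair (\<mu> + \<nu>) \<beta> = pair \<mu> \<beta> + pair \<nu> \<beta>"
  using int_comb_pairing[OF root_system, of \<beta> \<mu>] by (auto simp: inner_add_left elim!: Ints_cases)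

lemma t_add: "\<mu> \<in> \<Lambda> \<Longrightarrow> \<nu> \<in> \<Lambda> \<Longrightarrow> t (\<mu> + \<nu>) = t \<mu> + t \<nu>"
  by (simp add: t_def pair_add distrib_right sum.distrib)

lemma t_diff: "\<mu> \<in> \<Lambda> \<Longrightarrow> \<nu> \<in> \<Lambda> \<Longrightarrow> t (\<mu> - \<nu>) = t \<mu> - t \<nu>"
  using t_add[OF int_comb_diff, of \<mu> \<nu> \<nu>] by simp

lemma t_scale:
  assumes "\<mu> \<in> \<Lambda>" shows "t (of_int k *\<^sub>R \<mu>) = of_int k * t \<mu>"
proof (induction k rule: int_induct[where k = 0])
  case base show ?case by (simp add: t_def)
next
  case (step1 i)
  then show ?case using t_add[OF int_comb_scale[OF assms, of i] assms] by (simp add: algebra_simps)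
next
  case (step2 i)
  then show ?case using t_diff[OF int_comb_scale[OF assms, of i] assms] by (simp add: algebra_simps)
qed

text \<open>\<open>W\<close> permutes the roots and preserves the pairing, so the sum is merely
  reindexed.\<close>

lemma t_act:
  assumes w: "w \<in> W" and "\<mu> \<in> \<Lambda>" shows "act G w (t \<mu>) = t (w \<mu>)"
proof -
  have "act G w (t \<mu>) = (\<Sum>\<beta>\<in>\<Phi>. of_int (pair (w \<mu>) (w \<beta>)) * x (w \<beta>))"
    unfolding t_def act_sum[OF w]
    by (rule sum.cong) (simp_all add: act_mult[OF w] act_of_int[OF w] act_x[OF w] root_lattice
        weyl_inner[OF w] flip: weyl_coroot[OF w])
  also have "\<dots> = t (w \<mu>)" unfolding t_def
    by (rule sum.reindex_bij_witness[of _ "winv w" w])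
      (use weyl_roots[OF root_system w] weyl_roots[OF root_system weyl_inv[OF w]] weyl_inv_comp[OF w] in auto)
  finally show ?thesis .
qed

lemma t_reflection:
  assumes "\<mu> \<in> \<Lambda>" "\<alpha> \<in> \<Phi>"
  shows "t \<mu> - act G (reflection \<alpha>) (t \<mu>) = of_int (pair \<mu> \<alpha>) * t \<alpha>"
proof -
  have "t \<mu> - act G (reflection \<alpha>) (t \<mu>) = t (\<mu> - reflection \<alpha> \<mu>)"
    using assms by (simp add: t_act weyl_refl t_diff reflection_lattice)
  then show ?thesis using assms t_scale[OF root_lattice, of \<alpha>] by (simp add: reflection_pair)
qed

text \<open>Dividing \<open>t \<alpha> - act G (reflection \<alpha>) (t \<alpha>)\<close> by
  \<open>x \<alpha>\<close> term by term gives a series \<open>q\<close> whose constant term is the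
  integer \<open>M\<close>, a sum of products of opposite Cartan integers. These products are
  nonnegative, so \<open>M\<close> is positive, hence invertible in \<open>R\<close>, and
  \<open>q\<close> represents a unit.\<close>

lemma t_unit_multiple:
  assumes al: "\<alpha> \<in> \<Phi>"
  shows "\<exists>u\<in>Sset G. \<exists>v\<in>Sset G. u * v = 1 \<and> t \<alpha> = x \<alpha> * u"
proof -
  let ?s = "reflection \<alpha>"
  have sW: "?s \<in> W" using weyl_refl al by blast
  have a0: "\<alpha> \<noteq> 0" using al zero_notin_roots by auto
  have p2: "pair \<alpha> \<alpha> = 2" by (simp add: inner_coroot_self[OF a0])
  obtain half where half: "half \<in> Sset G" "2 * half = 1" using int_unit[of 2] by auto
  define p where "p = (\<lambda>\<beta>. SOME p. p \<in> P \<and> x \<beta> - x (?s \<beta>) = x \<alpha> * E p \<and> p {#} = of_int (pair \<beta> \<alpha>))"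
  have p: "p \<beta> \<in> P" "x \<beta> - x (?s \<beta>) = x \<alpha> * E (p \<beta>)" "p \<beta> {#} = of_int (pair \<beta> \<alpha>)" if "\<beta> \<in> \<Phi>" for \<beta>
    using someI_ex[OF x_reflection_diff[OF root_lattice[OF that] al, unfolded Bex_def]]
    by (simp_all add: p_def)
  define q where "q = (\<lambda>m. \<Sum>\<beta>\<in>\<Phi>. of_int (pair \<alpha> \<beta>) * p \<beta> m)"
  have q: "q \<in> P" unfolding q_def by (intro psc_sum psc_scale p)
  define M where "M = (\<Sum>\<beta>\<in>\<Phi>. pair \<alpha> \<beta> * pair \<beta> \<alpha>)"
  have qM: "q {#} = of_int M" unfolding q_def M_def of_int_sum by (rule sum.cong) (auto simp: p)
  have nonneg: "pair \<alpha> \<beta> * pair \<beta> \<alpha> \<ge> 0" if "\<beta> \<in> \<Phi>" for \<beta>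
  proof -
    have "real_of_int (pair \<alpha> \<beta> * pair \<beta> \<alpha>) = inner \<alpha> (coroot \<beta>) * inner \<beta> (coroot \<alpha>)"
      by (simp only: of_int_mult of_int_pair[OF root_lattice[OF al] that] of_int_pair[OF root_lattice[OF that] al])
    also have "\<dots> = 4 * (inner \<alpha> \<beta>)\<^sup>2 / (inner \<alpha> \<alpha> * inner \<beta> \<beta>)"
      by (simp add: coroot_def inner_commute power2_eq_square)
    also have "\<dots> \<ge> 0" by simp
    finally show ?thesis by linarith
  qed
  \<comment> \<open>The summand of \<alpha> itself is 4.\<close>
  have "pair \<alpha> \<alpha> * pair \<alpha> \<alpha> \<le> M" unfolding M_def
    by (rule member_le_sum) (use al nonneg finite_roots in auto)
  then have "M \<noteq> 0" by (simp add: p2)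
  then obtain r where "of_int M * r = (1::'r)" using ex_int_inverse by blast
  then obtain b where b: "b \<in> Sset G" "E q * b = 1" using E_unit[OF q] qM by auto
  have "E q = (\<Sum>\<beta>\<in>\<Phi>. of_int (pair \<alpha> \<beta>) * E (p \<beta>))" unfolding q_def
    by (subst E_sum) (auto intro!: psc_scale p sum.cong simp: E_scale p(1) C_of_int)
  then have "x \<alpha> * E q = (\<Sum>\<beta>\<in>\<Phi>. of_int (pair \<alpha> \<beta>) * (x \<beta> - x (?s \<beta>)))"
    by (simp add: sum_distrib_left p mult.left_commute)
  also have "\<dots> = t \<alpha> - act G ?s (t \<alpha>)"
    unfolding t_def act_sum[OF sW]
    by (simp add: act_mult[OF sW] act_of_int[OF sW] act_x[OF sW] root_lattice right_diff_distrib sum_subtractf)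
  also have "\<dots> = 2 * t \<alpha>" using t_reflection[OF root_lattice[OF al] al] p2 by simp
  finally have "half * (2 * t \<alpha>) = x \<alpha> * (half * E q)" by (simp add: mult_ac)
  then have "t \<alpha> = x \<alpha> * (half * E q)" using half by (metis mult.assoc mult.commute mult.right_neutral)
  moreover have "(half * E q) * (2 * b) = 1"
    using half b by (metis (no_types, lifting) mult.assoc mult.commute mult.right_neutral)
  moreover have "2 * b \<in> Sset G" unfolding mult_2 by (rule Sset_add[OF b(1) b(1)])
  moreover have "half * E q \<in> Sset G" by (rule Sset_mult[OF half(1) SsetI[OF q]])
  ultimately show ?thesis by (intro bexI[of _ "half * E q"] bexI[of _ "2 * b"] conjI)
qed

lemma t_unit: "\<alpha> \<in> \<Phi> \<Longrightarrow> t \<alpha> dvd 1"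
  using t_unit_multiple[of \<alpha>] x_unit[of \<alpha>] by (metis dvd_triv_left unit_mult)

end

section \<open>Finitely supported functions and the functionals on them\<close>

lemma poly_mapping_expand: "z = (\<Sum>u\<in>Poly_Mapping.keys z. Poly_Mapping.single u (Poly_Mapping.lookup z u))"
proof (rule poly_mapping_eqI)
  fix k
  have "(\<Sum>u\<in>Poly_Mapping.keys z. Poly_Mapping.lookup (Poly_Mapping.single u (Poly_Mapping.lookup z u)) k)
    = (\<Sum>u\<in>Poly_Mapping.keys z. if u = k then Poly_Mapping.lookup z k else 0)"
    by (rule sum.cong) (auto simp: lookup_single when_def)
  then show "Poly_Mapping.lookup z k = Poly_Mapping.lookup (\<Sum>u\<in>Poly_Mapping.keys z. Poly_Mapping.single u (Poly_Mapping.lookup z u)) k"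
    by (simp add: lookup_sum in_keys_iff)
qed

lemma keys_induct [consumes 1, case_names zero single add]:
  fixes z :: "'u \<Rightarrow>\<^sub>0 'b::comm_monoid_add"
  assumes z: "Poly_Mapping.keys z \<subseteq> K"
    and P0: "P 0" and Ps: "\<And>u a. u \<in> K \<Longrightarrow> P (Poly_Mapping.single u a)"
    and Pa: "\<And>y z. Poly_Mapping.keys y \<subseteq> K \<Longrightarrow> Poly_Mapping.keys z \<subseteq> K \<Longrightarrow> P y \<Longrightarrow> P z \<Longrightarrow> P (y + z)"
  shows "P z"
proof -
  let ?S = "\<lambda>B. \<Sum>u\<in>B. Poly_Mapping.single u (Poly_Mapping.lookup z u)"
  have "P (?S B) \<and> Poly_Mapping.keys (?S B) \<subseteq> K" if B: "finite B" "B \<subseteq> K" for B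
    using B
  proof (induction B rule: finite_induct)
    case empty show ?case using P0 by simp
  next
    case (insert u B)
    have k: "Poly_Mapping.keys (Poly_Mapping.single u (Poly_Mapping.lookup z u)) \<subseteq> K" using insert.prems by simp
    have IH: "P (?S B)" "Poly_Mapping.keys (?S B) \<subseteq> K" using insert by auto
    have eq: "?S (insert u B) = Poly_Mapping.single u (Poly_Mapping.lookup z u) + ?S B" using insert.hyps by simp
    have "P (Poly_Mapping.single u (Poly_Mapping.lookup z u) + ?S B)"
      by (rule Pa[OF k IH(2) Ps IH(1)]) (use insert.prems in simp)
    moreover have "Poly_Mapping.keys (Poly_Mapping.single u (Poly_Mapping.lookup z u) + ?S B) \<subseteq> K"
      by (rule subset_trans[OF keys_add]) (use k IH(2) in simp)
    ultimately show ?case unfolding eq by blast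
  qed
  then have "P (?S (Poly_Mapping.keys z))" using z by simp
  then show ?thesis by (simp flip: poly_mapping_expand)
qed

lemma keys_sum_subset:
  "(\<And>i. i \<in> A \<Longrightarrow> Poly_Mapping.keys (f i) \<subseteq> K) \<Longrightarrow> Poly_Mapping.keys (sum f A) \<subseteq> K"
proof (induction A rule: infinite_finite_induct)
  case (insert i A)
  then show ?case using keys_add[of "f i" "sum f A"] by auto
qed auto

text \<open>Pairing of a combination of basis elements with a function on the basis:
  \<open>functional\<close> without its restriction to a domain.\<close>

definition ap :: "('u \<Rightarrow>\<^sub>0 'q::comm_ring_1) \<Rightarrow> ('u \<Rightarrow> 'q) \<Rightarrow> 'q" where
  "ap z f = (\<Sum>u\<in>Poly_Mapping.keys z. Poly_Mapping.lookup z u * f u)"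

lemma ap_add: "ap (y + z) f = ap y f + ap z f"
  unfolding ap_def by (rule setsum_keys_plus_distrib) (auto simp: distrib_right)

lemma ap_single: "ap (Poly_Mapping.single u a) f = a * f u"
  by (simp add: ap_def)

lemma ap_zero: "ap 0 f = 0"
  by (simp add: ap_def)

lemma ap_neg: "ap (- z) f = - ap z f"
  using ap_add[of z "- z" f] by (simp add: ap_zero eq_neg_iff_add_eq_0 add.commute)

lemma ap_diff: "ap (y - z) f = ap y f - ap z f"
  using ap_add[of y "- z" f] by (simp add: ap_neg)

lemma ap_sum: "ap (sum g A) f = (\<Sum>i\<in>A. ap (g i) f)"
  by (induction A rule: infinite_finite_induct) (auto simp: ap_add ap_zero)

lemma ap_cong: "(\<And>u. u \<in> Poly_Mapping.keys z \<Longrightarrow> f u = g u) \<Longrightarrow> ap z f = ap z g"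
  unfolding ap_def by (rule sum.cong) auto

lemma ap_fun_add: "ap z (\<lambda>u. f u + g u) = ap z f + ap z g"
  and ap_fun_diff: "ap z (\<lambda>u. f u - g u) = ap z f - ap z g"
  and ap_fun_scale: "ap z (\<lambda>u. a * f u) = a * ap z f"
  by (simp_all add: ap_def algebra_simps sum.distrib sum_subtractf sum_distrib_left)

lemma ap_fun_sum: "ap z (\<lambda>u. \<Sum>i\<in>A. f i u) = (\<Sum>i\<in>A. ap z (f i))"
  unfolding ap_def sum_distrib_left by (rule sum.swap)

section \<open>The twisted group algebra of the affine Weyl group\<close>

context affine_setup
begin

abbreviation "A \<equiv> aff_weyl \<Phi>"
abbreviation "L \<equiv> int_comb (coroot ` \<Phi>)"
abbreviation single where "single \<equiv> Poly_Mapping.single"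
abbreviation keys where "keys \<equiv> Poly_Mapping.keys"
abbreviation lookup where "lookup \<equiv> Poly_Mapping.lookup"
abbreviation "K \<equiv> carrier (QWa G)"
abbreviation tm (infixl "\<star>" 70) where "z \<star> y \<equiv> z \<otimes>\<^bsub>QWa G\<^esub> y"

lemma A_iff: "u \<in> A \<longleftrightarrow> fst u \<in> L \<and> snd u \<in> W"
  by (auto simp: aff_weyl_def mem_Times_iff)

lemma A_W: "u \<in> A \<Longrightarrow> snd u \<in> W" and A_L: "u \<in> A \<Longrightarrow> fst u \<in> L"
  by (auto simp: A_iff)

lemma aff_one_A: "aff_one \<in> A"
  by (simp add: A_iff aff_one_def int_comb_zero weyl_group.id)

lemma aff_mult_A: "u \<in> A \<Longrightarrow> v \<in> A \<Longrightarrow> aff_mult u v \<in> A"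
  by (simp add: A_iff aff_mult_def int_comb_add weyl_comp weyl_int_comb_coroot[OF root_system])

lemma aff_mult_assoc: "u \<in> A \<Longrightarrow> aff_mult (aff_mult u v) w = aff_mult u (aff_mult v w)"
  by (simp add: aff_mult_def comp_assoc linear_add[OF weyl_linear[OF A_W]] add.assoc)

lemma aff_mult_one: "aff_mult aff_one u = u" "u \<in> A \<Longrightarrow> aff_mult u aff_one = u"
  by (auto simp: aff_mult_def aff_one_def linear_0[OF weyl_linear[OF A_W]])

lemma snd_aff: "snd (aff_mult u v) = snd u \<circ> snd v" "snd aff_one = id" "fst aff_one = 0"
  by (auto simp: aff_mult_def aff_one_def)

lemma aff_inv_A: "u \<in> A \<Longrightarrow> aff_inv u \<in> A"
  by (simp add: A_iff aff_inv_def int_comb_neg weyl_inv weyl_int_comb_coroot[OF root_system])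

lemma K_iff: "z \<in> K \<longleftrightarrow> keys z \<subseteq> A"
  by (simp add: QWa_def)

lemma K_zero: "0 \<in> K"
  by (simp add: K_iff)

lemma K_add: "z \<in> K \<Longrightarrow> y \<in> K \<Longrightarrow> z + y \<in> K"
  using keys_add[of z y] by (auto simp: K_iff)

lemma K_neg: "z \<in> K \<Longrightarrow> - z \<in> K"
  by (simp add: K_iff subset_iff in_keys_iff)

lemma K_diff: "z \<in> K \<Longrightarrow> y \<in> K \<Longrightarrow> z - y \<in> K"
  using K_add[OF _ K_neg, of z y] by simp

lemma K_single: "u \<in> A \<Longrightarrow> single u a \<in> K"
  by (simp add: K_iff)

lemma K_eta: "u \<in> A \<Longrightarrow> eta u \<in> K" and K_cst: "cst a \<in> K"
  by (simp_all add: eta_def cst_def K_single aff_one_A)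

lemma K_sum: "(\<And>i. i \<in> B \<Longrightarrow> f i \<in> K) \<Longrightarrow> sum f B \<in> K"
  by (induction B rule: infinite_finite_induct) (auto simp: K_zero K_add)

lemma K_induct [consumes 1, case_names zero single add]:
  assumes "z \<in> K" "Pr 0" "\<And>u a. u \<in> A \<Longrightarrow> Pr (single u a)"
    "\<And>y z. y \<in> K \<Longrightarrow> z \<in> K \<Longrightarrow> Pr y \<Longrightarrow> Pr z \<Longrightarrow> Pr (y + z)"
  shows "Pr z"
  using assms(1) unfolding K_iff
  by (induction rule: keys_induct) (use assms(2-4) in \<open>auto simp: K_iff\<close>)

lemma tm_def: "z \<star> y = (\<Sum>u\<in>keys z. \<Sum>v\<in>keys y. single (aff_mult u v) (lookup z u * act G (snd u) (lookup y v)))"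
  by (simp add: QWa_def)

lemma tm_single: "u \<in> A \<Longrightarrow> single u a \<star> single v b = single (aff_mult u v) (a * act G (snd u) b)"
  by (auto simp: tm_def act_zero A_W)

lemma tm_zero: "0 \<star> y = 0" "z \<star> 0 = 0"
  by (simp_all add: tm_def)

lemma tm_add_left: "(z + z') \<star> y = z \<star> y + z' \<star> y"
  unfolding tm_def
  by (rule setsum_keys_plus_distrib) (auto simp: distrib_right single_add sum.distrib)

lemma tm_add_right:
  assumes "z \<in> K" shows "z \<star> (y + y') = z \<star> y + z \<star> y'"
proof -
  have "(\<Sum>v\<in>keys (y + y'). single (aff_mult u v) (lookup z u * act G (snd u) (lookup (y + y') v)))
    = (\<Sum>v\<in>keys y. single (aff_mult u v) (lookup z u * act G (snd u) (lookup y v)))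
    + (\<Sum>v\<in>keys y'. single (aff_mult u v) (lookup z u * act G (snd u) (lookup y' v)))" if "u \<in> keys z" for u
  proof -
    have "snd u \<in> W" using that assms K_iff A_W by blast
    then show ?thesis
      by (intro setsum_keys_plus_distrib) (auto simp: act_zero act_add distrib_left single_add)
  qed
  then show ?thesis by (simp add: tm_def sum.distrib)
qed

lemma tm_neg_left: "(- z) \<star> y = - (z \<star> y)"
  using tm_add_left[of z "- z" y] by (simp add: tm_zero eq_neg_iff_add_eq_0 add.commute)

lemma tm_neg_right: "z \<in> K \<Longrightarrow> z \<star> (- y) = - (z \<star> y)"
  using tm_add_right[of z y "- y"] by (simp add: tm_zero eq_neg_iff_add_eq_0 add.commute)

lemma tm_diff_left: "(z - z') \<star> y = z \<star> y - z' \<star> y"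
  using tm_add_left[of z "- z'" y] by (simp add: tm_neg_left)

lemma tm_diff_right: "z \<in> K \<Longrightarrow> z \<star> (y - y') = z \<star> y - z \<star> y'"
  using tm_add_right[of z y "- y'"] by (simp add: tm_neg_right)

lemma tm_sum_left: "sum f B \<star> y = (\<Sum>i\<in>B. f i \<star> y)"
  by (induction B rule: infinite_finite_induct) (auto simp: tm_zero tm_add_left)

lemma tm_sum_right: "z \<in> K \<Longrightarrow> z \<star> sum f B = (\<Sum>i\<in>B. z \<star> f i)"
  by (induction B rule: infinite_finite_induct) (auto simp: tm_zero tm_add_right)

lemma K_tm: "z \<in> K \<Longrightarrow> y \<in> K \<Longrightarrow> z \<star> y \<in> K"
  unfolding tm_def
  by (intro K_sum K_single aff_mult_A) (auto simp: K_iff)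

lemma tm_assoc:
  assumes "z \<in> K" "y \<in> K" "y' \<in> K"
  shows "(z \<star> y) \<star> y' = z \<star> (y \<star> y')"
  using assms(1)
proof (induction rule: K_induct)
  case (single u a)
  show ?case using assms(2)
  proof (induction rule: K_induct)
    case (single v b)
    show ?case using assms(3)
    proof (induction rule: K_induct)
      case (single w c)
      show ?case
        using \<open>u \<in> A\<close> \<open>v \<in> A\<close>
        by (simp add: tm_single aff_mult_A aff_mult_assoc act_mult A_W act_comp snd_aff mult.assoc)
    qed (use \<open>u \<in> A\<close> \<open>v \<in> A\<close> in \<open>simp_all add: tm_zero tm_add_right K_single K_tm\<close>)
  qed (use \<open>u \<in> A\<close> in \<open>simp_all add: tm_zero tm_add_left tm_add_right K_single\<close>)
qed (simp_all add: tm_zero tm_add_left)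

lemma cst_tm_single: "cst a \<star> single u b = single u (a * b)"
  by (simp add: cst_def tm_single aff_one_A aff_mult_one snd_aff act_id)

lemma single_tm_cst: "u \<in> A \<Longrightarrow> single u b \<star> cst a = single u (b * act G (snd u) a)"
  by (simp add: cst_def tm_single aff_mult_one)

lemma one_tm: "z \<in> K \<Longrightarrow> cst 1 \<star> z = z"
  by (induction rule: K_induct) (auto simp: tm_zero cst_tm_single tm_add_right K_cst)

lemma tm_one: "z \<in> K \<Longrightarrow> z \<star> cst 1 = z"
  by (induction rule: K_induct) (auto simp: tm_zero single_tm_cst tm_add_left act_one A_W)

lemma cst_add: "cst (a + b) = cst a + (cst b :: ('v, 'q) tga)"
  by (simp add: cst_def single_add)

lemma cst_mult: "cst a \<star> cst b = cst (a * b)"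
  using cst_tm_single[of a aff_one b] by (simp add: cst_def)

lemma cst_cst_tm: "z \<in> K \<Longrightarrow> cst a \<star> (cst b \<star> z) = cst (a * b) \<star> z"
  by (simp add: cst_mult K_cst flip: tm_assoc)

lemma cst_zero_tm: "cst 0 \<star> z = 0"
  by (simp add: cst_def tm_zero)

lemma eta_mult: "u \<in> A \<Longrightarrow> eta u \<star> eta v = eta (aff_mult u v)"
  by (simp add: eta_def tm_single act_one A_W)

lemma eta_tm_cst: "u \<in> A \<Longrightarrow> eta u \<star> cst a = cst (act G (snd u) a) \<star> eta u"
  unfolding eta_def cst_tm_single by (simp add: single_tm_cst)

lemma ap_cst_tm: "z \<in> K \<Longrightarrow> ap (cst a \<star> z) f = a * ap z f"
  by (induction rule: K_induct)
    (auto simp: tm_zero ap_zero cst_tm_single ap_single tm_add_right K_cst ap_add distrib_left mult.assoc)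

text \<open>Moving the scalar to the left of a basis element applies the finite part to it, so right
  multiplication of arguments is dual to the action \<open>bullet\<close> on functions.\<close>

lemma ap_tm_cst: "z \<in> K \<Longrightarrow> ap (z \<star> cst a) f = ap z (\<lambda>u. act G (snd u) a * f u)"
  by (induction rule: K_induct)
    (auto simp: tm_zero ap_zero single_tm_cst ap_single tm_add_left ap_add mult.assoc)

lemma single_eta: "single u a = cst a \<star> eta u"
  by (simp add: eta_def cst_tm_single)

lemma QWa_simps: "\<one>\<^bsub>QWa G\<^esub> = cst 1" "\<zero>\<^bsub>QWa G\<^esub> = 0" "z \<oplus>\<^bsub>QWa G\<^esub> y = z + y"
  by (simp_all add: QWa_def)

lemma ring_QWa: "ring (QWa G)"
proof (rule ringI)
  show "abelian_group (QWa G)"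
  proof (rule abelian_groupI)
    fix z assume "z \<in> K"
    then show "\<exists>y\<in>K. y \<oplus>\<^bsub>QWa G\<^esub> z = \<zero>\<^bsub>QWa G\<^esub>"
      by (intro bexI[of _ "- z"]) (auto simp: QWa_simps K_neg)
  qed (auto simp: QWa_simps K_add K_zero add.assoc add.commute)
  show "monoid (QWa G)"
    by (rule monoidI) (auto simp: QWa_simps K_tm K_cst tm_assoc one_tm tm_one)
qed (auto simp: QWa_simps tm_add_left tm_add_right)

lemma QWa_a_inv: "z \<in> K \<Longrightarrow> \<ominus>\<^bsub>QWa G\<^esub> z = - z"
  by (rule abelian_group.minus_equality[OF ring.is_abelian_group[OF ring_QWa]]) (auto simp: QWa_simps K_neg)

subsection \<open>The algebra generated by the Demazure elements\<close>

abbreviation "D \<equiv> DWa G"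
abbreviation xi where "xi \<beta> \<equiv> unit_inv (x \<beta>)"

text \<open>The root and the group element of each Demazure generator, so that all generators are
  treated alike. For the affine one the root is the negative of \<theta>, with the same
  reflection.\<close>

definition gens :: "('v \<times> 'v aff) set" where
  "gens = (\<lambda>\<alpha>. (\<alpha>, (0, reflection \<alpha>))) ` simples G \<union>
     {(- theta G, (coroot (theta G), reflection (theta G)))}"

lemma gensD:
  assumes "(\<beta>, s) \<in> gens"
  shows gens_root: "\<beta> \<in> \<Phi>" and gens_A: "s \<in> A" and gens_snd: "snd s = reflection \<beta>" and "aff_mult s s = aff_one"
proof -
  have th: "coroot (theta G) \<in> L" using theta_root finite_roots by (intro int_comb_incl) auto
  have t0: "theta G \<noteq> 0" using theta_root zero_notin_roots by auto
  have "reflection (theta G) (coroot (theta G)) = - coroot (theta G)"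
    using reflection_self[OF t0] by (simp add: coroot_def reflection_scaleR)
  then show "\<beta> \<in> \<Phi>" "s \<in> A" "snd s = reflection \<beta>" "aff_mult s s = aff_one"
    using assms simple_sub theta_root roots_neg th
    by (auto simp: gens_def A_iff weyl_refl int_comb_zero reflection_minus aff_mult_def aff_one_def
        reflection_comp_self linear_0[OF reflection_linear])
qed

lemma x_xi: "\<beta> \<in> \<Phi> \<Longrightarrow> x \<beta> * xi \<beta> = 1"
  using unit_inv x_unit by blast

lemma demazure_eq: "demazure G \<beta> s = single aff_one (xi \<beta>) - single s (xi \<beta>)"
  by (simp add: demazure_def tm_diff_right K_cst cst_mult eta_def cst_tm_single) (simp add: cst_def)

lemma K_demazure: "s \<in> A \<Longrightarrow> demazure G \<beta> s \<in> K"
  by (simp add: demazure_eq K_diff K_single aff_one_A)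

lemma demazure_tm:
  assumes "s \<in> A" "z \<in> K"
  shows "demazure G \<beta> s \<star> z = cst (xi \<beta>) \<star> (z - eta s \<star> z)"
proof -
  have "demazure G \<beta> s \<star> z = cst (xi \<beta>) \<star> ((cst 1 - eta s) \<star> z)"
    unfolding demazure_def by (rule tm_assoc) (use assms in \<open>simp_all add: K_cst K_diff K_eta\<close>)
  then show ?thesis by (simp add: tm_diff_left one_tm assms)
qed

lemma DWa_gens: "D = generate_ring (QWa G) (cst ` Sset G \<union> (\<lambda>(\<beta>, s). demazure G \<beta> s) ` gens)"
  unfolding DWa_def gens_def by (rule arg_cong[of _ _ "generate_ring (QWa G)"]) auto

lemma gens_K: "cst ` Sset G \<union> (\<lambda>(\<beta>, s). demazure G \<beta> s) ` gens \<subseteq> K"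
  using gens_A by (auto simp: K_cst K_demazure)

lemma D_K: "z \<in> D \<Longrightarrow> z \<in> K"
  unfolding DWa_gens using ring.generate_ring_in_carrier[OF ring_QWa gens_K] by blast

lemma D_one: "cst 1 \<in> D"
  using generate_ring.one[of "QWa G"] by (simp add: DWa_gens QWa_simps)

lemma D_cst: "a \<in> Sset G \<Longrightarrow> cst a \<in> D"
  unfolding DWa_gens by (rule generate_ring.incl) auto

lemma D_demazure: "(\<beta>, s) \<in> gens \<Longrightarrow> demazure G \<beta> s \<in> D"
  unfolding DWa_gens by (rule generate_ring.incl) force

lemma D_add: "z \<in> D \<Longrightarrow> y \<in> D \<Longrightarrow> z + y \<in> D"
  using generate_ring.eng_add[of z "QWa G" _ y] by (simp add: DWa_gens QWa_simps)

lemma D_tm: "z \<in> D \<Longrightarrow> y \<in> D \<Longrightarrow> z \<star> y \<in> D"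
  unfolding DWa_gens by (rule generate_ring.eng_mult)

lemma D_neg: "z \<in> D \<Longrightarrow> - z \<in> D"
  using generate_ring.a_inv[of z "QWa G"] QWa_a_inv[OF D_K] by (simp add: DWa_gens)

lemma D_diff: "z \<in> D \<Longrightarrow> y \<in> D \<Longrightarrow> z - y \<in> D"
  using D_add[OF _ D_neg, of z y] by simp

lemma D_zero: "0 \<in> D"
  using D_diff[OF D_one D_one] by simp

lemma D_sum: "(\<And>i. i \<in> B \<Longrightarrow> f i \<in> D) \<Longrightarrow> sum f B \<in> D"
  by (induction B rule: infinite_finite_induct) (auto simp: D_zero D_add)

text \<open>It suffices to control left multiplication by scalars and generators. The statement
  proved along the generation of the ring is that left multiplication by \<open>z\<close> preserves
  \<open>Pr\<close>; it is finally applied to 1.\<close>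

lemma D_induct [consumes 1, case_names one neg add cst demazure]:
  assumes z: "z \<in> D"
    and P1: "Pr (cst 1)" and Pn: "\<And>y. y \<in> D \<Longrightarrow> Pr y \<Longrightarrow> Pr (- y)"
    and Pa: "\<And>y z. y \<in> D \<Longrightarrow> z \<in> D \<Longrightarrow> Pr y \<Longrightarrow> Pr z \<Longrightarrow> Pr (y + z)"
    and Pc: "\<And>a y. a \<in> Sset G \<Longrightarrow> y \<in> D \<Longrightarrow> Pr y \<Longrightarrow> Pr (cst a \<star> y)"
    and Pd: "\<And>\<beta> s y. (\<beta>, s) \<in> gens \<Longrightarrow> y \<in> D \<Longrightarrow> Pr y \<Longrightarrow> Pr (demazure G \<beta> s \<star> y)"
  shows "Pr z"
proof -
  have "z \<in> D \<and> (\<forall>y\<in>D. Pr y \<longrightarrow> Pr (z \<star> y))"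
    using z[unfolded DWa_gens]
  proof (induction rule: generate_ring.induct)
    case one
    have "Pr (cst 1 \<star> y)" if "y \<in> D" "Pr y" for y using that by (simp only: one_tm[OF D_K])
    then show ?case unfolding QWa_simps using D_one by blast
  next
    case (incl h)
    then consider a where "a \<in> Sset G" "h = cst a" | \<beta> s where "(\<beta>, s) \<in> gens" "h = demazure G \<beta> s" by auto
    then show ?case
    proof cases
      case 1
      then show ?thesis using D_cst Pc by blast
    next
      case 2
      then show ?thesis using D_demazure Pd by blast
    qed
  next
    case (a_inv h)
    have h: "h \<in> D" "\<And>y. y \<in> D \<Longrightarrow> Pr y \<Longrightarrow> Pr (h \<star> y)" using a_inv by blast+
    have "Pr (- h \<star> y)" if "y \<in> D" "Pr y" for y
      unfolding tm_neg_left by (rule Pn[OF D_tm[OF h(1) that(1)] h(2)[OF that]])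
    then show ?case unfolding QWa_a_inv[OF D_K[OF h(1)]] using D_neg[OF h(1)] by blast
  next
    case (eng_add h1 h2)
    have h: "h1 \<in> D" "\<And>y. y \<in> D \<Longrightarrow> Pr y \<Longrightarrow> Pr (h1 \<star> y)" "h2 \<in> D" "\<And>y. y \<in> D \<Longrightarrow> Pr y \<Longrightarrow> Pr (h2 \<star> y)"
      using eng_add by blast+
    have "Pr ((h1 + h2) \<star> y)" if "y \<in> D" "Pr y" for y
      unfolding tm_add_left
      by (rule Pa[OF D_tm[OF h(1) that(1)] D_tm[OF h(3) that(1)] h(2)[OF that] h(4)[OF that]])
    then show ?case unfolding QWa_simps using D_add[OF h(1,3)] by blast
  next
    case (eng_mult h1 h2)
    have h: "h1 \<in> D" "\<And>y. y \<in> D \<Longrightarrow> Pr y \<Longrightarrow> Pr (h1 \<star> y)" "h2 \<in> D" "\<And>y. y \<in> D \<Longrightarrow> Pr y \<Longrightarrow> Pr (h2 \<star> y)"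
      using eng_mult by blast+
    have "Pr (h1 \<star> h2 \<star> y)" if "y \<in> D" "Pr y" for y
      unfolding tm_assoc[OF D_K[OF h(1)] D_K[OF h(3)] D_K[OF that(1)]]
      by (rule h(2)[OF D_tm[OF h(3) that(1)] h(4)[OF that]])
    then show ?case using D_tm[OF h(1,3)] by blast
  qed
  then have "Pr (z \<star> cst 1)" using P1 D_one by blast
  then show ?thesis by (simp only: tm_one[OF D_K[OF z]])
qed

text \<open>Multiplying the Demazure element by \<open>x \<beta>\<close> clears its denominator and
  leaves \<open>cst 1 - eta s\<close>.\<close>

lemma D_eta_gens:
  assumes "(\<beta>, s) \<in> gens" shows "eta s \<in> D"
proof -
  have "cst (x \<beta>) \<star> demazure G \<beta> s = cst 1 - eta s"
    unfolding demazure_def using gensD(1,2)[OF assms]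
    by (simp add: cst_cst_tm K_diff K_cst K_eta x_xi one_tm)
  moreover have "cst (x \<beta>) \<star> demazure G \<beta> s \<in> D"
    by (intro D_tm D_cst D_demazure assms x_Sset root_lattice gensD(1)[OF assms])
  ultimately have "cst 1 - (cst 1 - eta s) \<in> D" using D_diff[OF D_one] by metis
  then show ?thesis by simp
qed

lemma W_A: "w \<in> W \<Longrightarrow> (0, w) \<in> A"
  by (simp add: A_iff int_comb_zero)

lemma L_A: "\<mu> \<in> L \<Longrightarrow> (\<mu>, id) \<in> A"
  by (simp add: A_iff weyl_group.id)

lemma D_eta_W:
  assumes "w \<in> W" shows "eta (0, w) \<in> D"
proof -
  obtain M where M: "set M \<subseteq> simples G" "w = refl_word M" using weyl_word[OF assms] by blast
  have "eta (0, refl_word M) \<in> D" using M(1)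
  proof (induction M)
    case Nil
    then show ?case using D_one by (simp add: cst_def eta_def aff_one_def id_def)
  next
    case (Cons a M)
    have "eta (0, reflection a) \<star> eta (0, refl_word M) \<in> D"
      by (rule D_tm[OF D_eta_gens[of a]]) (use Cons in \<open>auto simp: gens_def\<close>)
    moreover have "(0, reflection a) \<in> A" using Cons simple_sub by (intro W_A weyl_refl) auto
    ultimately show ?case by (simp add: eta_mult aff_mult_def linear_0[OF reflection_linear] comp_def)
  qed
  then show ?thesis using M by simp
qed

text \<open>The translation by the coroot of \<theta> is the affine generator times the finite
  reflection in \<theta>, and the product in the other order is its inverse. Conjugation by
  \<open>W\<close> yields the whole orbit, which generates the lattice.\<close>

lemma D_eta_L:
  assumes "\<mu> \<in> L" shows "eta (\<mu>, id) \<in> D"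
proof -
  let ?th = "coroot (theta G)" and ?s = "reflection (theta G)"
  have g: "(- theta G, (?th, ?s)) \<in> gens" by (simp add: gens_def)
  have sW: "?s \<in> W" by (rule weyl_refl[OF theta_root])
  have t0: "theta G \<noteq> 0" using theta_root zero_notin_roots by auto
  have sth: "?s ?th = - ?th" using reflection_self[OF t0] by (simp add: coroot_def reflection_scaleR)
  note s0 = D_eta_gens[OF g] and s = D_eta_W[OF sW]
  have "eta (?th, ?s) \<star> eta (0, ?s) = eta (?th, id)"
    using gensD(2)[OF g] by (simp add: eta_mult aff_mult_def reflection_comp_self linear_0[OF reflection_linear])
  then have pos: "eta (?th, id) \<in> D" using D_tm[OF s0 s] by simp
  have "eta (0, ?s) \<star> eta (?th, ?s) = eta (- ?th, id)"
    by (simp add: eta_mult W_A sW aff_mult_def reflection_comp_self sth)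
  then have neg: "eta (- ?th, id) \<in> D" using D_tm[OF s s0] by simp
  have thL: "?th \<in> L" using theta_root finite_roots by (intro int_comb_incl) auto
  have conj: "eta (w \<nu>, id) \<in> D" if w: "w \<in> W" and n: "\<nu> \<in> L" "eta (\<nu>, id) \<in> D" for w \<nu>
  proof -
    have "w \<circ> winv w = id" using weyl_inv_comp[OF w] by (simp add: fun_eq_iff)
    moreover have "eta (0, w) \<star> eta (\<nu>, id) = eta (w \<nu>, w)"
      using eta_mult[OF W_A[OF w]] by (simp add: aff_mult_def)
    moreover have "(w \<nu>, w) \<in> A" using w n by (simp add: A_iff weyl_int_comb_coroot[OF root_system])
    ultimately have "eta (0, w) \<star> eta (\<nu>, id) \<star> eta (0, winv w) = eta (w \<nu>, id)"
      by (simp add: eta_mult aff_mult_def linear_0[OF weyl_linear[OF w]])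
    moreover have "eta (0, w) \<star> eta (\<nu>, id) \<star> eta (0, winv w) \<in> D"
      by (intro D_tm D_eta_W w n weyl_inv)
    ultimately show ?thesis by simp
  qed
  \<comment> \<open>The inverse translation is carried along because passing to the negative
    exchanges the two.\<close>
  have "\<mu> \<in> L \<and> eta (\<mu>, id) \<in> D \<and> eta (- \<mu>, id) \<in> D" using assms
  proof (induction rule: int_comb_coroot_induct)
    case zero
    then show ?case using D_one by (simp add: cst_def eta_def aff_one_def int_comb_zero id_def)
  next
    case (add \<mu> \<nu>)
    then have "eta (\<mu>, id) \<star> eta (\<nu>, id) \<in> D" "eta (- \<mu>, id) \<star> eta (- \<nu>, id) \<in> D" "\<mu> \<in> L" "\<nu> \<in> L"
      using D_tm by blast+
    then have "\<mu> + \<nu> \<in> L" "eta (\<mu> + \<nu>, id) \<in> D" "eta (- (\<mu> + \<nu>), id) \<in> D"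
      by (simp_all add: eta_mult L_A int_comb_neg int_comb_add aff_mult_def)
    then show ?case by (simp add: id_def)
  next
    case (neg \<mu>)
    then show ?case by (simp add: int_comb_neg)
  next
    case (orbit w)
    have "w (- ?th) = - w ?th" by (rule linear_neg[OF weyl_linear[OF orbit]])
    then show ?case using conj[OF orbit thL pos] conj[OF orbit int_comb_neg[OF thL] neg]
        weyl_int_comb_coroot[OF root_system orbit thL] by (simp add: id_def)
  qed
  then show ?thesis by blast
qed

lemma D_eta: "u \<in> A \<Longrightarrow> eta u \<in> D"
proof -
  assume u: "u \<in> A"
  have "eta (fst u, id) \<star> eta (0, snd u) = eta u"
    using u by (simp add: eta_mult L_A A_L aff_mult_def)
  then show ?thesis using D_tm[OF D_eta_L[OF A_L[OF u]] D_eta_W[OF A_W[OF u]]] by simp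
qed

lemma common_denominator:
  "\<exists>m. m dvd 1 \<and> m \<in> Sset G \<and> (\<forall>u. m * lookup z u \<in> Sset G)"
proof -
  have "\<exists>m. m dvd 1 \<and> m \<in> Sset G \<and> (\<forall>u\<in>B. m * lookup z u \<in> Sset G)" if "finite B" for B
    using that
  proof (induction B rule: finite_induct)
    case empty
    show ?case using Sset_one by (intro exI[of _ 1]) auto
  next
    case (insert v B)
    then obtain m where m: "m dvd 1" "m \<in> Sset G" "\<forall>u\<in>B. m * lookup z u \<in> Sset G" by blast
    obtain M a where M: "set M \<subseteq> \<Phi>" "a \<in> Sset G" "lookup z v * prod_list (map x M) = a"
      using denominators by blast
    let ?p = "prod_list (map x M)"
    have "(m * ?p) * lookup z u \<in> Sset G" if u: "u \<in> insert v B" for u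
    proof (cases "u = v")
      case True
      have "(m * ?p) * lookup z v = m * a" using M by (simp add: mult_ac)
      then show ?thesis using True m M Sset_mult by simp
    next
      case False
      have e: "(m * ?p) * lookup z u = ?p * (m * lookup z u)" by (simp add: mult_ac)
      have "?p * (m * lookup z u) \<in> Sset G"
        by (rule Sset_mult[OF prod_x_Sset[OF M(1)]]) (use False u m in auto)
      then show ?thesis by (simp only: e)
    qed
    moreover have "m * ?p dvd 1" by (intro unit_mult m prod_x_unit M)
    moreover have "m * ?p \<in> Sset G" by (intro Sset_mult m prod_x_Sset M)
    ultimately show ?case by blast
  qed
  from this[of "keys z"] obtain m where m: "m dvd 1" "m \<in> Sset G" "\<forall>u\<in>keys z. m * lookup z u \<in> Sset G" by auto
  then have "m * lookup z u \<in> Sset G" for u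
    by (cases "u \<in> keys z") (auto simp: in_keys_iff Sset_zero)
  then show ?thesis using m by blast
qed


lemma card_W: "card W > 0"
  using finite_weyl_group[OF root_system] weyl_group.id by (auto simp: card_gt_0_iff)

subsection \<open>Polynomials in the additive coordinates\<close>

text \<open>Integral polynomials of degree strictly below \<open>k\<close> in the
  \<open>t \<mu>\<close>. With this convention \<open>T 0\<close> is zero, so lowering the degree
  \<open>k\<close> times kills \<open>T k\<close>. It is a filtration and presupposes no algebraic
  independence.\<close>

inductive_set T :: "nat \<Rightarrow> 'q set" for k where
  zero: "0 \<in> T k"
| add: "a \<in> T k \<Longrightarrow> b \<in> T k \<Longrightarrow> a + b \<in> T k"
| neg: "a \<in> T k \<Longrightarrow> - a \<in> T k"
| prod: "set M \<subseteq> \<Lambda> \<Longrightarrow> length M < k \<Longrightarrow> prod_list (map t M) \<in> T k"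

lemma T_0: "g \<in> T 0 \<Longrightarrow> g = 0"
  by (induction rule: T.induct) auto

lemma T_Suc: "g \<in> T k \<Longrightarrow> g \<in> T (Suc k)"
  by (induction rule: T.induct) (auto intro: T.intros)

lemma T_mono: "g \<in> T k \<Longrightarrow> k \<le> l \<Longrightarrow> g \<in> T l"
  by (induction l rule: nat_induct) (auto simp: le_Suc_eq intro: T_Suc)

lemma T_t:
  assumes "g \<in> T k" "\<mu> \<in> \<Lambda>" shows "t \<mu> * g \<in> T (Suc k)"
  using assms(1)
proof (induction rule: T.induct)
  case (prod M)
  then show ?case using T.prod[of "\<mu> # M" "Suc k"] assms(2) by simp
qed (auto simp: distrib_left intro: T.intros)

lemma T_of_int: "g \<in> T k \<Longrightarrow> of_int n * g \<in> T k"
proof (induction n rule: int_induct[where k = 0])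
  case (step2 i)
  have "of_int i * g + - g \<in> T k" by (intro T.add T.neg) (use step2 in auto)
  then show ?case by (simp add: left_diff_distrib)
qed (auto simp: distrib_right intro: T.intros)

text \<open>Twisted Leibniz rule again. In contrast to \<open>x\<close>, the quotient for a single
  factor \<open>t \<mu>\<close> is an integer, so the degree really drops.\<close>

lemma T_divided_difference:
  assumes al: "\<alpha> \<in> \<Phi>" and g: "g \<in> T (Suc k)"
  shows "\<exists>h\<in>T k. g - act G (reflection \<alpha>) g = t \<alpha> * h"
  using g
proof (induction rule: T.induct)
  let ?s = "reflection \<alpha>"
  have sW: "?s \<in> W" by (rule weyl_refl[OF al])
  {
    case zero
    then show ?case by (intro bexI[of _ 0]) (auto simp: act_zero[OF sW] intro: T.zero)
  next
    case (add a b)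
    then obtain h h' where "h \<in> T k" "a - act G ?s a = t \<alpha> * h" "h' \<in> T k" "b - act G ?s b = t \<alpha> * h'" by blast
    moreover have "(a + b) - act G ?s (a + b) = (a - act G ?s a) + (b - act G ?s b)" by (simp add: act_add[OF sW])
    ultimately show ?case by (intro bexI[of _ "h + h'"]) (auto simp: distrib_left intro: T.add)
  next
    case (neg a)
    then obtain h where "h \<in> T k" "a - act G ?s a = t \<alpha> * h" by blast
    then show ?case by (intro bexI[of _ "- h"]) (auto simp: act_neg[OF sW] algebra_simps intro: T.neg)
  next
    case (prod M)
    then show ?case
    proof (induction M arbitrary: k)
      case Nil
      show ?case by (rule bexI[of _ 0]) (auto simp: act_one[OF sW] intro: T.zero)
    next
      case (Cons \<mu> M)
      then obtain l where l: "k = Suc l" "length M < Suc l" by (cases k) auto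
      let ?g = "prod_list (map t M)"
      obtain h where h: "h \<in> T l" "?g - act G ?s ?g = t \<alpha> * h" using Cons.IH[of l] Cons.prems l by auto
      have mu: "\<mu> \<in> \<Lambda>" using Cons.prems by simp
      have smu: "act G ?s (t \<mu>) = t (?s \<mu>)" by (rule t_act[OF sW mu])
      have "t \<mu> * ?g - act G ?s (t \<mu> * ?g) = (t \<mu> - act G ?s (t \<mu>)) * ?g + act G ?s (t \<mu>) * (?g - act G ?s ?g)"
        by (simp add: act_mult[OF sW] algebra_simps)
      also have "\<dots> = t \<alpha> * (of_int (pair \<mu> \<alpha>) * ?g + t (?s \<mu>) * h)"
        unfolding smu t_reflection[OF mu al, unfolded smu] h(2) by (simp add: algebra_simps)
      finally have "t \<mu> * ?g - act G ?s (t \<mu> * ?g) = t \<alpha> * (of_int (pair \<mu> \<alpha>) * ?g + t (?s \<mu>) * h)" .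
      moreover have "of_int (pair \<mu> \<alpha>) * ?g + t (?s \<mu>) * h \<in> T k"
        unfolding l(1) by (intro T.add T_of_int T.prod T_t h reflection_lattice mu al) (use Cons.prems l in auto)
      ultimately show ?case by auto
    qed
  }
qed

subsection \<open>The evaluation action\<close>

text \<open>The algebra acts on its own scalars. Translations act trivially, so only the finite part
  \<open>fin\<close> can be recovered from this action.\<close>

definition ev :: "('v, 'q) tga \<Rightarrow> 'q \<Rightarrow> 'q" where
  "ev z g = ap z (\<lambda>u. act G (snd u) g)"

lemma ev_tm:
  assumes "z \<in> K" "y \<in> K" shows "ev (z \<star> y) g = ev z (ev y g)"
  using assms(1)
proof (induction rule: K_induct)
  case (single u a)
  show ?case using assms(2)
  proof (induction rule: K_induct)
    case (single v b)
    then show ?case using \<open>u \<in> A\<close>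
      by (simp add: tm_single ev_def ap_single act_mult A_W act_comp snd_aff mult.assoc)
  qed (use \<open>u \<in> A\<close> in \<open>simp_all add: tm_zero ev_def ap_zero ap_single act_zero A_W tm_add_right K_single
        ap_add act_add distrib_left\<close>)
qed (simp_all add: tm_zero ev_def ap_zero tm_add_left ap_add)

definition fin :: "('v, 'q) tga set" where
  "fin = {z. keys z \<subseteq> {0} \<times> W}"

lemma fin_K: "z \<in> fin \<Longrightarrow> z \<in> K"
  using int_comb_zero[of "coroot ` \<Phi>"] by (auto simp: fin_def K_iff A_iff)

lemma fin_single: "w \<in> W \<Longrightarrow> single (0, w) a \<in> fin"
  by (simp add: fin_def)

lemma fin_add: "z \<in> fin \<Longrightarrow> y \<in> fin \<Longrightarrow> z + y \<in> fin"
  using keys_add[of z y] by (auto simp: fin_def)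

lemma fin_tm:
  assumes "z \<in> fin" "y \<in> fin" shows "z \<star> y \<in> fin"
  unfolding tm_def fin_def mem_Collect_eq
proof (intro keys_sum_subset)
  fix u v assume "u \<in> keys z" "v \<in> keys y"
  then have "fst u = 0" "snd u \<in> W" "fst v = 0" "snd v \<in> W" using assms by (auto simp: fin_def)
  then show "keys (single (aff_mult u v) (lookup z u * act G (snd u) (lookup y v))) \<subseteq> {0} \<times> W"
    by (auto simp: aff_mult_def linear_0[OF weyl_linear] weyl_comp)
qed

lemma ap_fin: "z \<in> fin \<Longrightarrow> ap z f = (\<Sum>w\<in>W. lookup z (0, w) * f (0, w))"
proof -
  assume z: "z \<in> fin"
  have "ap z f = (\<Sum>u\<in>{0} \<times> W. lookup z u * f u)" unfolding ap_def
    by (rule sum.mono_neutral_left) (use z finite_weyl_group[OF root_system] in \<open>auto simp: fin_def in_keys_iff\<close>)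
  also have "\<dots> = (\<Sum>w\<in>W. lookup z (0, w) * f (0, w))"
    by (rule sum.reindex_bij_witness[of _ "\<lambda>w. (0, w)" snd]) auto
  finally show ?thesis .
qed

lemma prod_units: "(\<And>i. i \<in> B \<Longrightarrow> (f i :: 'q) dvd 1) \<Longrightarrow> prod f B dvd 1"
  by (induction B rule: infinite_finite_induct) (auto intro: unit_mult)

text \<open>The displacement lemma for the quotient of \<open>w\<close> by \<open>v\<close> gives
  \<mu> with \<open>w \<mu> - v \<mu>\<close> equal to \<open>n\<close> times a root. By additivity
  the difference of the \<open>t\<close> values is \<open>n\<close> times a unit, and
  \<open>n\<close> is a unit as well.\<close>

lemma separation:
  assumes w: "w \<in> W" "v \<in> W" "w \<noteq> v"
  shows "\<exists>\<mu>\<in>\<Lambda>. t (w \<mu>) - t (v \<mu>) dvd 1"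
proof -
  let ?u = "winv v \<circ> w"
  have uW: "?u \<in> W" by (intro weyl_comp weyl_inv w)
  have "?u \<noteq> id"
  proof
    assume "?u = id"
    then have "winv v (w y) = y" for y by (metis comp_apply id_apply)
    then have "w y = v y" for y using weyl_inv_comp(1)[OF w(2), of "w y"] by simp
    then show False using w by auto
  qed
  then obtain \<mu> \<beta> n where *: "\<mu> \<in> \<Lambda>" "\<beta> \<in> \<Phi>" "n > 0" "?u \<mu> - \<mu> = real n *\<^sub>R \<beta>"
    using weyl_displacement_root[OF uW] by blast
  have vb: "v \<beta> \<in> \<Phi>" by (rule weyl_roots[OF root_system w(2) *(2)])
  have "w \<mu> - v \<mu> = v (?u \<mu> - \<mu>)"
    by (simp add: linear_diff[OF weyl_linear[OF w(2)]] weyl_inv_comp[OF w(2)])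
  also have "\<dots> = of_int (int n) *\<^sub>R v \<beta>" unfolding *(4) by (simp add: linear_scale[OF weyl_linear[OF w(2)]])
  finally have "t (w \<mu> - v \<mu>) = of_int (int n) * t (v \<beta>)"
    using t_scale[OF root_lattice[OF vb], of "int n"] by (simp only:)
  moreover have "t (w \<mu> - v \<mu>) = t (w \<mu>) - t (v \<mu>)"
    by (rule t_diff) (use W_lattice w *(1) in blast)+
  ultimately have "t (w \<mu>) - t (v \<mu>) = of_int (int n) * t (v \<beta>)" by (simp only:)
  moreover have "(of_int (int n) :: 'q) dvd 1" using int_unit[of "int n"] *(3) by (metis dvd_triv_left of_nat_0_less_iff less_irrefl of_nat_eq_0_iff)
  ultimately show ?thesis using unit_mult t_unit[OF vb] * by (intro bexI[of _ \<mu>]) simp_all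
qed

text \<open>
  By the separation property, \<open>\<Prod>\<^sub>w\<^sub>\<noteq>\<^sub>v (w(\<mu>\<^sub>w) \<otimes> 1 - 1 \<otimes> \<mu>\<^sub>w)\<close> isolates the coefficient of \<open>v\<close>.
\<close>

lemma fin_eq_0:
  assumes z: "z \<in> fin" and ev0: "\<And>g. g \<in> T (card W) \<Longrightarrow> ev z g = 0"
  shows "z = 0"
proof -
  have finW: "finite W" by (rule finite_weyl_group[OF root_system])
  have "lookup z (0, v) = 0" if v: "v \<in> W" for v
  proof -
    have "\<forall>w\<in>W - {v}. \<exists>\<mu>. \<mu> \<in> \<Lambda> \<and> t (w \<mu>) - t (v \<mu>) dvd 1" using separation v by blast
    then obtain m where m: "\<And>w. w \<in> W - {v} \<Longrightarrow> m w \<in> \<Lambda>" "\<And>w. w \<in> W - {v} \<Longrightarrow> t (w (m w)) - t (v (m w)) dvd 1"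
      by metis
    define F where "F = (\<lambda>B u. \<Prod>w\<in>B. t (w (m w)) - t (u (m w)))"
    \<comment> \<open>Expanding one factor of the product leaves two sums over the smaller product,
      one with \<open>g\<close> and one with \<open>t (m w) * g\<close>. Each factor thus costs one
      degree, whence the bound \<open>card B + k\<close>.\<close>
    have main: "(\<Sum>u\<in>W. lookup z (0, u) * F B u * act G u g) = 0"
      if B: "finite B" "B \<subseteq> W - {v}" "card B + k \<le> card W" "g \<in> T k" for B k g
      using B
    proof (induction B arbitrary: k g rule: finite_induct)
      case empty
      then have "ev z g = 0" using ev0 T_mono by simp
      then show ?case by (simp add: F_def ev_def ap_fin[OF z])
    next
      case (insert w B)
      have mw: "m w \<in> \<Lambda>" using insert.prems m by blast
      have F: "F (insert w B) u = (t (w (m w)) - t (u (m w))) * F B u" for u using insert.hyps by (simp add: F_def)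
      have "(\<Sum>u\<in>W. lookup z (0, u) * F (insert w B) u * act G u g) =
        (\<Sum>u\<in>W. t (w (m w)) * (lookup z (0, u) * F B u * act G u g) - lookup z (0, u) * F B u * act G u (t (m w) * g))"
        by (rule sum.cong) (simp_all add: F act_mult t_act mw algebra_simps)
      also have "\<dots> = t (w (m w)) * (\<Sum>u\<in>W. lookup z (0, u) * F B u * act G u g)
        - (\<Sum>u\<in>W. lookup z (0, u) * F B u * act G u (t (m w) * g))"
        by (simp add: sum_subtractf sum_distrib_left)
      also have "(\<Sum>u\<in>W. lookup z (0, u) * F B u * act G u g) = 0"
        by (rule insert.IH[of k]) (use insert in auto)
      also have "(\<Sum>u\<in>W. lookup z (0, u) * F B u * act G u (t (m w) * g)) = 0"
        by (rule insert.IH[of "Suc k"]) (use insert T_t mw in auto)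
      finally show ?case by simp
    qed
    \<comment> \<open>With |W| - 1 factors and the constant 1, which lies in \<open>T 1\<close>, the
      admissible degree is used up exactly.\<close>
    have "card (W - {v}) + 1 \<le> card W" using v finW card_W by simp
    moreover have "1 \<in> T 1" using T.prod[of "[]" 1] by simp
    ultimately have "0 = (\<Sum>u\<in>W. lookup z (0, u) * F (W - {v}) u * act G u 1)"
      using main[of "W - {v}" 1 1] finW by simp
    also have "\<dots> = (\<Sum>u\<in>W. if u = v then lookup z (0, v) * F (W - {v}) v else 0)"
    proof (rule sum.cong)
      fix u assume u: "u \<in> W"
      have "F (W - {v}) u = 0" if "u \<noteq> v"
        unfolding F_def by (rule prod_zero) (use finW u that in auto)
      then show "lookup z (0, u) * F (W - {v}) u * act G u 1 = (if u = v then lookup z (0, v) * F (W - {v}) v else 0)"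
        using u by (simp add: act_one)
    qed simp
    also have "\<dots> = F (W - {v}) v * lookup z (0, v)" using v finW by (simp add: mult.commute)
    finally have "F (W - {v}) v * lookup z (0, v) = F (W - {v}) v * 0" by simp
    moreover have "F (W - {v}) v dvd 1" unfolding F_def by (rule prod_units) (rule m)
    ultimately show ?thesis using unit_cancel by blast
  qed
  then have "lookup z u = 0" for u using z by (cases "u \<in> {0} \<times> W") (auto simp: fin_def in_keys_iff)
  then show ?thesis by (intro poly_mapping_eqI) simp
qed

subsection \<open>Words in the additive divided differences\<close>

definition dd :: "'v \<Rightarrow> ('v, 'q) tga" where
  "dd \<alpha> = cst (unit_inv (t \<alpha>)) \<star> (cst 1 - eta (0, reflection \<alpha>))"

text \<open>Since \<open>t \<alpha>\<close> is \<open>x \<alpha>\<close> times a unit of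
  \<open>S\<close>, the element is a Demazure generator times the inverse of that unit.\<close>

lemma dd_D:
  assumes "\<alpha> \<in> simples G" shows "dd \<alpha> \<in> D"
proof -
  have al: "\<alpha> \<in> \<Phi>" using assms simple_sub by blast
  have sA: "(0, reflection \<alpha>) \<in> A" by (intro W_A weyl_refl al)
  obtain u v where uv: "u \<in> Sset G" "v \<in> Sset G" "u * v = 1" "t \<alpha> = x \<alpha> * u" using t_unit_multiple[OF al] by blast
  have "t \<alpha> * (v * xi \<alpha>) = (u * v) * (x \<alpha> * xi \<alpha>)" by (simp add: uv(4) mult_ac)
  then have "t \<alpha> * unit_inv (t \<alpha>) = t \<alpha> * (v * xi \<alpha>)"
    using uv(3) x_xi[OF al] unit_inv[OF t_unit[OF al]] by simp
  then have "unit_inv (t \<alpha>) = v * xi \<alpha>" by (rule unit_cancel[OF t_unit[OF al]])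
  then have "dd \<alpha> = cst v \<star> demazure G \<alpha> (0, reflection \<alpha>)"
    unfolding dd_def demazure_def using sA by (simp add: cst_cst_tm K_diff K_cst K_eta)
  moreover have "(\<alpha>, (0, reflection \<alpha>)) \<in> gens" using assms by (simp add: gens_def)
  ultimately show ?thesis using D_tm[OF D_cst[OF uv(2)] D_demazure] by simp
qed

lemma dd_fin: "\<alpha> \<in> \<Phi> \<Longrightarrow> dd \<alpha> \<in> fin"
proof -
  assume al: "\<alpha> \<in> \<Phi>"
  have c: "cst a \<in> fin" for a :: 'q by (simp add: cst_def aff_one_def fin_single weyl_group.id)
  have "cst 1 - eta (0, reflection \<alpha>) = cst 1 + (single (0, reflection \<alpha>) (- 1) :: ('v, 'q) tga)"
    by (simp add: eta_def single_uminus)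
  then show ?thesis unfolding dd_def by (metis fin_tm c fin_add fin_single weyl_refl al)
qed

lemma ev_dd:
  assumes "\<alpha> \<in> \<Phi>" "g \<in> T (Suc k)" shows "ev (dd \<alpha>) g \<in> T k"
proof -
  obtain h where h: "h \<in> T k" "g - act G (reflection \<alpha>) g = t \<alpha> * h" using T_divided_difference assms by blast
  have "ev (dd \<alpha>) g = unit_inv (t \<alpha>) * (g - act G (reflection \<alpha>) g)"
    unfolding dd_def ev_def
    by (simp add: ap_cst_tm K_diff K_cst K_eta W_A weyl_refl assms ap_diff)
      (simp add: cst_def eta_def ap_single aff_one_def act_id)
  also have "\<dots> = h" unfolding h(2) using unit_inv[OF t_unit[OF assms(1)]]
    by (metis mult.assoc mult.commute mult.left_neutral)
  finally show ?thesis using h by simp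
qed

fun ddw :: "'v list \<Rightarrow> ('v, 'q) tga" where
  "ddw [] = cst 1"
| "ddw (a # M) = dd a \<star> ddw M"

lemma ddw_D: "set M \<subseteq> simples G \<Longrightarrow> ddw M \<in> D"
  by (induction M) (auto intro: D_one D_tm dd_D)

lemma ddw_fin: "set M \<subseteq> simples G \<Longrightarrow> ddw M \<in> fin"
proof (induction M)
  case Nil
  show ?case by (simp add: cst_def aff_one_def fin_single weyl_group.id)
next
  case (Cons a M)
  then show ?case using simple_sub by (auto intro!: fin_tm dd_fin)
qed

lemma ev_ddw: "set M \<subseteq> simples G \<Longrightarrow> g \<in> T (length M + k) \<Longrightarrow> ev (ddw M) g \<in> T k"
proof (induction M arbitrary: k)
  case Nil
  then show ?case by (simp add: ev_def cst_def ap_single aff_one_def act_id)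
next
  case (Cons a M)
  have a: "a \<in> \<Phi>" using Cons.prems simple_sub by auto
  have "ev (ddw M) g \<in> T (Suc k)" using Cons.IH[of "Suc k"] Cons.prems by simp
  then have "ev (dd a) (ev (ddw M) g) \<in> T k" by (rule ev_dd[OF a])
  then show ?case using Cons.prems by (simp add: ev_tm fin_K dd_fin a ddw_fin)
qed

lemma ddw_eq_0:
  assumes "set M \<subseteq> simples G" "length M = card W" shows "ddw M = 0"
proof (rule fin_eq_0[OF ddw_fin[OF assms(1)]])
  fix g assume "g \<in> T (card W)"
  then have "ev (ddw M) g \<in> T 0" using ev_ddw[OF assms(1), of g 0] assms(2) by simp
  then show "ev (ddw M) g = 0" by (rule T_0)
qed

definition inv_el :: "('v, 'q) tga set" where
  "inv_el = {d \<in> D \<inter> fin. \<forall>w\<in>W. eta (0, w) \<star> d = d}"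

text \<open>The left \<open>S\<close>-span of the invariant elements, that is \<open>D\<^sub>W e D\<^sub>W\<close> with \<open>e\<close> the averaging idempotent.\<close>

definition inv_span :: "('v, 'q) tga set" where
  "inv_span = {\<Sum>i<n. cst (b i) \<star> d i | n b d. \<forall>i<(n::nat). b i \<in> Sset G \<and> d i \<in> inv_el}"

lemma inv_spanI: "(\<And>i. i < n \<Longrightarrow> b i \<in> Sset G \<and> d i \<in> inv_el) \<Longrightarrow> (\<Sum>i<(n::nat). cst (b i) \<star> d i) \<in> inv_span"
  unfolding inv_span_def by (intro CollectI exI conjI allI impI) auto

lemma inv_span_zero: "0 \<in> inv_span"
  unfolding inv_span_def by (rule CollectI, intro exI[of _ 0]) simp

lemma inv_span_add:
  assumes "y \<in> inv_span" "z \<in> inv_span" shows "y + z \<in> inv_span"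
proof -
  obtain n b d m c e where 1: "y = (\<Sum>i<n. cst (b i) \<star> d i)" "\<forall>i<(n::nat). b i \<in> Sset G \<and> d i \<in> inv_el"
    "z = (\<Sum>i<m. cst (c i) \<star> e i)" "\<forall>i<(m::nat). c i \<in> Sset G \<and> e i \<in> inv_el"
    using assms unfolding inv_span_def by blast
  define b' where "b' i = (if i < n then b i else c (i - n))" for i
  define d' where "d' i = (if i < n then d i else e (i - n))" for i
  have "(\<Sum>i<n + m. cst (b' i) \<star> d' i) = (\<Sum>i<n. cst (b' i) \<star> d' i) + (\<Sum>i<m. cst (b' (n + i)) \<star> d' (n + i))"
    by (induction m) (simp_all add: add.assoc)
  then have "y + z = (\<Sum>i<n + m. cst (b' i) \<star> d' i)" by (simp add: 1 b'_def d'_def)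
  moreover have "\<forall>i<n + m. b' i \<in> Sset G \<and> d' i \<in> inv_el" using 1 by (auto simp: b'_def d'_def)
  ultimately show ?thesis unfolding inv_span_def by blast
qed

lemma inv_el_K: "d \<in> inv_el \<Longrightarrow> d \<in> K" and inv_el_D: "d \<in> inv_el \<Longrightarrow> d \<in> D"
  and inv_el_eta: "d \<in> inv_el \<Longrightarrow> w \<in> W \<Longrightarrow> eta (0, w) \<star> d = d"
  by (auto simp: inv_el_def D_K)

lemma inv_span_K: "y \<in> inv_span \<Longrightarrow> y \<in> K"
  by (auto simp: inv_span_def intro: K_sum K_tm K_cst inv_el_K)

lemma inv_span_cst:
  assumes "a \<in> Sset G" "y \<in> inv_span" shows "cst a \<star> y \<in> inv_span"
proof -
  obtain n b d where 1: "y = (\<Sum>i<n. cst (b i) \<star> d i)" "\<forall>i<(n::nat). b i \<in> Sset G \<and> d i \<in> inv_el"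
    using assms unfolding inv_span_def by blast
  have "cst a \<star> y = (\<Sum>i<n. cst (a * b i) \<star> d i)"
    unfolding 1(1) tm_sum_right[OF K_cst] by (rule sum.cong) (use 1 in \<open>auto simp: cst_cst_tm inv_el_K\<close>)
  then show ?thesis using inv_spanI[of n "\<lambda>i. a * b i" d] 1 assms by (simp add: Sset_mult)
qed

text \<open>A group element passes a scalar at the cost of acting on it and is then absorbed by the
  invariant factor.\<close>

lemma inv_span_eta:
  assumes "w \<in> W" "y \<in> inv_span" shows "eta (0, w) \<star> y \<in> inv_span"
proof -
  obtain n b d where 1: "y = (\<Sum>i<n. cst (b i) \<star> d i)" "\<forall>i<(n::nat). b i \<in> Sset G \<and> d i \<in> inv_el"
    using assms unfolding inv_span_def by blast
  have "eta (0, w) \<star> (cst (b i) \<star> d i) = cst (act G w (b i)) \<star> d i" if "i < n" for i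
  proof -
    have d: "d i \<in> inv_el" using 1 that by blast
    have "eta (0, w) \<star> (cst (b i) \<star> d i) = (eta (0, w) \<star> cst (b i)) \<star> d i"
      by (rule tm_assoc[symmetric, OF K_eta[OF W_A[OF assms(1)]] K_cst inv_el_K[OF d]])
    also have "\<dots> = (cst (act G w (b i)) \<star> eta (0, w)) \<star> d i"
      using eta_tm_cst[OF W_A[OF assms(1)], of "b i"] by simp
    also have "\<dots> = cst (act G w (b i)) \<star> d i"
      using tm_assoc[OF K_cst K_eta[OF W_A[OF assms(1)]] inv_el_K[OF d]] inv_el_eta[OF d assms(1)] by simp
    finally show ?thesis .
  qed
  then have "eta (0, w) \<star> y = (\<Sum>i<n. cst (act G w (b i)) \<star> d i)"
    unfolding 1(1) tm_sum_right[OF K_eta[OF W_A[OF assms(1)]]] by simp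
  then show ?thesis using inv_spanI[of n "\<lambda>i. act G w (b i)" d] 1 assms by (simp add: act_Sset)
qed

lemma neg_one_tm: "y \<in> K \<Longrightarrow> cst (- 1) \<star> y = - y"
proof -
  assume "y \<in> K"
  moreover have "cst (- 1) = - (cst 1 :: ('v, 'q) tga)" by (simp add: cst_def single_uminus)
  ultimately show ?thesis by (simp add: tm_neg_left one_tm)
qed

lemma inv_span_neg: "y \<in> inv_span \<Longrightarrow> - y \<in> inv_span"
  using inv_span_cst[OF Sset_neg[OF Sset_one]] by (simp add: neg_one_tm inv_span_K)

lemma inv_span_sum: "(\<And>i. i \<in> B \<Longrightarrow> f i \<in> inv_span) \<Longrightarrow> sum f B \<in> inv_span"
  by (induction B rule: infinite_finite_induct) (auto intro: inv_span_zero inv_span_add)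

lemma of_nat_tm: "y \<in> K \<Longrightarrow> (\<Sum>i\<in>B. y) = cst (of_nat (card B)) \<star> y"
proof (induction B rule: infinite_finite_induct)
  case (insert i B)
  then show ?case by (simp add: cst_add tm_add_left one_tm)
qed (auto simp: cst_zero_tm)

text \<open>Modulo \<open>inv_span\<close>, \<open>y\<close> is invariant under \<open>W\<close>, hence equal to its average, which lies in \<open>inv_span\<close>.\<close>

lemma inv_span_step:
  assumes y: "y \<in> D" "y \<in> fin" and dd: "\<And>a. a \<in> simples G \<Longrightarrow> dd a \<star> y \<in> inv_span"
  shows "y \<in> inv_span"
proof -
  have yK: "y \<in> K" using y D_K by simp
  have finW: "finite W" by (rule finite_weyl_group[OF root_system])
  have step: "eta (0, reflection a) \<star> y - y \<in> inv_span" if a: "a \<in> simples G" for a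
  proof -
    have al: "a \<in> \<Phi>" using a simple_sub by blast
    have sA: "(0, reflection a) \<in> A" by (intro W_A weyl_refl al)
    \<comment> \<open>Multiplying by \<open>t a\<close> clears the denominator, so the hypothesis on
      \<open>dd a\<close> says that \<open>y\<close> is invariant under the simple reflection modulo
      the span.\<close>
    have "cst (t a) \<star> (dd a \<star> y) = (cst (t a) \<star> dd a) \<star> y"
      using tm_assoc[OF K_cst fin_K[OF dd_fin[OF al]] yK] by simp
    also have "cst (t a) \<star> dd a = cst 1 - eta (0, reflection a)"
      unfolding dd_def using sA by (simp add: cst_cst_tm K_diff K_cst K_eta unit_inv t_unit al one_tm)
    finally have "cst (t a) \<star> (dd a \<star> y) = y - eta (0, reflection a) \<star> y"
      by (simp add: tm_diff_left one_tm yK)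
    then have "y - eta (0, reflection a) \<star> y \<in> inv_span"
      using inv_span_cst[OF t_Sset dd[OF a]] by metis
    then show ?thesis using inv_span_neg by fastforce
  qed
  have all: "eta (0, w) \<star> y - y \<in> inv_span" if w: "w \<in> W" for w
  proof -
    obtain M where M: "set M \<subseteq> simples G" "w = refl_word M" using weyl_word[OF w] by blast
    have "eta (0, refl_word M) \<star> y - y \<in> inv_span" using M(1)
    proof (induction M)
      case Nil
      have "eta (0, id) = (cst 1 :: ('v, 'q) tga)" by (simp add: eta_def cst_def aff_one_def)
      then show ?case using inv_span_zero by (simp add: one_tm yK id_def)
    next
      case (Cons a M)
      have a: "a \<in> simples G" and M: "set M \<subseteq> simples G" using Cons.prems by auto
      have al: "a \<in> \<Phi>" using a simple_sub by blast
      have sA: "(0, reflection a) \<in> A" and mA: "(0, refl_word M) \<in> A"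
        using M simple_sub by (auto intro!: W_A weyl_refl al refl_word_weyl)
      have "eta (0, refl_word (a # M)) = eta (0, reflection a) \<star> eta (0, refl_word M)"
        by (simp add: eta_mult sA aff_mult_def linear_0[OF reflection_linear])
      then have e: "eta (0, refl_word (a # M)) \<star> y - y
        = eta (0, reflection a) \<star> (eta (0, refl_word M) \<star> y - y) + (eta (0, reflection a) \<star> y - y)"
        by (simp add: tm_assoc K_eta sA mA yK tm_diff_right)
      show ?case unfolding e
        by (rule inv_span_add[OF inv_span_eta[OF weyl_refl[OF al] Cons.IH[OF M]] step[OF a]])
    qed
    then show ?thesis using M by simp
  qed
  \<comment> \<open>The average of \<open>y\<close> times |W|; leaving out the factor keeps it
    visibly inside \<open>D\<close> and the division waits until the end.\<close>
  define m where "m = (\<Sum>w\<in>W. eta (0, w) \<star> y)"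
  have "m \<in> inv_el"
  proof -
    have "m \<in> D" unfolding m_def by (intro D_sum D_tm D_eta_W y)
    moreover have "m \<in> fin" unfolding m_def fin_def mem_Collect_eq
    proof (rule keys_sum_subset)
      fix w assume "w \<in> W"
      then show "keys (eta (0, w) \<star> y) \<subseteq> {0} \<times> W"
        using fin_tm[OF fin_single y(2), of w 1] by (simp add: fin_def eta_def)
    qed
    moreover have "eta (0, v) \<star> m = m" if v: "v \<in> W" for v
    proof -
      have "eta (0, v) \<star> m = (\<Sum>w\<in>W. eta (0, v \<circ> w) \<star> y)"
        unfolding m_def tm_sum_right[OF K_eta[OF W_A[OF v]]]
      proof (rule sum.cong)
        fix w assume w: "w \<in> W"
        have "eta (0, v) \<star> eta (0, w) = eta (0, v \<circ> w)"
          by (simp add: eta_mult W_A v aff_mult_def linear_0[OF weyl_linear[OF v]])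
        then show "eta (0, v) \<star> (eta (0, w) \<star> y) = eta (0, v \<circ> w) \<star> y"
          using tm_assoc[OF K_eta[OF W_A[OF v]] K_eta[OF W_A[OF w]] yK] by simp
      qed simp
      also have "\<dots> = m" unfolding m_def
        by (rule sum.reindex_bij_witness[of _ "\<lambda>w. winv v \<circ> w" "\<lambda>w. v \<circ> w"])
          (use v in \<open>auto simp: weyl_comp weyl_inv weyl_inv_comp fun_eq_iff\<close>)
      finally show ?thesis .
    qed
    ultimately show ?thesis by (simp add: inv_el_def)
  qed
  then have "cst 1 \<star> m \<in> inv_span" unfolding inv_span_def
    by (intro CollectI exI[of _ "1::nat"] exI[of _ "\<lambda>_. 1"] exI[of _ "\<lambda>_. m"]) (auto simp: Sset_one)
  then have mS: "m \<in> inv_span" using \<open>m \<in> inv_el\<close> by (simp add: one_tm inv_el_K)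
  have "(\<Sum>w\<in>W. y) = m - (\<Sum>w\<in>W. eta (0, w) \<star> y - y)" by (simp add: m_def sum_subtractf)
  also have "\<dots> = m + - (\<Sum>w\<in>W. eta (0, w) \<star> y - y)" by simp
  also have "\<dots> \<in> inv_span" by (intro inv_span_add inv_span_neg inv_span_sum mS all)
  finally have "cst (of_nat (card W)) \<star> y \<in> inv_span" by (simp only: of_nat_tm[OF yK])
  moreover obtain k where k: "k \<in> Sset G" "of_nat (card W) * k = 1"
    using int_unit[of "int (card W)"] card_W by auto
  ultimately have "cst k \<star> (cst (of_nat (card W)) \<star> y) \<in> inv_span" using inv_span_cst by blast
  then show ?thesis using k by (simp add: cst_cst_tm yK mult.commute one_tm)
qed

lemma one_inv_span: "cst 1 \<in> inv_span"
proof -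
  have "\<forall>M. set M \<subseteq> simples G \<longrightarrow> length M = n \<longrightarrow> ddw M \<in> inv_span" if "n \<le> card W" for n
    using that
  proof (induction n rule: inc_induct)
    case base
    show ?case using ddw_eq_0 inv_span_zero by simp
  next
    case (step n)
    show ?case
    proof (intro allI impI)
      fix M assume M: "set M \<subseteq> simples G" "length M = n"
      show "ddw M \<in> inv_span"
        by (rule inv_span_step[OF ddw_D[OF M(1)] ddw_fin[OF M(1)]])
          (use step.IH[rule_format, of "_ # M"] M in simp)
    qed
  qed
  from this[of 0] show ?thesis by (simp add: spec[of _ "[]"])
qed


subsection \<open>Projection to the translations\<close>

text \<open>Projection and inclusion combined into one map of the twisted algebra, so that the
  translation algebra needs no product of its own.\<close>

definition tproj :: "('v, 'q) tga \<Rightarrow> ('v, 'q) tga" where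
  "tproj z = imath (pr z)"

lemma pr_add: "pr (y + z) = pr y + (pr z :: 'v \<Rightarrow>\<^sub>0 'q)"
  unfolding pr_def by (rule setsum_keys_plus_distrib) (auto simp: single_add)

lemma imath_add: "imath (y + z) = imath y + (imath z :: ('v, 'q) tga)"
  unfolding imath_def by (rule setsum_keys_plus_distrib) (auto simp: single_add)

lemma tproj_add: "tproj (y + z) = tproj y + tproj z"
  by (simp add: tproj_def pr_add imath_add)

lemma tproj_zero: "tproj 0 = 0"
  by (simp add: tproj_def pr_def imath_def)

lemma tproj_single: "tproj (single u a) = single (fst u, id) a"
  by (simp add: tproj_def pr_def imath_def)

lemma tproj_sum: "tproj (sum f B) = (\<Sum>i\<in>B. tproj (f i))"
  by (induction B rule: infinite_finite_induct) (auto simp: tproj_zero tproj_add)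

lemma DQ_eq: "DQ G = tproj ` D"
  by (auto simp: DQ_def tproj_def)

definition trans :: "('v, 'q) tga set" where
  "trans = {z. keys z \<subseteq> L \<times> {id}}"

lemma trans_K: "z \<in> trans \<Longrightarrow> z \<in> K"
  by (auto simp: trans_def K_iff A_iff weyl_group.id)

lemma trans_add: "y \<in> trans \<Longrightarrow> z \<in> trans \<Longrightarrow> y + z \<in> trans"
  using keys_add[of y z] by (auto simp: trans_def)

lemma trans_single: "\<mu> \<in> L \<Longrightarrow> single (\<mu>, id) a \<in> trans"
  by (simp add: trans_def)

lemma trans_zero: "0 \<in> trans"
  by (simp add: trans_def)

lemma trans_induct [consumes 1, case_names zero single add]:
  assumes z: "z \<in> trans"
    and "Pr 0" "\<And>\<mu> a. \<mu> \<in> L \<Longrightarrow> Pr (single (\<mu>, id) a)"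
    and "\<And>y z. y \<in> trans \<Longrightarrow> z \<in> trans \<Longrightarrow> Pr y \<Longrightarrow> Pr z \<Longrightarrow> Pr (y + z)"
  shows "Pr z"
  using z unfolding trans_def mem_Collect_eq
proof (induction rule: keys_induct)
  case (single u a)
  then show ?case using assms(3) by auto
next
  case (add y z)
  then show ?case using assms(4) by (simp add: trans_def)
qed (rule assms(2))

lemma tproj_trans: "z \<in> K \<Longrightarrow> tproj z \<in> trans"
  by (induction rule: K_induct) (auto simp: tproj_zero tproj_add tproj_single trans_zero trans_single trans_add A_L)

lemma tproj_id: "z \<in> trans \<Longrightarrow> tproj z = z"
  by (induction rule: trans_induct) (auto simp: tproj_zero tproj_add tproj_single)

lemma trans_tm:
  assumes "y \<in> trans" "z \<in> trans" shows "y \<star> z \<in> trans"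
  using assms(1)
proof (induction rule: trans_induct)
  case (single \<mu> a)
  show ?case using assms(2)
  proof (induction rule: trans_induct)
    case (single \<nu> b)
    have "single (\<mu>, id) a \<star> single (\<nu>, id) b = single (\<mu> + \<nu>, id) (a * b)"
      using \<open>\<mu> \<in> L\<close> by (simp add: tm_single L_A aff_mult_def act_id)
    moreover have "single (\<mu> + \<nu>, id) (a * b) \<in> trans"
      by (intro trans_single int_comb_add) fact+
    ultimately show ?case by (simp only: id_def)
  qed (use K_single[OF L_A[OF \<open>\<mu> \<in> L\<close>], of a] in \<open>simp_all add: tm_zero trans_zero tm_add_right trans_add id_def\<close>)
qed (simp_all add: tm_zero trans_zero tm_add_left trans_add)

text \<open>Translations act trivially on scalars. Hence the two actions of \<open>S\<close> on
  functionals agree after restriction, which is why commutators restrict to zero.\<close>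

lemma trans_cst_commute:
  assumes "z \<in> trans" shows "z \<star> cst a = cst a \<star> z"
  using assms
proof (induction rule: trans_induct)
  case (single \<mu> b)
  then have "single (\<mu>, id) b \<star> cst a = single (\<mu>, id) (b * a)" by (simp add: single_tm_cst L_A act_id)
  then show ?case by (simp add: cst_tm_single mult.commute)
qed (simp_all add: tm_zero tm_add_left tm_add_right K_cst)

lemma cst_trans: "cst a \<in> trans"
  by (simp add: cst_def aff_one_def trans_single int_comb_zero)

lemma eta_trans: "\<mu> \<in> L \<Longrightarrow> eta (\<mu>, id) \<in> trans"
  by (simp add: eta_def trans_single)

lemma tproj_cst_tm:
  assumes "z \<in> K" shows "tproj (cst a \<star> z) = cst a \<star> tproj z"
  using assms
  by (induction rule: K_induct) (auto simp: tm_zero tproj_zero cst_tm_single tproj_single tm_add_right K_cst tproj_add)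

text \<open>The finite part of the right factor affects only the finite part of the product, which
  the projection forgets.\<close>

lemma tproj_tm_tproj:
  assumes "z \<in> K" "y \<in> K" shows "tproj (z \<star> tproj y) = tproj (z \<star> y)"
  using assms(1)
proof (induction rule: K_induct)
  case (single u a)
  show ?case using assms(2)
  proof (induction rule: K_induct)
    case (single v b)
    then show ?case using \<open>u \<in> A\<close> by (simp add: tproj_single tm_single aff_mult_def)
  qed (use \<open>u \<in> A\<close> in \<open>simp_all add: tm_zero tproj_zero tm_add_right K_single tproj_add\<close>)
qed (simp_all add: tm_zero tproj_zero tm_add_left tproj_add)

lemma single_decompose: "u \<in> A \<Longrightarrow> single u a = single (fst u, id) a \<star> eta (0, snd u)"
  by (simp add: eta_def tm_single L_A A_L act_id aff_mult_def)

text \<open>A basis element is a translation times an element of \<open>W\<close>, and the latter is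
  absorbed by \<open>d\<close>.\<close>

lemma tproj_tm_inv:
  assumes "z \<in> K" "d \<in> inv_el" shows "tproj z \<star> d = z \<star> d"
  using assms(1)
proof (induction rule: K_induct)
  case (single u a)
  have "single u a \<star> d = single (fst u, id) a \<star> (eta (0, snd u) \<star> d)"
    unfolding single_decompose[OF single]
    by (rule tm_assoc) (use single assms in \<open>auto intro: K_single K_eta L_A W_A A_L A_W inv_el_K\<close>)
  then show ?case using inv_el_eta[OF assms(2) A_W[OF single]] by (simp add: tproj_single)
qed (simp_all add: tproj_zero tm_zero tproj_add tm_add_left)

subsection \<open>Integral functions on the affine Weyl group\<close>

text \<open>The dual of \<open>D\<close> seen inside all functions on the group. Product and
  antipode are given by values on the \<open>eta u\<close>, so that they stay in the dual is exactly
  a statement about this predicate.\<close>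

definition intg :: "('v aff \<Rightarrow> 'q) \<Rightarrow> bool" where
  "intg f \<longleftrightarrow> (\<forall>z\<in>D. ap z f \<in> Sset G)"

lemma intgD: "intg f \<Longrightarrow> z \<in> D \<Longrightarrow> ap z f \<in> Sset G"
  by (simp add: intg_def)

lemma ap_tm:
  assumes "z \<in> K" "y \<in> K" shows "ap (z \<star> y) f = ap z (\<lambda>u. ap (eta u \<star> y) f)"
  using assms(1)
proof (induction rule: K_induct)
  case (single u a)
  have "single u a \<star> y = cst a \<star> (eta u \<star> y)"
    unfolding single_eta by (rule tm_assoc) (use single assms in \<open>auto intro: K_cst K_eta\<close>)
  then show ?case by (simp add: ap_cst_tm K_tm K_eta single assms(2) ap_single)
qed (simp_all add: tm_zero ap_zero tm_add_left ap_add)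

lemma ap_eta_tm:
  assumes "s \<in> A" "z \<in> K" and inv: "\<And>a. act G (snd s) (act G (snd s) a) = a"
  shows "ap (eta s \<star> z) f = act G (snd s) (ap z (\<lambda>u. act G (snd s) (f (aff_mult s u))))"
  using assms(2)
proof (induction rule: K_induct)
  case (single u a)
  show ?case using assms(1) inv by (simp add: eta_def tm_single ap_single act_mult A_W)
qed (use assms(1) in \<open>simp_all add: tm_zero ap_zero act_zero A_W tm_add_right K_eta ap_add act_add\<close>)

lemma act_reflection_twice: "\<beta> \<in> \<Phi> \<Longrightarrow> act G (reflection \<beta>) (act G (reflection \<beta>) a) = a"
  by (simp add: act_comp weyl_refl reflection_comp_self act_id)

text \<open>Left translation by \<open>s\<close>, twisted such that pairing with
  \<open>eta s \<star> z\<close> equals pairing with \<open>z\<close> followed by the action of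
  \<open>s\<close>.\<close>

definition tw :: "'v aff \<Rightarrow> ('v aff \<Rightarrow> 'q) \<Rightarrow> 'v aff \<Rightarrow> 'q" where
  "tw s f = (\<lambda>u. act G (snd s) (f (aff_mult s u)))"

context
  fixes \<beta> s assumes g: "(\<beta>, s) \<in> gens"
begin

lemma ap_eta_gens: "z \<in> K \<Longrightarrow> ap (eta s \<star> z) f = act G (reflection \<beta>) (ap z (tw s f))"
  using ap_eta_tm[OF gensD(2)[OF g], of z f] act_reflection_twice[OF gensD(1)[OF g]] gensD(3)[OF g]
  by (simp add: tw_def)

lemma ap_demazure: "z \<in> K \<Longrightarrow> ap (demazure G \<beta> s \<star> z) f = xi \<beta> * (ap z f - act G (reflection \<beta>) (ap z (tw s f)))"
  by (simp add: demazure_tm gensD(2)[OF g] ap_cst_tm K_diff K_tm K_eta ap_diff ap_eta_gens)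

lemma ap_tw: "z \<in> K \<Longrightarrow> ap z (tw s f) = act G (reflection \<beta>) (ap (eta s \<star> z) f)"
  using act_reflection_twice[OF gensD(1)[OF g]] by (simp add: ap_eta_gens)

lemma xi_diff_Sset: "c \<in> Sset G \<Longrightarrow> xi \<beta> * (c - act G (reflection \<beta>) c) \<in> Sset G"
proof -
  assume "c \<in> Sset G"
  then obtain b where b: "b \<in> Sset G" "c - act G (reflection \<beta>) c = x \<beta> * b"
    using divided_difference gensD(1)[OF g] by blast
  have "xi \<beta> * (x \<beta> * b) = (x \<beta> * xi \<beta>) * b" by (simp only: mult_ac)
  then show ?thesis using b x_xi[OF gensD(1)[OF g]] by simp
qed

lemma intg_tw: "intg f \<Longrightarrow> intg (tw s f)"
  unfolding intg_def using D_eta[OF gensD(2)[OF g]]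
  by (auto simp: ap_tw D_K intro!: act_Sset weyl_refl gensD(1)[OF g] D_tm)

text \<open>A divided difference of functions. Its pairing with \<open>z\<close> is the value of
  \<open>f\<close> on a Demazure multiple of \<open>z\<close> plus the divided difference of an
  element of \<open>S\<close>; both are integral.\<close>

lemma intg_quot:
  assumes f: "intg f" shows "intg (\<lambda>u. xi \<beta> * (f u - tw s f u))"
  unfolding intg_def
proof
  fix z assume z: "z \<in> D"
  define c where "c = ap (eta s \<star> z) f"
  have c: "c \<in> Sset G" unfolding c_def by (intro intgD f D_tm D_eta gensD(2)[OF g] z)
  have d: "ap (demazure G \<beta> s \<star> z) f \<in> Sset G" by (intro intgD f D_tm D_demazure g z)
  have "ap z (\<lambda>u. xi \<beta> * (f u - tw s f u)) = xi \<beta> * (ap z f - act G (reflection \<beta>) c)"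
    by (simp add: ap_fun_scale ap_fun_diff ap_tw D_K z c_def)
  also have "\<dots> = xi \<beta> * (ap z f - c) + xi \<beta> * (c - act G (reflection \<beta>) c)" by (simp add: algebra_simps)
  also have "xi \<beta> * (ap z f - c) = ap (demazure G \<beta> s \<star> z) f"
    by (simp add: c_def ap_demazure ap_eta_gens D_K z)
  finally show "ap z (\<lambda>u. xi \<beta> * (f u - tw s f u)) \<in> Sset G" using Sset_add[OF d xi_diff_Sset[OF c]] by simp
qed

end

lemma intg_one: "intg (\<lambda>_. 1)"
  unfolding intg_def
proof
  fix z assume "z \<in> D"
  then show "ap z (\<lambda>_. 1) \<in> Sset G"
  proof (induction rule: D_induct)
    case one show ?case by (simp add: cst_def ap_single Sset_one)
  next
    case (demazure \<beta> s y)
    have "tw s (\<lambda>_. 1) = (\<lambda>_. 1)" using A_W[OF gensD(2)[OF demazure(1)]] by (simp add: tw_def act_one)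
    then show ?case using demazure xi_diff_Sset by (simp add: ap_demazure D_K)
  qed (auto simp: ap_neg ap_add ap_cst_tm D_K intro: Sset_neg Sset_add Sset_mult)
qed

text \<open>Twisted Leibniz rule: the divided difference of a product is a sum of two products, in
  each of which one factor is replaced by its divided difference or its translate. As the functions
  change, the induction is over all pairs of integral functions.\<close>

lemma intg_mult:
  assumes "intg f" "intg g" shows "intg (\<lambda>u. f u * g u)"
  unfolding intg_def
proof
  fix z assume "z \<in> D"
  then have "\<forall>f g. intg f \<longrightarrow> intg g \<longrightarrow> ap z (\<lambda>u. f u * g u) \<in> Sset G"
  proof (induction rule: D_induct)
    case one
    have "f aff_one * g aff_one \<in> Sset G" if "intg f" "intg g" for f g
      using intgD[OF that(1) D_one] intgD[OF that(2) D_one] by (simp add: cst_def ap_single Sset_mult)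
    then show ?case by (simp add: cst_def ap_single)
  next
    case (demazure \<beta> s y)
    note gn = demazure(1)
    show ?case
    proof (intro allI impI)
      fix f g assume fg: "intg f" "intg g"
      let ?h = "\<lambda>u. f u * g u" and ?f = "tw s f" and ?g = "tw s g"
      let ?f2 = "\<lambda>u. xi \<beta> * (f u - ?f u)" and ?g2 = "\<lambda>u. xi \<beta> * (g u - ?g u)"
      define c where "c = ap y (\<lambda>u. ?f u * ?g u)"
      have c: "c \<in> Sset G" unfolding c_def using demazure(3) intg_tw[OF gn] fg by blast
      have tw: "tw s ?h = (\<lambda>u. ?f u * ?g u)" using A_W[OF gensD(2)[OF gn]] by (simp add: tw_def act_mult)
      have "ap (demazure G \<beta> s \<star> y) ?h = xi \<beta> * (ap y ?h - act G (reflection \<beta>) c)"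
        using demazure by (simp add: ap_demazure D_K tw c_def)
      also have "\<dots> = xi \<beta> * (ap y ?h - c) + xi \<beta> * (c - act G (reflection \<beta>) c)"
        by (simp add: algebra_simps)
      also have "xi \<beta> * (ap y ?h - c) = ap y (\<lambda>u. xi \<beta> * (?h u - ?f u * ?g u))"
        by (simp add: c_def ap_fun_scale ap_fun_diff)
      also have "(\<lambda>u. xi \<beta> * (?h u - ?f u * ?g u)) = (\<lambda>u. ?f2 u * g u + ?f u * ?g2 u)"
        by (simp add: algebra_simps)
      also have "ap y \<dots> = ap y (\<lambda>u. ?f2 u * g u) + ap y (\<lambda>u. ?f u * ?g2 u)" by (rule ap_fun_add)
      finally have e: "ap (demazure G \<beta> s \<star> y) ?h = ap y (\<lambda>u. ?f2 u * g u) + ap y (\<lambda>u. ?f u * ?g2 u)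
        + xi \<beta> * (c - act G (reflection \<beta>) c)" .
      have "ap y (\<lambda>u. ?f2 u * g u) \<in> Sset G" "ap y (\<lambda>u. ?f u * ?g2 u) \<in> Sset G"
        using demazure(3)[rule_format, OF intg_quot[OF gn fg(1)] fg(2)]
          demazure(3)[rule_format, OF intg_tw[OF gn fg(1)] intg_quot[OF gn fg(2)]] by simp_all
      then show "ap (demazure G \<beta> s \<star> y) ?h \<in> Sset G" unfolding e by (intro Sset_add xi_diff_Sset[OF gn c])
    qed
  qed (auto simp: ap_neg ap_add ap_cst_tm D_K intro: Sset_neg Sset_add Sset_mult)
  then show "ap z (\<lambda>u. f u * g u) \<in> Sset G" using assms by blast
qed

lemma intg_right:
  assumes f: "intg f" and y: "y \<in> D" shows "intg (\<lambda>u. ap (eta u \<star> y) f)"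
  unfolding intg_def using intgD[OF f D_tm[OF _ y]] by (simp add: ap_tm[symmetric] D_K y)

definition antip :: "('v aff \<Rightarrow> 'q) \<Rightarrow> 'v aff \<Rightarrow> 'q" where
  "antip f = (\<lambda>u. act G (snd u) (f (aff_inv u)))"

lemma snd_aff_inv: "snd (aff_inv u) = winv (snd u)"
  by (simp add: aff_inv_def)

lemma act_inv_act: "w \<in> W \<Longrightarrow> act G w (act G (winv w) a) = a"
proof -
  assume w: "w \<in> W"
  have "w \<circ> winv w = id" using weyl_inv_comp[OF w] by (simp add: fun_eq_iff)
  then show ?thesis using act_comp[OF w weyl_inv[OF w]] by (simp add: act_id)
qed

lemma aff_inv_mult:
  assumes u: "u \<in> A" and s: "s \<in> A" "aff_mult s s = aff_one"
  shows "aff_inv (aff_mult s u) = aff_mult (aff_inv u) s"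
proof -
  note us = A_W[OF u] and ss = A_W[OF s(1)]
  have s2: "snd s (snd s y) = y" "fst s + snd s (fst s) = 0" for y
    using s(2) by (auto simp: aff_mult_def aff_one_def fun_eq_iff)
  have inv: "winv (snd s \<circ> snd u) = winv (snd u) \<circ> snd s"
  proof (rule ext)
    fix y
    have "y = (snd s \<circ> snd u) ((winv (snd u) \<circ> snd s) y)" by (simp add: weyl_inv_comp[OF us] s2)
    then show "winv (snd s \<circ> snd u) y = (winv (snd u) \<circ> snd s) y"
      using weyl_inv_comp(2)[OF weyl_comp[OF ss us]] by metis
  qed
  note li = weyl_linear[OF weyl_inv[OF us]] and ls = weyl_linear[OF ss]
  have "- fst s = snd s (fst s)" using s2(2) by (simp add: neg_eq_iff_add_eq_0)
  then have "- winv (snd u) (snd s (fst s)) = winv (snd u) (fst s)"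
    by (metis linear_neg[OF li] minus_minus)
  then show ?thesis
    by (simp add: aff_inv_def aff_mult_def inv linear_add[OF li] linear_add[OF ls] s2(1))
qed

text \<open>Inversion exchanges left and right multiplication. The left divided difference of
  \<open>antip f\<close> is therefore \<open>antip\<close> of a right multiple of \<open>f\<close>
  by the Demazure element, and right multiples are integral because \<open>D\<close> is a ring.
  Again the induction runs over all \<open>f\<close>.\<close>

lemma intg_antip:
  assumes "intg f" shows "intg (antip f)"
  unfolding intg_def
proof
  fix z assume "z \<in> D"
  then have "\<forall>f. intg f \<longrightarrow> ap z (antip f) \<in> Sset G"
  proof (induction rule: D_induct)
    case one
    have "f aff_one \<in> Sset G" if "intg f" for f
      using intgD[OF that D_one] by (simp add: cst_def ap_single)
    moreover have "aff_inv aff_one = (aff_one :: 'v aff)" by (simp add: aff_inv_def aff_one_def)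
    ultimately show ?case by (simp add: cst_def ap_single antip_def snd_aff act_id)
  next
    case (demazure \<beta> s y)
    note gn = demazure(1)
    have sA: "s \<in> A" and sW: "snd s \<in> W" and b: "\<beta> \<in> \<Phi>" and ss: "snd s = reflection \<beta>"
      and s2: "aff_mult s s = aff_one" using gensD[OF gn] A_W[OF gensD(2)[OF gn]] by simp_all
    have yK: "y \<in> K" using demazure D_K by blast
    show ?case
    proof (intro allI impI)
      fix f assume f: "intg f"
      \<comment> \<open>The right multiples of \<open>f\<close> by \<open>s\<close> and by the
        Demazure element. For a basis element \<open>v\<close>, the scalar \<open>xi \<beta>\<close>
        emerges from the latter twisted by \<open>snd v\<close>; the twist in \<open>antip\<close>
        turns it back into \<open>xi \<beta>\<close>.\<close>
      define fs where "fs = (\<lambda>v. ap (eta v \<star> eta s) f)"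
      define fX where "fX = (\<lambda>v. ap (eta v \<star> demazure G \<beta> s) f)"
      have fs: "intg fs" unfolding fs_def by (rule intg_right[OF f D_eta[OF sA]])
      have fX: "intg fX" unfolding fX_def by (rule intg_right[OF f D_demazure[OF gn]])
      have fs_eq: "fs v = f (aff_mult v s)" if "v \<in> A" for v
        using that by (simp add: fs_def eta_mult) (simp add: eta_def ap_single)
      have fX_eq: "f v - fs v = act G (snd v) (x \<beta>) * fX v" if v: "v \<in> A" for v
      proof -
        have e: "eta v \<star> demazure G \<beta> s = single v (act G (snd v) (xi \<beta>)) - single (aff_mult v s) (act G (snd v) (xi \<beta>))"
          using v by (simp add: demazure_eq tm_diff_right K_eta) (simp add: eta_def tm_single aff_mult_one)
        have "fX v = act G (snd v) (xi \<beta>) * (f v - fs v)"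
          unfolding fX_def e ap_diff ap_single fs_eq[OF v] by (simp only: right_diff_distrib)
        moreover have "act G (snd v) (x \<beta>) * act G (snd v) (xi \<beta>) = 1"
          using A_W[OF v] x_xi[OF b] by (simp add: act_one flip: act_mult)
        ultimately show ?thesis by (simp flip: mult.assoc)
      qed
      have tw: "tw s (antip f) u = antip fs u" if u: "u \<in> A" for u
      proof -
        have "tw s (antip f) u = act G (snd s) (act G (snd s \<circ> snd u) (f (aff_mult (aff_inv u) s)))"
          by (simp add: tw_def antip_def snd_aff aff_inv_mult[OF u sA s2])
        also have "\<dots> = act G (snd u) (f (aff_mult (aff_inv u) s))"
          using act_reflection_twice[OF b] by (simp add: ss A_W[OF u] weyl_refl[OF b] flip: act_comp)
        finally show ?thesis by (simp add: antip_def fs_eq aff_inv_A u)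
      qed
      have keysA: "u \<in> A" if "u \<in> keys y" for u using yK that by (auto simp: K_iff)
      define c where "c = ap y (antip fs)"
      have c: "c \<in> Sset G" unfolding c_def using demazure fs by blast
      have "ap (demazure G \<beta> s \<star> y) (antip f) = xi \<beta> * (ap y (antip f) - act G (reflection \<beta>) c)"
        using ap_cong[of y "tw s (antip f)" "antip fs"] tw keysA by (simp add: ap_demazure[OF gn yK] c_def)
      also have "\<dots> = xi \<beta> * (ap y (antip f) - c) + xi \<beta> * (c - act G (reflection \<beta>) c)"
        by (simp add: algebra_simps)
      also have "xi \<beta> * (ap y (antip f) - c) = ap y (\<lambda>u. xi \<beta> * (antip f u - antip fs u))"
        by (simp add: c_def ap_fun_scale ap_fun_diff)
      also have "\<dots> = ap y (antip fX)"
      proof (rule ap_cong)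
        fix u assume "u \<in> keys y"
        then have u: "u \<in> A" by (rule keysA)
        have "antip f u - antip fs u = act G (snd u) (f (aff_inv u) - fs (aff_inv u))"
          by (simp add: antip_def act_diff A_W u)
        also have "\<dots> = x \<beta> * antip fX u"
          by (simp add: fX_eq aff_inv_A u act_mult A_W snd_aff_inv act_inv_act antip_def)
        finally have "xi \<beta> * (antip f u - antip fs u) = (x \<beta> * xi \<beta>) * antip fX u" by (simp add: mult_ac)
        then show "xi \<beta> * (antip f u - antip fs u) = antip fX u" using x_xi[OF b] by simp
      qed
      finally show "ap (demazure G \<beta> s \<star> y) (antip f) \<in> Sset G"
        using demazure(3) fX xi_diff_Sset[OF gn c] by (simp add: Sset_add)
    qed
  qed (auto simp: ap_neg ap_add ap_cst_tm D_K intro: Sset_neg Sset_add Sset_mult)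
  then show "ap z (antip f) \<in> Sset G" using assms by blast
qed

end

section \<open>Dual modules and completed tensor squares\<close>

lemma dual_simps:
  "add (dual G D) f g = (\<lambda>z\<in>D. f z + g z)"
  "zero (dual G D) = (\<lambda>z\<in>D. 0)"
  "mult (dual G D) f g = functional D (\<lambda>u. f (eta u) * g (eta u))"
  "one (dual G D) = functional D (\<lambda>_. 1)"
  "smult (dual G D) a f = (\<lambda>z\<in>D. a * f z)"
  "tsq (dual G D) = dual_tsq G D"
  "tens (dual G D) f g = (\<lambda>(z, y)\<in>D \<times> D. f (z \<otimes>\<^bsub>QWa G\<^esub> cst (g y)))"
  "comult (dual G D) f = (\<lambda>(z, y)\<in>D \<times> D. f (z \<otimes>\<^bsub>QWa G\<^esub> y))"
  "counit (dual G D) f = f (eta aff_one)"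
  "antipode (dual G D) f = functional D (\<lambda>u. act G (snd u) (f (eta (aff_inv u))))"
  by (simp_all add: dual_def)

lemma tsq_simps:
  "mult (dual_tsq G D) \<Psi> \<Psi>' = (\<lambda>p\<in>D \<times> D. \<Psi> p + \<Psi>' p)"
  "one (dual_tsq G D) = (\<lambda>p\<in>D \<times> D. 0)"
  by (simp_all add: dual_tsq_def)

lemma functional_ap: "functional D g = (\<lambda>z\<in>D. ap z g)"
  by (simp add: functional_def ap_def)

context affine_setup
begin

lemma dual_iff: "f \<in> carrier (dual G D') \<longleftrightarrow> f \<in> extensional D' \<and> (\<forall>z\<in>D'. f z \<in> Sset G) \<and>
    (\<forall>z\<in>D'. \<forall>z'\<in>D'. f (z + z') = f z + f z') \<and> (\<forall>a\<in>Sset G. \<forall>z\<in>D'. f (cst a \<star> z) = a * f z)"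
  by (simp add: dual_def)

lemma dualD:
  assumes "f \<in> carrier (dual G D')"
  shows "f \<in> extensional D'" "z \<in> D' \<Longrightarrow> f z \<in> Sset G" "z \<in> D' \<Longrightarrow> z' \<in> D' \<Longrightarrow> f (z + z') = f z + f z'"
    "a \<in> Sset G \<Longrightarrow> z \<in> D' \<Longrightarrow> f (cst a \<star> z) = a * f z"
  using assms unfolding dual_iff by blast+

lemma tsq_iff: "\<Psi> \<in> carrier (dual_tsq G D') \<longleftrightarrow> \<Psi> \<in> extensional (D' \<times> D') \<and>
    (\<forall>z\<in>D'. \<forall>y\<in>D'. \<Psi> (z, y) \<in> Sset G) \<and>
    (\<forall>z\<in>D'. \<forall>z'\<in>D'. \<forall>y\<in>D'. \<Psi> (z + z', y) = \<Psi> (z, y) + \<Psi> (z', y) \<and> \<Psi> (y, z + z') = \<Psi> (y, z) + \<Psi> (y, z')) \<and>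
    (\<forall>a\<in>Sset G. \<forall>z\<in>D'. \<forall>y\<in>D'. \<Psi> (cst a \<star> z, y) = a * \<Psi> (z, y) \<and> \<Psi> (z \<star> cst a, y) = \<Psi> (z, cst a \<star> y))"
  by (simp add: dual_tsq_def)

lemma tsqD:
  assumes "\<Psi> \<in> carrier (dual_tsq G D')"
  shows "\<Psi> \<in> extensional (D' \<times> D')" "z \<in> D' \<Longrightarrow> y \<in> D' \<Longrightarrow> \<Psi> (z, y) \<in> Sset G"
    "z \<in> D' \<Longrightarrow> z' \<in> D' \<Longrightarrow> y \<in> D' \<Longrightarrow> \<Psi> (z + z', y) = \<Psi> (z, y) + \<Psi> (z', y)"
    "z \<in> D' \<Longrightarrow> z' \<in> D' \<Longrightarrow> y \<in> D' \<Longrightarrow> \<Psi> (y, z + z') = \<Psi> (y, z) + \<Psi> (y, z')"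
    "a \<in> Sset G \<Longrightarrow> z \<in> D' \<Longrightarrow> y \<in> D' \<Longrightarrow> \<Psi> (cst a \<star> z, y) = a * \<Psi> (z, y)"
    "a \<in> Sset G \<Longrightarrow> z \<in> D' \<Longrightarrow> y \<in> D' \<Longrightarrow> \<Psi> (z \<star> cst a, y) = \<Psi> (z, cst a \<star> y)"
  using assms unfolding tsq_iff by blast+

text \<open>What \<open>DWa G\<close> and \<open>DQ G\<close> have in common, so that both duals are
  handled together. Containing the \<open>eta u\<close> for all \<open>u\<close> in the support of
  an element allows functionals to be evaluated term by term.\<close>

definition good :: "('v, 'q) tga set \<Rightarrow> bool" where
  "good D' \<longleftrightarrow> D' \<subseteq> D \<and> 0 \<in> D' \<and> (\<forall>y\<in>D'. \<forall>z\<in>D'. y + z \<in> D' \<and> y \<star> z \<in> D') \<and>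
     (\<forall>a\<in>Sset G. cst a \<in> D') \<and> (\<forall>z\<in>D'. \<forall>u\<in>keys z. eta u \<in> D')"

lemma goodD:
  assumes "good D'"
  shows "z \<in> D' \<Longrightarrow> z \<in> D" "0 \<in> D'" "y \<in> D' \<Longrightarrow> z \<in> D' \<Longrightarrow> y + z \<in> D'" "y \<in> D' \<Longrightarrow> z \<in> D' \<Longrightarrow> y \<star> z \<in> D'"
    "a \<in> Sset G \<Longrightarrow> cst a \<in> D'" "z \<in> D' \<Longrightarrow> u \<in> keys z \<Longrightarrow> eta u \<in> D'"
  using assms unfolding good_def by blast+

lemma good_D: "good D"
  unfolding good_def using D_zero D_add D_tm D_cst D_eta D_K by (auto simp: K_iff subset_iff)

lemma good_K: "good D' \<Longrightarrow> z \<in> D' \<Longrightarrow> z \<in> K"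
  using goodD(1) D_K by blast

lemma additive_sum:
  assumes D': "good D'" and f: "\<And>y z. y \<in> D' \<Longrightarrow> z \<in> D' \<Longrightarrow> f (y + z) = f y + (f z :: 'q)"
    and g: "\<And>i. i \<in> B \<Longrightarrow> g i \<in> D'"
  shows "f (sum g B) = (\<Sum>i\<in>B. f (g i)) \<and> sum g B \<in> D'"
proof -
  have "f 0 = 0" using f[OF goodD(2)[OF D'] goodD(2)[OF D']] by simp
  then show ?thesis using g
  proof (induction B rule: infinite_finite_induct)
    case (insert i B)
    then have "sum g B \<in> D'" "f (sum g B) = (\<Sum>i\<in>B. f (g i))" "g i \<in> D'" by auto
    then show ?case using insert.hyps f[of "g i" "sum g B"] goodD(3)[OF D'] by simp
  qed (auto simp: goodD(2)[OF D'])
qed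

text \<open>A functional is determined by its values on the \<open>\<eta>\<^sub>u\<close>, since denominators can be cleared.\<close>

lemma dual_ap:
  assumes D': "good D'" and f: "f \<in> carrier (dual G D')" and z: "z \<in> D'"
  shows "f z = ap z (\<lambda>u. f (eta u))"
proof -
  obtain m where m: "m dvd 1" "m \<in> Sset G" "\<And>u. m * lookup z u \<in> Sset G" using common_denominator by blast
  have g: "cst (m * lookup z u) \<star> eta u \<in> D'" if "u \<in> keys z" for u
    by (intro goodD[OF D'] m) (rule z that)+
  have "cst m \<star> z = cst m \<star> (\<Sum>u\<in>keys z. single u (lookup z u))" by (simp flip: poly_mapping_expand)
  also have "\<dots> = (\<Sum>u\<in>keys z. cst (m * lookup z u) \<star> eta u)"
    by (simp add: tm_sum_right K_cst cst_tm_single flip: single_eta)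
  finally have e: "cst m \<star> z = (\<Sum>u\<in>keys z. cst (m * lookup z u) \<star> eta u)" .
  have "m * f z = f (cst m \<star> z)" using dualD(4)[OF f m(2) z] by simp
  also have "\<dots> = (\<Sum>u\<in>keys z. f (cst (m * lookup z u) \<star> eta u))"
    unfolding e using additive_sum[OF D', of f "keys z"] dualD(3)[OF f] g by simp
  also have "\<dots> = (\<Sum>u\<in>keys z. m * (lookup z u * f (eta u)))"
    by (rule sum.cong) (simp_all add: dualD(4)[OF f] m goodD(6)[OF D' z] mult.assoc)
  also have "\<dots> = m * ap z (\<lambda>u. f (eta u))" by (simp add: ap_def sum_distrib_left)
  finally show ?thesis by (rule unit_cancel[OF m(1)])
qed

lemma ap_eta: "ap (eta u) g = g u"
  by (simp add: eta_def ap_single)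

lemma functional_dual:
  assumes D': "good D'" and g: "\<And>z. z \<in> D' \<Longrightarrow> ap z g \<in> Sset G"
  shows "functional D' g \<in> carrier (dual G D')"
  unfolding dual_iff functional_ap
  using g by (auto simp: goodD[OF D'] ap_add ap_cst_tm good_K[OF D'])

lemma dual_intg: "f \<in> carrier (dual G D) \<Longrightarrow> intg (\<lambda>u. f (eta u))"
  unfolding intg_def using dual_ap[OF good_D, of f] dualD(2)[of f D] by simp

lemma intg_dual: "intg g \<Longrightarrow> functional D g \<in> carrier (dual G D)"
  by (rule functional_dual[OF good_D]) (rule intgD)

lemma dual_abelian:
  assumes D': "good D'" shows "abelian_group (dual G D')"
proof (rule abelian_groupI)
  note gd = goodD[OF D']
  show "\<zero>\<^bsub>dual G D'\<^esub> \<in> carrier (dual G D')"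
    by (auto simp: dual_iff dual_simps gd Sset_zero)
  fix f g h assume f: "f \<in> carrier (dual G D')"
  show "\<zero>\<^bsub>dual G D'\<^esub> \<oplus>\<^bsub>dual G D'\<^esub> f = f"
    by (rule extensionalityI[of _ D']) (auto simp: dual_simps dualD(1)[OF f])
  show "\<exists>y\<in>carrier (dual G D'). y \<oplus>\<^bsub>dual G D'\<^esub> f = \<zero>\<^bsub>dual G D'\<^esub>"
    by (rule bexI[of _ "\<lambda>z\<in>D'. - f z"])
      (auto simp: dual_simps dual_iff gd Sset_neg dualD[OF f] intro!: restrict_ext)
  assume g: "g \<in> carrier (dual G D')"
  show "f \<oplus>\<^bsub>dual G D'\<^esub> g \<in> carrier (dual G D')"
    by (auto simp: dual_simps dual_iff gd Sset_add dualD(2-)[OF f] dualD(2-)[OF g] algebra_simps)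
  show "f \<oplus>\<^bsub>dual G D'\<^esub> g = g \<oplus>\<^bsub>dual G D'\<^esub> f" by (simp add: dual_simps add.commute)
  assume h: "h \<in> carrier (dual G D')"
  show "f \<oplus>\<^bsub>dual G D'\<^esub> g \<oplus>\<^bsub>dual G D'\<^esub> h = f \<oplus>\<^bsub>dual G D'\<^esub> (g \<oplus>\<^bsub>dual G D'\<^esub> h)"
    by (auto simp: dual_simps add.assoc intro!: restrict_ext)
qed

lemma dual_a_inv:
  assumes D': "good D'" and f: "f \<in> carrier (dual G D')"
  shows "\<ominus>\<^bsub>dual G D'\<^esub> f = (\<lambda>z\<in>D'. - f z)"
  by (rule abelian_group.minus_equality[OF dual_abelian[OF D']])
    (use f in \<open>auto simp: dual_simps dual_iff goodD[OF D'] Sset_neg dualD(2-)[OF f] intro!: restrict_ext\<close>)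

lemma dual_minus:
  assumes "good D'" "f \<in> carrier (dual G D')" "g \<in> carrier (dual G D')"
  shows "f \<ominus>\<^bsub>dual G D'\<^esub> g = (\<lambda>z\<in>D'. f z - g z)"
  unfolding a_minus_def dual_a_inv[OF assms(1,3)] dual_simps by (rule restrict_ext) simp

lemma tsq_group:
  assumes D': "good D'" shows "group (dual_tsq G D')"
proof (rule groupI)
  note gd = goodD[OF D']
  show "\<one>\<^bsub>dual_tsq G D'\<^esub> \<in> carrier (dual_tsq G D')"
    by (auto simp: tsq_iff tsq_simps gd Sset_zero)
  fix f g h assume f: "f \<in> carrier (dual_tsq G D')"
  show "\<one>\<^bsub>dual_tsq G D'\<^esub> \<otimes>\<^bsub>dual_tsq G D'\<^esub> f = f"
    by (rule extensionalityI[of _ "D' \<times> D'"]) (auto simp: tsq_simps tsqD(1)[OF f])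
  show "\<exists>y\<in>carrier (dual_tsq G D'). y \<otimes>\<^bsub>dual_tsq G D'\<^esub> f = \<one>\<^bsub>dual_tsq G D'\<^esub>"
    by (rule bexI[of _ "\<lambda>z\<in>D' \<times> D'. - f z"])
      (auto simp: tsq_simps tsq_iff gd Sset_neg tsqD(2-)[OF f] intro!: restrict_ext)
  assume g: "g \<in> carrier (dual_tsq G D')"
  show "f \<otimes>\<^bsub>dual_tsq G D'\<^esub> g \<in> carrier (dual_tsq G D')"
    by (auto simp: tsq_simps tsq_iff gd Sset_add tsqD(2-)[OF f] tsqD(2-)[OF g] algebra_simps)
  assume h: "h \<in> carrier (dual_tsq G D')"
  show "f \<otimes>\<^bsub>dual_tsq G D'\<^esub> g \<otimes>\<^bsub>dual_tsq G D'\<^esub> h = f \<otimes>\<^bsub>dual_tsq G D'\<^esub> (g \<otimes>\<^bsub>dual_tsq G D'\<^esub> h)"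
    by (auto simp: tsq_simps add.assoc intro!: restrict_ext)
qed

lemma tsq_inv:
  assumes D': "good D'" and f: "f \<in> carrier (dual_tsq G D')"
  shows "inv\<^bsub>dual_tsq G D'\<^esub> f = (\<lambda>z\<in>D' \<times> D'. - f z)"
  by (rule group.inv_equality[OF tsq_group[OF D']])
    (use f in \<open>auto simp: tsq_simps tsq_iff goodD[OF D'] Sset_neg tsqD(2-)[OF f] intro!: restrict_ext\<close>)

lemma tsqI:
  assumes D': "good D'" and "\<And>z y. z \<in> D' \<Longrightarrow> y \<in> D' \<Longrightarrow> H z y \<in> Sset G"
    and "\<And>z z' y. z \<in> D' \<Longrightarrow> z' \<in> D' \<Longrightarrow> y \<in> D' \<Longrightarrow> H (z + z') y = H z y + H z' y"
    and "\<And>z z' y. z \<in> D' \<Longrightarrow> z' \<in> D' \<Longrightarrow> y \<in> D' \<Longrightarrow> H y (z + z') = H y z + H y z'"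
    and "\<And>a z y. a \<in> Sset G \<Longrightarrow> z \<in> D' \<Longrightarrow> y \<in> D' \<Longrightarrow> H (cst a \<star> z) y = a * H z y"
    and "\<And>a z y. a \<in> Sset G \<Longrightarrow> z \<in> D' \<Longrightarrow> y \<in> D' \<Longrightarrow> H (z \<star> cst a) y = H z (cst a \<star> y)"
  shows "(\<lambda>(z, y)\<in>D' \<times> D'. H z y) \<in> carrier (dual_tsq G D')"
  unfolding tsq_iff using assms(2-) by (simp add: goodD[OF D'])

lemma tsq_dual:
  assumes D': "good D'" and P: "\<Psi> \<in> carrier (dual_tsq G D')" and y: "y \<in> D'"
  shows "(\<lambda>z\<in>D'. \<Psi> (z, y)) \<in> carrier (dual G D')"
  unfolding dual_iff using y by (simp add: goodD[OF D'] tsqD(2-)[OF P])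

text \<open>With the second argument fixed, a balanced map is a functional of the first. In the
  second argument no such expansion is available, since scalars there are twisted by the
  first.\<close>

lemma tsq_ap:
  assumes D': "good D'" and P: "\<Psi> \<in> carrier (dual_tsq G D')" and y: "y \<in> D'" and z: "z \<in> D'"
  shows "\<Psi> (z, y) = ap z (\<lambda>u. \<Psi> (eta u, y))"
proof -
  have "\<Psi> (z, y) = ap z (\<lambda>u. (\<lambda>z\<in>D'. \<Psi> (z, y)) (eta u))"
    using dual_ap[OF D' tsq_dual[OF D' P y] z] z by simp
  also have "\<dots> = ap z (\<lambda>u. \<Psi> (eta u, y))" by (rule ap_cong) (simp add: goodD(6)[OF D' z])
  finally show ?thesis .
qed

end

section \<open>Consequences of one fixed decomposition of 1 into invariant elements\<close>

locale affine_basis = affine_setup G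
  for G :: "('v::euclidean_space, 'r::{comm_ring_1, ring_char_0}, 'q::comm_ring_1) affine_datum" +
  fixes N :: nat and b :: "nat \<Rightarrow> 'q" and d :: "nat \<Rightarrow> ('v, 'q) tga"
  assumes b: "i < N \<Longrightarrow> b i \<in> Sset G" and d: "i < N \<Longrightarrow> d i \<in> inv_el"
    and one_eq: "cst 1 = (\<Sum>i<N. cst (b i) \<star> d i)"
begin

lemma d_K: "i < N \<Longrightarrow> d i \<in> K" and d_D: "i < N \<Longrightarrow> d i \<in> D"
  using d inv_el_K inv_el_D by auto

text \<open>The decomposition of 1 multiplied by \<open>w\<close> from the left: \<open>w\<close>
  acts on the scalars and is absorbed by the \<open>d i\<close>.\<close>

lemma eta_expand:
  assumes w: "w \<in> W" shows "(\<Sum>i<N. cst (act G w (b i)) \<star> d i) = eta (0, w)"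
proof -
  have e: "eta (0, w) \<in> K" by (intro K_eta W_A w)
  have "eta (0, w) \<star> (cst (b i) \<star> d i) = cst (act G w (b i)) \<star> d i" if i: "i < N" for i
  proof -
    have "eta (0, w) \<star> (cst (b i) \<star> d i) = (eta (0, w) \<star> cst (b i)) \<star> d i"
      by (rule tm_assoc[symmetric, OF e K_cst d_K[OF i]])
    also have "\<dots> = (cst (act G w (b i)) \<star> eta (0, w)) \<star> d i"
      using eta_tm_cst[OF W_A[OF w], of "b i"] by simp
    also have "\<dots> = cst (act G w (b i)) \<star> d i"
      using tm_assoc[OF K_cst e d_K[OF i]] inv_el_eta[OF d[OF i] w] by simp
    finally show ?thesis .
  qed
  then have "(\<Sum>i<N. cst (act G w (b i)) \<star> d i) = eta (0, w) \<star> cst 1"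
    unfolding one_eq tm_sum_right[OF e] by simp
  then show ?thesis by (simp add: tm_one e)
qed

text \<open>A translation commutes with scalars, so the \<open>b i\<close> may be moved to its
  left.\<close>

lemma trans_expand:
  assumes p: "p \<in> trans" shows "p = (\<Sum>i<N. cst (b i) \<star> (p \<star> d i))"
proof -
  have pK: "p \<in> K" by (rule trans_K[OF p])
  have "p \<star> (cst (b i) \<star> d i) = cst (b i) \<star> (p \<star> d i)" if i: "i < N" for i
    using tm_assoc[OF pK K_cst d_K[OF i]] tm_assoc[OF K_cst pK d_K[OF i]] trans_cst_commute[OF p, of "b i"]
    by metis
  then have "p \<star> cst 1 = (\<Sum>i<N. cst (b i) \<star> (p \<star> d i))" unfolding one_eq tm_sum_right[OF pK] by simp
  then show ?thesis by (simp only: tm_one[OF pK])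
qed

lemma tproj_expand: "z \<in> K \<Longrightarrow> tproj z = (\<Sum>i<N. cst (b i) \<star> (z \<star> d i))"
  using trans_expand[OF tproj_trans, of z] by (simp add: tproj_tm_inv d)

lemma pi_D:
  assumes z: "z \<in> D" shows "tproj z \<in> D"
  unfolding tproj_expand[OF D_K[OF z]] by (intro D_sum D_tm D_cst z) (simp_all add: b d_D)

lemma K_expand:
  assumes z: "z \<in> K" shows "z = (\<Sum>i<N. tproj (z \<star> cst (b i)) \<star> d i)"
proof -
  have "tproj (z \<star> cst (b i)) \<star> d i = z \<star> (cst (b i) \<star> d i)" if i: "i < N" for i
    using tproj_tm_inv[OF K_tm[OF z K_cst] d[OF i]] tm_assoc[OF z K_cst d_K[OF i]] by simp
  then have "(\<Sum>i<N. tproj (z \<star> cst (b i)) \<star> d i) = z \<star> cst 1" unfolding one_eq tm_sum_right[OF z] by simp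
  then show ?thesis by (simp only: tm_one[OF z])
qed

abbreviation "Q \<equiv> DQ G"

text \<open>The projection maps \<open>D\<close> into itself and fixes combinations of translations.
  As an intersection of two subrings, \<open>Q\<close> is a subring.\<close>

lemma Q_iff: "p \<in> Q \<longleftrightarrow> p \<in> D \<and> p \<in> trans"
proof
  assume "p \<in> Q"
  then obtain z where "z \<in> D" "p = tproj z" by (auto simp: DQ_eq)
  then show "p \<in> D \<and> p \<in> trans" using pi_D tproj_trans D_K by blast
next
  assume "p \<in> D \<and> p \<in> trans"
  then show "p \<in> Q" using tproj_id unfolding DQ_eq by (metis image_eqI)
qed

lemma Q_D: "p \<in> Q \<Longrightarrow> p \<in> D" and Q_trans: "p \<in> Q \<Longrightarrow> p \<in> trans"
  by (simp_all add: Q_iff)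

lemma pi_Q: "z \<in> D \<Longrightarrow> tproj z \<in> Q"
  by (simp add: DQ_eq)

lemma Q_eta: "\<mu> \<in> L \<Longrightarrow> eta (\<mu>, id) \<in> Q"
  by (simp add: Q_iff D_eta L_A eta_trans)

lemma good_Q: "good Q"
  unfolding good_def
proof (intro conjI ballI)
  show "Q \<subseteq> D" using Q_D by blast
  show "0 \<in> Q" by (simp add: Q_iff D_zero trans_zero)
next
  fix y z assume "y \<in> Q" "z \<in> Q"
  then show "y + z \<in> Q" "y \<star> z \<in> Q" by (auto simp: Q_iff intro: D_add D_tm trans_add trans_tm)
next
  fix a assume "a \<in> Sset G"
  then show "cst a \<in> Q" by (simp add: Q_iff D_cst cst_trans)
next
  fix z u assume "z \<in> Q" "u \<in> keys z"
  then have "fst u \<in> L" "u = (fst u, id)" by (auto simp: Q_iff trans_def)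
  then show "eta u \<in> Q" using Q_eta by metis
qed

lemmas gQ = goodD[OF good_Q] and gD = goodD[OF good_D]

lemma keys_Q: "p \<in> Q \<Longrightarrow> u \<in> keys p \<Longrightarrow> u = (fst u, id) \<and> fst u \<in> L"
  using Q_trans by (fastforce simp: trans_def)

lemma keys_D: "z \<in> D \<Longrightarrow> u \<in> keys z \<Longrightarrow> u \<in> A"
  using D_K by (auto simp: K_iff)

abbreviation "Dd \<equiv> carrier (dual G D)"
abbreviation "Dq \<equiv> carrier (dual G Q)"
abbreviation "Td \<equiv> carrier (dual_tsq G D)"
abbreviation "Tq \<equiv> carrier (dual_tsq G Q)"

subsection \<open>The kernel of restriction\<close>

lemma res_Dq: "f \<in> Dd \<Longrightarrow> res G f \<in> Dq"
  unfolding dual_iff res_def by (auto simp: gQ Q_D)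

lemma res_surj: "res G ` Dd = Dq"
proof
  show "res G ` Dd \<subseteq> Dq" using res_Dq by blast
  show "Dq \<subseteq> res G ` Dd"
  proof
    fix g assume g: "g \<in> Dq"
    define f where "f = (\<lambda>z\<in>D. g (tproj z))"
    have "f \<in> Dd" unfolding dual_iff f_def
      by (simp add: gD pi_Q dualD(2-)[OF g] tproj_add tproj_cst_tm D_K)
    moreover have "res G f = g"
      by (rule extensionalityI[of _ Q])
        (auto simp: res_def f_def Q_D tproj_id Q_trans dualD(1)[OF g])
    ultimately show "g \<in> res G ` Dd" by blast
  qed
qed

text \<open>In this form the action needs no values at group elements and extends to maps of two
  arguments.\<close>

lemma bullet_eq:
  assumes f: "f \<in> Dd" and a: "a \<in> Sset G" shows "bullet G a f = (\<lambda>z\<in>D. f (z \<star> cst a))"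
  unfolding bullet_def functional_ap
proof (rule restrict_ext)
  fix z assume z: "z \<in> D"
  show "ap z (\<lambda>u. act G (snd u) a * f (eta u)) = f (z \<star> cst a)"
    using dual_ap[OF good_D f D_tm[OF z D_cst[OF a]]] by (simp add: ap_tm_cst D_K z)
qed

lemma bullet_dual:
  assumes f: "f \<in> Dd" and a: "a \<in> Sset G" shows "bullet G a f \<in> Dd"
  unfolding bullet_eq[OF assms] dual_iff
  by (simp add: gD a dualD(2-)[OF f] tm_add_left tm_assoc K_cst D_K)

lemma smult_dual:
  assumes "good D'" "f \<in> carrier (dual G D')" "a \<in> Sset G" shows "(\<lambda>z\<in>D'. a * f z) \<in> carrier (dual G D')"
  unfolding dual_iff by (simp add: goodD[OF assms(1)] dualD(2-)[OF assms(2)] Sset_mult assms(3) algebra_simps)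

lemma comm_gen:
  assumes f: "f \<in> Dd" and a: "a \<in> Sset G"
  shows "bullet G a f \<ominus>\<^bsub>dual G D\<^esub> (a \<odot>\<^bsub>dual G D\<^esub> f) = (\<lambda>z\<in>D. f (z \<star> cst a) - a * f z)"
proof -
  have s: "a \<odot>\<^bsub>dual G D\<^esub> f \<in> Dd" using smult_dual[OF good_D f a] by (simp add: dual_simps)
  show ?thesis unfolding dual_minus[OF good_D bullet_dual[OF f a] s]
    by (rule restrict_ext) (simp add: bullet_eq f a dual_simps)
qed

lemma comm_sub_gen: "f \<in> Dd \<Longrightarrow> a \<in> Sset G \<Longrightarrow> (\<lambda>z\<in>D. f (z \<star> cst a) - a * f z) \<in> comm_sub G"
  unfolding comm_sub_def by (rule generate.incl) (use comm_gen in force)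

lemma add_monoid_one: "\<one>\<^bsub>add_monoid (dual G D)\<^esub> = (\<lambda>z\<in>D. 0)"
  using dual_simps(2)[of G D] by simp

lemma comm_sub_sum:
  "(\<And>i. i < (n::nat) \<Longrightarrow> (\<lambda>z\<in>D. Cf i z) \<in> comm_sub G) \<Longrightarrow> (\<lambda>z\<in>D. \<Sum>i<n. Cf i z) \<in> comm_sub G"
proof (induction n)
  case 0
  have "(\<lambda>z\<in>D. \<Sum>i<(0::nat). Cf i z) = \<one>\<^bsub>add_monoid (dual G D)\<^esub>"
    unfolding add_monoid_one by (rule restrict_ext) simp
  moreover have "\<one>\<^bsub>add_monoid (dual G D)\<^esub> \<in> comm_sub G" unfolding comm_sub_def by (rule generate.one)
  ultimately show ?case by (simp only:)
next
  case (Suc n)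
  have "(\<lambda>z\<in>D. (\<lambda>z\<in>D. \<Sum>i<n. Cf i z) z + (\<lambda>z\<in>D. Cf n z) z) \<in> comm_sub G"
    using generate.eng[OF Suc.IH[unfolded comm_sub_def] Suc.prems[of n, unfolded comm_sub_def]] Suc.prems
    by (simp add: comm_sub_def dual_simps)
  moreover have "(\<lambda>z\<in>D. (\<lambda>z\<in>D. \<Sum>i<n. Cf i z) z + (\<lambda>z\<in>D. Cf n z) z) = (\<lambda>z\<in>D. \<Sum>i<Suc n. Cf i z)"
    by (rule restrict_ext) simp
  ultimately show ?case by (simp only:)
qed

text \<open>Generators vanish on \<open>Q\<close> because scalars commute with translations. For the
  converse, the \<open>c i\<close> below express a functional vanishing on \<open>Q\<close> through
  commutators.\<close>

lemma comm_sub_eq: "comm_sub G = {f \<in> Dd. \<forall>p\<in>Q. f p = 0}"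
proof
  show "comm_sub G \<subseteq> {f \<in> Dd. \<forall>p\<in>Q. f p = 0}"
  proof
    have gens: "h \<in> Dd \<and> (\<forall>p\<in>Q. h p = 0)"
      if h: "h \<in> {bullet G a f \<ominus>\<^bsub>dual G D\<^esub> (a \<odot>\<^bsub>dual G D\<^esub> f) | a f. a \<in> Sset G \<and> f \<in> Dd}" for h
    proof -
      obtain a f where af: "a \<in> Sset G" "f \<in> Dd" "h = bullet G a f \<ominus>\<^bsub>dual G D\<^esub> (a \<odot>\<^bsub>dual G D\<^esub> f)" using h by blast
      have "h \<in> Dd" unfolding af(3)
        by (intro abelian_group.minus_closed[OF dual_abelian[OF good_D]] bullet_dual af)
          (unfold dual_simps, rule smult_dual[OF good_D af(2,1)])
      moreover have "h p = 0" if "p \<in> Q" for p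
        using af(1,2) that unfolding af(3) comm_gen[OF af(2,1)]
        by (simp add: Q_D trans_cst_commute Q_trans dualD(4)[OF af(2)])
      ultimately show ?thesis by blast
    qed
    fix f assume "f \<in> comm_sub G"
    then show "f \<in> {f \<in> Dd. \<forall>p\<in>Q. f p = 0}" unfolding comm_sub_def
    proof (induction rule: generate.induct)
      case one
      have "(\<lambda>z\<in>D. 0) \<in> Dd"
        using abelian_monoid.zero_closed[OF abelian_group.axioms(1)[OF dual_abelian[OF good_D]]]
        unfolding dual_simps .
      then show ?case unfolding add_monoid_one
        by (intro CollectI conjI ballI) (assumption, simp add: Q_D)
    next
      case (incl h)
      then show ?case using gens[of h] by (intro CollectI) simp
    next
      case (inv h)
      then have h: "h \<in> Dd" "\<forall>p\<in>Q. h p = 0" using gens[of h] by simp_all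
      have e: "inv\<^bsub>add_monoid (dual G D)\<^esub> h = (\<lambda>z\<in>D. - h z)"
        using dual_a_inv[OF good_D h(1)] by (simp only: a_inv_def)
      have "(\<lambda>z\<in>D. - h z) \<in> Dd"
        using abelian_group.a_inv_closed[OF dual_abelian[OF good_D] h(1)] by (simp only: dual_a_inv[OF good_D h(1)])
      then show ?case unfolding e
        by (intro CollectI conjI ballI) (assumption, simp add: Q_D h)
    next
      case (eng f g)
      then have "f \<oplus>\<^bsub>dual G D\<^esub> g \<in> Dd"
        by (intro abelian_monoid.a_closed[OF abelian_group.axioms(1)[OF dual_abelian[OF good_D]]]) auto
      then show ?case using eng by (intro CollectI conjI ballI) (simp, simp add: dual_simps Q_D)
    qed
  qed
  show "{f \<in> Dd. \<forall>p\<in>Q. f p = 0} \<subseteq> comm_sub G"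
  proof
    fix f assume "f \<in> {f \<in> Dd. \<forall>p\<in>Q. f p = 0}"
    then have f: "f \<in> Dd" and f0: "\<And>p. p \<in> Q \<Longrightarrow> f p = 0" by auto
    define c where "c i = (\<lambda>z\<in>D. f (tproj z \<star> d i))" for i
    have c: "c i \<in> Dd" if i: "i < N" for i
      unfolding dual_iff c_def
      by (simp add: gD pi_D d_D i dualD(2-)[OF f] tproj_add tm_add_left tproj_cst_tm D_K tm_assoc K_cst d_K)
    have "(\<lambda>z\<in>D. \<Sum>i<N. (c i (z \<star> cst (b i)) - b i * c i z)) \<in> comm_sub G"
      by (rule comm_sub_sum) (rule comm_sub_gen[OF c b])
    moreover have "(\<lambda>z\<in>D. \<Sum>i<N. (c i (z \<star> cst (b i)) - b i * c i z)) = f"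
    proof (rule extensionalityI[of _ D])
      fix z assume z: "z \<in> D"
      have "(\<Sum>i<N. c i (z \<star> cst (b i))) = (\<Sum>i<N. f (tproj (z \<star> cst (b i)) \<star> d i))"
        by (rule sum.cong) (simp_all add: c_def D_tm z D_cst b)
      also have "\<dots> = f (\<Sum>i<N. tproj (z \<star> cst (b i)) \<star> d i)"
        using additive_sum[OF good_D dualD(3)[OF f], of "{..<N}" "\<lambda>i. tproj (z \<star> cst (b i)) \<star> d i"]
        by (simp add: D_tm pi_D z D_cst b d_D)
      also have "\<dots> = f z" by (simp flip: K_expand add: D_K z)
      finally have 1: "(\<Sum>i<N. c i (z \<star> cst (b i))) = f z" .
      have "(\<Sum>i<N. b i * c i z) = (\<Sum>i<N. f (cst (b i) \<star> (tproj z \<star> d i)))"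
        by (rule sum.cong) (simp_all add: c_def z dualD(4)[OF f] b D_tm pi_D d_D)
      also have "\<dots> = f (\<Sum>i<N. cst (b i) \<star> (tproj z \<star> d i))"
        using additive_sum[OF good_D dualD(3)[OF f], of "{..<N}" "\<lambda>i. cst (b i) \<star> (tproj z \<star> d i)"]
        by (simp add: D_tm pi_D z D_cst b d_D)
      also have "\<dots> = f (tproj z)" by (simp flip: trans_expand add: tproj_trans D_K z)
      also have "\<dots> = 0" by (rule f0[OF pi_Q[OF z]])
      finally show "(\<lambda>z\<in>D. \<Sum>i<N. (c i (z \<star> cst (b i)) - b i * c i z)) z = f z"
        using 1 z by (simp add: sum_subtractf)
    qed (simp_all add: dualD(1)[OF f])
    ultimately show "f \<in> comm_sub G" by simp
  qed
qed

subsection \<open>Extension of bilinear maps and the kernel in degree two\<close>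

text \<open>On \<open>Q\<close> scalars are central, so a balanced map is linear over
  \<open>S\<close> in both arguments.\<close>

definition bil :: "(('v, 'q) tga \<Rightarrow> ('v, 'q) tga \<Rightarrow> 'q) \<Rightarrow> bool" where
  "bil H \<longleftrightarrow> (\<forall>p\<in>Q. \<forall>q\<in>Q. H p q \<in> Sset G) \<and>
     (\<forall>p\<in>Q. \<forall>p'\<in>Q. \<forall>q\<in>Q. H (p + p') q = H p q + H p' q \<and> H q (p + p') = H q p + H q p') \<and>
     (\<forall>a\<in>Sset G. \<forall>p\<in>Q. \<forall>q\<in>Q. H (cst a \<star> p) q = a * H p q \<and> H p (cst a \<star> q) = a * H p q)"

lemma bilD:
  assumes "bil H"
  shows "p \<in> Q \<Longrightarrow> q \<in> Q \<Longrightarrow> H p q \<in> Sset G"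
    "p \<in> Q \<Longrightarrow> p' \<in> Q \<Longrightarrow> q \<in> Q \<Longrightarrow> H (p + p') q = H p q + H p' q"
    "p \<in> Q \<Longrightarrow> p' \<in> Q \<Longrightarrow> q \<in> Q \<Longrightarrow> H q (p + p') = H q p + H q p'"
    "a \<in> Sset G \<Longrightarrow> p \<in> Q \<Longrightarrow> q \<in> Q \<Longrightarrow> H (cst a \<star> p) q = a * H p q"
    "a \<in> Sset G \<Longrightarrow> p \<in> Q \<Longrightarrow> q \<in> Q \<Longrightarrow> H p (cst a \<star> q) = a * H p q"
  using assms unfolding bil_def by blast+

lemma bil_ap:
  assumes H: "bil H" and p: "p \<in> Q" and q: "q \<in> Q" shows "H p q = ap p (\<lambda>u. H (eta u) q)"
proof -
  have "(\<lambda>p\<in>Q. H p q) \<in> Dq" unfolding dual_iff by (simp add: gQ q bilD[OF H])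
  then have "H p q = ap p (\<lambda>u. (\<lambda>p\<in>Q. H p q) (eta u))" using dual_ap[OF good_Q _ p] p by fastforce
  also have "\<dots> = ap p (\<lambda>u. H (eta u) q)" by (rule ap_cong) (simp add: gQ(6)[OF p])
  finally show ?thesis .
qed

lemma ap_tproj: "z \<in> K \<Longrightarrow> ap (tproj z) f = ap z (\<lambda>u. f (fst u, id))"
  by (induction rule: K_induct) (simp_all add: tproj_zero ap_zero tproj_single ap_single tproj_add ap_add id_def)

text \<open>In coordinates, \<open>ext H\<close> sends \<open>(t\<^sub>\<lambda>w, t\<^sub>\<mu>v)\<close> to \<open>H(t\<^sub>\<lambda>, wt\<^sub>\<mu>w\<^sup>-\<^sup>1)\<close>.\<close>

definition ext :: "(('v, 'q) tga \<Rightarrow> ('v, 'q) tga \<Rightarrow> 'q) \<Rightarrow> ('v, 'q) tga \<Rightarrow> ('v, 'q) tga \<Rightarrow> 'q" where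
  "ext H z y = ap z (\<lambda>u. H (eta (fst u, id)) (tproj (eta (0, snd u) \<star> y)))"

lemma eta_tm_expand:
  assumes "w \<in> W" "y \<in> K" shows "eta (0, w) \<star> y = (\<Sum>k<N. cst (act G w (b k)) \<star> (d k \<star> y))"
  unfolding eta_expand[OF assms(1), symmetric] tm_sum_left
  by (rule sum.cong) (simp_all add: tm_assoc K_cst d_K assms(2))

lemma act_b: "w \<in> W \<Longrightarrow> i < N \<Longrightarrow> act G w (b i) \<in> Sset G"
  by (simp add: act_Sset b)

lemma bil_sum_right:
  assumes H: "bil H" and p: "p \<in> Q" and a: "\<And>k. k < N \<Longrightarrow> a k \<in> Sset G" and q: "\<And>k. k < N \<Longrightarrow> q k \<in> Q"
  shows "H p (\<Sum>k<N. cst (a k) \<star> q k) = (\<Sum>k<N. a k * H p (q k))"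
proof -
  have "H p (\<Sum>k<N. cst (a k) \<star> q k) = (\<Sum>k<N. H p (cst (a k) \<star> q k))"
    using additive_sum[OF good_Q, of "H p" "{..<N}" "\<lambda>k. cst (a k) \<star> q k"] bilD(3)[OF H _ _ p] gQ(4,5) a q by simp
  also have "\<dots> = (\<Sum>k<N. a k * H p (q k))" by (rule sum.cong) (simp_all add: bilD(5)[OF H] p a q)
  finally show ?thesis .
qed

lemma tproj_eta_Q: "w \<in> W \<Longrightarrow> y \<in> D \<Longrightarrow> tproj (eta (0, w) \<star> y) \<in> Q"
  by (intro pi_Q D_tm D_eta W_A)

text \<open>The definition of \<open>ext\<close> runs over the coefficients of \<open>z\<close>,
  which have denominators, so integrality is not visible there. Expanding the finite part as a sum
  of \<open>act G w (b k)\<close> times \<open>d k\<close> turns the value into finitely many values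
  of \<open>H\<close> on \<open>Q\<close>.\<close>

lemma ext_eq:
  assumes H: "bil H" and z: "z \<in> D" and y: "y \<in> D"
  shows "ext H z y = (\<Sum>k<N. H (tproj (z \<star> cst (b k))) (tproj (d k \<star> y)))"
proof -
  have "H (tproj (z \<star> cst (b k))) (tproj (d k \<star> y)) =
      ap z (\<lambda>u. act G (snd u) (b k) * H (eta (fst u, id)) (tproj (d k \<star> y)))" if k: "k < N" for k
  proof -
    have zb: "z \<star> cst (b k) \<in> D" by (intro D_tm z D_cst b k)
    have q: "tproj (d k \<star> y) \<in> Q" by (intro pi_Q D_tm d_D k y)
    show ?thesis unfolding bil_ap[OF H pi_Q[OF zb] q] ap_tproj[OF D_K[OF zb]] ap_tm_cst[OF D_K[OF z]] ..
  qed
  then have "(\<Sum>k<N. H (tproj (z \<star> cst (b k))) (tproj (d k \<star> y))) =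
    ap z (\<lambda>u. \<Sum>k<N. act G (snd u) (b k) * H (eta (fst u, id)) (tproj (d k \<star> y)))"
    by (simp add: ap_fun_sum)
  also have "\<dots> = ext H z y" unfolding ext_def
  proof (rule ap_cong)
    fix u assume "u \<in> keys z"
    then have u: "u \<in> A" using keys_D z by blast
    have "tproj (eta (0, snd u) \<star> y) = (\<Sum>k<N. cst (act G (snd u) (b k)) \<star> tproj (d k \<star> y))"
      unfolding eta_tm_expand[OF A_W[OF u] D_K[OF y]] tproj_sum
      by (rule sum.cong) (simp_all add: tproj_cst_tm K_tm d_K D_K y)
    then show "(\<Sum>k<N. act G (snd u) (b k) * H (eta (fst u, id)) (tproj (d k \<star> y)))
      = H (eta (fst u, id)) (tproj (eta (0, snd u) \<star> y))"
      by (simp add: bil_sum_right[OF H] Q_eta A_L u act_b A_W pi_Q D_tm d_D y)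
  qed
  finally show ?thesis by simp
qed

lemma tproj_eta_cst:
  assumes "w \<in> W" "y \<in> K" shows "tproj (eta (0, w) \<star> (cst a \<star> y)) = cst (act G w a) \<star> tproj (eta (0, w) \<star> y)"
proof -
  have e: "eta (0, w) \<in> K" by (intro K_eta W_A assms)
  have "eta (0, w) \<star> (cst a \<star> y) = (eta (0, w) \<star> cst a) \<star> y"
    by (rule tm_assoc[symmetric, OF e K_cst assms(2)])
  also have "\<dots> = (cst (act G w a) \<star> eta (0, w)) \<star> y" using eta_tm_cst[OF W_A[OF assms(1)], of a] by simp
  also have "\<dots> = cst (act G w a) \<star> (eta (0, w) \<star> y)" by (rule tm_assoc[OF K_cst e assms(2)])
  finally have "eta (0, w) \<star> (cst a \<star> y) = cst (act G w a) \<star> (eta (0, w) \<star> y)" .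
  then show ?thesis by (simp add: tproj_cst_tm K_tm e assms)
qed

text \<open>Balancedness is the reason for moving the finite part of the first argument onto the
  second: a scalar standing between the two comes out acted on by this finite part, on either
  side.\<close>

lemma ext_Td:
  assumes H: "bil H" shows "(\<lambda>(z, y)\<in>D \<times> D. ext H z y) \<in> Td"
proof (rule tsqI[OF good_D])
  fix z y assume zy: "z \<in> D" "y \<in> D"
  show "ext H z y \<in> Sset G" unfolding ext_eq[OF H zy]
    by (intro Sset_sum bilD(1)[OF H] pi_Q D_tm D_cst zy) (simp_all add: b d_D)
  {
    fix a assume a: "a \<in> Sset G"
    show "ext H (cst a \<star> z) y = a * ext H z y" unfolding ext_def by (simp add: ap_cst_tm D_K zy)
    show "ext H (z \<star> cst a) y = ext H z (cst a \<star> y)"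
      unfolding ext_def ap_tm_cst[OF D_K[OF zy(1)]]
    proof (rule ap_cong)
      fix u assume "u \<in> keys z"
      then have u: "u \<in> A" using keys_D zy by blast
      show "act G (snd u) a * H (eta (fst u, id)) (tproj (eta (0, snd u) \<star> y)) =
        H (eta (fst u, id)) (tproj (eta (0, snd u) \<star> (cst a \<star> y)))"
        using u zy a by (simp add: tproj_eta_cst A_W D_K bilD(5)[OF H] act_Sset Q_eta A_L tproj_eta_Q)
    qed
  }
  fix z' assume z': "z' \<in> D"
  show "ext H (z + z') y = ext H z y + ext H z' y" unfolding ext_def by (rule ap_add)
  show "ext H y (z + z') = ext H y z + ext H y z'" unfolding ext_def ap_fun_add[symmetric]
  proof (rule ap_cong)
    fix u assume "u \<in> keys y"
    then have u: "u \<in> A" using keys_D zy by blast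
    show "H (eta (fst u, id)) (tproj (eta (0, snd u) \<star> (z + z'))) =
      H (eta (fst u, id)) (tproj (eta (0, snd u) \<star> z)) + H (eta (fst u, id)) (tproj (eta (0, snd u) \<star> z'))"
      using u zy z' by (simp add: tm_add_right K_eta W_A A_W tproj_add bilD(3)[OF H] Q_eta A_L tproj_eta_Q)
  qed
qed

lemma eta_id_tm: "y \<in> K \<Longrightarrow> eta (0, id) \<star> y = y"
  using one_tm[of y] by (simp add: cst_def eta_def aff_one_def)

lemma ext_Q:
  assumes H: "bil H" and p: "p \<in> Q" and q: "q \<in> Q" shows "ext H p q = H p q"
proof -
  have "ext H p q = ap p (\<lambda>u. H (eta u) q)" unfolding ext_def
  proof (rule ap_cong)
    fix u assume "u \<in> keys p"
    then obtain \<mu> where u: "u = (\<mu>, id)" using keys_Q[OF p] by blast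
    have "tproj (eta (0, id) \<star> q) = q" by (simp only: eta_id_tm[OF trans_K[OF Q_trans[OF q]]] tproj_id[OF Q_trans[OF q]])
    then show "H (eta (fst u, id)) (tproj (eta (0, snd u) \<star> q)) = H (eta u) q" unfolding u by (simp only: fst_conv snd_conv)
  qed
  then show ?thesis using bil_ap[OF H p q] by simp
qed

lemma bil_Tq:
  assumes P: "\<Psi> \<in> Tq" shows "bil (\<lambda>p q. \<Psi> (p, q))"
proof -
  have "\<Psi> (p, cst a \<star> q) = a * \<Psi> (p, q)" if "a \<in> Sset G" "p \<in> Q" "q \<in> Q" for a p q
    using tsqD(5,6)[OF P that] trans_cst_commute[OF Q_trans[OF that(2)], of a] by simp
  then show ?thesis unfolding bil_def by (simp add: tsqD(2-5)[OF P])
qed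

lemma res2_Tq: "\<Psi> \<in> Td \<Longrightarrow> res2 G \<Psi> \<in> Tq"
  unfolding tsq_iff[of _ Q] res2_def by (simp add: gQ Q_D tsqD(2-)[of \<Psi> D])

lemma res2_surj: "res2 G ` Td = Tq"
proof
  show "res2 G ` Td \<subseteq> Tq" using res2_Tq by blast
  show "Tq \<subseteq> res2 G ` Td"
  proof
    fix \<Psi> assume P: "\<Psi> \<in> Tq"
    note H = bil_Tq[OF P]
    have e: "res2 G (\<lambda>(z, y)\<in>D \<times> D. ext (\<lambda>p q. \<Psi> (p, q)) z y) = \<Psi>"
      by (rule extensionalityI[of _ "Q \<times> Q"])
        (auto simp: res2_def Q_D ext_Q[OF H] tsqD(1)[OF P])
    show "\<Psi> \<in> res2 G ` Td" by (subst e[symmetric], rule imageI, rule ext_Td[OF H])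
  qed
qed

text \<open>
  \<open>th \<Psi> z q\<close> is the value of \<open>\<Psi>\<close> at \<open>\<Sum>\<^sub>u z\<^sub>u \<eta>\<^sub>u \<otimes> w\<^sub>u\<^sup>-\<^sup>1(q)\<close>. This lies in \<open>D \<otimes>\<^sub>S D\<close>, because
  \<open>w\<^sup>-\<^sup>1 = \<Sum>\<^sub>j w\<^sup>-\<^sup>1(b\<^sub>j) d\<^sub>j\<close> turns it into \<open>\<Sum>\<^sub>j b\<^sub>j z \<otimes> d\<^sub>j q\<close>.
\<close>

definition th :: "(('v, 'q) tga \<times> ('v, 'q) tga \<Rightarrow> 'q) \<Rightarrow> ('v, 'q) tga \<Rightarrow> ('v, 'q) tga \<Rightarrow> 'q" where
  "th \<Psi> z q = ap z (\<lambda>u. \<Psi> (eta u, tproj (eta (0, winv (snd u)) \<star> q)))"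

text \<open>Balancedness moves the scalar to the right of \<open>eta u\<close>; passing it applies
  \<open>snd u\<close>, which cancels the inverse.\<close>

lemma tsq_eta_cst:
  assumes P: "\<Psi> \<in> Td" and u: "u \<in> A" and a: "a \<in> Sset G" and y: "y \<in> D"
  shows "\<Psi> (eta u, cst (act G (winv (snd u)) a) \<star> y) = a * \<Psi> (eta u, y)"
proof -
  have a': "act G (winv (snd u)) a \<in> Sset G" by (intro act_Sset weyl_inv A_W u a)
  have "\<Psi> (eta u, cst (act G (winv (snd u)) a) \<star> y) = \<Psi> (eta u \<star> cst (act G (winv (snd u)) a), y)"
    using tsqD(6)[OF P a' D_eta[OF u] y] by simp
  also have "eta u \<star> cst (act G (winv (snd u)) a) = cst a \<star> eta u"
    using eta_tm_cst[OF u] act_inv_act[OF A_W[OF u]] by simp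
  finally show ?thesis using tsqD(5)[OF P a D_eta[OF u] y] by simp
qed

lemma th_eq:
  assumes P: "\<Psi> \<in> Td" and z: "z \<in> D" and q: "q \<in> D"
  shows "th \<Psi> z q = (\<Sum>j<N. b j * \<Psi> (z, tproj (d j \<star> q)))"
proof -
  have y: "tproj (d j \<star> q) \<in> D" if "j < N" for j by (intro pi_D D_tm d_D that q)
  have "(\<Sum>j<N. b j * \<Psi> (z, tproj (d j \<star> q))) = (\<Sum>j<N. ap z (\<lambda>u. b j * \<Psi> (eta u, tproj (d j \<star> q))))"
    by (rule sum.cong) (simp_all add: tsq_ap[OF good_D P y z] ap_fun_scale)
  also have "\<dots> = ap z (\<lambda>u. \<Sum>j<N. b j * \<Psi> (eta u, tproj (d j \<star> q)))" by (simp add: ap_fun_sum)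
  also have "\<dots> = th \<Psi> z q" unfolding th_def
  proof (rule ap_cong)
    fix u assume "u \<in> keys z"
    then have u: "u \<in> A" using keys_D z by blast
    let ?w = "winv (snd u)"
    have w: "?w \<in> W" by (intro weyl_inv A_W u)
    have "tproj (eta (0, ?w) \<star> q) = (\<Sum>j<N. cst (act G ?w (b j)) \<star> tproj (d j \<star> q))"
      unfolding eta_tm_expand[OF w D_K[OF q]] tproj_sum
      by (rule sum.cong) (simp_all add: tproj_cst_tm K_tm d_K D_K q)
    also have "\<Psi> (eta u, \<dots>) = (\<Sum>j<N. \<Psi> (eta u, cst (act G ?w (b j)) \<star> tproj (d j \<star> q)))"
      using additive_sum[OF good_D, of "\<lambda>y. \<Psi> (eta u, y)" "{..<N}"] tsqD(4)[OF P _ _ D_eta[OF u]]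
      by (simp add: D_tm D_cst act_b w y)
    also have "\<dots> = (\<Sum>j<N. b j * \<Psi> (eta u, tproj (d j \<star> q)))"
      by (rule sum.cong) (simp_all add: tsq_eta_cst[OF P u] b y)
    finally show "(\<Sum>j<N. b j * \<Psi> (eta u, tproj (d j \<star> q))) = \<Psi> (eta u, tproj (eta (0, ?w) \<star> q))" by simp
  qed
  finally show ?thesis by simp
qed

lemma th_sum:
  assumes "\<And>i. i < N \<Longrightarrow> z i \<in> K"
  shows "(\<Sum>i<N. a i * th \<Psi> (z i) q) = th \<Psi> (\<Sum>i<N. cst (a i) \<star> z i) q"
  unfolding th_def ap_sum by (rule sum.cong) (simp_all add: ap_cst_tm assms)

text \<open>The inverse finite part inside \<open>th\<close> undoes the twist that a balanced map
  has in its second argument, so \<open>th\<close> is honestly linear in \<open>q\<close>.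
  Integrality comes from the finite expansion \<open>th_eq\<close>.\<close>

lemma bil_th:
  assumes P: "\<Psi> \<in> Td" and i: "i < N" shows "bil (\<lambda>p q. th \<Psi> (p \<star> d i) q)"
  unfolding bil_def
proof (intro conjI ballI)
  fix p q assume p: "p \<in> Q" and q: "q \<in> Q"
  have pd: "p \<star> d i \<in> D" by (intro D_tm Q_D p d_D i)
  show "th \<Psi> (p \<star> d i) q \<in> Sset G" unfolding th_eq[OF P pd Q_D[OF q]]
    by (intro Sset_sum Sset_mult tsqD(2)[OF P] pd pi_D D_tm Q_D[OF q]) (simp_all add: b d_D)
next
  fix p p' q assume p: "p \<in> Q" "p' \<in> Q" and q: "q \<in> Q"
  show "th \<Psi> ((p + p') \<star> d i) q = th \<Psi> (p \<star> d i) q + th \<Psi> (p' \<star> d i) q"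
    by (simp add: th_def tm_add_left ap_add)
  show "th \<Psi> (q \<star> d i) (p + p') = th \<Psi> (q \<star> d i) p + th \<Psi> (q \<star> d i) p'"
    unfolding th_def ap_fun_add[symmetric]
  proof (rule ap_cong)
    fix u assume "u \<in> keys (q \<star> d i)"
    then have u: "u \<in> A" using keys_D[OF D_tm[OF Q_D[OF q] d_D[OF i]]] by blast
    have w: "winv (snd u) \<in> W" by (intro weyl_inv A_W u)
    show "\<Psi> (eta u, tproj (eta (0, winv (snd u)) \<star> (p + p'))) =
      \<Psi> (eta u, tproj (eta (0, winv (snd u)) \<star> p)) + \<Psi> (eta u, tproj (eta (0, winv (snd u)) \<star> p'))"
      by (simp add: tm_add_right K_eta W_A w tproj_add tsqD(4)[OF P] D_eta u Q_D tproj_eta_Q p)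
  qed
next
  fix a p q assume a: "a \<in> Sset G" and p: "p \<in> Q" and q: "q \<in> Q"
  have pd: "p \<star> d i \<in> D" by (intro D_tm Q_D p d_D i)
  have "(cst a \<star> p) \<star> d i = cst a \<star> (p \<star> d i)"
    by (rule tm_assoc) (simp_all add: K_cst D_K Q_D p d_K i)
  then show "th \<Psi> ((cst a \<star> p) \<star> d i) q = a * th \<Psi> (p \<star> d i) q"
    by (simp add: th_def ap_cst_tm D_K pd)
  show "th \<Psi> (p \<star> d i) (cst a \<star> q) = a * th \<Psi> (p \<star> d i) q"
    unfolding th_def ap_fun_scale[symmetric]
  proof (rule ap_cong)
    fix u assume "u \<in> keys (p \<star> d i)"
    then have u: "u \<in> A" using keys_D[OF pd] by blast
    have w: "winv (snd u) \<in> W" by (intro weyl_inv A_W u)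
    show "\<Psi> (eta u, tproj (eta (0, winv (snd u)) \<star> (cst a \<star> q))) = a * \<Psi> (eta u, tproj (eta (0, winv (snd u)) \<star> q))"
      by (simp add: tproj_eta_cst w D_K Q_D q tsq_eta_cst[OF P u a] tproj_eta_Q)
  qed
qed

lemma comm_sub2_gen1:
  "\<Psi> \<in> Td \<Longrightarrow> a \<in> Sset G \<Longrightarrow> (\<lambda>(z, y)\<in>D \<times> D. \<Psi> (z \<star> cst a, y) - a * \<Psi> (z, y)) \<in> comm_sub2 G"
  unfolding comm_sub2_def by (rule generate.incl) blast

lemma comm_sub2_gen2:
  "\<Psi> \<in> Td \<Longrightarrow> a \<in> Sset G \<Longrightarrow> (\<lambda>(z, y)\<in>D \<times> D. \<Psi> (z, y \<star> cst a) - \<Psi> (z, cst a \<star> y)) \<in> comm_sub2 G"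
  unfolding comm_sub2_def by (rule generate.incl) blast

lemma comm_sub2_add:
  assumes "(\<lambda>(z, y)\<in>D \<times> D. F z y) \<in> comm_sub2 G" "(\<lambda>(z, y)\<in>D \<times> D. F' z y) \<in> comm_sub2 G"
  shows "(\<lambda>(z, y)\<in>D \<times> D. F z y + F' z y) \<in> comm_sub2 G"
proof -
  have "(\<lambda>p\<in>D \<times> D. (\<lambda>(z, y)\<in>D \<times> D. F z y) p + (\<lambda>(z, y)\<in>D \<times> D. F' z y) p) \<in> comm_sub2 G"
    using generate.eng[OF assms[unfolded comm_sub2_def]] by (simp add: comm_sub2_def tsq_simps)
  moreover have "(\<lambda>p\<in>D \<times> D. (\<lambda>(z, y)\<in>D \<times> D. F z y) p + (\<lambda>(z, y)\<in>D \<times> D. F' z y) p) =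
    (\<lambda>(z, y)\<in>D \<times> D. F z y + F' z y)" by (rule restrict_ext) auto
  ultimately show ?thesis by simp
qed

lemma comm_sub2_sum:
  "(\<And>i. i < (n::nat) \<Longrightarrow> (\<lambda>(z, y)\<in>D \<times> D. F i z y) \<in> comm_sub2 G) \<Longrightarrow>
    (\<lambda>(z, y)\<in>D \<times> D. \<Sum>i<n. F i z y) \<in> comm_sub2 G"
proof (induction n)
  case 0
  have "(\<lambda>(z, y)\<in>D \<times> D. \<Sum>i<(0::nat). F i z y) = \<one>\<^bsub>dual_tsq G D\<^esub>"
    unfolding tsq_simps by (rule restrict_ext) auto
  moreover have "\<one>\<^bsub>dual_tsq G D\<^esub> \<in> comm_sub2 G" unfolding comm_sub2_def by (rule generate.one)
  ultimately show ?case by (simp only:)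
next
  case (Suc n)
  show ?case unfolding sum.lessThan_Suc
    by (rule comm_sub2_add[OF Suc.IH Suc.prems]) (simp_all only: Suc.prems less_Suc_eq simp_thms)
qed

text \<open>As in one variable, the generators vanish on \<open>Q\<close> because scalars and
  translations commute.\<close>

lemma comm_sub2_sub: "comm_sub2 G \<subseteq> {\<Psi> \<in> Td. \<forall>p\<in>Q. \<forall>q\<in>Q. \<Psi> (p, q) = 0}"
proof
  note grp = tsq_group[OF good_D]
  let ?gens = "{\<lambda>(z, y)\<in>D \<times> D. \<Psi> (z \<star> cst a, y) - a * \<Psi> (z, y) | a \<Psi>. a \<in> Sset G \<and> \<Psi> \<in> Td} \<union>
      {\<lambda>(z, y)\<in>D \<times> D. \<Psi> (z, y \<star> cst a) - \<Psi> (z, cst a \<star> y) | a \<Psi>. a \<in> Sset G \<and> \<Psi> \<in> Td}"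
  have gens: "h \<in> Td \<and> (\<forall>p\<in>Q. \<forall>q\<in>Q. h (p, q) = 0)" if h: "h \<in> ?gens" for h
  proof -
    consider a \<Psi> where "a \<in> Sset G" "\<Psi> \<in> Td" "h = (\<lambda>(z, y)\<in>D \<times> D. \<Psi> (z \<star> cst a, y) - a * \<Psi> (z, y))"
      | a \<Psi> where "a \<in> Sset G" "\<Psi> \<in> Td" "h = (\<lambda>(z, y)\<in>D \<times> D. \<Psi> (z, y \<star> cst a) - \<Psi> (z, cst a \<star> y))"
      using h by blast
    then show ?thesis
    proof cases
      case 1
      note P = tsqD(2-)[OF 1(2)]
      have "h \<in> Td" unfolding 1(3)
      proof (rule tsqI[OF good_D])
        fix c z y assume c: "c \<in> Sset G" and z: "z \<in> D" and y: "y \<in> D"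
        \<comment> \<open>Right multiplications by two scalars commute, which keeps the commutator
          balanced.\<close>
        have "z \<star> cst c \<star> cst a = z \<star> cst a \<star> cst c"
          by (simp add: tm_assoc D_K z K_cst cst_mult mult.commute)
        then show "\<Psi> (z \<star> cst c \<star> cst a, y) - a * \<Psi> (z \<star> cst c, y) = \<Psi> (z \<star> cst a, cst c \<star> y) - a * \<Psi> (z, cst c \<star> y)"
          using P(5)[OF c z y] P(5)[OF c D_tm[OF z D_cst[OF 1(1)]] y] by simp
        have "cst c \<star> z \<star> cst a = cst c \<star> (z \<star> cst a)" by (simp add: tm_assoc D_K z K_cst)
        then show "\<Psi> (cst c \<star> z \<star> cst a, y) - a * \<Psi> (cst c \<star> z, y) = c * (\<Psi> (z \<star> cst a, y) - a * \<Psi> (z, y))"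
          using P(4)[OF c z y] P(4)[OF c D_tm[OF z D_cst[OF 1(1)]] y] by (simp add: algebra_simps)
      qed (simp_all add: P gD 1(1) Sset_diff Sset_mult tm_add_left algebra_simps)
      moreover have "h (p, q) = 0" if "p \<in> Q" "q \<in> Q" for p q
        using that 1 by (simp add: Q_D trans_cst_commute Q_trans P(4))
      ultimately show ?thesis by blast
    next
      case 2
      note P = tsqD(2-)[OF 2(2)]
      have "h \<in> Td" unfolding 2(3)
      proof (rule tsqI[OF good_D])
        fix c z y assume c: "c \<in> Sset G" and z: "z \<in> D" and y: "y \<in> D"
        have 1: "cst c \<star> y \<star> cst a = cst c \<star> (y \<star> cst a)" by (simp add: tm_assoc D_K y K_cst)
        have 3: "cst a \<star> (cst c \<star> y) = cst c \<star> (cst a \<star> y)" by (simp add: cst_cst_tm D_K y mult.commute)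
        show "\<Psi> (z \<star> cst c, y \<star> cst a) - \<Psi> (z \<star> cst c, cst a \<star> y) = \<Psi> (z, cst c \<star> y \<star> cst a) - \<Psi> (z, cst a \<star> (cst c \<star> y))"
          unfolding 1 3 using P(5)[OF c z D_tm[OF y D_cst[OF 2(1)]]] P(5)[OF c z D_tm[OF D_cst[OF 2(1)] y]] by simp
      qed (simp_all add: P gD 2(1) Sset_diff tm_add_left tm_add_right K_cst algebra_simps)
      moreover have "h (p, q) = 0" if "p \<in> Q" "q \<in> Q" for p q
        using that 2 by (simp add: Q_D trans_cst_commute Q_trans)
      ultimately show ?thesis by blast
    qed
  qed
  fix h assume "h \<in> comm_sub2 G"
  then show "h \<in> {\<Psi> \<in> Td. \<forall>p\<in>Q. \<forall>q\<in>Q. \<Psi> (p, q) = 0}" unfolding comm_sub2_def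
  proof (induction rule: generate.induct)
    case one
    have "(\<lambda>p\<in>D \<times> D. 0) \<in> Td" using monoid.one_closed[OF group.is_monoid[OF grp]] unfolding tsq_simps .
    then show ?case unfolding tsq_simps
      by (intro CollectI conjI ballI) (assumption, simp add: Q_D)
  next
    case (incl h)
    then show ?case using gens[of h] by simp
  next
    case (inv h)
    then have h: "h \<in> Td" "\<forall>p\<in>Q. \<forall>q\<in>Q. h (p, q) = 0" using gens[of h] by simp_all
    have "(\<lambda>z\<in>D \<times> D. - h z) \<in> Td" using group.inv_closed[OF grp h(1)] by (simp only: tsq_inv[OF good_D h(1)])
    then show ?case unfolding tsq_inv[OF good_D h(1)]
      by (intro CollectI conjI ballI) (assumption, simp add: Q_D h)
  next
    case (eng f g)
    then have "f \<otimes>\<^bsub>dual_tsq G D\<^esub> g \<in> Td" by (intro monoid.m_closed[OF group.is_monoid[OF grp]]) auto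
    then show ?case using eng by (intro CollectI conjI ballI) (simp, simp add: tsq_simps Q_D)
  qed
qed

text \<open>Two reductions. Commutators in the second factor change \<open>\<Psi> (z, y)\<close>
  into \<open>\<Psi> (z, tproj y)\<close>; commutators in the first factor change this into a map
  built from values on \<open>Q\<close> in both arguments, which is zero.\<close>

lemma comm_sub2_super:
  assumes P: "\<Psi> \<in> Td" and P0: "\<And>p q. p \<in> Q \<Longrightarrow> q \<in> Q \<Longrightarrow> \<Psi> (p, q) = 0"
  shows "\<Psi> \<in> comm_sub2 G"
proof -
  \<comment> \<open>The one-variable construction applied to the second argument.\<close>
  define \<Psi>2 where "\<Psi>2 j = (\<lambda>(z, y)\<in>D \<times> D. \<Psi> (z, tproj y \<star> d j))" for j
  have P2: "\<Psi>2 j \<in> Td" if j: "j < N" for j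
    unfolding \<Psi>2_def
  proof (rule tsqI[OF good_D])
    fix a z y assume a: "a \<in> Sset G" and z: "z \<in> D" and y: "y \<in> D"
    have "tproj (cst a \<star> y) \<star> d j = cst a \<star> (tproj y \<star> d j)"
      by (simp add: tproj_cst_tm D_K y tm_assoc K_cst pi_D d_K j)
    then show "\<Psi> (z \<star> cst a, tproj y \<star> d j) = \<Psi> (z, tproj (cst a \<star> y) \<star> d j)"
      using tsqD(6)[OF P a z D_tm[OF pi_D[OF y] d_D[OF j]]] by simp
  qed (simp_all add: tsqD(2-5)[OF P] gD pi_D d_D j tproj_add tm_add_left)
  have 2: "(\<lambda>(z, y)\<in>D \<times> D. \<Sum>j<N. \<Psi>2 j (z, y \<star> cst (b j)) - \<Psi>2 j (z, cst (b j) \<star> y)) \<in> comm_sub2 G"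
    by (rule comm_sub2_sum) (rule comm_sub2_gen2[OF P2 b])
  \<comment> \<open>In the first argument \<open>p \<star> d i\<close> is no longer a combination of
    translations, so inserting it into \<Psi> directly would destroy linearity in \<open>q\<close>.
    The correction \<open>th\<close> restores it, and \<open>ext\<close> then extends the bilinear
    map to \<open>D\<close>.\<close>
  define H where "H i = (\<lambda>p q. th \<Psi> (p \<star> d i) q)" for i
  have H: "bil (H i)" if "i < N" for i unfolding H_def by (rule bil_th[OF P that])
  define \<Psi>1 where "\<Psi>1 i = (\<lambda>(z, y)\<in>D \<times> D. ext (H i) z y)" for i
  have P1: "\<Psi>1 i \<in> Td" if "i < N" for i unfolding \<Psi>1_def by (rule ext_Td[OF H[OF that]])
  have 1: "(\<lambda>(z, y)\<in>D \<times> D. \<Sum>i<N. \<Psi>1 i (z \<star> cst (b i), y) - b i * \<Psi>1 i (z, y)) \<in> comm_sub2 G"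
    by (rule comm_sub2_sum) (rule comm_sub2_gen1[OF P1 b])
  have "(\<lambda>(z, y)\<in>D \<times> D. (\<Sum>j<N. \<Psi>2 j (z, y \<star> cst (b j)) - \<Psi>2 j (z, cst (b j) \<star> y)) +
      (\<Sum>i<N. \<Psi>1 i (z \<star> cst (b i), y) - b i * \<Psi>1 i (z, y))) = \<Psi>"
  proof (rule extensionalityI[of _ "D \<times> D"])
    fix v assume "v \<in> D \<times> D"
    then obtain z y where v: "v = (z, y)" and z: "z \<in> D" and y: "y \<in> D" by blast
    note add2 = additive_sum[OF good_D, of "\<lambda>y. \<Psi> (z, y)" "{..<N}"]
    have "(\<Sum>j<N. \<Psi>2 j (z, y \<star> cst (b j))) = (\<Sum>j<N. \<Psi> (z, tproj (y \<star> cst (b j)) \<star> d j))"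
      by (rule sum.cong) (simp_all add: \<Psi>2_def z D_tm y D_cst b)
    also have "\<dots> = \<Psi> (z, \<Sum>j<N. tproj (y \<star> cst (b j)) \<star> d j)"
      using add2[of "\<lambda>j. tproj (y \<star> cst (b j)) \<star> d j"] tsqD(4)[OF P _ _ z] by (simp add: D_tm pi_D y D_cst b d_D)
    also have "\<dots> = \<Psi> (z, y)" using K_expand[OF D_K[OF y]] by simp
    finally have e1: "(\<Sum>j<N. \<Psi>2 j (z, y \<star> cst (b j))) = \<Psi> (z, y)" .
    have "(\<Sum>j<N. \<Psi>2 j (z, cst (b j) \<star> y)) = (\<Sum>j<N. \<Psi> (z, cst (b j) \<star> (tproj y \<star> d j)))"
      by (rule sum.cong) (simp_all add: \<Psi>2_def z D_tm y D_cst b tproj_cst_tm D_K tm_assoc K_cst pi_D d_K)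
    also have "\<dots> = \<Psi> (z, \<Sum>j<N. cst (b j) \<star> (tproj y \<star> d j))"
      using add2[of "\<lambda>j. cst (b j) \<star> (tproj y \<star> d j)"] tsqD(4)[OF P _ _ z] by (simp add: D_tm pi_D y D_cst b d_D)
    also have "\<dots> = \<Psi> (z, tproj y)" using trans_expand[OF tproj_trans[OF D_K[OF y]]] by simp
    finally have e2: "(\<Sum>j<N. \<Psi>2 j (z, cst (b j) \<star> y)) = \<Psi> (z, tproj y)" .
    have "(\<Sum>i<N. \<Psi>1 i (z \<star> cst (b i), y)) = (\<Sum>i<N. ext (H i) (z \<star> cst (b i)) y)"
      by (rule sum.cong) (simp_all add: \<Psi>1_def z D_tm y D_cst b)
    also have "\<dots> = ap z (\<lambda>u. \<Sum>i<N. act G (snd u) (b i) * H i (eta (fst u, id)) (tproj (eta (0, snd u) \<star> y)))"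
      by (simp add: ext_def ap_tm_cst D_K z ap_fun_sum)
    \<comment> \<open>The scalars \<open>act G (snd u) (b i)\<close> reassemble \<open>snd u\<close>
      from the \<open>d i\<close>, so the first argument becomes \<open>eta u\<close>; then the
      untwisting in \<open>th\<close> cancels the twisting in \<open>ext\<close>.\<close>
    also have "\<dots> = ap z (\<lambda>u. \<Psi> (eta u, tproj y))"
    proof (rule ap_cong)
      fix u assume "u \<in> keys z"
      then have u: "u \<in> A" using keys_D z by blast
      have uW: "snd u \<in> W" by (rule A_W[OF u])
      let ?m = "eta (fst u, id)" and ?q = "tproj (eta (0, snd u) \<star> y)"
      have m: "?m \<in> trans" "?m \<in> K" by (simp_all add: eta_trans trans_K A_L u)
      have "(\<Sum>i<N. act G (snd u) (b i) * H i ?m ?q) = th \<Psi> (\<Sum>i<N. cst (act G (snd u) (b i)) \<star> (?m \<star> d i)) ?q"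
        unfolding H_def by (rule th_sum) (simp add: K_tm m d_K)
      also have "(\<Sum>i<N. cst (act G (snd u) (b i)) \<star> (?m \<star> d i)) = ?m \<star> (\<Sum>i<N. cst (act G (snd u) (b i)) \<star> d i)"
        unfolding tm_sum_right[OF m(2)]
      proof (rule sum.cong)
        fix i assume "i \<in> {..<N}"
        then have i: "d i \<in> K" by (simp add: d_K)
        show "cst (act G (snd u) (b i)) \<star> (?m \<star> d i) = ?m \<star> (cst (act G (snd u) (b i)) \<star> d i)"
          using tm_assoc[OF K_cst m(2) i] tm_assoc[OF m(2) K_cst i] trans_cst_commute[OF m(1)] by metis
      qed simp
      also have "\<dots> = eta u" unfolding eta_expand[OF uW]
        using single_decompose[OF u, of 1] by (simp add: eta_def)
      also have "th \<Psi> (eta u) ?q = \<Psi> (eta u, tproj (eta (0, winv (snd u)) \<star> ?q))" by (simp add: th_def ap_eta)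
      also have "tproj (eta (0, winv (snd u)) \<star> ?q) = tproj (eta (0, winv (snd u)) \<star> (eta (0, snd u) \<star> y))"
        by (rule tproj_tm_tproj) (simp_all add: K_eta W_A weyl_inv uW K_tm D_K y)
      also have "eta (0, winv (snd u)) \<star> (eta (0, snd u) \<star> y) = y"
      proof -
        have wi: "(0, winv (snd u)) \<in> A" and w: "(0, snd u) \<in> A" by (simp_all add: W_A weyl_inv uW)
        have "winv (snd u) \<circ> snd u = id" using weyl_inv_comp(2)[OF uW] by (simp add: fun_eq_iff)
        then have "eta (0, winv (snd u)) \<star> eta (0, snd u) = eta (0, id)"
          by (simp only: eta_mult[OF wi] aff_mult_def fst_conv snd_conv linear_0[OF weyl_linear[OF weyl_inv[OF uW]]] add_0)
        then show ?thesis using tm_assoc[OF K_eta[OF wi] K_eta[OF w] D_K[OF y]] eta_id_tm[OF D_K[OF y]] by metis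
      qed
      finally show "(\<Sum>i<N. act G (snd u) (b i) * H i ?m ?q) = \<Psi> (eta u, tproj y)" .
    qed
    also have "\<dots> = \<Psi> (z, tproj y)" using tsq_ap[OF good_D P pi_D[OF y] z] by simp
    finally have e3: "(\<Sum>i<N. \<Psi>1 i (z \<star> cst (b i), y)) = \<Psi> (z, tproj y)" .
    have "(\<Sum>i<N. b i * \<Psi>1 i (z, y)) = ap z (\<lambda>u. \<Sum>i<N. b i * H i (eta (fst u, id)) (tproj (eta (0, snd u) \<star> y)))"
      by (simp add: \<Psi>1_def z y ext_def ap_fun_sum ap_fun_scale)
    \<comment> \<open>With the untwisted scalars \<open>b i\<close> the first argument collapses to
      the translation \<open>?m\<close>, and \<Psi> is evaluated on two elements of
      \<open>Q\<close>.\<close>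
    also have "\<dots> = ap z (\<lambda>u. 0)"
    proof (rule ap_cong)
      fix u assume "u \<in> keys z"
      then have u: "u \<in> A" using keys_D z by blast
      let ?m = "eta (fst u, id)" and ?q = "tproj (eta (0, snd u) \<star> y)"
      have m: "?m \<in> trans" "?m \<in> K" "?m \<in> Q" by (simp_all add: eta_trans trans_K A_L u Q_eta)
      have q: "?q \<in> Q" by (rule tproj_eta_Q[OF A_W[OF u] y])
      have "(\<Sum>i<N. b i * H i ?m ?q) = th \<Psi> (\<Sum>i<N. cst (b i) \<star> (?m \<star> d i)) ?q"
        unfolding H_def by (rule th_sum) (simp add: K_tm m d_K)
      also have "\<dots> = th \<Psi> ?m ?q" using trans_expand[OF m(1)] by simp
      also have "\<dots> = \<Psi> (?m, tproj (eta (0, winv id) \<star> ?q))" unfolding th_def ap_eta snd_conv ..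
      also have "winv id = (id :: 'v \<Rightarrow> 'v)" by (rule inv_id)
      also have "tproj (eta (0, id) \<star> ?q) = ?q"
        by (simp only: eta_id_tm[OF trans_K[OF Q_trans[OF q]]] tproj_id[OF Q_trans[OF q]])
      also have "\<Psi> (?m, ?q) = 0" by (rule P0[OF m(3) q])
      finally show "(\<Sum>i<N. b i * H i ?m ?q) = 0" .
    qed
    also have "\<dots> = 0" by (simp add: ap_def)
    finally have e4: "(\<Sum>i<N. b i * \<Psi>1 i (z, y)) = 0" .
    show "(\<lambda>(z, y)\<in>D \<times> D. (\<Sum>j<N. \<Psi>2 j (z, y \<star> cst (b j)) - \<Psi>2 j (z, cst (b j) \<star> y)) +
      (\<Sum>i<N. \<Psi>1 i (z \<star> cst (b i), y) - b i * \<Psi>1 i (z, y))) v = \<Psi> v"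
      using v z y by (simp add: sum_subtractf e1 e2 e3 e4)
  qed (simp_all add: tsqD(1)[OF P])
  then show ?thesis using comm_sub2_add[OF 2 1] by simp
qed

lemma comm_sub2_eq: "comm_sub2 G = {\<Psi> \<in> Td. \<forall>p\<in>Q. \<forall>q\<in>Q. \<Psi> (p, q) = 0}"
  using comm_sub2_sub comm_sub2_super by blast


subsection \<open>Cosets as fibres of the restriction maps\<close>

lemma res_eq_iff:
  assumes "f \<in> Dd" "g \<in> Dd" shows "res G f = res G g \<longleftrightarrow> (\<forall>p\<in>Q. f p = g p)"
  unfolding res_def
proof
  assume eq: "restrict f Q = restrict g Q"
  show "\<forall>p\<in>Q. f p = g p" using fun_cong[OF eq] by (metis restrict_apply')
qed (rule restrict_ext, blast)

lemma res2_eq_iff: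
  assumes "\<Psi> \<in> Td" "\<Psi>' \<in> Td" shows "res2 G \<Psi> = res2 G \<Psi>' \<longleftrightarrow> (\<forall>p\<in>Q. \<forall>q\<in>Q. \<Psi> (p, q) = \<Psi>' (p, q))"
  unfolding res2_def
proof
  assume eq: "restrict \<Psi> (Q \<times> Q) = restrict \<Psi>' (Q \<times> Q)"
  show "\<forall>p\<in>Q. \<forall>q\<in>Q. \<Psi> (p, q) = \<Psi>' (p, q)"
  proof (intro ballI)
    fix p q assume "p \<in> Q" "q \<in> Q"
    then show "\<Psi> (p, q) = \<Psi>' (p, q)" using fun_cong[OF eq, of "(p, q)"] by simp
  qed
qed (rule restrict_ext, blast)

lemma Dd_add: "f \<in> Dd \<Longrightarrow> g \<in> Dd \<Longrightarrow> f \<oplus>\<^bsub>dual G D\<^esub> g \<in> Dd"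
  by (rule abelian_monoid.a_closed[OF abelian_group.axioms(1)[OF dual_abelian[OF good_D]]])

lemma Dd_minus: "f \<in> Dd \<Longrightarrow> g \<in> Dd \<Longrightarrow> f \<ominus>\<^bsub>dual G D\<^esub> g \<in> Dd"
  by (rule abelian_group.minus_closed[OF dual_abelian[OF good_D]])

lemma Td_mult: "f \<in> Td \<Longrightarrow> g \<in> Td \<Longrightarrow> f \<otimes>\<^bsub>dual_tsq G D\<^esub> g \<in> Td"
  by (rule monoid.m_closed[OF group.is_monoid[OF tsq_group[OF good_D]]])

lemma Td_inv: "f \<in> Td \<Longrightarrow> inv\<^bsub>dual_tsq G D\<^esub> f \<in> Td"
  by (rule group.inv_closed[OF tsq_group[OF good_D]])

text \<open>Cosets become fibres of the restriction map. Well-definedness of an operation on cosets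
  is then implied by its compatibility with restriction.\<close>

lemma hh_class_eq:
  assumes f: "f \<in> Dd" shows "hh_class G f = {g \<in> Dd. res G g = res G f}"
proof
  show "hh_class G f \<subseteq> {g \<in> Dd. res G g = res G f}"
  proof
    fix g assume "g \<in> hh_class G f"
    then obtain k where k: "k \<in> comm_sub G" "g = k \<oplus>\<^bsub>dual G D\<^esub> f"
      by (auto simp: hh_class_def a_r_coset_def')
    have k': "k \<in> Dd" "\<forall>p\<in>Q. k p = 0" using k(1) by (simp_all add: comm_sub_eq)
    then have g: "g \<in> Dd" using Dd_add k(2) f by simp
    moreover have "\<forall>p\<in>Q. g p = f p" using k' by (simp add: k(2) dual_simps Q_D)
    ultimately show "g \<in> {g \<in> Dd. res G g = res G f}" using res_eq_iff[OF g f] by simp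
  qed
  show "{g \<in> Dd. res G g = res G f} \<subseteq> hh_class G f"
  proof
    fix g assume "g \<in> {g \<in> Dd. res G g = res G f}"
    then have g: "g \<in> Dd" "\<forall>p\<in>Q. g p = f p" using res_eq_iff f by auto
    have "g \<ominus>\<^bsub>dual G D\<^esub> f \<in> comm_sub G"
      unfolding comm_sub_eq
      by (intro CollectI conjI ballI Dd_minus g f) (use g f in \<open>simp add: dual_minus[OF good_D] Q_D\<close>)
    moreover have "g = (g \<ominus>\<^bsub>dual G D\<^esub> f) \<oplus>\<^bsub>dual G D\<^esub> f"
      by (rule extensionalityI[of _ D]) (use g f in \<open>auto simp: dual_minus[OF good_D] dual_simps dualD(1)\<close>)
    ultimately show "g \<in> hh_class G f" unfolding hh_class_def a_r_coset_def' by blast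
  qed
qed

lemma hh_class2_eq:
  assumes P: "\<Psi> \<in> Td" shows "hh_class2 G \<Psi> = {\<Psi>' \<in> Td. res2 G \<Psi>' = res2 G \<Psi>}"
proof
  show "hh_class2 G \<Psi> \<subseteq> {\<Psi>' \<in> Td. res2 G \<Psi>' = res2 G \<Psi>}"
  proof
    fix g assume "g \<in> hh_class2 G \<Psi>"
    then obtain k where k: "k \<in> comm_sub2 G" "g = k \<otimes>\<^bsub>dual_tsq G D\<^esub> \<Psi>"
      by (auto simp: hh_class2_def r_coset_def)
    have k': "k \<in> Td" "\<forall>p\<in>Q. \<forall>q\<in>Q. k (p, q) = 0" using k(1) by (simp_all add: comm_sub2_eq)
    then have g: "g \<in> Td" using Td_mult k(2) P by simp
    moreover have "\<forall>p\<in>Q. \<forall>q\<in>Q. g (p, q) = \<Psi> (p, q)" using k' by (simp add: k(2) tsq_simps Q_D)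
    ultimately show "g \<in> {\<Psi>' \<in> Td. res2 G \<Psi>' = res2 G \<Psi>}" using res2_eq_iff[OF g P] by simp
  qed
  show "{\<Psi>' \<in> Td. res2 G \<Psi>' = res2 G \<Psi>} \<subseteq> hh_class2 G \<Psi>"
  proof
    fix g assume "g \<in> {\<Psi>' \<in> Td. res2 G \<Psi>' = res2 G \<Psi>}"
    then have g: "g \<in> Td" "\<forall>p\<in>Q. \<forall>q\<in>Q. g (p, q) = \<Psi> (p, q)" using res2_eq_iff P by auto
    let ?k = "g \<otimes>\<^bsub>dual_tsq G D\<^esub> inv\<^bsub>dual_tsq G D\<^esub> \<Psi>"
    have "?k \<in> comm_sub2 G" unfolding comm_sub2_eq
      by (intro CollectI conjI ballI Td_mult Td_inv g P) (use g P in \<open>simp add: tsq_inv[OF good_D] tsq_simps Q_D\<close>)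
    moreover have "g = ?k \<otimes>\<^bsub>dual_tsq G D\<^esub> \<Psi>"
      using g P group.inv_solve_right[OF tsq_group[OF good_D], of ?k g \<Psi>] Td_mult Td_inv by simp
    ultimately show "g \<in> hh_class2 G \<Psi>" unfolding hh_class2_def r_coset_def by blast
  qed
qed

lemma hh_self: "f \<in> Dd \<Longrightarrow> f \<in> hh_class G f"
  by (simp add: hh_class_eq)

lemma hh2_self: "\<Psi> \<in> Td \<Longrightarrow> \<Psi> \<in> hh_class2 G \<Psi>"
  by (simp add: hh_class2_eq)

lemma hh_classD: "f \<in> Dd \<Longrightarrow> g \<in> hh_class G f \<Longrightarrow> g \<in> Dd \<and> (\<forall>p\<in>Q. g p = f p)"
  using res_eq_iff by (auto simp: hh_class_eq)

lemma UN_const_eq: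
  assumes "a \<in> X" "\<And>y. y \<in> X \<Longrightarrow> F y = F a" shows "(\<Union>y\<in>X. F y) = F a"
proof -
  have "(\<Union>y\<in>X. F y) = (\<Union>y\<in>X. F a)" by (rule SUP_cong[OF HOL.refl]) (rule assms(2))
  then show ?thesis using assms(1) by blast
qed

subsection \<open>The structure maps\<close>

lemma mult_Dd: "f \<in> Dd \<Longrightarrow> g \<in> Dd \<Longrightarrow> f \<otimes>\<^bsub>dual G D\<^esub> g \<in> Dd"
  unfolding dual_simps by (intro intg_dual intg_mult dual_intg)

lemma one_Dd: "\<one>\<^bsub>dual G D\<^esub> \<in> Dd"
  unfolding dual_simps by (intro intg_dual intg_one)

lemma smult_Dd: "a \<in> Sset G \<Longrightarrow> f \<in> Dd \<Longrightarrow> a \<odot>\<^bsub>dual G D\<^esub> f \<in> Dd"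
  unfolding dual_simps by (rule smult_dual[OF good_D])

lemma antipode_Dd: "f \<in> Dd \<Longrightarrow> antipode (dual G D) f \<in> Dd"
  unfolding dual_simps using intg_dual[OF intg_antip[OF dual_intg]] by (simp add: antip_def)

lemma comult_Td:
  assumes f: "f \<in> Dd" shows "comult (dual G D) f \<in> Td"
  unfolding dual_simps
  by (rule tsqI[OF good_D])
    (simp_all add: gD dualD(2-)[OF f] tm_add_left tm_add_right D_K tm_assoc K_cst)

lemma tens_Td:
  assumes f: "f \<in> Dd" and g: "g \<in> Dd" shows "tens (dual G D) f g \<in> Td"
  unfolding dual_simps
proof (rule tsqI[OF good_D])
  fix z z' y assume z: "z \<in> D" "z' \<in> D" and y: "y \<in> D"
  show "f (y \<star> cst (g (z + z'))) = f (y \<star> cst (g z)) + f (y \<star> cst (g z'))"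
    using z y by (simp add: dualD(2-)[OF g] dualD(3)[OF f] cst_add tm_add_right D_K gD)
next
  fix a z y assume a: "a \<in> Sset G" and z: "z \<in> D" and y: "y \<in> D"
  show "f (z \<star> cst a \<star> cst (g y)) = f (z \<star> cst (g (cst a \<star> y)))"
    using a z y by (simp add: dualD(2-)[OF g] tm_assoc D_K K_cst cst_mult)
  show "f (cst a \<star> z \<star> cst (g y)) = a * f (z \<star> cst (g y))"
    using a z y by (simp add: tm_assoc D_K K_cst dualD(4)[OF f] gD dualD(2)[OF g])
qed (simp_all add: gD dualD(2-)[OF f] dualD(2)[OF g] tm_add_left)

lemma res_mult:
  assumes f: "f \<in> Dd" and g: "g \<in> Dd"
  shows "res G (f \<otimes>\<^bsub>dual G D\<^esub> g) = res G f \<otimes>\<^bsub>dual G Q\<^esub> res G g"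
  unfolding res_def dual_simps functional_ap
proof (rule restrict_ext)
  fix p assume p: "p \<in> Q"
  have "ap p (\<lambda>u. f (eta u) * g (eta u)) = ap p (\<lambda>u. restrict f Q (eta u) * restrict g Q (eta u))"
    by (rule ap_cong) (simp add: gQ(6)[OF p])
  then show "(\<lambda>z\<in>D. ap z (\<lambda>u. f (eta u) * g (eta u))) p = ap p (\<lambda>u. restrict f Q (eta u) * restrict g Q (eta u))"
    using p by (simp add: Q_D)
qed

lemma res_one: "res G \<one>\<^bsub>dual G D\<^esub> = \<one>\<^bsub>dual G Q\<^esub>"
  unfolding res_def dual_simps functional_ap by (rule restrict_ext) (simp add: Q_D)

lemma res_add: "res G (f \<oplus>\<^bsub>dual G D\<^esub> g) = res G f \<oplus>\<^bsub>dual G Q\<^esub> res G g"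
  unfolding res_def dual_simps by (rule restrict_ext) (simp add: Q_D)

lemma res_smult: "res G (a \<odot>\<^bsub>dual G D\<^esub> f) = a \<odot>\<^bsub>dual G Q\<^esub> res G f"
  unfolding res_def dual_simps by (rule restrict_ext) (simp add: Q_D)

lemma res2_add: "res2 G (\<Psi> \<otimes>\<^bsub>dual_tsq G D\<^esub> \<Psi>') = res2 G \<Psi> \<otimes>\<^bsub>dual_tsq G Q\<^esub> res2 G \<Psi>'"
  unfolding res2_def tsq_simps by (rule restrict_ext) (auto simp: Q_D)

lemma res2_tens:
  assumes g: "g \<in> Dd" shows "res2 G (tens (dual G D) f g) = tens (dual G Q) (res G f) (res G g)"
  unfolding res2_def res_def dual_simps
  by (rule restrict_ext) (auto simp: Q_D gQ dualD(2)[OF g])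

lemma res2_comult: "res2 G (comult (dual G D) f) = comult (dual G Q) (res G f)"
  unfolding res2_def res_def dual_simps by (rule restrict_ext) (auto simp: Q_D gQ)

lemma aff_one_Q: "eta aff_one \<in> Q"
  using Q_eta[OF int_comb_zero] by (simp add: aff_one_def)

lemma res_counit: "counit (dual G D) f = counit (dual G Q) (res G f)"
  by (simp add: dual_simps res_def aff_one_Q)

lemma res_antipode: "res G (antipode (dual G D) f) = antipode (dual G Q) (res G f)"
  unfolding res_def dual_simps functional_ap
proof (rule restrict_ext)
  fix p assume p: "p \<in> Q"
  have "ap p (\<lambda>u. act G (snd u) (f (eta (aff_inv u)))) = ap p (\<lambda>u. act G (snd u) (restrict f Q (eta (aff_inv u))))"
  proof (rule ap_cong)
    fix u assume "u \<in> keys p"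
    then obtain \<mu> where u: "u = (\<mu>, id)" "\<mu> \<in> L" using keys_Q[OF p, of u] by (cases u) auto
    have "aff_inv u = (- \<mu>, id)" unfolding u(1) aff_inv_def fst_conv snd_conv inv_id by (simp only: id_apply)
    then show "act G (snd u) (f (eta (aff_inv u))) = act G (snd u) (restrict f Q (eta (aff_inv u)))"
      using Q_eta[OF int_comb_neg[OF u(2)]] by (simp only: restrict_apply')
  qed
  then show "(\<lambda>z\<in>D. ap z (\<lambda>u. act G (snd u) (f (eta (aff_inv u))))) p =
      ap p (\<lambda>u. act G (snd u) (restrict f Q (eta (aff_inv u))))"
    using p by (simp only: restrict_apply' Q_D)
qed

text \<open>Representatives of one coset have the same restriction, so the union runs over copies of
  a single coset.\<close>

lemma UN_hh_class:
  assumes f: "f \<in> Dd" and op: "\<And>g. g \<in> Dd \<Longrightarrow> op g \<in> Dd" "\<And>g. g \<in> Dd \<Longrightarrow> res G (op g) = op' (res G g)"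
  shows "(\<Union>g\<in>hh_class G f. hh_class G (op g)) = hh_class G (op f)"
proof (rule UN_const_eq[of f, OF hh_self[OF f]])
  fix g assume "g \<in> hh_class G f"
  then have g: "g \<in> Dd" "res G g = res G f" using hh_class_eq[OF f] by auto
  then have "res G (op g) = res G (op f)" using op(2) f by simp
  then show "hh_class G (op g) = hh_class G (op f)" using hh_class_eq op(1) g f by simp
qed

lemma UN_hh_class2:
  assumes f: "f \<in> Dd" and op: "\<And>g. g \<in> Dd \<Longrightarrow> op g \<in> Td" "\<And>g. g \<in> Dd \<Longrightarrow> res2 G (op g) = op' (res G g)"
  shows "(\<Union>g\<in>hh_class G f. hh_class2 G (op g)) = hh_class2 G (op f)"
proof (rule UN_const_eq[of f, OF hh_self[OF f]])
  fix g assume "g \<in> hh_class G f"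
  then have g: "g \<in> Dd" "res G g = res G f" using hh_class_eq[OF f] by auto
  then have "res2 G (op g) = res2 G (op f)" using op(2) f by simp
  then show "hh_class2 G (op g) = hh_class2 G (op f)" using hh_class2_eq op(1) g f by simp
qed

lemma HH0_carrier: "carrier (HH0 G) = hh_class G ` Dd"
  by (auto simp: HH0_def Let_def FactRing_def A_RCOSETS_def' hh_class_def)

lemma HH0_tsq_carrier: "carrier (tsq (HH0 G)) = hh_class2 G ` Td"
  by (auto simp: HH0_def Let_def FactGroup_def RCOSETS_def hh_class2_def dual_simps)

lemma HH0_one: "\<one>\<^bsub>HH0 G\<^esub> = hh_class G \<one>\<^bsub>dual G D\<^esub>"
  by (simp add: HH0_def Let_def FactRing_def hh_class_def)

lemma HH0_mult:
  assumes f: "f \<in> Dd" and g: "g \<in> Dd"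
  shows "hh_class G f \<otimes>\<^bsub>HH0 G\<^esub> hh_class G g = hh_class G (f \<otimes>\<^bsub>dual G D\<^esub> g)"
proof -
  have "hh_class G f \<otimes>\<^bsub>HH0 G\<^esub> hh_class G g =
    (\<Union>f'\<in>hh_class G f. \<Union>g'\<in>hh_class G g. hh_class G (f' \<otimes>\<^bsub>dual G D\<^esub> g'))"
    by (simp add: HH0_def Let_def FactRing_def rcoset_mult_def hh_class_def)
  also have "\<dots> = (\<Union>f'\<in>hh_class G f. hh_class G (f' \<otimes>\<^bsub>dual G D\<^esub> g))"
  proof (rule SUP_cong)
    fix f' assume "f' \<in> hh_class G f"
    then have f': "f' \<in> Dd" using hh_classD f by blast
    show "(\<Union>g'\<in>hh_class G g. hh_class G (f' \<otimes>\<^bsub>dual G D\<^esub> g')) = hh_class G (f' \<otimes>\<^bsub>dual G D\<^esub> g)"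
      by (rule UN_hh_class[where op' = "\<lambda>r. res G f' \<otimes>\<^bsub>dual G Q\<^esub> r"], rule g, erule mult_Dd[OF f'], erule res_mult[OF f'])
  qed simp
  also have "\<dots> = hh_class G (f \<otimes>\<^bsub>dual G D\<^esub> g)"
    by (rule UN_hh_class[where op' = "\<lambda>r. r \<otimes>\<^bsub>dual G Q\<^esub> res G g"], rule f, erule mult_Dd[OF _ g], erule res_mult[OF _ g])
  finally show ?thesis .
qed

text \<open>Cosets are added as sets of sums, so every element of the target coset has to be written
  as such a sum.\<close>

lemma HH0_add:
  assumes f: "f \<in> Dd" and g: "g \<in> Dd"
  shows "hh_class G f \<oplus>\<^bsub>HH0 G\<^esub> hh_class G g = hh_class G (f \<oplus>\<^bsub>dual G D\<^esub> g)"
proof -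
  have fg: "f \<oplus>\<^bsub>dual G D\<^esub> g \<in> Dd" by (rule Dd_add[OF f g])
  have "hh_class G f \<oplus>\<^bsub>HH0 G\<^esub> hh_class G g = (\<Union>f'\<in>hh_class G f. \<Union>g'\<in>hh_class G g. {f' \<oplus>\<^bsub>dual G D\<^esub> g'})"
    by (simp add: HH0_def Let_def FactRing_def set_add_def')
  also have "\<dots> = hh_class G (f \<oplus>\<^bsub>dual G D\<^esub> g)"
  proof
    show "(\<Union>f'\<in>hh_class G f. \<Union>g'\<in>hh_class G g. {f' \<oplus>\<^bsub>dual G D\<^esub> g'}) \<subseteq> hh_class G (f \<oplus>\<^bsub>dual G D\<^esub> g)"
      using f g fg by (auto simp: hh_class_eq Dd_add res_add)
    show "hh_class G (f \<oplus>\<^bsub>dual G D\<^esub> g) \<subseteq> (\<Union>f'\<in>hh_class G f. \<Union>g'\<in>hh_class G g. {f' \<oplus>\<^bsub>dual G D\<^esub> g'})"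
    proof
      fix h assume "h \<in> hh_class G (f \<oplus>\<^bsub>dual G D\<^esub> g)"
      then have h: "h \<in> Dd" "\<forall>p\<in>Q. h p = (f \<oplus>\<^bsub>dual G D\<^esub> g) p" using hh_classD[OF fg] by auto
      \<comment> \<open>The second summand is kept equal to \<open>g\<close>, so that only the first
        one moves within its coset.\<close>
      let ?k = "h \<ominus>\<^bsub>dual G D\<^esub> g"
      have k: "?k \<in> Dd" by (rule Dd_minus[OF h(1) g])
      have "h = ?k \<oplus>\<^bsub>dual G D\<^esub> g"
        by (rule extensionalityI[of _ D]) (use h g in \<open>auto simp: dual_minus[OF good_D] dual_simps dualD(1)\<close>)
      moreover have "\<forall>p\<in>Q. ?k p = f p" using h g by (simp add: dual_minus[OF good_D] dual_simps Q_D)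
      then have "?k \<in> hh_class G f" using k res_eq_iff[OF k f] by (simp add: hh_class_eq f)
      ultimately show "h \<in> (\<Union>f'\<in>hh_class G f. \<Union>g'\<in>hh_class G g. {f' \<oplus>\<^bsub>dual G D\<^esub> g'})"
        using hh_self[OF g] by blast
    qed
  qed
  finally show ?thesis .
qed

lemma HH0_tsq_mult:
  assumes f: "f \<in> Td" and g: "g \<in> Td"
  shows "hh_class2 G f \<otimes>\<^bsub>tsq (HH0 G)\<^esub> hh_class2 G g = hh_class2 G (f \<otimes>\<^bsub>dual_tsq G D\<^esub> g)"
proof -
  have fg: "f \<otimes>\<^bsub>dual_tsq G D\<^esub> g \<in> Td" by (rule Td_mult[OF f g])
  have "hh_class2 G f \<otimes>\<^bsub>tsq (HH0 G)\<^esub> hh_class2 G g =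
      (\<Union>f'\<in>hh_class2 G f. \<Union>g'\<in>hh_class2 G g. {f' \<otimes>\<^bsub>dual_tsq G D\<^esub> g'})"
    by (simp add: HH0_def Let_def FactGroup_def set_mult_def dual_simps)
  also have "\<dots> = hh_class2 G (f \<otimes>\<^bsub>dual_tsq G D\<^esub> g)"
  proof
    show "(\<Union>f'\<in>hh_class2 G f. \<Union>g'\<in>hh_class2 G g. {f' \<otimes>\<^bsub>dual_tsq G D\<^esub> g'}) \<subseteq> hh_class2 G (f \<otimes>\<^bsub>dual_tsq G D\<^esub> g)"
      using f g fg by (auto simp: hh_class2_eq Td_mult res2_add)
    show "hh_class2 G (f \<otimes>\<^bsub>dual_tsq G D\<^esub> g) \<subseteq> (\<Union>f'\<in>hh_class2 G f. \<Union>g'\<in>hh_class2 G g. {f' \<otimes>\<^bsub>dual_tsq G D\<^esub> g'})"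
    proof
      fix h assume "h \<in> hh_class2 G (f \<otimes>\<^bsub>dual_tsq G D\<^esub> g)"
      then have h: "h \<in> Td" "\<forall>p\<in>Q. \<forall>q\<in>Q. h (p, q) = (f \<otimes>\<^bsub>dual_tsq G D\<^esub> g) (p, q)"
        using hh_class2_eq[OF fg] res2_eq_iff[OF _ fg] by auto
      let ?k = "h \<otimes>\<^bsub>dual_tsq G D\<^esub> inv\<^bsub>dual_tsq G D\<^esub> g"
      have k: "?k \<in> Td" by (rule Td_mult[OF h(1) Td_inv[OF g]])
      have "h = ?k \<otimes>\<^bsub>dual_tsq G D\<^esub> g"
        using h g k group.inv_solve_right[OF tsq_group[OF good_D], of ?k h g] by simp
      moreover have "\<forall>p\<in>Q. \<forall>q\<in>Q. ?k (p, q) = f (p, q)" using h g by (simp add: tsq_inv[OF good_D] tsq_simps Q_D)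
      then have "?k \<in> hh_class2 G f" using k res2_eq_iff[OF k f] by (simp add: hh_class2_eq f)
      ultimately show "h \<in> (\<Union>f'\<in>hh_class2 G f. \<Union>g'\<in>hh_class2 G g. {f' \<otimes>\<^bsub>dual_tsq G D\<^esub> g'})"
        using hh2_self[OF g] by blast
    qed
  qed
  finally show ?thesis .
qed

lemma HH0_smult: "f \<in> Dd \<Longrightarrow> a \<in> Sset G \<Longrightarrow> a \<odot>\<^bsub>HH0 G\<^esub> hh_class G f = hh_class G (a \<odot>\<^bsub>dual G D\<^esub> f)"
  using UN_hh_class[of f "\<lambda>f. a \<odot>\<^bsub>dual G D\<^esub> f", OF _ smult_Dd res_smult] by (simp add: HH0_def Let_def)

lemma HH0_antipode: "f \<in> Dd \<Longrightarrow> antipode (HH0 G) (hh_class G f) = hh_class G (antipode (dual G D) f)"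
  using UN_hh_class[of f "antipode (dual G D)", OF _ antipode_Dd res_antipode] by (simp add: HH0_def Let_def)

lemma HH0_comult: "f \<in> Dd \<Longrightarrow> comult (HH0 G) (hh_class G f) = hh_class2 G (comult (dual G D) f)"
  using UN_hh_class2[of f "comult (dual G D)", OF _ comult_Td res2_comult] by (simp add: HH0_def Let_def)

lemma HH0_tens:
  assumes f: "f \<in> Dd" and g: "g \<in> Dd"
  shows "tens (HH0 G) (hh_class G f) (hh_class G g) = hh_class2 G (tens (dual G D) f g)"
proof -
  have "tens (HH0 G) (hh_class G f) (hh_class G g) =
    (\<Union>f'\<in>hh_class G f. \<Union>g'\<in>hh_class G g. hh_class2 G (tens (dual G D) f' g'))"
    by (simp add: HH0_def Let_def)
  also have "\<dots> = (\<Union>f'\<in>hh_class G f. hh_class2 G (tens (dual G D) f' g))"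
  proof (rule SUP_cong)
    fix f' assume "f' \<in> hh_class G f"
    then have f': "f' \<in> Dd" using hh_classD f by blast
    show "(\<Union>g'\<in>hh_class G g. hh_class2 G (tens (dual G D) f' g')) = hh_class2 G (tens (dual G D) f' g)"
      by (rule UN_hh_class2[where op' = "\<lambda>r. tens (dual G Q) (res G f') r"], rule g, erule tens_Td[OF f'], erule res2_tens)
  qed simp
  also have "\<dots> = hh_class2 G (tens (dual G D) f g)"
    by (rule UN_hh_class2[where op' = "\<lambda>r. tens (dual G Q) r (res G g)"], rule f, erule tens_Td[OF _ g], rule res2_tens[OF g])
  finally show ?thesis .
qed

lemma HH0_counit:
  assumes f: "f \<in> Dd" shows "counit (HH0 G) (hh_class G f) = counit (dual G D) f"
proof -
  have "counit (dual G D) g = counit (dual G D) f" if g: "g \<in> hh_class G f" for g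
    using hh_classD[OF f g] aff_one_Q by (simp add: dual_simps)
  then have "counit (dual G D) ` hh_class G f = (\<lambda>_. counit (dual G D) f) ` hh_class G f"
    by (rule image_cong[OF HOL.refl])
  also have "\<dots> = {counit (dual G D) f}" using hh_self[OF f] by blast
  finally have "counit (dual G D) ` hh_class G f = {counit (dual G D) f}" .
  then show ?thesis by (simp add: HH0_def Let_def)
qed

lemma main:
  "\<exists>h h2. (\<forall>f\<in>Dd. h (hh_class G f) = res G f) \<and> (\<forall>\<Psi>\<in>Td. h2 (hh_class2 G \<Psi>) = res2 G \<Psi>) \<and>
    hopf_iso (Sset G) (HH0 G) (dual G Q) h h2"
proof -
  \<comment> \<open>Any representative serves, since a coset is a fibre of restriction.\<close>
  define h where "h = (\<lambda>X. res G (SOME f. f \<in> X))"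
  define h2 where "h2 = (\<lambda>X. res2 G (SOME \<Psi>. \<Psi> \<in> X))"
  have h: "h (hh_class G f) = res G f" if f: "f \<in> Dd" for f
    using someI[of "\<lambda>g. g \<in> hh_class G f", OF hh_self[OF f]] by (simp add: h_def hh_class_eq f)
  have h2: "h2 (hh_class2 G \<Psi>) = res2 G \<Psi>" if P: "\<Psi> \<in> Td" for \<Psi>
    using someI[of "\<lambda>g. g \<in> hh_class2 G \<Psi>", OF hh2_self[OF P]] by (simp add: h2_def hh_class2_eq P)
  have "bij_betw h (carrier (HH0 G)) Dq"
    unfolding bij_betw_def HH0_carrier
  proof
    show "inj_on h (hh_class G ` Dd)"
    proof (rule inj_onI)
      fix X Y assume "X \<in> hh_class G ` Dd" "Y \<in> hh_class G ` Dd" and eq: "h X = h Y"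
      then obtain f g where f: "f \<in> Dd" "X = hh_class G f" and g: "g \<in> Dd" "Y = hh_class G g" by blast
      have "res G f = res G g" using eq by (simp only: f(2) g(2) h[OF f(1)] h[OF g(1)])
      then show "X = Y" by (simp only: f(2) g(2) hh_class_eq[OF f(1)] hh_class_eq[OF g(1)])
    qed
    have "h ` hh_class G ` Dd = res G ` Dd" unfolding image_image by (rule image_cong[OF HOL.refl h])
    then show "h ` hh_class G ` Dd = Dq" using res_surj by simp
  qed
  moreover have "h \<in> ring_hom (HH0 G) (dual G Q)"
  proof (rule ring_hom_memI)
    fix X assume "X \<in> carrier (HH0 G)"
    then obtain f where f: "f \<in> Dd" "X = hh_class G f" unfolding HH0_carrier by blast
    show "h X \<in> Dq" using f res_Dq by (simp add: h)
    fix Y assume "Y \<in> carrier (HH0 G)"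
    then obtain g where g: "g \<in> Dd" "Y = hh_class G g" unfolding HH0_carrier by blast
    show "h (X \<otimes>\<^bsub>HH0 G\<^esub> Y) = h X \<otimes>\<^bsub>dual G Q\<^esub> h Y" unfolding f(2) g(2) HH0_mult[OF f(1) g(1)]
      by (simp only: h f g mult_Dd res_mult)
    show "h (X \<oplus>\<^bsub>HH0 G\<^esub> Y) = h X \<oplus>\<^bsub>dual G Q\<^esub> h Y" unfolding f(2) g(2) HH0_add[OF f(1) g(1)]
      by (simp only: h f g Dd_add res_add)
  next
    show "h \<one>\<^bsub>HH0 G\<^esub> = \<one>\<^bsub>dual G Q\<^esub>" unfolding HH0_one by (simp only: h one_Dd res_one)
  qed
  ultimately have 1: "h \<in> ring_iso (HH0 G) (dual G Q)" by (simp add: ring_iso_def)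
  have "h2 \<in> hom (tsq (HH0 G)) (dual_tsq G Q)"
  proof (rule homI)
    fix X assume "X \<in> carrier (tsq (HH0 G))"
    then obtain f where f: "f \<in> Td" "X = hh_class2 G f" unfolding HH0_tsq_carrier by blast
    show "h2 X \<in> Tq" using f res2_Tq by (simp add: h2)
    fix Y assume "Y \<in> carrier (tsq (HH0 G))"
    then obtain g where g: "g \<in> Td" "Y = hh_class2 G g" unfolding HH0_tsq_carrier by blast
    show "h2 (X \<otimes>\<^bsub>tsq (HH0 G)\<^esub> Y) = h2 X \<otimes>\<^bsub>dual_tsq G Q\<^esub> h2 Y" unfolding f(2) g(2) HH0_tsq_mult[OF f(1) g(1)]
      by (simp only: h2 f g Td_mult res2_add)
  qed
  moreover have "bij_betw h2 (carrier (tsq (HH0 G))) Tq"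
    unfolding bij_betw_def HH0_tsq_carrier
  proof
    show "inj_on h2 (hh_class2 G ` Td)"
    proof (rule inj_onI)
      fix X Y assume "X \<in> hh_class2 G ` Td" "Y \<in> hh_class2 G ` Td" and eq: "h2 X = h2 Y"
      then obtain f g where f: "f \<in> Td" "X = hh_class2 G f" and g: "g \<in> Td" "Y = hh_class2 G g" by blast
      have "res2 G f = res2 G g" using eq by (simp only: f(2) g(2) h2[OF f(1)] h2[OF g(1)])
      then show "X = Y" by (simp only: f(2) g(2) hh_class2_eq[OF f(1)] hh_class2_eq[OF g(1)])
    qed
    have "h2 ` hh_class2 G ` Td = res2 G ` Td" unfolding image_image by (rule image_cong[OF HOL.refl h2])
    then show "h2 ` hh_class2 G ` Td = Tq" using res2_surj by simp
  qed
  ultimately have 2: "h2 \<in> iso (tsq (HH0 G)) (tsq (dual G Q))" by (simp add: iso_def dual_simps)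
  have "hopf_iso (Sset G) (HH0 G) (dual G Q) h h2"
    unfolding hopf_iso_def HH0_carrier HH0_tsq_carrier
  proof (intro conjI ballI)
    fix a X assume a: "a \<in> Sset G" and "X \<in> hh_class G ` Dd"
    then obtain f where f: "f \<in> Dd" "X = hh_class G f" by blast
    show "h (a \<odot>\<^bsub>HH0 G\<^esub> X) = a \<odot>\<^bsub>dual G Q\<^esub> h X"
      unfolding f(2) HH0_smult[OF f(1) a] by (simp only: h f a smult_Dd res_smult)
  next
    fix X Y assume "X \<in> hh_class G ` Dd" "Y \<in> hh_class G ` Dd"
    then obtain f g where f: "f \<in> Dd" "X = hh_class G f" and g: "g \<in> Dd" "Y = hh_class G g" by blast
    show "tens (HH0 G) X Y \<in> hh_class2 G ` Td"
      unfolding f(2) g(2) HH0_tens[OF f(1) g(1)] by (intro imageI tens_Td f g)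
    show "h2 (tens (HH0 G) X Y) = tens (dual G Q) (h X) (h Y)"
      unfolding f(2) g(2) HH0_tens[OF f(1) g(1)] by (simp only: h h2 f g tens_Td res2_tens)
  next
    fix X assume "X \<in> hh_class G ` Dd"
    then obtain f where f: "f \<in> Dd" "X = hh_class G f" by blast
    show "comult (HH0 G) X \<in> hh_class2 G ` Td"
      unfolding f(2) HH0_comult[OF f(1)] by (intro imageI comult_Td f)
    show "h2 (comult (HH0 G) X) = comult (dual G Q) (h X)"
      unfolding f(2) HH0_comult[OF f(1)] by (simp only: h h2 f comult_Td res2_comult)
    show "counit (HH0 G) X = counit (dual G Q) (h X)"
      unfolding f(2) HH0_counit[OF f(1)] h[OF f(1)] by (rule res_counit)
    show "antipode (HH0 G) X \<in> hh_class G ` Dd"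
      unfolding f(2) HH0_antipode[OF f(1)] by (intro imageI antipode_Dd f)
    show "h (antipode (HH0 G) X) = antipode (dual G Q) (h X)"
      unfolding f(2) HH0_antipode[OF f(1)] by (simp only: h f antipode_Dd res_antipode)
  qed (rule 1, rule 2)
  then show ?thesis using h h2 by blast
qed

end

theorem theorem3:
  fixes G :: "('v::euclidean_space, 'r::{comm_ring_1, ring_char_0}, 'q::comm_ring_1) affine_datum"
  assumes "root_system (roots G)" and "irreducible_roots (roots G)"
    and "simple_roots (roots G) (simples G)" and "highest_root (roots G) (simples G) (theta G)"
    and "formal_group_law (coeffs G)"
    and "\<forall>\<alpha>\<in>roots G. regular_in (Sring G) (Sclass G (ps_var \<alpha>))"
    and "localization_map (Sring G) ((\<lambda>\<alpha>. Sclass G (ps_var \<alpha>)) ` roots G) (emb G)"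
    and "\<exists>h :: rat \<Rightarrow> 'r. rational_embedding h"
  shows "DQ G \<subseteq> DWa G \<and>
    res G ` carrier (dual G (DWa G)) = carrier (dual G (DQ G)) \<and>
    (\<exists>h h2. (\<forall>f\<in>carrier (dual G (DWa G)). h (hh_class G f) = res G f) \<and>
            (\<forall>\<Psi>\<in>carrier (dual_tsq G (DWa G)). h2 (hh_class2 G \<Psi>) = res2 G \<Psi>) \<and>
            hopf_iso (Sset G) (HH0 G) (dual G (DQ G)) h h2)"
proof -
  interpret affine_setup G
    by unfold_locales (fact assms)+
  obtain N b d where "cst 1 = (\<Sum>i<N. cst (b i) \<star> d i)" "\<forall>i<(N::nat). b i \<in> Sset G \<and> d i \<in> inv_el"
    using one_inv_span unfolding inv_span_def by blast
  then interpret affine_basis G N b d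
    by unfold_locales auto
  show ?thesis using Q_D res_surj main by blast
qed

end
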